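(* Let $S$ be a locally Noetherian scheme and let $f\colon X\to S$ and $g\colon Y\to S$ be locally Noetherian $S$-schemes. Assume that $g$ is flat and with geometrically integral fibres. For $\eta\in \mathrm{Ass}(X)$, set $s=f(\eta)\in S$ and $(Y_s)_\eta=Y_s\times_{\mathrm{Spec}\,\kappa(s)}\mathrm{Spec}\,\kappa(\eta)$, where $Y_s$ is the fibre of $g$ over $s$. Then the scheme $(Y_s)_{\eta}$ is integral and its generic point is mapped to an associated point $\xi_{\eta}$ of $X\times_S Y$ by the natural monomorphism $(Y_s)_{\eta}\hookrightarrow X\times_S Y$. Furthermore, the map sending $\eta\in \mathrm{Ass}(X)$ to $\xi_{\eta}\in \mathrm{Ass}(X\times_S Y)$ is a one-to-one correspondence between $\mathrm{Ass}(X)$ and $\mathrm{Ass}(X\times_S Y)$, which preserves specialisations.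
   Context: $\mathrm{Ass}(X)$ denotes the set of associated points of a scheme $X$, and $\kappa(x)$ the residue field of a point $x$. Preserving specialisations means: if $\eta\in\overline{\{\eta'\}}$ for $\eta,\eta'\in \mathrm{Ass}(X)$, then $\xi_\eta\in\overline{\{\xi_{\eta'}\}}$. *)

theory Defs
  imports
    "HOL-Algebra.QuotRing"
    "HOL-Algebra.Module"
    "HOL-Algebra.Ring_Divisibility"
    "HOL-Analysis.Abstract_Topology"
begin

no_notation eq_closure_of (\<open>closure'_of\<index>\<close>)

section \<open>Commutative algebra\<close>

definition local_ring :: "'a ring \<Rightarrow> bool" where
  "local_ring R \<longleftrightarrow> cring R \<and> (\<exists>!m. maximalideal m R)"

text \<open>Only used for local rings.\<close>
definition max_ideal :: "'a ring \<Rightarrow> 'a set" where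
  "max_ideal R = (THE m. maximalideal m R)"

definition annihilator :: "'a ring \<Rightarrow> 'a \<Rightarrow> 'a set" where
  "annihilator R a = {r \<in> carrier R. r \<otimes>\<^bsub>R\<^esub> a = \<zero>\<^bsub>R\<^esub>}"

subsection \<open>Localisation at a prime ideal\<close>

text \<open>The fraction \<open>a / s\<close>, as the set of all pairs \<open>(b, t)\<close> representing it.\<close>
definition loc_frac :: "'a ring \<Rightarrow> 'a set \<Rightarrow> 'a \<Rightarrow> 'a \<Rightarrow> ('a \<times> 'a) set" where
  "loc_frac R p a s =
    {(b, t). b \<in> carrier R \<and> t \<in> carrier R - p \<and>
       (\<exists>u\<in>carrier R - p. u \<otimes>\<^bsub>R\<^esub> (a \<otimes>\<^bsub>R\<^esub> t) = u \<otimes>\<^bsub>R\<^esub> (b \<otimes>\<^bsub>R\<^esub> s))}"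

definition loc :: "'a ring \<Rightarrow> 'a set \<Rightarrow> ('a \<times> 'a) set ring" where
  "loc R p =
    \<lparr>carrier = {loc_frac R p a s | a s. a \<in> carrier R \<and> s \<in> carrier R - p},
     mult = (\<lambda>X Y. \<Union>(a, s)\<in>X. \<Union>(b, t)\<in>Y. loc_frac R p (a \<otimes>\<^bsub>R\<^esub> b) (s \<otimes>\<^bsub>R\<^esub> t)),
     one = loc_frac R p \<one>\<^bsub>R\<^esub> \<one>\<^bsub>R\<^esub>,
     zero = loc_frac R p \<zero>\<^bsub>R\<^esub> \<one>\<^bsub>R\<^esub>,
     add = (\<lambda>X Y. \<Union>(a, s)\<in>X. \<Union>(b, t)\<in>Y.
       loc_frac R p ((a \<otimes>\<^bsub>R\<^esub> t) \<oplus>\<^bsub>R\<^esub> (b \<otimes>\<^bsub>R\<^esub> s)) (s \<otimes>\<^bsub>R\<^esub> t))\<rparr>"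

text \<open>The map \<open>R\<^sub>p \<rightarrow> A\<^sub>q\<close> induced by \<open>\<phi> : R \<rightarrow> A\<close>, where \<open>p\<close> is the preimage of \<open>q\<close>.\<close>
definition loc_map :: "'b ring \<Rightarrow> ('a \<Rightarrow> 'b) \<Rightarrow> 'b set \<Rightarrow> ('a \<times> 'a) set \<Rightarrow> ('b \<times> 'b) set" where
  "loc_map A \<phi> q X = (\<Union>(a, s)\<in>X. loc_frac A q (\<phi> a) (\<phi> s))"

subsection \<open>Tensor products\<close>

text \<open>A list of pairs \<open>[(m\<^sub>1, n\<^sub>1), \<dots>, (m\<^sub>k, n\<^sub>k)]\<close> stands for the formal sum of the \<open>m\<^sub>i \<otimes> n\<^sub>i\<close>;
  the tensor product is the quotient of the monoid of such lists under concatenation by the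
  congruence making it commutative and the pairing bilinear and balanced.\<close>

inductive tensor_eq ::
    "'r ring \<Rightarrow> ('r, 'm) module \<Rightarrow> ('r, 'n) module \<Rightarrow> ('m \<times> 'n) list \<Rightarrow> ('m \<times> 'n) list \<Rightarrow> bool"
  for R M N where
  refl: "set u \<subseteq> carrier M \<times> carrier N \<Longrightarrow> tensor_eq R M N u u"
| sym: "tensor_eq R M N u v \<Longrightarrow> tensor_eq R M N v u"
| trans: "tensor_eq R M N u v \<Longrightarrow> tensor_eq R M N v w \<Longrightarrow> tensor_eq R M N u w"
| append: "tensor_eq R M N u u' \<Longrightarrow> tensor_eq R M N v v' \<Longrightarrow> tensor_eq R M N (u @ v) (u' @ v')"
| comm: "set u \<subseteq> carrier M \<times> carrier N \<Longrightarrow> set v \<subseteq> carrier M \<times> carrier N \<Longrightarrow>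
    tensor_eq R M N (u @ v) (v @ u)"
| zero: "n \<in> carrier N \<Longrightarrow> tensor_eq R M N [(\<zero>\<^bsub>M\<^esub>, n)] []"
| add_left: "m \<in> carrier M \<Longrightarrow> m' \<in> carrier M \<Longrightarrow> n \<in> carrier N \<Longrightarrow>
    tensor_eq R M N [(m \<oplus>\<^bsub>M\<^esub> m', n)] [(m, n), (m', n)]"
| add_right: "m \<in> carrier M \<Longrightarrow> n \<in> carrier N \<Longrightarrow> n' \<in> carrier N \<Longrightarrow>
    tensor_eq R M N [(m, n \<oplus>\<^bsub>N\<^esub> n')] [(m, n), (m, n')]"
| balanced: "r \<in> carrier R \<Longrightarrow> m \<in> carrier M \<Longrightarrow> n \<in> carrier N \<Longrightarrow>
    tensor_eq R M N [(r \<odot>\<^bsub>M\<^esub> m, n)] [(m, r \<odot>\<^bsub>N\<^esub> n)]"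

definition tensor_class ::
    "'r ring \<Rightarrow> ('r, 'm) module \<Rightarrow> ('r, 'n) module \<Rightarrow> ('m \<times> 'n) list \<Rightarrow> ('m \<times> 'n) list set" where
  "tensor_class R M N u = {v. tensor_eq R M N u v}"

definition formal_mult ::
    "('r, 'm) module \<Rightarrow> ('r, 'n) module \<Rightarrow> ('m \<times> 'n) list \<Rightarrow> ('m \<times> 'n) list \<Rightarrow> ('m \<times> 'n) list" where
  "formal_mult M N u v =
    map (\<lambda>((m, n), (m', n')). (m \<otimes>\<^bsub>M\<^esub> m', n \<otimes>\<^bsub>N\<^esub> n')) (List.product u v)"

text \<open>\<open>mult\<close> and \<open>one\<close> are meaningful only if \<open>M\<close> and \<open>N\<close> are \<open>R\<close>-algebras.\<close>
definition tensor ::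
    "'r ring \<Rightarrow> ('r, 'm) module \<Rightarrow> ('r, 'n) module \<Rightarrow> ('m \<times> 'n) list set ring" where
  "tensor R M N =
    \<lparr>carrier = {tensor_class R M N u | u. set u \<subseteq> carrier M \<times> carrier N},
     mult = (\<lambda>X Y. \<Union>u\<in>X. \<Union>v\<in>Y. tensor_class R M N (formal_mult M N u v)),
     one = tensor_class R M N [(\<one>\<^bsub>M\<^esub>, \<one>\<^bsub>N\<^esub>)],
     zero = tensor_class R M N [],
     add = (\<lambda>X Y. \<Union>u\<in>X. \<Union>v\<in>Y. tensor_class R M N (u @ v))\<rparr>"

definition alg :: "('r \<Rightarrow> 'a) \<Rightarrow> 'a ring \<Rightarrow> ('r, 'a) module" where
  "alg \<phi> A = \<lparr>carrier = carrier A, mult = mult A, one = one A, zero = zero A, add = add A,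
     smult = (\<lambda>r a. \<phi> r \<otimes>\<^bsub>A\<^esub> a)\<rparr>"

subsection \<open>Flatness\<close>

definition linear_maps :: "'r ring \<Rightarrow> ('r, 'm) module \<Rightarrow> ('r, 'n) module \<Rightarrow> ('m \<Rightarrow> 'n) set" where
  "linear_maps R M N =
    {u. u \<in> carrier M \<rightarrow> carrier N \<and>
        (\<forall>x\<in>carrier M. \<forall>y\<in>carrier M. u (x \<oplus>\<^bsub>M\<^esub> y) = u x \<oplus>\<^bsub>N\<^esub> u y) \<and>
        (\<forall>r\<in>carrier R. \<forall>x\<in>carrier M. u (r \<odot>\<^bsub>M\<^esub> x) = r \<odot>\<^bsub>N\<^esub> u x)}"

text \<open>\<open>u \<otimes> id : M \<otimes> A \<rightarrow> N \<otimes> A\<close> for linear \<open>u : M \<rightarrow> N\<close>.\<close>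
definition tensor_map ::
    "'r ring \<Rightarrow> ('r, 'n) module \<Rightarrow> ('r, 'a) module \<Rightarrow> ('m \<Rightarrow> 'n) \<Rightarrow>
     ('m \<times> 'a) list set \<Rightarrow> ('n \<times> 'a) list set" where
  "tensor_map R N A u X = (\<Union>l\<in>X. tensor_class R N A (map (map_prod u id) l))"

text \<open>Tensoring with the \<open>R\<close>-algebra \<open>A\<close> preserves injectivity. HOL cannot quantify over the
  carrier types of \<open>M\<close> and \<open>N\<close> here; modules carried by the type of \<open>R\<close> are enough, because they
  include the inclusions \<open>I \<rightarrow> R\<close> of all ideals, which already detect flatness.\<close>
definition flat_hom :: "'r ring \<Rightarrow> 'a ring \<Rightarrow> ('r \<Rightarrow> 'a) \<Rightarrow> bool" where
  "flat_hom R A \<phi> \<longleftrightarrow>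
    (\<forall>(M :: ('r, 'r) module) (N :: ('r, 'r) module) u.
       module R M \<longrightarrow> module R N \<longrightarrow> u \<in> linear_maps R M N \<longrightarrow> inj_on u (carrier M) \<longrightarrow>
       inj_on (tensor_map R N (alg \<phi> A) u) (carrier (tensor R M (alg \<phi> A))))"

section \<open>Locally ringed spaces\<close>

text \<open>Sections over all open sets share one element type; nothing is required of \<open>sec\<close> and \<open>res\<close>
  on sets that are not open.\<close>
record ('p, 'r) rspace =
  space_top :: "'p topology"
  sec :: "'p set \<Rightarrow> 'r ring"
  res :: "'p set \<Rightarrow> 'p set \<Rightarrow> 'r \<Rightarrow> 'r"

type_synonym ('p, 'r) germ = "('p set \<times> 'r) set"
type_synonym ('p, 'r) residue = "('p, 'r) germ set"

abbreviation points :: "('p, 'r) rspace \<Rightarrow> 'p set" where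
  "points X \<equiv> topspace (space_top X)"

abbreviation is_open :: "('p, 'r) rspace \<Rightarrow> 'p set \<Rightarrow> bool" where
  "is_open X U \<equiv> openin (space_top X) U"

definition ringed_space :: "('p, 'r) rspace \<Rightarrow> bool" where
  "ringed_space X \<longleftrightarrow>
    (\<forall>U. is_open X U \<longrightarrow> cring (sec X U) \<and> (\<forall>s\<in>carrier (sec X U). res X U U s = s)) \<and>
    (\<forall>U V. is_open X U \<longrightarrow> is_open X V \<longrightarrow> V \<subseteq> U \<longrightarrow>
       res X U V \<in> ring_hom (sec X U) (sec X V)) \<and>
    (\<forall>U V W. is_open X U \<longrightarrow> is_open X V \<longrightarrow> is_open X W \<longrightarrow> W \<subseteq> V \<longrightarrow> V \<subseteq> U \<longrightarrow>
       (\<forall>s\<in>carrier (sec X U). res X V W (res X U V s) = res X U W s)) \<and>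
    (\<forall>\<U> \<sigma>. (\<forall>U\<in>\<U>. is_open X U \<and> \<sigma> U \<in> carrier (sec X U)) \<longrightarrow>
       (\<forall>U\<in>\<U>. \<forall>V\<in>\<U>. res X U (U \<inter> V) (\<sigma> U) = res X V (U \<inter> V) (\<sigma> V)) \<longrightarrow>
       (\<exists>!s. s \<in> carrier (sec X (\<Union>\<U>)) \<and> (\<forall>U\<in>\<U>. res X (\<Union>\<U>) U s = \<sigma> U)))"

text \<open>The germ at \<open>x\<close> of \<open>s \<in> \<O>(U)\<close>, as the set of all \<open>(V, t)\<close> representing it.\<close>
definition germ :: "('p, 'r) rspace \<Rightarrow> 'p \<Rightarrow> 'p set \<Rightarrow> 'r \<Rightarrow> ('p, 'r) germ" where
  "germ X x U s =
    {(V, t). is_open X V \<and> x \<in> V \<and> t \<in> carrier (sec X V) \<and>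
       (\<exists>W. is_open X W \<and> x \<in> W \<and> W \<subseteq> U \<inter> V \<and> res X U W s = res X V W t)}"

definition stalk :: "('p, 'r) rspace \<Rightarrow> 'p \<Rightarrow> ('p, 'r) germ ring" where
  "stalk X x =
    \<lparr>carrier = {germ X x U s | U s. is_open X U \<and> x \<in> U \<and> s \<in> carrier (sec X U)},
     mult = (\<lambda>a b. \<Union>(U, s)\<in>a. \<Union>(V, t)\<in>b. germ X x (U \<inter> V)
       (res X U (U \<inter> V) s \<otimes>\<^bsub>sec X (U \<inter> V)\<^esub> res X V (U \<inter> V) t)),
     one = germ X x (points X) \<one>\<^bsub>sec X (points X)\<^esub>,
     zero = germ X x (points X) \<zero>\<^bsub>sec X (points X)\<^esub>,
     add = (\<lambda>a b. \<Union>(U, s)\<in>a. \<Union>(V, t)\<in>b. germ X x (U \<inter> V)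
       (res X U (U \<inter> V) s \<oplus>\<^bsub>sec X (U \<inter> V)\<^esub> res X V (U \<inter> V) t))\<rparr>"

definition locally_ringed_space :: "('p, 'r) rspace \<Rightarrow> bool" where
  "locally_ringed_space X \<longleftrightarrow> ringed_space X \<and> (\<forall>x\<in>points X. local_ring (stalk X x))"

definition open_subspace :: "('p, 'r) rspace \<Rightarrow> 'p set \<Rightarrow> ('p, 'r) rspace" where
  "open_subspace X U = X\<lparr>space_top := subtopology (space_top X) U\<rparr>"

definition residue_field :: "('p, 'r) rspace \<Rightarrow> 'p \<Rightarrow> ('p, 'r) residue ring" where
  "residue_field X x = stalk X x Quot max_ideal (stalk X x)"

subsection \<open>Morphisms\<close>

text \<open>For \<open>h : X \<rightarrow> Y\<close>, \<open>com h V\<close> is the ring homomorphism \<open>\<O>\<^sub>Y(V) \<rightarrow> \<O>\<^sub>X(h\<^sup>-\<^sup>1 V)\<close>.\<close>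
record ('p, 'r, 'q, 's) morph =
  pt :: "'p \<Rightarrow> 'q"
  com :: "'q set \<Rightarrow> 's \<Rightarrow> 'r"

definition preim :: "('p, 'r) rspace \<Rightarrow> ('p, 'r, 'q, 's) morph \<Rightarrow> 'q set \<Rightarrow> 'p set" where
  "preim X h V = {x \<in> points X. pt h x \<in> V}"

definition stalk_map ::
    "('p, 'r) rspace \<Rightarrow> ('p, 'r, 'q, 's) morph \<Rightarrow> 'p \<Rightarrow> ('q, 's) germ \<Rightarrow> ('p, 'r) germ" where
  "stalk_map X h x a = (\<Union>(V, s)\<in>a. germ X x (preim X h V) (com h V s))"

definition is_morphism ::
    "('p, 'r) rspace \<Rightarrow> ('q, 's) rspace \<Rightarrow> ('p, 'r, 'q, 's) morph \<Rightarrow> bool" where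
  "is_morphism X Y h \<longleftrightarrow>
    continuous_map (space_top X) (space_top Y) (pt h) \<and>
    (\<forall>V. is_open Y V \<longrightarrow> com h V \<in> ring_hom (sec Y V) (sec X (preim X h V))) \<and>
    (\<forall>V W. is_open Y V \<longrightarrow> is_open Y W \<longrightarrow> W \<subseteq> V \<longrightarrow> (\<forall>s\<in>carrier (sec Y V).
       com h W (res Y V W s) = res X (preim X h V) (preim X h W) (com h V s))) \<and>
    (\<forall>x\<in>points X.
       stalk_map X h x ` max_ideal (stalk Y (pt h x)) \<subseteq> max_ideal (stalk X x))"

definition morph_eq ::
    "('p, 'r) rspace \<Rightarrow> ('q, 's) rspace \<Rightarrow> ('p, 'r, 'q, 's) morph \<Rightarrow> ('p, 'r, 'q, 's) morph \<Rightarrow> bool"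
  where "morph_eq X Y h k \<longleftrightarrow>
    (\<forall>x\<in>points X. pt h x = pt k x) \<and>
    (\<forall>V. is_open Y V \<longrightarrow> (\<forall>s\<in>carrier (sec Y V). com h V s = com k V s))"

definition morph_id :: "('p, 'r, 'p, 'r) morph" where
  "morph_id = \<lparr>pt = id, com = (\<lambda>_. id)\<rparr>"

text \<open>\<open>morph_comp Y k h\<close> is the composite of \<open>h : X \<rightarrow> Y\<close> followed by \<open>k : Y \<rightarrow> Z\<close>.\<close>
definition morph_comp ::
    "('q, 's) rspace \<Rightarrow> ('q, 's, 'z, 't) morph \<Rightarrow> ('p, 'r, 'q, 's) morph \<Rightarrow> ('p, 'r, 'z, 't) morph"
  where "morph_comp Y k h = \<lparr>pt = pt k \<circ> pt h, com = (\<lambda>W. com h (preim Y k W) \<circ> com k W)\<rparr>"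

definition isomorphic :: "('p, 'r) rspace \<Rightarrow> ('q, 's) rspace \<Rightarrow> bool" where
  "isomorphic X Y \<longleftrightarrow> (\<exists>h k. is_morphism X Y h \<and> is_morphism Y X k \<and>
     morph_eq X X (morph_comp Y k h) morph_id \<and> morph_eq Y Y (morph_comp X h k) morph_id)"

definition residue_map ::
    "('p, 'r) rspace \<Rightarrow> ('q, 's) rspace \<Rightarrow> ('p, 'r, 'q, 's) morph \<Rightarrow> 'p \<Rightarrow>
     ('q, 's) residue \<Rightarrow> ('p, 'r) residue" where
  "residue_map X Y h x C =
     max_ideal (stalk X x) <+>\<^bsub>stalk X x\<^esub> (stalk_map X h x ` C)"

section \<open>Schemes\<close>

subsection \<open>Sheaves of locally prescribed functions\<close>

text \<open>Sections over \<open>U\<close> are the functions on \<open>U\<close> with values in the rings \<open>L z\<close> that locally agree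
  with one of the functions \<open>\<tau>\<close> satisfying \<open>adm V \<tau>\<close>.\<close>
definition function_space ::
    "'p topology \<Rightarrow> ('p \<Rightarrow> 'l ring) \<Rightarrow> ('p set \<Rightarrow> ('p \<Rightarrow> 'l) \<Rightarrow> bool) \<Rightarrow> ('p, 'p \<Rightarrow> 'l) rspace" where
  "function_space T L adm =
    \<lparr>space_top = T,
     sec = (\<lambda>U.
       \<lparr>carrier = {\<sigma> \<in> (\<Pi>\<^sub>E z\<in>U. carrier (L z)). \<forall>z\<in>U. \<exists>V \<tau>. openin T V \<and> z \<in> V \<and> V \<subseteq> U \<and>
          adm V \<tau> \<and> (\<forall>w\<in>V. \<sigma> w = \<tau> w)},
        mult = (\<lambda>\<sigma> \<tau>. \<lambda>z\<in>U. \<sigma> z \<otimes>\<^bsub>L z\<^esub> \<tau> z),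
        one = (\<lambda>z\<in>U. \<one>\<^bsub>L z\<^esub>),
        zero = (\<lambda>z\<in>U. \<zero>\<^bsub>L z\<^esub>),
        add = (\<lambda>\<sigma> \<tau>. \<lambda>z\<in>U. \<sigma> z \<oplus>\<^bsub>L z\<^esub> \<tau> z)\<rparr>),
     res = (\<lambda>U V \<sigma>. restrict \<sigma> V)\<rparr>"

subsection \<open>Spectra\<close>

definition Spec :: "'a ring \<Rightarrow> ('a set, 'a set \<Rightarrow> ('a \<times> 'a) set) rspace" where
  "Spec R = function_space
     (topology_generated_by {{p. primeideal p R \<and> a \<notin> p} | a. a \<in> carrier R})
     (loc R)
     (\<lambda>V \<tau>. \<exists>a\<in>carrier R. \<exists>s\<in>carrier R. \<forall>p\<in>V. s \<notin> p \<and> \<tau> p = loc_frac R p a s)"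

definition Spec_map ::
    "'a ring \<Rightarrow> 'b ring \<Rightarrow> ('a \<Rightarrow> 'b) \<Rightarrow>
     ('b set, 'b set \<Rightarrow> ('b \<times> 'b) set, 'a set, 'a set \<Rightarrow> ('a \<times> 'a) set) morph" where
  "Spec_map R A \<phi> =
    \<lparr>pt = (\<lambda>q. {r \<in> carrier R. \<phi> r \<in> q}),
     com = (\<lambda>U \<sigma>. \<lambda>q\<in>{q \<in> points (Spec A). {r \<in> carrier R. \<phi> r \<in> q} \<in> U}.
       loc_map A \<phi> q (\<sigma> {r \<in> carrier R. \<phi> r \<in> q}))\<rparr>"

text \<open>The canonical morphism \<open>Spec \<kappa>(x) \<rightarrow> X\<close>.\<close>
definition point_map ::
    "('p, 'r) rspace \<Rightarrow> 'p \<Rightarrow>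
     (('p, 'r) residue set,
      ('p, 'r) residue set \<Rightarrow> (('p, 'r) residue \<times> ('p, 'r) residue) set, 'p, 'r) morph" where
  "point_map X x =
    \<lparr>pt = (\<lambda>_. x),
     com = (\<lambda>U s. \<lambda>p\<in>{p \<in> points (Spec (residue_field X x)). x \<in> U}.
       loc_frac (residue_field X x) p
         (max_ideal (stalk X x) +>\<^bsub>stalk X x\<^esub> germ X x U s) \<one>\<^bsub>residue_field X x\<^esub>)\<rparr>"

subsection \<open>Classes of schemes\<close>

text \<open>A locally ringed space is isomorphic to some \<open>Spec R\<close> iff it is isomorphic to the spectrum of
  its own ring of global sections; the latter avoids a quantification over carrier types.\<close>
definition affine_open :: "('p, 'r) rspace \<Rightarrow> 'p set \<Rightarrow> bool" where
  "affine_open X U \<longleftrightarrow> is_open X U \<and> isomorphic (open_subspace X U) (Spec (sec X U))"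

definition scheme :: "('p, 'r) rspace \<Rightarrow> bool" where
  "scheme X \<longleftrightarrow> locally_ringed_space X \<and> (\<forall>x\<in>points X. \<exists>U. x \<in> U \<and> affine_open X U)"

definition locally_noetherian :: "('p, 'r) rspace \<Rightarrow> bool" where
  "locally_noetherian X \<longleftrightarrow> scheme X \<and>
     (\<forall>x\<in>points X. \<exists>U. x \<in> U \<and> affine_open X U \<and> noetherian_ring (sec X U))"

definition integral_scheme :: "('p, 'r) rspace \<Rightarrow> bool" where
  "integral_scheme X \<longleftrightarrow> scheme X \<and> points X \<noteq> {} \<and>
     (\<forall>U. is_open X U \<longrightarrow> U \<noteq> {} \<longrightarrow> domain (sec X U))"

definition generic_point :: "('p, 'r) rspace \<Rightarrow> 'p \<Rightarrow> bool" where
  "generic_point X z \<longleftrightarrow> z \<in> points X \<and> space_top X closure_of {z} = points X"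

text \<open>\<open>x\<close> is associated iff the maximal ideal of its local ring is the annihilator of an element.\<close>
definition Ass :: "('p, 'r) rspace \<Rightarrow> 'p set" where
  "Ass X = {x \<in> points X.
     \<exists>a\<in>carrier (stalk X x). max_ideal (stalk X x) = annihilator (stalk X x) a}"

definition flat_morphism ::
    "('p, 'r) rspace \<Rightarrow> ('q, 's) rspace \<Rightarrow> ('p, 'r, 'q, 's) morph \<Rightarrow> bool" where
  "flat_morphism X Y h \<longleftrightarrow> is_morphism X Y h \<and>
     (\<forall>x\<in>points X. flat_hom (stalk Y (pt h x)) (stalk X x) (stalk_map X h x))"

text \<open>The type arguments fix the types of the test schemes.\<close>
definition monomorphism ::
    "'t itself \<Rightarrow> 'u itself \<Rightarrow> ('p, 'r) rspace \<Rightarrow> ('q, 's) rspace \<Rightarrow> ('p, 'r, 'q, 's) morph \<Rightarrow> bool"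
  where "monomorphism _ _ X Y h \<longleftrightarrow> is_morphism X Y h \<and>
    (\<forall>(T :: ('t, 'u) rspace) u v. scheme T \<longrightarrow> is_morphism T X u \<longrightarrow> is_morphism T X v \<longrightarrow>
       morph_eq T Y (morph_comp X h u) (morph_comp X h v) \<longrightarrow> morph_eq T X u v)"

section \<open>Fibre products\<close>

text \<open>The fibre product \<open>X \<times>\<^sub>S Y\<close> of \<open>f : X \<rightarrow> S\<close> and \<open>g : Y \<rightarrow> S\<close>, constructed directly as a locally
  ringed space. Its points are the triples \<open>(x, y, p)\<close> with \<open>f(x) = g(y) = s\<close> and \<open>p\<close> a prime ideal
  of \<open>\<O>\<^sub>X\<^sub>,\<^sub>x \<otimes> \<O>\<^sub>Y\<^sub>,\<^sub>y\<close> (over \<open>\<O>\<^sub>S\<^sub>,\<^sub>s\<close>) lying over both maximal ideals, equivalently a prime ideal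
  of \<open>\<kappa>(x) \<otimes> \<kappa>(y)\<close> (over \<open>\<kappa>(s)\<close>); the local ring there is the localisation at \<open>p\<close>. Topology and
  structure sheaf are generated by the elements \<open>\<Sum>i. a\<^sub>i \<otimes> b\<^sub>i\<close> with \<open>a\<^sub>i \<in> \<O>\<^sub>X(U)\<close>, \<open>b\<^sub>i \<in> \<O>\<^sub>Y(V)\<close>
  exactly as those of a spectrum are by the elements of the ring; for affine \<open>X\<close>, \<open>Y\<close>, \<open>S\<close> this is
  the spectrum of the tensor product of the coordinate rings. (W. D. Gillam, Localization of ringed
  spaces, shows that this is the fibre product in all locally ringed spaces, hence for schemes.)\<close>

type_synonym ('x, 'a, 'y, 'b) fp_tensor = "(('x, 'a) germ \<times> ('y, 'b) germ) list set"
type_synonym ('x, 'a, 'y, 'b) fp_point = "'x \<times> 'y \<times> ('x, 'a, 'y, 'b) fp_tensor set"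
type_synonym ('x, 'a, 'y, 'b) fp_sec =
  "('x, 'a, 'y, 'b) fp_point \<Rightarrow> (('x, 'a, 'y, 'b) fp_tensor \<times> ('x, 'a, 'y, 'b) fp_tensor) set"

context
  fixes X :: "('x, 'a) rspace" and f :: "('x, 'a, 's, 'o) morph" and S :: "('s, 'o) rspace"
    and Y :: "('y, 'b) rspace" and g :: "('y, 'b, 's, 'o) morph"
begin

definition fp_ring :: "'x \<Rightarrow> 'y \<Rightarrow> ('x, 'a, 'y, 'b) fp_tensor ring" where
  "fp_ring x y = tensor (stalk S (pt f x))
     (alg (stalk_map X f x) (stalk X x)) (alg (stalk_map Y g y) (stalk Y y))"

definition fp_class :: "'x \<Rightarrow> 'y \<Rightarrow> (('x, 'a) germ \<times> ('y, 'b) germ) list \<Rightarrow>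
    ('x, 'a, 'y, 'b) fp_tensor" where
  "fp_class x y = tensor_class (stalk S (pt f x))
     (alg (stalk_map X f x) (stalk X x)) (alg (stalk_map Y g y) (stalk Y y))"

definition fp_points :: "('x, 'a, 'y, 'b) fp_point set" where
  "fp_points = {(x, y, p). x \<in> points X \<and> y \<in> points Y \<and> pt f x = pt g y \<and>
     primeideal p (fp_ring x y) \<and>
     {a \<in> carrier (stalk X x). fp_class x y [(a, \<one>\<^bsub>stalk Y y\<^esub>)] \<in> p} = max_ideal (stalk X x) \<and>
     {b \<in> carrier (stalk Y y). fp_class x y [(\<one>\<^bsub>stalk X x\<^esub>, b)] \<in> p} = max_ideal (stalk Y y)}"

text \<open>The value at \<open>(x, y)\<close> of \<open>\<Sum>i. a\<^sub>i \<otimes> b\<^sub>i\<close>, given as the list of the \<open>(a\<^sub>i, b\<^sub>i)\<close>.\<close>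
definition fp_germ :: "'x set \<Rightarrow> 'y set \<Rightarrow> ('a \<times> 'b) list \<Rightarrow> 'x \<Rightarrow> 'y \<Rightarrow>
    ('x, 'a, 'y, 'b) fp_tensor" where
  "fp_germ U V l x y = fp_class x y (map (map_prod (germ X x U) (germ Y y V)) l)"

definition fp_sums :: "'x set \<Rightarrow> 'y set \<Rightarrow> ('a \<times> 'b) list set" where
  "fp_sums U V = {l. set l \<subseteq> carrier (sec X U) \<times> carrier (sec Y V)}"

definition fp_basic :: "'x set \<Rightarrow> 'y set \<Rightarrow> ('a \<times> 'b) list \<Rightarrow> ('x, 'a, 'y, 'b) fp_point set" where
  "fp_basic U V l = {(x, y, p). (x, y, p) \<in> fp_points \<and> x \<in> U \<and> y \<in> V \<and> fp_germ U V l x y \<notin> p}"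

definition fibre_product :: "(('x, 'a, 'y, 'b) fp_point, ('x, 'a, 'y, 'b) fp_sec) rspace" where
  "fibre_product = function_space
     (topology_generated_by
       {fp_basic U V l | U V l. is_open X U \<and> is_open Y V \<and> l \<in> fp_sums U V})
     (\<lambda>(x, y, p). loc (fp_ring x y) p)
     (\<lambda>\<Omega> \<tau>. \<exists>U V k l. is_open X U \<and> is_open Y V \<and> k \<in> fp_sums U V \<and> l \<in> fp_sums U V \<and>
        \<Omega> \<subseteq> fp_basic U V l \<and>
        (\<forall>(x, y, p)\<in>\<Omega>. \<tau> (x, y, p) =
           loc_frac (fp_ring x y) p (fp_germ U V k x y) (fp_germ U V l x y)))"

definition fp_proj1 :: "(('x, 'a, 'y, 'b) fp_point, ('x, 'a, 'y, 'b) fp_sec, 'x, 'a) morph" where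
  "fp_proj1 =
    \<lparr>pt = (\<lambda>(x, y, p). x),
     com = (\<lambda>U s. \<lambda>(x, y, p)\<in>{(x, y, p). (x, y, p) \<in> fp_points \<and> x \<in> U}.
       loc_frac (fp_ring x y) p (fp_class x y [(germ X x U s, \<one>\<^bsub>stalk Y y\<^esub>)]) \<one>\<^bsub>fp_ring x y\<^esub>)\<rparr>"

definition fp_proj2 :: "(('x, 'a, 'y, 'b) fp_point, ('x, 'a, 'y, 'b) fp_sec, 'y, 'b) morph" where
  "fp_proj2 =
    \<lparr>pt = (\<lambda>(x, y, p). y),
     com = (\<lambda>V t. \<lambda>(x, y, p)\<in>{(x, y, p). (x, y, p) \<in> fp_points \<and> y \<in> V}.
       loc_frac (fp_ring x y) p (fp_class x y [(\<one>\<^bsub>stalk X x\<^esub>, germ Y y V t)]) \<one>\<^bsub>fp_ring x y\<^esub>)\<rparr>"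

end

subsection \<open>Fibres and base change of fields\<close>

text \<open>The fibre \<open>Y\<^sub>s\<close> of \<open>g : Y \<rightarrow> S\<close>, and its structure morphism to \<open>Spec \<kappa>(s)\<close>.\<close>
definition "fibre Y g S s =
  fibre_product Y g S (Spec (residue_field S s)) (point_map S s)"

definition "fibre_str Y g S s =
  fp_proj2 Y g S (Spec (residue_field S s)) (point_map S s)"

text \<open>\<open>Z \<times> Spec K\<close> over \<open>Spec k\<close>, for \<open>\<pi> : Z \<rightarrow> Spec k\<close> and \<open>\<phi> : k \<rightarrow> K\<close>.\<close>
definition "base_change k Z \<pi> K \<phi> =
  fibre_product Z \<pi> (Spec k) (Spec K) (Spec_map k K \<phi>)"

text \<open>The type argument is the type carrying the field extensions \<open>K\<close> of \<open>k\<close> under consideration;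
  the notion is the usual one as soon as an algebraic closure of \<open>k\<close> fits into this type.\<close>
definition geometrically_integral :: "'k itself \<Rightarrow> _" where
  "geometrically_integral _ k Z \<pi> \<longleftrightarrow>
     (\<forall>(K :: 'k ring) \<phi>. field K \<longrightarrow> \<phi> \<in> ring_hom k K \<longrightarrow> integral_scheme (base_change k Z \<pi> K \<phi>))"

definition geometrically_integral_fibres :: "'k itself \<Rightarrow> _" where
  "geometrically_integral_fibres T Y g S \<longleftrightarrow>
     (\<forall>s\<in>points S. geometrically_integral T (residue_field S s) (fibre Y g S s) (fibre_str Y g S s))"

text \<open>\<open>(Y\<^sub>s)\<^sub>\<eta>\<close> for \<open>s = f(\<eta>)\<close>.\<close>
definition "fibre_at X f Y g S \<eta> =
  base_change (residue_field S (pt f \<eta>)) (fibre Y g S (pt f \<eta>)) (fibre_str Y g S (pt f \<eta>))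
    (residue_field X \<eta>) (residue_map X S f \<eta>)"

text \<open>\<open>\<iota>\<close> is the natural morphism \<open>(Y\<^sub>s)\<^sub>\<eta> \<rightarrow> X \<times>\<^sub>S Y\<close>: its components are
  \<open>(Y\<^sub>s)\<^sub>\<eta> \<rightarrow> Spec \<kappa>(\<eta>) \<rightarrow> X\<close> and \<open>(Y\<^sub>s)\<^sub>\<eta> \<rightarrow> Y\<^sub>s \<rightarrow> Y\<close>.\<close>
definition "natural_morphism X f Y g S \<eta> \<iota> \<longleftrightarrow>
  (let s = pt f \<eta>; k = residue_field S s; K = residue_field X \<eta>; \<phi> = residue_map X S f \<eta>;
       Ys = fibre Y g S s; \<pi> = fibre_str Y g S s;
       F = fibre_at X f Y g S \<eta>; P = fibre_product X f S Y g
   in is_morphism F P \<iota> \<and>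
      morph_eq F X (morph_comp P (fp_proj1 X f S Y g) \<iota>)
        (morph_comp (Spec K) (point_map X \<eta>) (fp_proj2 Ys \<pi> (Spec k) (Spec K) (Spec_map k K \<phi>))) \<and>
      morph_eq F Y (morph_comp P (fp_proj2 X f S Y g) \<iota>)
        (morph_comp Ys (fp_proj1 Y g S (Spec k) (point_map S s))
          (fp_proj1 Ys \<pi> (Spec k) (Spec K) (Spec_map k K \<phi>))))"

end

theory Submission
  imports Defs "HOL-Algebra.Weak_Morphisms"
begin

text \<open>The stalk of \<open>X \<times>\<^sub>S Y\<close> at a point \<open>z\<close> over \<open>x\<close>, \<open>y\<close>, \<open>s\<close> is the localisation of \<open>A \<otimes>\<^sub>R C\<close> at a
  prime, where \<open>A\<close>, \<open>C\<close>, \<open>R\<close> are the stalks at \<open>x\<close>, \<open>y\<close>, \<open>s\<close>; it is flat over \<open>A\<close>, and \<open>(A/m) \<otimes>\<^sub>R C\<close> is a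
  domain by geometric integrality. If \<open>m\<close> is the annihilator of \<open>a\<close>, flatness makes \<open>m \<otimes>\<^sub>R C\<close> the
  annihilator of \<open>a \<otimes> 1\<close>, so the generic point of the fibre over \<open>x\<close> is associated. Conversely, if \<open>z\<close>
  is associated, then so is \<open>x\<close>; and the socle of \<open>A\<close> is a vector space over \<open>A/m\<close>, whose base change is
  torsion-free over that domain, which forces the prime at \<open>z\<close> to be generated by \<open>m\<close>, that is, \<open>z\<close> is
  the generic point of its fibre. Finally, by flatness every open neighbourhood of \<open>\<xi>\<^sub>\<eta>\<close> meets the fibre
  over a generisation \<open>\<eta>'\<close> of \<open>\<eta>\<close>, and so contains its generic point.\<close>

text \<open>Two obstacles shape the proof. Tensor products are quotients of lists, and
  \<open>flat_hom\<close> tests injectivity only on modules carried by the type of the base ring R.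
  Injectivity of P \<otimes> C -> A \<otimes> C for a submodule P of an algebra A is therefore
  derived from ideals of R, by removing one element of A after the other from a derivation of u = 0.
  All later uses of flatness go through \<open>flat_kernel\<close>. The scheme (Y_s)_\<eta> is an
  iterated fibre product, whose points and stalks are awkward to compare with those of X \<times>_S
  Y. It is replaced by the isomorphic space Spec \<kappa>(\<eta>) \<times>_S Y, whose stalks are
  localisations of \<kappa>(\<eta>) \<otimes> O_{Y,y} over O_{S,s}, with the same y. The isomorphism
  is obtained without coordinates, from the universal property among locally ringed spaces, which is
  proved for the explicit construction. The same comparison moves \<kappa>(\<eta>) into the type for
  which geometric integrality is assumed. Affine charts translate properties of schemes into
  statements on stalks: generisations are primes, integrality gives domains, and the maximal ideals
  are finitely generated.\<close>

abbreviation (input) ring_mul ("_ *[_] _" [70,0,71] 70) where "x *[R] y == x \<otimes>\<^bsub>R\<^esub> y"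
abbreviation (input) ring_plus ("_ +[_] _" [65,0,66] 65) where "x +[R] y == x \<oplus>\<^bsub>R\<^esub> y"
abbreviation (input) ring_neg ("-[_] _" [0,81] 80) where "-[R] x == \<ominus>\<^bsub>R\<^esub> x"
abbreviation (input) ring_null ("0[_]") where "0[R] == \<zero>\<^bsub>R\<^esub>"
abbreviation (input) ring_unit ("1[_]") where "1[R] == \<one>\<^bsub>R\<^esub>"

abbreviation (input) "Stk X x == carrier (stalk X x)"
abbreviation (input) "Mst X x == max_ideal (stalk X x)"
abbreviation (input) "Scs X U == carrier (sec X U)"
abbreviation (input) "cmp == morph_comp"
abbreviation (input) "smap == stalk_map"
abbreviation (input) "mor == is_morphism"
abbreviation (input) "meq == morph_eq"
abbreviation (input) "lrsp == locally_ringed_space"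
abbreviation (input) "osub == open_subspace"

section \<open>Commutative algebra\<close>

subsection \<open>Ideals, units and local rings\<close>

lemma cring_ring: "cring R ==> ring R"
 by (rule cring.axioms)

lemma hom_zero: "h : ring_hom R S ==> cring R ==> cring S ==> h 0[R] = 0[S]"
 by (rule ring_hom_zero) (auto dest: cring_ring)

lemma hom_a_inv:
 "h : ring_hom R S ==> cring R ==> cring S ==> x : carrier R ==> h (-[R] x) = -[S] h x"
 by (rule ring_hom_cring.hom_a_inv[of R S]) (auto intro!: ring_hom_cring.intro ring_hom_cring_axioms.intro)

lemma hom_simps:
 assumes "h : ring_hom R S" "cring R" "cring S"
 shows "x : carrier R ==> h x : carrier S"
  "x : carrier R ==> y : carrier R ==> h (x *[R] y) = h x *[S] h y"
  "x : carrier R ==> y : carrier R ==> h (x +[R] y) = h x +[S] h y"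
  "h 1[R] = 1[S]" "h 0[R] = 0[S]"
  "x : carrier R ==> h (-[R] x) = -[S] h x"
 using assms ring_hom_closed[OF assms(1)] ring_hom_mult[OF assms(1)] ring_hom_add[OF assms(1)] ring_hom_one[OF assms(1)]
  hom_zero[OF assms] hom_a_inv[OF assms] by blast+

lemma hom_pow:
 assumes "h : ring_hom R S" "cring R" "cring S" "x : carrier R"
 shows "h (x [^]\<^bsub>R\<^esub> (n::nat)) = h x [^]\<^bsub>S\<^esub> n"
proof -
 interpret R: cring R by fact
 interpret S: cring S by fact
 show ?thesis using assms(4) by (induction n) (simp_all add: hom_simps[OF assms(1-3)])
qed

lemma UnitsI:
 assumes "cring R" "x : carrier R" "y : carrier R" "x *[R] y = 1[R]"
 shows "x : Units R"
proof -
 interpret cring R by fact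
 show ?thesis using assms m_comm[of x y] unfolding Units_def by auto
qed

lemma UnitsE:
 assumes "cring R" "x : Units R"
 obtains y where "y : carrier R" "x *[R] y = 1[R]" "x : carrier R"
 using assms unfolding Units_def by auto

lemma hom_Units:
 assumes "h : ring_hom R S" "cring R" "cring S" "x : Units R"
 shows "h x : Units S"
proof -
 obtain y where y: "y : carrier R" "x *[R] y = 1[R]" "x : carrier R"
  using UnitsE[OF assms(2,4)] .
 then have "h x *[S] h y = 1[S]" using assms(1) by (metis ring_hom_mult ring_hom_one)
 then show ?thesis using UnitsI assms(1,3) y by (metis ring_hom_closed)
qed

lemma Units_mult_iff:
 assumes "cring R" "x : carrier R" "y : carrier R"
 shows "x *[R] y : Units R \<longleftrightarrow> x : Units R & y : Units R"
proof -
 interpret cring R by fact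
 show ?thesis using assms unit_factor[of x y] unit_factor[of y x] m_comm by auto
qed

lemma Units_cancel:
 assumes "cring R" "u : Units R" "x : carrier R" "y : carrier R"
 shows "x *[R] u = y *[R] u \<longleftrightarrow> x = y"
proof -
 interpret cring R by fact
 show ?thesis using assms m_comm Units_l_cancel Units_closed by metis
qed

lemma idealI_cring:
 assumes "cring R" "I <= carrier R" "0[R] : I"
  and add: "!!x y. x : I ==> y : I ==> x +[R] y : I"
  and mult: "!!r x. r : carrier R ==> x : I ==> r *[R] x : I"
 shows "ideal I R"
proof -
 interpret cring R by fact
 have neg: "-[R] x : I" if "x : I" for x
  using mult[of "-[R] 1[R]" x] that assms(2) l_minus[of "1[R]" x] by auto
 show ?thesis
  using assms(2,3) neg add mult m_comm
  by (intro idealI ring_axioms subgroup.intro) (auto simp: a_inv_def[symmetric] subset_iff, metis+)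
qed

text \<open>Zorn's lemma applies because the union of a nonempty chain of ideals is an ideal. Two
  choices of \<open>M\<close> matter: a multiplicative set, for which the maximal element turns out
  to be prime, and {1}, for which it is a maximal ideal.\<close>

lemma ideal_maximal_disjoint:
 assumes R: "cring R" and I: "ideal I R" and disj: "I Int M = {}"
 obtains J where "ideal J R" "I <= J" "J Int M = {}"
  "!!J'. ideal J' R ==> J <= J' ==> J' Int M = {} ==> J' = J"
proof -
 interpret cring R by fact
 let ?A = "{J. ideal J R & I <= J & J Int M = {}}"
 have "EX J:?A. ALL X:?A. J <= X --> X = J"
 proof (rule subset_Zorn_nonempty)
  show "?A ~= {}" using I disj by blast
  fix CC assume C: "CC ~= {}" "subset.chain ?A CC"
  then have "subset.chain {I. ideal I R} CC" unfolding subset.chain_def by blast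
  from chain_Union_is_ideal[OF this] C(1) have "ideal (\<Union>CC) R" by simp
  moreover have "CC <= ?A" using C(2) by (rule subset.chain_def[THEN iffD1, THEN conjunct1])
  ultimately show "\<Union>CC : ?A" using C(1) by blast
 qed
 then obtain J where J: "J : ?A" and max: "ALL X:?A. J <= X --> X = J" by (elim bexE)
 show thesis
 proof (rule that)
  show "ideal J R" "I <= J" "J Int M = {}" using J by simp_all
  fix J' assume "ideal J' R" "J <= J'" "J' Int M = {}"
  then show "J' = J" using max J by (metis (mono_tags, lifting) mem_Collect_eq subset_trans)
 qed
qed

text \<open>The ideal generated by J and a is written as J + Ra, so that each member comes with an
  explicit coefficient of \<open>a\<close>.\<close>

lemma (in cring) Idl_insert_elem:
 assumes J: "ideal J R" and a: "a : carrier R"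
 defines "K == {x \<oplus> r \<otimes> a | x r. x : J & r : carrier R}"
 shows "ideal K R" "J <= K" "a : K"
proof -
 interpret J: ideal J R by fact
 show "ideal K R"
 proof (rule idealI_cring)
  show "cring R" by (rule is_cring)
  show "K <= carrier R" using a J.Icarr by (auto simp: K_def)
  have "\<zero> = \<zero> \<oplus> \<zero> \<otimes> a" using a by simp
  then show "\<zero> : K" unfolding K_def using J.zero_closed by blast
 next
  fix x y assume "x : K" "y : K"
  then obtain u r v s where *: "x = u \<oplus> r \<otimes> a" "y = v \<oplus> s \<otimes> a" "u : J" "v : J" "r : carrier R" "s : carrier R"
   by (auto simp: K_def)
  then have "x \<oplus> y = (u \<oplus> v) \<oplus> (r \<oplus> s) \<otimes> a" using a J.Icarr by (auto simp: l_distr a_ac)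
  then show "x \<oplus> y : K" using * J.a_closed unfolding K_def by blast
 next
  fix r x assume r: "r : carrier R" and "x : K"
  then obtain u t where *: "x = u \<oplus> t \<otimes> a" "u : J" "t : carrier R"
   by (auto simp: K_def)
  then have "r \<otimes> x = r \<otimes> u \<oplus> (r \<otimes> t) \<otimes> a" using a r J.Icarr by (auto simp: r_distr m_assoc)
  then show "r \<otimes> x : K" using * r J.I_l_closed unfolding K_def by blast
 qed
 show "J <= K"
 proof
  fix x assume "x : J"
  then have "x = x \<oplus> \<zero> \<otimes> a" using a J.Icarr by simp
  with \<open>x : J\<close> show "x : K" unfolding K_def by blast
 qed
 have "a = \<zero> \<oplus> \<one> \<otimes> a" using a by simp
 then show "a : K" unfolding K_def using J.zero_closed by blast
qed

text \<open>An ideal J maximal among those avoiding a multiplicative set is prime: if a and b lie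
  outside J, then J + Ra and J + Rb meet \<open>M\<close>, and so does J + Rab, which equals J when
  ab is in J.\<close>

lemma prime_disjoint:
 assumes R: "cring R" and I: "ideal I R" and disj: "I Int M = {}" and one: "1[R] : M"
  and M: "M <= carrier R" and mult: "!!x y. x : M ==> y : M ==> x *[R] y : M"
 obtains p where "primeideal p R" "I <= p" "p Int M = {}"
proof -
 interpret cring R by fact
 obtain J where J: "ideal J R" "I <= J" "J Int M = {}"
  and max: "!!J'. ideal J' R ==> J <= J' ==> J' Int M = {} ==> J' = J"
  using ideal_maximal_disjoint[OF R I disj] by metis
 interpret J: ideal J R by fact
 have ext: "EX x:J. EX r:carrier R. x +[R] r *[R] a : M" if a: "a : carrier R" "a ~: J" for a
  using max[OF Idl_insert_elem(1,2)[OF J(1) a(1)]] Idl_insert_elem(3)[OF J(1) a(1)] a(2) by blast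
 have "primeideal J R"
 proof (rule primeidealI)
  show "ideal J R" "cring R" by fact+
  show "carrier R ~= J" using one J(3) by auto
 next
  fix a b assume ab: "a : carrier R" "b : carrier R" "a *[R] b : J"
  show "a : J \<or> b : J"
  proof (rule ccontr)
   assume "~  (a : J \<or> b : J)"
   then obtain x r y s where *: "x : J" "r : carrier R" "x +[R] r *[R] a : M"
    "y : J" "s : carrier R" "y +[R] s *[R] b : M" using ext ab by meson
   \<comment> \<open>Each of the first three summands has a factor in \<open>J\<close>; the last one
     contains the product ab.\<close>
   have "(x +[R] r *[R] a) *[R] (y +[R] s *[R] b)
    = ((x *[R] y +[R] x *[R] (s *[R] b)) +[R] (r *[R] a) *[R] y) +[R] (r *[R] s) *[R] (a *[R] b)"
    using * ab J.Icarr by (simp add: l_distr r_distr m_ac a_ac)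
   also have "... : J" using * ab by (intro J.a_closed) (auto intro: J.I_l_closed J.I_r_closed)
   finally show False using mult[OF *(3,6)] J(3) by blast
  qed
 qed
 then show thesis using that J by blast
qed

lemma exists_maximalideal:
 assumes R: "cring R" and I: "ideal I R" and ne: "1[R] ~: I"
 obtains m where "maximalideal m R" "I <= m"
proof -
 interpret cring R by fact
 obtain J where J: "ideal J R" "I <= J" "J Int {1[R]} = {}"
  and max: "!!J'. ideal J' R ==> J <= J' ==> J' Int {1[R]} = {} ==> J' = J"
  using ideal_maximal_disjoint[OF R I, of "{1[R]}"] ne by blast
 have "maximalideal J R"
 proof (rule maximalidealI)
  show "ideal J R" by fact
  show "carrier R ~= J" using J(3) by auto
  fix J' assume J': "ideal J' R" "J <= J'" "J' <= carrier R"
  then show "J' = J \<or> J' = carrier R"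
   using max ideal.one_imp_carrier[OF J'(1)] by blast
 qed
 then show thesis using that J by blast
qed

text \<open>The powers of \<open>a\<close> form the multiplicative set. In \<open>generise\<close>
  this produces a point of a fibre at which a given function does not vanish.\<close>

lemma prime_avoiding_nonnilpotent:
 assumes R: "cring R" and a: "a : carrier R" and nil: "!!n::nat. a [^]\<^bsub>R\<^esub> n ~= 0[R]"
 obtains p where "primeideal p R" "a ~: p"
proof -
 interpret cring R by fact
 have mult: "x *[R] y : range (%n::nat. a [^]\<^bsub>R\<^esub> n)"
  if "x : range (%n::nat. a [^]\<^bsub>R\<^esub> n)" "y : range (%n::nat. a [^]\<^bsub>R\<^esub> n)" for x y
  using that a by (auto simp: nat_pow_mult)
 have one: "1[R] : range (%n::nat. a [^]\<^bsub>R\<^esub> n)" by (rule range_eqI[of _ _ 0]) simp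
 obtain p where p: "primeideal p R" "p Int range (%n::nat. a [^]\<^bsub>R\<^esub> n) = {}"
  using prime_disjoint[OF R zeroideal _ one _ mult] nil a by (metis (no_types, lifting) disjoint_iff nat_pow_closed rangeE image_subsetI singletonD)
 have "a = a [^]\<^bsub>R\<^esub> (1::nat)" using a by simp
 then show thesis using that[OF p(1)] p(2) by blast
qed

lemma maximalideal_Units:
 assumes "cring R" "maximalideal m R"
 shows "m Int Units R = {}"
proof (rule ccontr)
 interpret cring R by fact
 interpret m: maximalideal m R by fact
 assume "m Int Units R ~= {}"
 then obtain x where x: "x : m" "x : Units R" by auto
 obtain y where y: "y : carrier R" "x *[R] y = 1[R]" using UnitsE[OF assms(1) x(2)] by metis
 then have "1[R] : m" using x m.I_r_closed by metis
 then show False using m.one_imp_carrier m.I_notcarr by blast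
qed

lemma local_ringD:
 assumes "local_ring R"
 shows "cring R" "maximalideal (max_ideal R) R" "maximalideal m R ==> m = max_ideal R"
proof -
 show "cring R" using assms by (auto simp: local_ring_def)
 have ex: "EX! m. maximalideal m R" using assms by (auto simp: local_ring_def)
 then show m: "maximalideal (max_ideal R) R" unfolding max_ideal_def by (rule theI')
 show "maximalideal m R ==> m = max_ideal R" using ex m by blast
qed

lemma max_ideal_iff:
 assumes "local_ring R" "x : carrier R"
 shows "x : max_ideal R \<longleftrightarrow> x ~: Units R"
proof
 note R = local_ringD[OF assms(1)]
 interpret cring R by (rule R)
 show "x : max_ideal R ==> x ~: Units R" using maximalideal_Units[OF R(1,2)] by blast
 assume x: "x ~: Units R"
 have "1[R] ~: PIdl\<^bsub>R\<^esub> x"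
 proof
  assume "1[R] : PIdl\<^bsub>R\<^esub> x"
  then obtain r where "r : carrier R" "r *[R] x = 1[R]" unfolding cgenideal_def by auto
  then show False using UnitsI[OF R(1) assms(2)] m_comm x assms(2) by metis
 qed
 then obtain m where "maximalideal m R" "PIdl\<^bsub>R\<^esub> x <= m"
  using exists_maximalideal[OF R(1) cgenideal_ideal[OF assms(2)]] by blast
 then show "x : max_ideal R" using R(3) cgenideal_self[OF assms(2)] by blast
qed

lemma max_ideal_ideal: "local_ring R ==> ideal (max_ideal R) R"
 using local_ringD(2) maximalideal.axioms(1) by blast

lemma max_ideal_subset: "local_ring R ==> max_ideal R <= carrier R"
 using max_ideal_ideal additive_subgroup.a_subset ideal.axioms(1) by blast

lemma max_ideal_prime: "local_ring R ==> primeideal (max_ideal R) R"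
 using local_ringD cring.maximalideal_prime by blast

text \<open>As \<open>max_ideal\<close> is defined by THE, it is computed by exhibiting the nonunits
  as an ideal: every maximal ideal consists of nonunits, hence lies in it and equals it.\<close>

lemma local_ringI:
 assumes R: "cring R" and I: "ideal m R" and m: "!!x. x : carrier R ==> x : m \<longleftrightarrow> x ~: Units R"
 shows "local_ring R" "max_ideal R = m"
proof -
 interpret cring R by fact
 interpret I: ideal m R by fact
 have one: "1[R] ~: m" using m[of "1[R]"] by auto
 have *: "J = m" if J: "maximalideal J R" for J
 proof -
  interpret J: maximalideal J R by fact
  have "J <= m" using maximalideal_Units[OF R J] J.Icarr m by blast
  then show "J = m" using J.I_maximal[OF I] one I.Icarr by blast
 qed
 obtain J where "maximalideal J R" using exists_maximalideal[OF R I one] .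
 with * have "maximalideal m R" by metis
 with * have ex: "EX! m. maximalideal m R" by blast
 show "local_ring R" using R ex by (simp add: local_ring_def)
 from local_ringD(2)[OF this] * show "max_ideal R = m" by blast
qed

text \<open>One direction is locality of \<open>h\<close>; for the other, an element outside the
  maximal ideal is a unit, and homomorphisms preserve units.\<close>

lemma local_hom_iff:
 assumes "local_ring R" "local_ring S" "h : ring_hom R S" "h ` max_ideal R <= max_ideal S" "x : carrier R"
 shows "h x : max_ideal S \<longleftrightarrow> x : max_ideal R"
 using assms hom_Units[OF assms(3)] max_ideal_iff local_ringD(1) ring_hom_closed by (metis image_subset_iff)

lemma ideal_vimage:
 assumes "h : ring_hom R S" "cring R" "cring S" "ideal I S"
 shows "ideal {r : carrier R. h r : I} R"
proof -
 interpret cring R by fact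
 interpret S: cring S by fact
 interpret I: ideal I S by fact
 show ?thesis
  by (intro idealI_cring assms) (auto simp: hom_simps[OF assms(1-3)] intro: I.I_l_closed)
qed

lemma primeideal_vimage:
 assumes "h : ring_hom R S" "cring R" "cring S" "primeideal I S"
 shows "primeideal {r : carrier R. h r : I} R"
proof -
 interpret cring R by fact
 interpret S: cring S by fact
 interpret I: primeideal I S by fact
 have "1[S] ~: I" using I.one_imp_carrier I.I_notcarr by blast
 then have "carrier R ~= {r : carrier R. h r : I}" using one_closed ring_hom_one[OF assms(1)] by force
 then show ?thesis using ideal_vimage[OF assms(1,2,3) I.is_ideal] I.I_prime
  by (intro primeidealI assms) (auto simp: hom_simps[OF assms(1-3)])
qed

lemma primeideal_one: "primeideal p R ==> 1[R] ~: p"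
 using ideal.one_imp_carrier primeideal.I_notcarr primeideal.axioms(1) by metis

lemma primeideal_mult_notin:
 assumes "primeideal p R" "x : carrier R - p" "y : carrier R - p"
 shows "x *[R] y : carrier R - p"
proof -
 interpret primeideal p R by fact
 show ?thesis using assms I_prime by blast
qed

lemma field_prime_iff:
 assumes "field K"
 shows "primeideal p K \<longleftrightarrow> p = {0[K]}"
proof
 interpret field K by fact
 assume p: "primeideal p K"
 then have "p : {I. ideal I K}" by (auto dest: primeideal.axioms)
 then show "p = {0[K]}" using all_ideals primeideal.I_notcarr[OF p] by auto
next
 interpret field K by fact
 show "p = {0[K]} ==> primeideal p K" using zeroprimeideal by simp
qed

subsection \<open>Localisation\<close>

locale prime_at = primeideal I R for I and R :: "'a ring" (structure)
begin

lemma loc_frac_mem: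
 "(b, t) : loc_frac R I a s \<longleftrightarrow> b : carrier R & t : carrier R - I &
   (EX u:carrier R - I. u \<otimes> (a \<otimes> t) = u \<otimes> (b \<otimes> s))"
 by (auto simp: loc_frac_def)

lemma notin_mult: "x : carrier R - I ==> y : carrier R - I ==> x \<otimes> y : carrier R - I"
 by (rule primeideal_mult_notin[OF primeideal])

lemma one_notin: "\<one> : carrier R - I"
 using primeideal_one[OF primeideal] by auto

lemma loc_frac_eq_iff:
 assumes "a : carrier R" "b : carrier R" "s : carrier R - I" "t : carrier R - I"
 shows "loc_frac R I a s = loc_frac R I b t \<longleftrightarrow> (EX u:carrier R - I. u \<otimes> (a \<otimes> t) = u \<otimes> (b \<otimes> s))"
proof
 assume "loc_frac R I a s = loc_frac R I b t"
 moreover have "(b, t) : loc_frac R I b t" using assms one_notin by (auto simp: loc_frac_mem)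
 ultimately have "(b, t) : loc_frac R I a s" by simp
 then show "EX u:carrier R - I. u \<otimes> (a \<otimes> t) = u \<otimes> (b \<otimes> s)" by (simp add: loc_frac_mem)
next
 assume "EX u:carrier R - I. u \<otimes> (a \<otimes> t) = u \<otimes> (b \<otimes> s)"
 then obtain u where u: "u : carrier R - I" "u \<otimes> (a \<otimes> t) = u \<otimes> (b \<otimes> s)" by blast
 have *: "loc_frac R I a s <= loc_frac R I b t"
  if ab: "a : carrier R" "b : carrier R" "s : carrier R - I" "t : carrier R - I"
   and u: "u : carrier R - I" "u \<otimes> (a \<otimes> t) = u \<otimes> (b \<otimes> s)" for a b s t u
 proof
  fix x assume "x : loc_frac R I a s"
  then obtain c r v where x: "x = (c, r)" "c : carrier R" "r : carrier R - I" "v : carrier R - I"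
   "v \<otimes> (a \<otimes> r) = v \<otimes> (c \<otimes> s)" by (cases x) (auto simp: loc_frac_mem)
  \<comment> \<open>The fractions b/t and c/r are compared through a/s. The middle denominator
    \<open>s\<close> has to enter the witness besides u and v, since it cannot be cancelled.\<close>
  have "(u \<otimes> v \<otimes> s) \<otimes> (b \<otimes> r) = (v \<otimes> r) \<otimes> (u \<otimes> (b \<otimes> s))" using ab u x by (simp add: m_ac)
  also have "... = (u \<otimes> t) \<otimes> (v \<otimes> (a \<otimes> r))" unfolding u(2)[symmetric] using ab u(1) x(2-4) by (simp add: m_ac)
  also have "... = (u \<otimes> v \<otimes> s) \<otimes> (c \<otimes> t)" unfolding x(5) using ab u(1) x(2-4) by (simp add: m_ac)
  finally show "x : loc_frac R I b t"
   unfolding x(1) loc_frac_mem using x ab u by (auto intro!: bexI[of _ "u \<otimes> v \<otimes> s"] notin_mult dest: notin_mult I_prime)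
 qed
 show "loc_frac R I a s = loc_frac R I b t"
  using *[OF assms u] *[OF assms(2,1,4,3) u(1) u(2)[symmetric]] by blast
qed

lemma loc_frac_self: "a : carrier R ==> s : carrier R - I ==> (a, s) : loc_frac R I a s"
 using one_notin by (auto simp: loc_frac_mem)

text \<open>The operations of \<open>loc\<close> are unions over all pairs of representatives; such
  a union collapses to one class when \<open>F\<close> does not depend on the
  representatives.\<close>

lemma loc_frac_op:
 assumes a: "a : carrier R" "s : carrier R - I" and b: "b : carrier R" "t : carrier R - I"
  and F: "!!a' s' b' t'. (a', s') : loc_frac R I a s ==> (b', t') : loc_frac R I b t ==> F a' s' b' t' = F a s b t"
 shows "(\<Union>(a', s')\<in>loc_frac R I a s. \<Union>(b', t')\<in>loc_frac R I b t. F a' s' b' t') = F a s b t"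
 using loc_frac_self[OF a] loc_frac_self[OF b] F by blast

lemma loc_mult:
 assumes a: "a : carrier R" "s : carrier R - I" and b: "b : carrier R" "t : carrier R - I"
 shows "loc_frac R I a s *[loc R I] loc_frac R I b t = loc_frac R I (a \<otimes> b) (s \<otimes> t)"
proof -
 have "loc_frac R I (a' \<otimes> b') (s' \<otimes> t') = loc_frac R I (a \<otimes> b) (s \<otimes> t)"
  if A: "(a', s') : loc_frac R I a s" and B: "(b', t') : loc_frac R I b t" for a' s' b' t'
 proof -
  obtain u where u: "u : carrier R - I" "u \<otimes> (a \<otimes> s') = u \<otimes> (a' \<otimes> s)" and a': "a' : carrier R" "s' : carrier R - I"
   using A by (auto simp: loc_frac_mem)
  obtain v where v: "v : carrier R - I" "v \<otimes> (b \<otimes> t') = v \<otimes> (b' \<otimes> t)" and b': "b' : carrier R" "t' : carrier R - I"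
   using B by (auto simp: loc_frac_mem)
  have "(u \<otimes> v) \<otimes> ((a' \<otimes> b') \<otimes> (s \<otimes> t)) = (u \<otimes> (a' \<otimes> s)) \<otimes> (v \<otimes> (b' \<otimes> t))"
   using a b a' b' u(1) v(1) by (simp add: m_ac)
  also have "... = (u \<otimes> v) \<otimes> ((a \<otimes> b) \<otimes> (s' \<otimes> t'))"
   unfolding u(2)[symmetric] v(2)[symmetric] using a b a' b' u(1) v(1) by (simp add: m_ac)
  finally show ?thesis
   using a b a' b' u(1) v(1) notin_mult[OF u(1) v(1)]
   by (intro loc_frac_eq_iff[THEN iffD2] notin_mult bexI[of _ "u \<otimes> v"] m_closed; simp)
 qed
 from loc_frac_op[where F = "%a s b t. loc_frac R I (a \<otimes> b) (s \<otimes> t)", OF a b this]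
 show ?thesis by (simp add: loc_def)
qed

lemma loc_add:
 assumes a: "a : carrier R" "s : carrier R - I" and b: "b : carrier R" "t : carrier R - I"
 shows "loc_frac R I a s +[loc R I] loc_frac R I b t = loc_frac R I (a \<otimes> t \<oplus> b \<otimes> s) (s \<otimes> t)"
proof -
 have "loc_frac R I (a' \<otimes> t' \<oplus> b' \<otimes> s') (s' \<otimes> t') = loc_frac R I (a \<otimes> t \<oplus> b \<otimes> s) (s \<otimes> t)"
  if A: "(a', s') : loc_frac R I a s" and B: "(b', t') : loc_frac R I b t" for a' s' b' t'
 proof -
  obtain u where u: "u : carrier R - I" "u \<otimes> (a \<otimes> s') = u \<otimes> (a' \<otimes> s)" and a': "a' : carrier R" "s' : carrier R - I"
   using A by (auto simp: loc_frac_mem)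
  obtain v where v: "v : carrier R - I" "v \<otimes> (b \<otimes> t') = v \<otimes> (b' \<otimes> t)" and b': "b' : carrier R" "t' : carrier R - I"
   using B by (auto simp: loc_frac_mem)
  have "(u \<otimes> v) \<otimes> ((a' \<otimes> t' \<oplus> b' \<otimes> s') \<otimes> (s \<otimes> t)) = (u \<otimes> (a' \<otimes> s)) \<otimes> (v \<otimes> t \<otimes> t') \<oplus> (v \<otimes> (b' \<otimes> t)) \<otimes> (u \<otimes> s \<otimes> s')"
   using a b a' b' u(1) v(1) by (simp add: m_ac r_distr l_distr)
  also have "... = (u \<otimes> v) \<otimes> ((a \<otimes> t \<oplus> b \<otimes> s) \<otimes> (s' \<otimes> t'))"
   unfolding u(2)[symmetric] v(2)[symmetric] using a b a' b' u(1) v(1) by (simp add: m_ac r_distr l_distr)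
  finally show ?thesis
   using a b a' b' u(1) v(1) notin_mult[OF u(1) v(1)]
   by (intro loc_frac_eq_iff[THEN iffD2] notin_mult bexI[of _ "u \<otimes> v"] m_closed a_closed; simp)
 qed
 from loc_frac_op[where F = "%a s b t. loc_frac R I (a \<otimes> t \<oplus> b \<otimes> s) (s \<otimes> t)", OF a b this]
 show ?thesis by (simp add: loc_def)
qed

lemma loc_frac_closed: "a : carrier R ==> s : carrier R - I ==> loc_frac R I a s : carrier (loc R I)"
 by (auto simp: loc_def)

lemma loc_cases:
 assumes "x : carrier (loc R I)"
 obtains a s where "x = loc_frac R I a s" "a : carrier R" "s : carrier R - I"
 using assms by (auto simp: loc_def)

lemma loc_one: "1[loc R I] = loc_frac R I \<one> \<one>" and loc_zero: "0[loc R I] = loc_frac R I \<zero> \<one>"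
 by (simp_all add: loc_def)

lemma loc_frac_eqI:
 assumes "a : carrier R" "b : carrier R" "s : carrier R - I" "t : carrier R - I" "a \<otimes> t = b \<otimes> s"
 shows "loc_frac R I a s = loc_frac R I b t"
 using assms loc_frac_eq_iff[of a b s t] one_notin by auto

lemma loc_cring: "cring (loc R I)"
proof (rule cringI)
 note [intro] = loc_frac_closed and [simp] = loc_mult loc_add
 have c[simp]: "s \<otimes> t ~: I" if "s : carrier R" "s ~: I" "t : carrier R" "t ~: I" for s t
  using notin_mult that by blast
 have [simp]: "\<one> ~: I" using one_notin by auto
 show "abelian_group (loc R I)"
 proof (rule abelian_groupI)
  fix x y assume xy: "x : carrier (loc R I)" "y : carrier (loc R I)"
  then obtain a s b t where x: "x = loc_frac R I a s" "a : carrier R" "s : carrier R - I"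
   and y: "y = loc_frac R I b t" "b : carrier R" "t : carrier R - I" by (metis loc_cases)
  show "x +[loc R I] y : carrier (loc R I)" using x y by auto
  show "x +[loc R I] y = y +[loc R I] x" using x y by (auto simp: m_ac a_ac)
  fix z assume "z : carrier (loc R I)"
  then obtain c r where z: "z = loc_frac R I c r" "c : carrier R" "r : carrier R - I" by (metis loc_cases)
  show "x +[loc R I] y +[loc R I] z = x +[loc R I] (y +[loc R I] z)"
   using x y z by (auto simp: m_ac a_ac l_distr r_distr)
 next
  show "0[loc R I] : carrier (loc R I)" by (auto simp: loc_zero)
  fix x assume "x : carrier (loc R I)"
  then obtain a s where x: "x = loc_frac R I a s" "a : carrier R" "s : carrier R - I" by (metis loc_cases)
  show "0[loc R I] +[loc R I] x = x" using x by (auto simp: loc_zero)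
  have "loc_frac R I (\<ominus> a) s +[loc R I] x = loc_frac R I (\<ominus> a \<otimes> s \<oplus> a \<otimes> s) (s \<otimes> s)" using x by auto
  also have "... = 0[loc R I]" unfolding loc_zero using x
   by (intro loc_frac_eqI) (auto simp: l_distr[symmetric] l_neg)
  finally show "EX y:carrier (loc R I). y +[loc R I] x = 0[loc R I]" using x by blast
 qed
 show "comm_monoid (loc R I)"
 proof (rule comm_monoidI)
  fix x y assume xy: "x : carrier (loc R I)" "y : carrier (loc R I)"
  then obtain a s b t where x: "x = loc_frac R I a s" "a : carrier R" "s : carrier R - I"
   and y: "y = loc_frac R I b t" "b : carrier R" "t : carrier R - I" by (metis loc_cases)
  show "x *[loc R I] y : carrier (loc R I)" using x y by auto
  show "x *[loc R I] y = y *[loc R I] x" using x y by (auto simp: m_ac)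
  fix z assume "z : carrier (loc R I)"
  then obtain c r where z: "z = loc_frac R I c r" "c : carrier R" "r : carrier R - I" by (metis loc_cases)
  show "x *[loc R I] y *[loc R I] z = x *[loc R I] (y *[loc R I] z)"
   using x y z by (auto simp: m_ac)
 next
  show "1[loc R I] : carrier (loc R I)" by (auto simp: loc_one)
  fix x assume "x : carrier (loc R I)"
  then obtain a s where x: "x = loc_frac R I a s" "a : carrier R" "s : carrier R - I" by (metis loc_cases)
  show "1[loc R I] *[loc R I] x = x" using x by (auto simp: loc_one)
 qed
 fix x y z assume xy: "x : carrier (loc R I)" "y : carrier (loc R I)" "z : carrier (loc R I)"
 then obtain a s b t c r where x: "x = loc_frac R I a s" "a : carrier R" "s : carrier R - I"
  and y: "y = loc_frac R I b t" "b : carrier R" "t : carrier R - I"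
  and z: "z = loc_frac R I c r" "c : carrier R" "r : carrier R - I" by (metis loc_cases)
 show "(x +[loc R I] y) *[loc R I] z = x *[loc R I] z +[loc R I] y *[loc R I] z"
  using x y z by (simp, intro loc_frac_eqI; simp add: m_ac l_distr r_distr)
qed

end

text \<open>\<open>B\<close> is a localisation of \<open>D\<close> at the prime ideal \<open>p\<close> by way of \<open>dd\<close>. Stalks of spectra and of
 fibre products are only used through this predicate.\<close>
definition is_loc :: "'a ring => 'a set => 'b ring => ('a => 'b) => bool" where
 "is_loc D p B dd \<longleftrightarrow> cring D & cring B & primeideal p D & dd : ring_hom D B &
  (ALL e:carrier D - p. dd e : Units B) &
  (ALL b:carrier B. EX d:carrier D. EX e:carrier D - p. b *[B] dd e = dd d) &
  (ALL d:carrier D. dd d = 0[B] --> (EX u:carrier D - p. u *[D] d = 0[D]))"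

lemma (in prime_at) is_loc_loc: "is_loc R I (loc R I) (%a. loc_frac R I a \<one>)"
proof -
 interpret L: cring "loc R I" by (rule loc_cring)
 have hom: "(%a. loc_frac R I a \<one>) : ring_hom R (loc R I)"
  using one_notin by (intro ring_hom_memI) (auto simp: loc_frac_closed loc_mult loc_add loc_one)
 have unit: "loc_frac R I e \<one> : Units (loc R I)" if "e : carrier R - I" for e
 proof (rule UnitsI[OF loc_cring])
  show "loc_frac R I \<one> e : carrier (loc R I)" "loc_frac R I e \<one> : carrier (loc R I)"
   using that one_notin loc_frac_closed by auto
  show "loc_frac R I e \<one> *[loc R I] loc_frac R I \<one> e = 1[loc R I]"
   using that one_notin by (simp add: loc_mult loc_one, intro loc_frac_eqI; simp)
 qed
 have surj: "EX d:carrier R. EX e:carrier R - I. b *[loc R I] loc_frac R I e \<one> = loc_frac R I d \<one>"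
  if b: "b : carrier (loc R I)" for b
 proof -
  obtain a s where x: "b = loc_frac R I a s" "a : carrier R" "s : carrier R - I" using loc_cases[OF b] .
  have "b *[loc R I] loc_frac R I s \<one> = loc_frac R I a \<one>"
   unfolding x(1) using x(2,3) one_notin by (subst loc_mult) (blast | (intro loc_frac_eqI notin_mult; simp))+
  then show ?thesis using x by blast
 qed
 have ker: "EX u:carrier R - I. u \<otimes> d = \<zero>" if "d : carrier R" "loc_frac R I d \<one> = 0[loc R I]" for d
  using that loc_frac_eq_iff[of d "\<zero>" "\<one>" "\<one>"] one_notin by (auto simp: loc_zero)
 show ?thesis unfolding is_loc_def
  using is_cring primeideal loc_cring hom unit surj ker by blast
qed

lemma is_locD:
 assumes "is_loc D p B dd"
 shows "cring D" "cring B" "primeideal p D" "dd : ring_hom D B"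
  "!!e. e : carrier D ==> e ~: p ==> dd e : Units B"
  "!!d. d : carrier D ==> dd d = 0[B] ==> EX u:carrier D - p. u *[D] d = 0[D]"
 using assms unfolding is_loc_def by auto

lemma is_loc_cases:
 assumes "is_loc D p B dd" "b : carrier B"
 obtains d e where "d : carrier D" "e : carrier D" "e ~: p" "b *[B] dd e = dd d"
 using assms unfolding is_loc_def by blast

text \<open>The kernel condition of \<open>is_loc\<close>, applied to d - d'.\<close>

lemma is_loc_eqD:
 assumes "is_loc D p B dd" "d : carrier D" "d' : carrier D" "dd d = dd d'"
 obtains u where "u : carrier D" "u ~: p" "u *[D] d = u *[D] d'"
proof -
 note L = is_locD[OF assms(1)] and H = hom_simps[OF is_locD(4,1,2)[OF assms(1)]]
 interpret D: cring D by (rule L)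
 interpret B: cring B by (rule L)
 have "dd (d +[D] -[D] d') = 0[B]" using H assms(2-4) by (simp add: B.r_neg)
 then obtain u where u: "u : carrier D" "u ~: p" "u *[D] (d +[D] -[D] d') = 0[D]"
  using L(6)[of "d +[D] -[D] d'"] assms(2,3) by auto
 then have "u *[D] d = u *[D] d'"
  using assms(2,3) D.r_right_minus_eq[of "u *[D] d" "u *[D] d'"] by (simp add: a_minus_def D.r_distr D.r_minus)
 then show thesis by (rule that[OF u(1,2)])
qed

lemma is_loc_zero_iff:
 assumes "is_loc D p B dd" "d : carrier D"
 shows "dd d = 0[B] \<longleftrightarrow> (EX u:carrier D - p. u *[D] d = 0[D])"
proof
 note L = is_locD[OF assms(1)] and H = hom_simps[OF is_locD(4,1,2)[OF assms(1)]]
 interpret D: cring D by (rule L)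
 interpret B: cring B by (rule L)
 show "dd d = 0[B] ==> EX u:carrier D - p. u *[D] d = 0[D]" using L(6) assms(2) by blast
 assume "EX u:carrier D - p. u *[D] d = 0[D]"
 then obtain u where u: "u : carrier D" "u ~: p" "u *[D] d = 0[D]" by blast
 have "dd d *[B] dd u = 0[B] *[B] dd u"
  using u assms(2) H(1) H(2)[of d u] D.m_comm[of d u] by (simp add: H(5) flip: H(2))
 then show "dd d = 0[B]" using Units_cancel[OF L(2) L(5)[OF u(1,2)]] assms(2) H
  by simp
qed

text \<open>A fraction is a unit exactly when its numerator lies outside \<open>p\<close>. So the
  nonunits are the fractions with numerator in \<open>p\<close>, and these form an ideal.\<close>

lemma is_loc_local:
 assumes "is_loc D p B dd"
 shows "local_ring B" "d : carrier D ==> dd d : max_ideal B \<longleftrightarrow> d : p"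
proof -
 note L = is_locD[OF assms(1)] and H = hom_simps[OF is_locD(4,1,2)[OF assms(1)]]
 interpret D: cring D by (rule L)
 interpret B: cring B by (rule L)
 interpret p: prime_at p D by (rule prime_at.intro, rule L)
 \<comment> \<open>An inverse c/e of \<open>dd d\<close> yields u(dc) = ue with u outside
   \<open>p\<close>. For d in \<open>p\<close> this would put ue into the prime \<open>p\<close>,
   although neither factor lies there.\<close>
 have unit: "d ~: p" if d: "d : carrier D" "dd d : Units B" for d
 proof
  assume "d : p"
  obtain b where b: "b : carrier B" "dd d *[B] b = 1[B]" using UnitsE[OF L(2) d(2)] by metis
  obtain c e where c: "c : carrier D" "e : carrier D" "e ~: p" "b *[B] dd e = dd c"
   using is_loc_cases[OF assms b(1)] .
  have "dd (d *[D] c) = dd d *[B] (b *[B] dd e)" using d c by (simp add: H(2))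
  also have "... = (dd d *[B] b) *[B] dd e" using H(1) d(1) b(1) c(2) by (simp add: B.m_assoc)
  also have "... = dd e" unfolding b(2) using H(1)[OF c(2)] by (rule B.l_one)
  finally obtain u where u: "u : carrier D" "u ~: p" "u *[D] (d *[D] c) = u *[D] e"
   using is_loc_eqD[OF assms] c d by (metis D.m_closed)
  have "u *[D] e = u *[D] (d *[D] c)" by (rule u(3)[symmetric])
  also have "... : p" using u c \<open>d : p\<close> by (intro p.I_l_closed p.I_r_closed) auto
  finally show False using p.I_prime u c by blast
 qed
 define m where "m = {b : carrier B. b ~: Units B}"
 have mI: "dd d : m \<longleftrightarrow> d : p" if "d : carrier D" for d
  using unit L(4,5) that by (auto simp: m_def ring_hom_closed)
 \<comment> \<open>Membership in \<open>m\<close> can thus be read off from any representation of b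
   as a fraction.\<close>
 have mrep: "b : m \<longleftrightarrow> d : p" if "b : carrier B" "d : carrier D" "e : carrier D" "e ~: p" "b *[B] dd e = dd d" for b d e
  using mI[OF that(2)] Units_mult_iff[OF L(2) that(1) ring_hom_closed[OF L(4) that(3)]] L(5)[OF that(3,4)] that H(1)
  by (auto simp: m_def)
 have "ideal m B"
 proof (rule idealI_cring)
  show "cring B" by fact
  show "m <= carrier B" by (auto simp: m_def)
  show "0[B] : m" using mI[of "0[D]"] hom_zero[OF L(4,1,2)] by auto
  fix x y assume xy: "x : m" "y : m"
  then have C: "x : carrier B" "y : carrier B" by (auto simp: m_def)
  obtain d e where x: "d : carrier D" "e : carrier D" "e ~: p" "x *[B] dd e = dd d"
   using is_loc_cases[OF assms C(1)] .
  obtain c f where y: "c : carrier D" "f : carrier D" "f ~: p" "y *[B] dd f = dd c"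
   using is_loc_cases[OF assms C(2)] .
  have dc: "d : p" "c : p" using mrep x y xy C by blast+
  have ef: "e *[D] f ~: p" using p.I_prime x y by blast
  have "(x +[B] y) *[B] dd (e *[D] f) = (x *[B] dd e) *[B] dd f +[B] (y *[B] dd f) *[B] dd e"
   using x(1-3) y(1-3) C by (simp add: H B.m_ac B.l_distr B.r_distr)
  also have "... = dd (d *[D] f +[D] c *[D] e)" using x y H by simp
  finally show "x +[B] y : m"
   using mrep[of "x +[B] y" "d *[D] f +[D] c *[D] e" "e *[D] f"] C ef dc x y
   by (auto intro!: p.a_closed p.I_r_closed)
 next
  fix r x assume rx: "r : carrier B" "x : m"
  then show "r *[B] x : m" using Units_mult_iff[OF L(2)] by (auto simp: m_def)
 qed
 from local_ringI[OF L(2) this] have "local_ring B" "max_ideal B = m" by (auto simp: m_def)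
 then show "local_ring B" "d : carrier D ==> dd d : max_ideal B \<longleftrightarrow> d : p" using mI by auto
qed

lemma is_loc_hom_unique:
 assumes "is_loc D p B dd" and C: "cring C" and h: "h : ring_hom B C" and k: "k : ring_hom B C"
  and eq: "!!d. d : carrier D ==> h (dd d) = k (dd d)" and b: "b : carrier B"
 shows "h b = k b"
proof -
 note L = is_locD[OF assms(1)] and H = hom_simps[OF is_locD(4,1,2)[OF assms(1)]]
 obtain d e where x: "d : carrier D" "e : carrier D" "e ~: p" "b *[B] dd e = dd d"
  using is_loc_cases[OF assms(1) b] .
 have de: "dd e : carrier B" using H x by simp
 have "h b *[C] h (dd e) = k b *[C] h (dd e)"
  using x eq ring_hom_mult[OF h b de] ring_hom_mult[OF k b de] by metis
 then show ?thesis
  using Units_cancel[OF C hom_Units[OF h L(2) C L(5)[OF x(2,3)]]] ring_hom_closed[OF h] ring_hom_closed[OF k] b by simp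
qed

lemma (in cring) frac_ops:
 assumes "x : carrier R" "y : carrier R" "e : carrier R" "f : carrier R"
 shows "(x \<otimes> y) \<otimes> (e \<otimes> f) = (x \<otimes> e) \<otimes> (y \<otimes> f)" "(x \<oplus> y) \<otimes> (e \<otimes> f) = (x \<otimes> e) \<otimes> f \<oplus> (y \<otimes> f) \<otimes> e"
 using assms by (simp_all add: m_ac l_distr r_distr)

lemma is_loc_hom_exists:
 assumes "is_loc D p B dd" and C: "cring C" and th: "th : ring_hom D C"
  and unit: "!!e. e : carrier D ==> e ~: p ==> th e : Units C"
 obtains h where "h : ring_hom B C" "!!d. d : carrier D ==> h (dd d) = th d"
proof -
 note L = is_locD[OF assms(1)] and H = hom_simps[OF is_locD(4,1,2)[OF assms(1)]]
 interpret D: cring D by (rule L)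
 interpret B: cring B by (rule L)
 interpret C: cring C by (rule C)
 interpret p: prime_at p D by (rule prime_at.intro, rule L)
 note T = hom_simps[OF th L(1) C]
 note [simp] = H(1-4) T(1-4)
 \<comment> \<open>The graph of the wanted homomorphism: c is \<open>th d\<close> divided by
   \<open>th e\<close> for some representation d/e of b. It is total and single-valued, so that h
   can be chosen from it and its values computed from any representation.\<close>
 define P where "P b c \<longleftrightarrow> c : carrier C & (EX d:carrier D. EX e:carrier D - p. b *[B] dd e = dd d & c *[C] th e = th d)" for b c
 have PI: "P b c" if "c : carrier C" "d : carrier D" "e : carrier D" "e ~: p" "b *[B] dd e = dd d" "c *[C] th e = th d" for b c d e
  unfolding P_def using that by blast
 have PE: thesis if "P b c" "!!d e. c : carrier C ==> d : carrier D ==> e : carrier D ==> e ~: p ==>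
   b *[B] dd e = dd d ==> c *[C] th e = th d ==> thesis" for b c thesis
  using that unfolding P_def by blast
 have ex: "EX c. P b c" if b: "b : carrier B" for b
 proof -
  obtain d e where x: "d : carrier D" "e : carrier D" "e ~: p" "b *[B] dd e = dd d"
   using is_loc_cases[OF assms(1) b] .
  obtain i where i: "i : carrier C" "th e *[C] i = 1[C]" using UnitsE[OF C unit[OF x(2,3)]] by metis
  have "(th d *[C] i) *[C] th e = th d" using i x by (simp add: C.m_assoc C.m_comm[of i])
  then show ?thesis using x i by (intro exI[of _ "th d *[C] i"] PI[OF _ x]) auto
 qed
 have uniq: "c = c'" if P: "P b c" "P b c'" and b: "b : carrier B" for b c c'
 proof -
  obtain d e where 1: "c : carrier C" "d : carrier D" "e : carrier D" "e ~: p" "b *[B] dd e = dd d" "c *[C] th e = th d"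
   by (rule PE[OF P(1)])
  obtain d' e' where 2: "c' : carrier C" "d' : carrier D" "e' : carrier D" "e' ~: p" "b *[B] dd e' = dd d'" "c' *[C] th e' = th d'"
   by (rule PE[OF P(2)])
  have "dd (d *[D] e') = (b *[B] dd e) *[B] dd e'" using 1 2 by simp
  also have "... = (b *[B] dd e') *[B] dd e" using 1(3) 2(3) b by (simp add: B.m_ac)
  also have "... = dd (d' *[D] e)" using 1 2 by simp
  finally obtain u where u: "u : carrier D" "u ~: p" "u *[D] (d *[D] e') = u *[D] (d' *[D] e)"
   using is_loc_eqD[OF assms(1)] 1(2,3) 2(2,3) by (metis D.m_closed)
  have "th u *[C] (th d *[C] th e') = th u *[C] (th d' *[C] th e)" using arg_cong[OF u(3), of th] u(1) 1(2,3) 2(2,3) by simp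
  then have "(c *[C] th e) *[C] th e' = (c' *[C] th e') *[C] th e"
   unfolding 1(6) 2(6) using C.Units_l_cancel[OF unit[OF u(1,2)]] 1(2,3) 2(2,3) by simp
  also have "... = (c' *[C] th e) *[C] th e'" using 1(3) 2(1,3) by (simp add: C.m_ac)
  finally have "c *[C] th e = c' *[C] th e" using Units_cancel[OF C unit[OF 2(3,4)]] 1(1,3) 2(1) by simp
  then show ?thesis using Units_cancel[OF C unit[OF 1(3,4)]] 1(1) 2(1) by simp
 qed
 define h where "h b = (SOME c. P b c)" for b
 have hP: "P b (h b)" if "b : carrier B" for b unfolding h_def using someI_ex[OF ex[OF that]] .
 have uni: "h b = c" if "P b c" "b : carrier B" for b c by (rule uniq[OF hP[OF that(2)] that])
 have hd: "h (dd d) = th d" if d: "d : carrier D" for d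
  using d p.one_notin by (intro uni PI[of _ d "1[D]"]) auto
 have "h : ring_hom B C"
 proof (rule ring_hom_memI)
  show "h x : carrier C" if "x : carrier B" for x using hP[OF that] by (simp add: P_def)
  show "h 1[B] = 1[C]" using hd[of "1[D]"] by simp
 next
  fix x y assume C: "x : carrier B" "y : carrier B"
  obtain d e where x: "h x : carrier C" "d : carrier D" "e : carrier D" "e ~: p" "x *[B] dd e = dd d" "h x *[C] th e = th d"
   by (rule PE[OF hP[OF C(1)]])
  obtain c f where y: "h y : carrier C" "c : carrier D" "f : carrier D" "f ~: p" "y *[B] dd f = dd c" "h y *[C] th f = th c"
   by (rule PE[OF hP[OF C(2)]])
  have ef: "e *[D] f ~: p" using p.I_prime x y by blast
  note FB = B.frac_ops[OF C H(1)[OF x(3)] H(1)[OF y(3)], unfolded x(5) y(5)]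
   and FC = C.frac_ops[OF x(1) y(1) T(1)[OF x(3)] T(1)[OF y(3)], unfolded x(6) y(6)]
  show "h (x *[B] y) = h x *[C] h y"
   by (rule uni[OF PI[OF _ _ _ ef, of _ "d *[D] c"]]) (use x(1-3) y(1-3) C FB FC in simp_all)
  show "h (x +[B] y) = h x +[C] h y"
   by (rule uni[OF PI[OF _ _ _ ef, of _ "d *[D] f +[D] c *[D] e"]]) (use x(1-3) y(1-3) C FB FC in simp_all)
 qed
 then show thesis using that hd by blast
qed

lemma is_loc_comp_iso:
 assumes "is_loc D p B dd" and C: "cring C" and h: "h : ring_hom B C" and bij: "bij_betw h (carrier B) (carrier C)"
 shows "is_loc D p C (h o dd)"
proof -
 note L = is_locD[OF assms(1)] and H = hom_simps[OF is_locD(4,1,2)[OF assms(1)]]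
 have surj: "EX d:carrier D. EX e:carrier D - p. c *[C] (h o dd) e = (h o dd) d" if c: "c : carrier C" for c
 proof -
  obtain b where b: "b : carrier B" "c = h b" using bij c by (auto simp: bij_betw_def)
  obtain d e where x: "d : carrier D" "e : carrier D" "e ~: p" "b *[B] dd e = dd d"
   using is_loc_cases[OF assms(1) b(1)] .
  have "c *[C] (h o dd) e = (h o dd) d"
   using ring_hom_mult[OF h b(1) ring_hom_closed[OF L(4) x(2)]] x(4) b(2) by simp
  then show ?thesis using x by blast
 qed
 have "dd d = 0[B]" if "d : carrier D" "h (dd d) = 0[C]" for d
  using that hom_zero[OF h L(2) C] bij ring_hom_closed[OF L(4)] L(2) unfolding bij_betw_def inj_on_def
  by (metis cring.cring_simprules(2))
 then show ?thesis unfolding is_loc_def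
  using L C surj ring_hom_trans[OF L(4) h] hom_Units[OF h L(2) C] by auto
qed

subsection \<open>Sums over lists\<close>

text \<open>Summation along a list, with repetitions, matches the formal sums that represent
  tensors; homomorphisms commute with it by a plain induction.\<close>

definition lsum :: "('a, 'b) ring_scheme => ('x => 'a) => 'x list => 'a" where
 "lsum B f u = foldr (%x s. f x +[B] s) u 0[B]"

lemma lsum_Nil[simp]: "lsum B f [] = 0[B]" and lsum_Cons[simp]: "lsum B f (x # u) = f x +[B] lsum B f u"
 by (simp_all add: lsum_def)

lemma lsum_map: "lsum B f (map g u) = lsum B (%x. f (g x)) u"
 by (induction u) auto

lemma lsum_cong: "(!!x. x : set u ==> f x = g x) ==> lsum B f u = lsum B g u"
 by (induction u) auto

context cring begin

lemma lsum_closed[simp]: "(!!x. x : set u ==> f x : carrier R) ==> lsum R f u : carrier R"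
 by (induction u) auto

lemma lsum_append:
 "(!!x. x : set u Un set v ==> f x : carrier R) ==> lsum R f (u @ v) = lsum R f u \<oplus> lsum R f v"
 by (induction u) (auto simp: a_assoc)

lemma lsum_zero: "(!!x. x : set u ==> f x = \<zero>) ==> lsum R f u = \<zero>"
 by (induction u) auto

end

lemma hom_lsum:
 assumes "h : ring_hom R S" "cring R" "cring S" "!!x. x : set u ==> f x : carrier R"
 shows "h (lsum R f u) = lsum S (%x. h (f x)) u"
proof -
 interpret cring R by fact
 show ?thesis using assms(4) by (induction u) (auto simp: hom_simps[OF assms(1-3)])
qed

subsection \<open>The tensor product of two algebras\<close>

lemma alg_simps[simp]:
 "carrier (alg ph A) = carrier A" "mult (alg ph A) = mult A" "one (alg ph A) = one A"
 "zero (alg ph A) = zero A" "add (alg ph A) = add A" "r \<odot>\<^bsub>alg ph A\<^esub> a = ph r *[A] a"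
 by (simp_all add: alg_def)

text \<open>Closure is what keeps every list of a derivation within the valid pairs. It is easily
  checked for the submodules and modules of pairs that occur below.\<close>

definition "act_closed R M \<longleftrightarrow> 0[M] : carrier M &
 (ALL x:carrier M. ALL y:carrier M. x +[M] y : carrier M) & (ALL r:carrier R. ALL x:carrier M. r \<odot>\<^bsub>M\<^esub> x : carrier M)"

lemma tensor_eq_valid:
 assumes "tensor_eq R M N u v" "act_closed R M" "act_closed R N"
 shows "set u <= carrier M \<times> carrier N & set v <= carrier M \<times> carrier N"
 using assms by (induction rule: tensor_eq.induct) (auto simp: act_closed_def)

text \<open>The rule \<open>comm\<close> exchanges two blocks, which is enough to bring the head of
  the first list to its position in the second.\<close>

lemma tensor_eq_mset:
 "mset u = mset v ==> set u <= carrier M \<times> carrier N ==> tensor_eq R M N u v"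
proof (induction u arbitrary: v)
 case (Cons x u)
 let ?TE = "tensor_eq R M N"
 from Cons.prems have "x : set v" by (metis list.set_intros(1) set_mset_mset)
 then obtain v1 v2 where v: "v = v1 @ x # v2" by (metis split_list)
 have s: "set v <= carrier M \<times> carrier N" using Cons.prems by (metis set_mset_mset)
 have "?TE u (v1 @ v2)" using Cons v by simp
 then have 1: "?TE ([x] @ u) ([x] @ (v1 @ v2))" using Cons.prems by (intro tensor_eq.append tensor_eq.refl) auto
 have "?TE ([x] @ v1) (v1 @ [x])" using s v by (intro tensor_eq.comm) auto
 moreover have "?TE v2 v2" using s v by (intro tensor_eq.refl) auto
 ultimately have "?TE (([x] @ v1) @ v2) ((v1 @ [x]) @ v2)" by (rule tensor_eq.append)
 from tensor_eq.trans[OF 1] this show ?case unfolding v by simp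
qed (simp add: tensor_eq.refl)

lemma tensor_eq_map:
 assumes "tensor_eq R M N u v" "!!m. m : carrier M ==> h m : carrier M'" "h 0[M] = 0[M']"
  "!!m m'. m : carrier M ==> m' : carrier M ==> h (m +[M] m') = h m +[M'] h m'"
  "!!r m. r : carrier R ==> m : carrier M ==> h (r \<odot>\<^bsub>M\<^esub> m) = r \<odot>\<^bsub>M'\<^esub> h m"
 shows "tensor_eq R M' N (map (%x. (h (fst x), snd x)) u) (map (%x. (h (fst x), snd x)) v)"
 using assms(1)
proof (induction rule: tensor_eq.induct)
 case (refl u) then show ?case using assms(2) by (intro tensor_eq.refl) auto
next
 case (comm u v) then show ?case using assms(2) unfolding map_append by (intro tensor_eq.comm) auto
qed (use assms(2-) in \<open>auto intro: tensor_eq.intros\<close>)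

text \<open>Additivity merges (n a, c) and (a, c) into (0, c), which the rule \<open>zero\<close>
  deletes. Negation is a parameter \<open>n\<close>, so that the lemma also serves where no group
  structure of \<open>M\<close> has been established.\<close>

lemma tensor_eq_neg:
 assumes n: "!!m. m : carrier M ==> n m : carrier M & n m +[M] m = 0[M]"
 shows "set u <= carrier M \<times> carrier N ==> tensor_eq R M N (map (%x. (n (fst x), snd x)) u @ u) []"
proof (induction u)
 case (Cons x u)
 obtain a c where x: "x = (a, c)" "a : carrier M" "c : carrier N" using Cons.prems by (cases x) auto
 let ?n = "map (%x. (n (fst x), snd x)) u"
 have "tensor_eq R M N ((n a, c) # ?n @ x # u) ([(n a, c), x] @ (?n @ u))"
  using Cons.prems x n by (intro tensor_eq_mset) auto
 also have "tensor_eq R M N [(n a, c), x] []"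
  using tensor_eq.add_left[of "n a" M a c N R] tensor_eq.zero[of c N R M] x n tensor_eq.sym tensor_eq.trans by metis
 then have "tensor_eq R M N ([(n a, c), x] @ (?n @ u)) ([] @ [])"
  using Cons by (intro tensor_eq.append) auto
 finally (tensor_eq.trans) show ?case using x by simp
qed (simp add: tensor_eq.refl)

locale tensor_rings =
 fixes R :: "'r ring" and A :: "'a ring" and C :: "'c ring" and ph :: "'r => 'a" and py :: "'r => 'c"
 assumes cR: "cring R" and cA: "cring A" and cC: "cring C"
  and ph: "ph : ring_hom R A" and py: "py : ring_hom R C"
begin

sublocale R: cring R by (rule cR)
sublocale A: cring A by (rule cA)
sublocale C: cring C by (rule cC)

lemmas ph_simps[simp] = hom_simps[OF ph cR cA]
lemmas py_simps[simp] = hom_simps[OF py cR cC]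

abbreviation "TE == tensor_eq R (alg ph A) (alg py C)"
abbreviation "V == {u. set u <= carrier A \<times> carrier C}"
abbreviation "T == tensor R (alg ph A) (alg py C)"
abbreviation "cls == tensor_class R (alg ph A) (alg py C)"
abbreviation "fm == formal_mult (alg ph A) (alg py C)"
abbreviation "pure a c == cls [(a, c)]"

lemma TE_V: "TE u v ==> u : V & v : V"
 using tensor_eq_valid[of R "alg ph A" "alg py C" u v] by (simp add: act_closed_def)

lemma TE_refl: "u : V ==> TE u u" by (rule tensor_eq.refl) simp

lemma cls_eq_iff: "u : V ==> cls u = cls v \<longleftrightarrow> TE u v"
proof
 assume "u : V" "cls u = cls v"
 then have "TE v u" using TE_refl by (auto simp: tensor_class_def set_eq_iff)
 then show "TE u v" by (rule tensor_eq.sym)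
next
 assume "TE u v"
 then show "cls u = cls v" unfolding tensor_class_def using tensor_eq.sym tensor_eq.trans by blast
qed

lemma cls_closed[simp]: "u : V ==> cls u : carrier T"
 by (auto simp: tensor_def)

lemma T_cases:
 assumes "X : carrier T" obtains u where "u : V" "X = cls u"
 using assms by (auto simp: tensor_def)

text \<open>Sums and products of classes are unions over representatives; compatibility of
  \<open>F\<close> with \<open>TE\<close> collapses them to a single class.\<close>

lemma cls_op:
 assumes "u : V" "v : V" and F: "!!u' v'. TE u u' ==> TE v v' ==> TE (F u v) (F u' v')"
 shows "(\<Union>u'\<in>cls u. \<Union>v'\<in>cls v. cls (F u' v')) = cls (F u v)"
proof -
 have "cls (F u' v') = cls (F u v)" if "u' : cls u" "v' : cls v" for u' v'
  using that F[of u' v'] TE_V cls_eq_iff unfolding tensor_class_def by blast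
 moreover have "u : cls u" "v : cls v" using assms(1,2) TE_refl by (auto simp: tensor_class_def)
 ultimately show ?thesis by blast
qed

lemma T_add[simp]: "u : V ==> v : V ==> cls u +[T] cls v = cls (u @ v)"
 using cls_op[of u v append] by (simp add: tensor_def tensor_eq.append)

lemma TE_mset: "mset u = mset v ==> u : V ==> TE u v"
 by (rule tensor_eq_mset) auto

lemma TE_Cons_cong: "TE [x] a ==> TE u v ==> TE (x # u) (a @ v)"
 using tensor_eq.append[of R "alg ph A" "alg py C" "[x]" a u v] by simp

lemma TE_map_cong: "(!!x. x : set v ==> TE [f x] [g x]) ==> TE (map f v) (map g v)"
proof (induction v)
 case (Cons x v)
 then show ?case using TE_Cons_cong[of "f x" "[g x]"] by simp
qed (simp add: tensor_eq.refl)

lemma TE_map_add: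
 "(!!x. x : set v ==> TE [f x] [g x, h x]) ==> TE (map f v) (map g v @ map h v)"
proof (induction v)
 case (Cons x v)
 then have "TE (map f (x # v)) ([g x, h x] @ (map g v @ map h v))" using TE_Cons_cong[of "f x" "[g x, h x]" "map f v" "map g v @ map h v"] by simp
 moreover from TE_V[OF this] have "TE ([g x, h x] @ (map g v @ map h v)) (map g (x # v) @ map h (x # v))"
  by (intro TE_mset) auto
 ultimately show ?case by (rule tensor_eq.trans)
qed (simp add: tensor_eq.refl)

lemma TE_map_zero: "(!!x. x : set v ==> TE [f x] []) ==> TE (map f v) []"
proof (induction v)
 case (Cons x v)
 then show ?case using TE_Cons_cong[of "f x" "[]"] by simp
qed (simp add: tensor_eq.refl)

lemma fm_Nil[simp]: "fm [] v = []"
 and fm_Cons[simp]: "fm (x # u) v = map (%y. (fst x *[A] fst y, snd x *[C] snd y)) v @ fm u v"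
 by (cases x; auto simp: formal_mult_def)+

lemma fm_append: "fm (u @ u') v = fm u v @ fm u' v"
 by (induction u) auto

lemma fm_V: "u : V ==> v : V ==> fm u v : V"
 by (induction u) auto

lemma TE_balanced: "r : carrier R ==> m : carrier A ==> n : carrier C ==>
  TE [(ph r *[A] m, n)] [(m, py r *[C] n)]"
 using tensor_eq.balanced[of r R m "alg ph A" n "alg py C"] by simp

text \<open>Multiplication by a fixed list respects each rule of the congruence, by associativity
  and distributivity in the two factors. Commutativity of the formal product transfers this to the
  right argument in \<open>fm_cong\<close>.\<close>

lemma fm_cong_left: "TE u u' ==> v : V ==> TE (fm u v) (fm u' v)"
proof (induction rule: tensor_eq.induct)
 case (refl u)
 then show ?case by (intro TE_refl fm_V) auto
next
 case (sym u v)
 then show ?case using tensor_eq.sym by blast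
next
 case (trans u v w)
 then show ?case using tensor_eq.trans by blast
next
 case (append u u' w w')
 then show ?case by (simp add: fm_append tensor_eq.append)
next
 case (comm u w)
 then show ?case using fm_V[of u v] fm_V[of w v] by (simp add: fm_append) (rule tensor_eq.comm, simp_all)
next
 case (zero n)
 then show ?case
  by simp (intro TE_map_zero, use tensor_eq.zero[of _ "alg py C" R "alg ph A"] in auto)
next
 case (add_left m m' n)
 then show ?case
  by simp (intro TE_map_add, use tensor_eq.add_left[of _ "alg ph A" _ _ "alg py C" R] in \<open>auto simp: A.l_distr\<close>)
next
 case (add_right m n n')
 then show ?case
  by simp (intro TE_map_add, use tensor_eq.add_right[of _ "alg ph A" _ "alg py C" _ R] in \<open>auto simp: C.l_distr\<close>)
next
 case (balanced r m n)
 then show ?case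
  by simp (intro TE_map_cong, use TE_balanced in \<open>auto simp: A.m_assoc C.m_assoc\<close>)
qed

lemma fm_Cons_right:
 "mset (fm u (y # v)) = mset (map (%x. (fst x *[A] fst y, snd x *[C] snd y)) u) + mset (fm u v)"
 by (induction u) auto

lemma fm_Nil_right[simp]: "fm u [] = []" by (induction u) auto

lemma fm_comm: "u : V ==> v : V ==> mset (fm u v) = mset (fm v u)"
proof (induction u)
 case (Cons x u)
 have "map (%y. (fst x *[A] fst y, snd x *[C] snd y)) v = map (%y. (fst y *[A] fst x, snd y *[C] snd x)) v"
  using Cons.prems by (auto simp: A.m_comm C.m_comm)
 then have e: "mset (map (%y. (fst x *[A] fst y, snd x *[C] snd y)) v) =
  mset (map (%y. (fst y *[A] fst x, snd y *[C] snd x)) v)" by (rule arg_cong)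
 have "mset (fm u v) = mset (fm v u)" using Cons by simp
 then show ?case unfolding fm_Cons_right fm_Cons mset_append e by simp
qed simp

lemma TE_fm_comm: "u : V ==> v : V ==> TE (fm u v) (fm v u)"
 by (intro TE_mset fm_comm fm_V)

lemma fm_cong:
 assumes "TE u u'" "TE v v'" shows "TE (fm u v) (fm u' v')"
proof -
 have V: "u : V" "u' : V" "v : V" "v' : V" using TE_V assms by auto
 have "TE (fm u v) (fm u' v)" using fm_cong_left assms V by blast
 also have "TE (fm u' v) (fm v u')" using TE_fm_comm V by blast
 also (tensor_eq.trans) have "TE (fm v u') (fm v' u')" using fm_cong_left assms V by blast
 also (tensor_eq.trans) have "TE (fm v' u') (fm u' v')" using TE_fm_comm V by blast
 finally (tensor_eq.trans) show ?thesis .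
qed

lemma T_mult[simp]: "u : V ==> v : V ==> cls u *[T] cls v = cls (fm u v)"
 using cls_op[of u v fm] fm_cong by (simp add: tensor_def)

lemma T_one: "1[T] = pure 1[A] 1[C]" and T_zero: "0[T] = cls []"
 by (simp_all add: tensor_def)

lemma fm_map_left:
 "x : carrier A \<times> carrier C ==> u : V ==> v : V ==>
  fm (map (%y. (fst x *[A] fst y, snd x *[C] snd y)) u) v =
  map (%y. (fst x *[A] fst y, snd x *[C] snd y)) (fm u v)"
 by (induction u) (auto simp: A.m_assoc C.m_assoc)

lemma fm_assoc: "u : V ==> v : V ==> w : V ==> fm (fm u v) w = fm u (fm v w)"
 by (induction u) (auto simp: fm_append fm_map_left)

lemma TE_neg: "u : V ==> TE (map (%x. (-[A] fst x, snd x)) u @ u) []"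
 by (rule tensor_eq_neg) (auto simp: A.l_neg)

lemma cT: "cring T"
proof (rule cringI)
 have [simp]: "u : V ==> v : V ==> set (fm u v) <= carrier A \<times> carrier C" for u v using fm_V by auto
 show "abelian_group T"
 proof (rule abelian_groupI)
  fix x y assume "x : carrier T" "y : carrier T"
  then obtain u v where uv: "u : V" "v : V" "x = cls u" "y = cls v" by (metis T_cases)
  show "x +[T] y : carrier T" using uv by simp
  have "TE (u @ v) (v @ u)" using uv by (intro tensor_eq.comm) auto
  then show "x +[T] y = y +[T] x" using uv by (simp add: cls_eq_iff)
  fix z assume "z : carrier T"
  then obtain w where w: "w : V" "z = cls w" by (metis T_cases)
  show "x +[T] y +[T] z = x +[T] (y +[T] z)" using uv w by simp
 next
  show "0[T] : carrier T" by (simp add: T_zero)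
  fix x assume "x : carrier T"
  then obtain u where u: "u : V" "x = cls u" by (metis T_cases)
  show "0[T] +[T] x = x" using u by (simp add: T_zero)
  have n: "map (%x. (-[A] fst x, snd x)) u : V" using u by auto
  have "cls (map (%x. (-[A] fst x, snd x)) u) +[T] x = 0[T]"
   using u n TE_neg[OF u(1)] TE_V by (simp add: T_zero cls_eq_iff del: mem_Collect_eq)
  then show "EX y:carrier T. y +[T] x = 0[T]" using cls_closed[OF n] by blast
 qed
 show "comm_monoid T"
 proof (rule comm_monoidI)
  fix x y assume "x : carrier T" "y : carrier T"
  then obtain u v where uv: "u : V" "v : V" "x = cls u" "y = cls v" by (metis T_cases)
  show "x *[T] y : carrier T" using uv fm_V by simp
  show "x *[T] y = y *[T] x" using uv TE_fm_comm fm_V by (simp add: cls_eq_iff)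
  fix z assume "z : carrier T"
  then obtain w where w: "w : V" "z = cls w" by (metis T_cases)
  show "x *[T] y *[T] z = x *[T] (y *[T] z)" using uv w fm_assoc by simp
 next
  show "1[T] : carrier T" by (simp add: T_one)
  fix x assume "x : carrier T"
  then obtain u where u: "u : V" "x = cls u" by (metis T_cases)
  have "fm [(1[A], 1[C])] u = u" using u by (auto intro!: map_idI)
  then show "1[T] *[T] x = x" using u by (simp add: T_one del: fm_Cons)
 qed
 fix x y z assume "x : carrier T" "y : carrier T" "z : carrier T"
 then obtain u v w where uv: "u : V" "v : V" "w : V" "x = cls u" "y = cls v" "z = cls w" by (metis T_cases)
 then show "(x +[T] y) *[T] z = x *[T] z +[T] y *[T] z" by (simp add: fm_append)
qed

sublocale T: cring T by (rule cT)

lemma pure_closed[simp]: "a : carrier A ==> c : carrier C ==> pure a c : carrier T"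
 by simp

lemma pure_add_left: "a : carrier A ==> a' : carrier A ==> c : carrier C ==>
  pure (a +[A] a') c = pure a c +[T] pure a' c"
 using tensor_eq.add_left[of a "alg ph A" a' c "alg py C" R] by (simp add: cls_eq_iff)

lemma pure_add_right: "a : carrier A ==> c : carrier C ==> c' : carrier C ==>
  pure a (c +[C] c') = pure a c +[T] pure a c'"
 using tensor_eq.add_right[of a "alg ph A" c "alg py C" c' R] by (simp add: cls_eq_iff)

lemma pure_balanced: "r : carrier R ==> a : carrier A ==> c : carrier C ==>
  pure (ph r *[A] a) c = pure a (py r *[C] c)"
 using TE_balanced by (simp add: cls_eq_iff)

lemma pure_zero_left: "c : carrier C ==> pure 0[A] c = 0[T]"
 using tensor_eq.zero[of c "alg py C" R "alg ph A"] by (simp add: cls_eq_iff T_zero)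

lemma cls_lsum: "u : V ==> cls u = lsum T (%x. pure (fst x) (snd x)) u"
proof (induction u)
 case (Cons x u)
 have "cls (x # u) = cls [x] +[T] cls u" using Cons.prems by (subst T_add) auto
 then show ?case using Cons by simp
qed (simp add: T_zero)

definition "inl a = pure a 1[C]"
definition "inr c = pure 1[A] c"

lemma inl_hom: "inl : ring_hom A T"
 unfolding inl_def by (rule ring_hom_memI) (simp_all add: pure_add_left T_one del: T_add)

lemma inr_hom: "inr : ring_hom C T"
 unfolding inr_def by (rule ring_hom_memI) (simp_all add: pure_add_right T_one del: T_add)

lemmas inl_simps[simp] = hom_simps[OF inl_hom cA cT]
lemmas inr_simps[simp] = hom_simps[OF inr_hom cC cT]

lemma pure_eq: "a : carrier A ==> c : carrier C ==> pure a c = inl a *[T] inr c"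
 by (simp add: inl_def inr_def)

lemma inl_inr: "r : carrier R ==> inl (ph r) = inr (py r)"
 using pure_balanced[of r "1[A]" "1[C]"] by (simp add: inl_def inr_def)

text \<open>Every tensor is a sum of products of an \<open>inl a\<close> and an
  \<open>inr c\<close>, so a homomorphism is determined on the two factors.\<close>

lemma T_hom_eqI:
 assumes h: "h : ring_hom T B" and k: "k : ring_hom T B" and B: "cring B"
  and "!!a. a : carrier A ==> h (inl a) = k (inl a)"
  and "!!c. c : carrier C ==> h (inr c) = k (inr c)" and x: "x : carrier T"
 shows "h x = k x"
proof -
 obtain u where u: "u : V" "x = cls u" by (metis T_cases x)
 have "h (pure (fst y) (snd y)) = k (pure (fst y) (snd y))" if "y : set u" for y
  using u that assms(4,5) by (auto simp: pure_eq hom_simps[OF h cT B] hom_simps[OF k cT B])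
 then show ?thesis unfolding u(2) cls_lsum[OF u(1)] using u
  by (subst (1 2) hom_lsum[OF _ cT B]) (auto simp: h k intro!: lsum_cong)
qed

text \<open>The pairing of a and c to al(a) bx(c) is biadditive and balanced, so the evaluation of
  lists respects each rule of the congruence. The formula on lists is part of the result because
  functions on the fibre product are given by lists of pairs of sections.\<close>

lemma T_lift:
 assumes B: "cring B" and al: "al : ring_hom A B" and bx: "bx : ring_hom C B"
  and eq: "!!r. r : carrier R ==> al (ph r) = bx (py r)"
 obtains h where "h : ring_hom T B"
  "!!u. u : V ==> h (cls u) = lsum B (%x. al (fst x) *[B] bx (snd x)) u"
  "!!a. a : carrier A ==> h (inl a) = al a"
  "!!c. c : carrier C ==> h (inr c) = bx c"
proof -
 interpret B: cring B by (rule B)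
 note [simp] = hom_simps[OF al cA B] hom_simps[OF bx cC B]
 define ev where "ev = lsum B (%x. al (fst x) *[B] bx (snd x))"
 have [simp]: "ev [] = 0[B]" "ev (x # u) = al (fst x) *[B] bx (snd x) +[B] ev u" for x u
  by (simp_all add: ev_def)
 have ev_closed[simp]: "ev u : carrier B" if "u : V" for u
  unfolding ev_def using that by (intro B.lsum_closed) auto
 have ev_append: "ev (u @ v) = ev u +[B] ev v" if "u : V" "v : V" for u v
  unfolding ev_def using that by (intro B.lsum_append) auto
 have ev_cong: "ev u = ev v" if "TE u v" for u v
  using that
 proof (induction rule: tensor_eq.induct)
  case (append u u' v v')
  then show ?case using TE_V by (simp add: ev_append del: mem_Collect_eq)
 next
  case (comm u v)
  then show ?case by (simp add: ev_append B.a_comm)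
 next
  case (balanced r m n)
  then show ?case by (simp add: ev_def eq B.m_ac)
 qed (auto simp: ev_def B.l_distr B.r_distr)
 \<comment> \<open>Evaluation at an arbitrary representative of the class; \<open>ev_cong\<close>
   makes the value independent of the choice.\<close>
 define h where "h X = ev (SOME u. u : X)" for X
 have h: "h (cls u) = ev u" if "u : V" for u
 proof -
  have "u : cls u" using that TE_refl by (auto simp: tensor_class_def)
  then have "(SOME v. v : cls u) : cls u" by (rule someI)
  then have "TE u (SOME v. v : cls u)" by (simp add: tensor_class_def)
  from ev_cong[OF this] show ?thesis by (simp add: h_def)
 qed
 have mult1: "ev (map (%y. (fst x *[A] fst y, snd x *[C] snd y)) v) = al (fst x) *[B] bx (snd x) *[B] ev v"
  if "x : carrier A \<times> carrier C" "v : V" for x v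
  using that(2,1) by (induction v) (auto simp: B.m_ac B.r_distr)
 have mult: "ev (fm u v) = ev u *[B] ev v" if "u : V" "v : V" for u v
  using that(1)
 proof (induction u)
  case Nil
  then show ?case using ev_closed[OF that(2)] by simp
 next
  case (Cons x u)
  have "map (%y. (fst x *[A] fst y, snd x *[C] snd y)) v : V" "fm u v : V"
   using Cons.prems that fm_V[of u v] by auto
  then have "ev (fm (x # u) v) = al (fst x) *[B] bx (snd x) *[B] ev v +[B] ev u *[B] ev v"
   using Cons that by (subst fm_Cons, subst ev_append) (auto simp: mult1)
  also have "... = ev (x # u) *[B] ev v"
   using Cons.prems that(2) ev_closed[of u] ev_closed[of v] by (auto simp: B.l_distr)
  finally show ?case .
 qed
 have hom: "h : ring_hom T B"
 proof (rule ring_hom_memI)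
  fix x y assume "x : carrier T" "y : carrier T"
  then obtain u v where uv: "u : V" "v : V" "x = cls u" "y = cls v" by (metis T_cases)
  then show "h x : carrier B" using h by simp
  show "h (x *[T] y) = h x *[B] h y" using uv h mult fm_V by simp
  show "h (x +[T] y) = h x +[B] h y" using uv h ev_append by simp
 next
  show "h 1[T] = 1[B]" using h by (simp add: T_one ev_def)
 qed
 show thesis
 proof (rule that[OF hom])
  show "h (cls u) = lsum B (%x. al (fst x) *[B] bx (snd x)) u" if "u : V" for u
   using h[OF that] by (simp add: ev_def)
  show "h (inl a) = al a" if "a : carrier A" for a using h that by (simp add: inl_def ev_def)
  show "h (inr c) = bx c" if "c : carrier C" for c using h that by (simp add: inr_def ev_def)
 qed
qed

end

subsection \<open>The equational criterion for flatness\<close>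

text \<open>For I = carrier R this is R as a module over itself, the target of the inclusions of
  ideals on which flatness will be tested.\<close>

definition ideal_module :: "'r ring => 'r set => ('r, 'r) module" where
 "ideal_module R I = \<lparr>carrier = I, mult = mult R, one = one R, zero = zero R, add = add R, smult = mult R\<rparr>"

lemma ideal_module_simps[simp]:
 "carrier (ideal_module R I) = I" "zero (ideal_module R I) = zero R" "add (ideal_module R I) = add R"
 "r \<odot>\<^bsub>ideal_module R I\<^esub> a = r *[R] a"
 by (simp_all add: ideal_module_def)

lemma ideal_module:
 assumes "cring R" "ideal I R"
 shows "module R (ideal_module R I)"
proof -
 interpret cring R by fact
 interpret I: ideal I R by fact
 have neg: "EX y:I. y +[R] x = 0[R]" if "x : I" for x
  using that I.a_inv_closed I.Icarr l_neg by blast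
 show ?thesis
  by (intro moduleI abelian_groupI is_cring)
   (use I.Icarr I.a_closed I.zero_closed I.I_l_closed neg in
    \<open>auto simp: a_ac l_distr r_distr m_assoc\<close>)
qed

text \<open>The negatives of \<open>w\<close> are appended to both sides and cancel against
  it.\<close>

lemma tensor_eq_cancel:
 assumes n: "!!m. m : carrier M ==> n m : carrier M & n m +[M] m = 0[M]"
  and s: "set (u @ v @ w) <= carrier M \<times> carrier N" and z: "tensor_eq R M N (u @ w) (v @ w)"
 shows "tensor_eq R M N u v"
proof -
 let ?TE = "tensor_eq R M N" and ?n = "map (%x. (n (fst x), snd x)) w"
 have N: "?TE (?n @ w) []" and n': "set ?n <= carrier M \<times> carrier N" using s n by (auto intro: tensor_eq_neg[OF n])
 have e: "?TE x ((x @ w) @ ?n)" if "set x <= carrier M \<times> carrier N" for x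
  using tensor_eq.sym[OF tensor_eq.trans[OF tensor_eq_mset[of "(x @ w) @ ?n" "x @ ?n @ w"] tensor_eq.append[OF tensor_eq.refl[OF that] N]]] that s n' by auto
 have "?TE ((u @ w) @ ?n) ((v @ w) @ ?n)" by (rule tensor_eq.append[OF z tensor_eq.refl[OF n']])
 from tensor_eq.trans[OF tensor_eq.trans[OF e this] tensor_eq.sym[OF e]] s show ?thesis by simp
qed

text \<open>Right exactness of the tensor product on the level of lists: a derivation over M2 is
  lifted to M1 rule by rule, at the cost of terms whose left factor lies in \<open>Z\<close>, which
  contains the kernel of \<open>pj\<close>. Such terms stand on both sides of the result, which
  avoids negatives.\<close>

lemma tensor_eq_right_exact:
 fixes N :: "('r, 'n) module"
 assumes M1: "act_closed R M1" and N: "act_closed R N" and Z: "Z <= carrier M1"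
  and surj: "!!m. m : carrier M2 ==> EX a:carrier M1. pj a = m"
  and pj: "!!a. a : carrier M1 ==> pj a : carrier M2" "pj 0[M1] = 0[M2]"
   "!!a b. a : carrier M1 ==> b : carrier M1 ==> pj (a +[M1] b) = pj a +[M2] pj b"
   "!!r a. r : carrier R ==> a : carrier M1 ==> pj (r \<odot>\<^bsub>M1\<^esub> a) = r \<odot>\<^bsub>M2\<^esub> pj a"
  and ker: "!!a b. a : carrier M1 ==> b : carrier M1 ==> pj a = pj b ==> EX z:Z. a = b +[M1] z"
  and u: "set u <= carrier M1 \<times> carrier N" and z: "tensor_eq R M2 N (map (%x. (pj (fst x), snd x)) u) []"
 obtains w w' where "set w <= Z \<times> carrier N" "set w' <= Z \<times> carrier N" "tensor_eq R M1 N (u @ w) w'"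
proof -
 let ?TE = "tensor_eq R M1 N" and ?V = "carrier M1 \<times> carrier N"
 note V = tensor_eq_valid[OF _ M1 N]
 define rel where "rel u v \<longleftrightarrow> (EX w w'. set w <= Z \<times> carrier N & set w' <= Z \<times> carrier N & ?TE (u @ w) (v @ w'))" for u v
 have relI: "rel u v" if "?TE u v" for u v
  unfolding rel_def using that by (intro exI[of _ "[]"]) simp
 have rel_sym: "rel v u" if "rel u v" for u v using that tensor_eq.sym unfolding rel_def by blast
 have rel_trans: "rel u v" if uv: "rel u y" "rel y v" for u y v
 proof -
  from uv obtain w w' x x' where w: "set w <= Z \<times> carrier N" "set w' <= Z \<times> carrier N" "?TE (u @ w) (y @ w')"
   "set x <= Z \<times> carrier N" "set x' <= Z \<times> carrier N" "?TE (y @ x) (v @ x')" unfolding rel_def by blast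
  note s = V[OF w(3)] V[OF w(6)]
  have 1: "?TE ((u @ w) @ x) ((y @ w') @ x)" by (rule tensor_eq.append[OF w(3) tensor_eq.refl]) (use s in auto)
  have 2: "?TE ((y @ x) @ w') ((v @ x') @ w')" by (rule tensor_eq.append[OF w(6) tensor_eq.refl]) (use s in auto)
  have "?TE ((y @ w') @ x) ((y @ x) @ w')" using s by (intro tensor_eq_mset) auto
  from tensor_eq.trans[OF tensor_eq.trans[OF 1 this] 2] have "?TE (u @ w @ x) (v @ x' @ w')" by simp
  with w show ?thesis unfolding rel_def by (intro exI[of _ "w @ x"] exI[of _ "x' @ w'"]) auto
 qed
 have rel_append: "rel (u @ u') (v @ v')" if uv: "rel u v" "rel u' v'" for u u' v v'
 proof -
  from uv obtain w w' x x' where w: "set w <= Z \<times> carrier N" "set w' <= Z \<times> carrier N" "?TE (u @ w) (v @ w')"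
   "set x <= Z \<times> carrier N" "set x' <= Z \<times> carrier N" "?TE (u' @ x) (v' @ x')" unfolding rel_def by blast
  note s = V[OF w(3)] V[OF w(6)]
  have "?TE ((u @ u') @ w @ x) ((u @ w) @ u' @ x)" "?TE ((v @ w') @ v' @ x') ((v @ v') @ w' @ x')"
   using s by (auto intro!: tensor_eq_mset)
  with tensor_eq.append[OF w(3,6)] have "?TE ((u @ u') @ w @ x) ((v @ v') @ w' @ x')" using tensor_eq.trans by blast
  with w show ?thesis unfolding rel_def by (intro exI[of _ "w @ x"] exI[of _ "w' @ x'"]) auto
 qed
 have rel_ker: "rel [(a, c)] [(b, c)]" if "a : carrier M1" "b : carrier M1" "pj a = pj b" "c : carrier N" for a b c
 proof -
  from ker[OF that(1-3)] obtain z where "z : Z" "a = b +[M1] z" by blast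
  then show ?thesis unfolding rel_def
   using tensor_eq.add_left[of b M1 z c N R] that Z by (intro exI[of _ "[]"] exI[of _ "[(z, c)]"]) auto
 qed
 \<comment> \<open>A set-theoretic section of \<open>pj\<close>. It is not linear in general, but
   its defects lie in \<open>Z\<close> and are absorbed by \<open>rel\<close>.\<close>
 define s where "s m = (SOME a. a : carrier M1 & pj a = m)" for m
 have s: "s m : carrier M1" "pj (s m) = m" if "m : carrier M2" for m
  using someI_ex[of "%a. a : carrier M1 & pj a = m"] surj[OF that] unfolding s_def by blast+
 define S where "S = map (%x. (s (fst x), snd x :: 'n))"
 have *: "rel (S u) (S v)" if "tensor_eq R M2 N u v" for u v
  using that
 proof (induction rule: tensor_eq.induct)
  case (refl u)
  then show ?case using s unfolding S_def by (intro relI tensor_eq.refl) auto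
 next
  case (comm u v)
  then show ?case using s unfolding S_def map_append by (intro relI tensor_eq.comm) auto
 next
  case (append u u' v v')
  then show ?case unfolding S_def map_append by (intro rel_append)
 next
  case (zero n)
  have z: "0[M1] : carrier M1" using M1 unfolding act_closed_def by blast
  then have "0[M2] : carrier M2" using pj(1,2) by metis
  with z zero show ?case unfolding S_def
   by (auto intro!: rel_trans[OF rel_ker relI[OF tensor_eq.zero]] s simp: pj(2))
 next
  case (add_left m m' n)
  have [simp]: "s m : carrier M1" "s m' : carrier M1" "s m +[M1] s m' : carrier M1" using s add_left M1 by (auto simp: act_closed_def)
  have p: "pj (s m +[M1] s m') = m +[M2] m'" using s add_left pj by simp
  then have "m +[M2] m' : carrier M2" using pj(1) by (metis \<open>s m +[M1] s m' : carrier M1\<close>)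
  then have "rel [(s (m +[M2] m'), n)] [(s m +[M1] s m', n)]" using s p add_left by (intro rel_ker) auto
  moreover have "rel [(s m +[M1] s m', n)] [(s m, n), (s m', n)]" using add_left by (intro relI tensor_eq.add_left) auto
  ultimately show ?case unfolding S_def using rel_trans by simp
 next
  case (add_right m n n')
  then show ?case unfolding S_def using s by (auto intro!: relI tensor_eq.add_right)
 next
  case (balanced r m n)
  have [simp]: "s m : carrier M1" "r \<odot>\<^bsub>M1\<^esub> s m : carrier M1" using s balanced M1 by (auto simp: act_closed_def)
  have p: "pj (r \<odot>\<^bsub>M1\<^esub> s m) = r \<odot>\<^bsub>M2\<^esub> m" using s balanced pj by simp
  then have "r \<odot>\<^bsub>M2\<^esub> m : carrier M2" using pj(1) by (metis \<open>r \<odot>\<^bsub>M1\<^esub> s m : carrier M1\<close>)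
  then have "rel [(s (r \<odot>\<^bsub>M2\<^esub> m), n)] [(r \<odot>\<^bsub>M1\<^esub> s m, n)]" using s p balanced by (intro rel_ker) auto
  moreover have "rel [(r \<odot>\<^bsub>M1\<^esub> s m, n)] [(s m, r \<odot>\<^bsub>N\<^esub> n)]" using balanced by (intro relI tensor_eq.balanced) auto
  ultimately show ?case unfolding S_def using rel_trans by simp
 qed (blast intro: rel_sym rel_trans)+
 have "rel u (S (map (%x. (pj (fst x), snd x)) u))" using u
 proof (induction u)
  case (Cons x u)
  have "rel [x] [(s (pj (fst x)), snd x)]" using Cons.prems s pj(1) rel_ker[of "fst x" _ "snd x"] by auto
  with Cons show ?case using rel_append[of "[x]" "[(s (pj (fst x)), snd x)]" u] by (simp add: S_def)
 qed (simp add: S_def relI tensor_eq.refl)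
 from rel_trans[OF this *[OF z]] have "rel u []" by (simp add: S_def)
 then show thesis using that unfolding rel_def by auto
qed

locale flat_algebra =
 fixes R :: "'r ring" and C :: "'c ring" and py :: "'r => 'c"
 assumes cR: "cring R" and cC: "cring C" and py: "py : ring_hom R C" and flat: "flat_hom R C py"
begin

sublocale R: cring R by (rule cR)
sublocale C: cring C by (rule cC)

lemmas py_simps[simp] = hom_simps[OF py cR cC]

text \<open>The one place where \<open>flat_hom\<close> is applied, namely to the inclusion of I
  into R. Injectivity of \<open>tensor_map\<close> becomes a statement on derivations: lists over I
  that are equal over R are equal over I.\<close>

lemma flat_ideal:
 assumes I: "ideal I R" and u: "set u <= I \<times> carrier C" "set v <= I \<times> carrier C"
  and z: "tensor_eq R (ideal_module R (carrier R)) (alg py C) u v"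
 shows "tensor_eq R (ideal_module R I) (alg py C) u v"
proof -
 let ?I = "ideal_module R I" and ?R = "ideal_module R (carrier R)" and ?C = "alg py C"
 have IR: "I <= carrier R" using I by (simp add: additive_subgroup.a_subset ideal_def)
 have inj: "inj_on (tensor_map R ?R ?C id) (carrier (tensor R ?I ?C))"
  by (rule flat[unfolded flat_hom_def, rule_format, OF ideal_module[OF cR I] ideal_module[OF cR R.oneideal]])
   (use IR in \<open>auto simp: linear_maps_def\<close>)
 have map: "tensor_map R ?R ?C id (tensor_class R ?I ?C v) = tensor_class R ?R ?C v"
  if v: "set v <= I \<times> carrier C" for v
 proof -
  have "v : tensor_class R ?I ?C v" using v tensor_eq.refl[of v ?I ?C R] by (simp add: tensor_class_def)
  moreover have "tensor_class R ?R ?C w = tensor_class R ?R ?C v" if "w : tensor_class R ?I ?C v" for w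
  proof -
   have "tensor_eq R ?R ?C v w"
    using tensor_eq_map[of R ?I ?C v w id ?R] that IR by (auto simp: tensor_class_def)
   then show ?thesis using tensor_eq.sym tensor_eq.trans unfolding tensor_class_def by blast
  qed
  ultimately have "(\<Union>l\<in>tensor_class R ?I ?C v. tensor_class R ?R ?C l) = tensor_class R ?R ?C v" by blast
  then show ?thesis by (simp add: tensor_map_def map_prod.id list.map_id0)
 qed
 have "tensor_class R ?R ?C u = tensor_class R ?R ?C v"
  using z tensor_eq.sym tensor_eq.trans unfolding tensor_class_def by blast
 moreover have "tensor_class R ?I ?C u : carrier (tensor R ?I ?C)" "tensor_class R ?I ?C v : carrier (tensor R ?I ?C)"
  using u by (auto simp: tensor_def)
 ultimately have "tensor_class R ?I ?C u = tensor_class R ?I ?C v"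
  using inj_onD[OF inj] map[OF u(1)] map[OF u(2)] by simp
 moreover have "v : tensor_class R ?I ?C v" using u tensor_eq.refl[of v ?I ?C R] by (simp add: tensor_class_def)
 ultimately show ?thesis unfolding tensor_class_def by blast
qed

end

locale flat_tensor = tensor_rings R A C ph py + flat_algebra R C py
 for R :: "'r ring" and A :: "'a ring" and C :: "'c ring" and ph :: "'r => 'a" and py :: "'r => 'c"
begin

definition "sub P = (alg ph A)\<lparr>carrier := P\<rparr>"

lemma sub_simps[simp]: "carrier (sub P) = P" "zero (sub P) = zero A" "add (sub P) = add A" "smult (sub P) = smult (alg ph A)"
 by (simp_all add: sub_def alg_def)

abbreviation "TEs P == tensor_eq R (sub P) (alg py C)"

definition "submod P \<longleftrightarrow> P <= carrier A & act_closed R (sub P)"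

lemma submodD:
 assumes "submod P"
 shows "P <= carrier A" "0[A] : P" "!!x y. x : P ==> y : P ==> x +[A] y : P" "!!r x. r : carrier R ==> x : P ==> ph r *[A] x : P"
 using assms by (auto simp: submod_def act_closed_def)

lemma submodI:
 assumes "P <= carrier A" "0[A] : P" "!!x y. x : P ==> y : P ==> x +[A] y : P" "!!r x. r : carrier R ==> x : P ==> ph r *[A] x : P"
 shows "submod P"
 using assms by (simp add: submod_def act_closed_def)

lemma submod_minus:
 assumes "submod P" "x : P" shows "-[A] x : P"
 using submodD(4)[OF assms(1) _ assms(2), of "-[R] 1[R]"] submodD(1)[OF assms(1)] assms(2) by (auto simp: A.l_minus)

lemma TEs_zeros: "snd ` set u <= carrier C ==> TEs P (map (%x. (0[A], snd x)) u) []" if "0[A] : P"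
proof (induction u)
 case (Cons x u)
 then show ?case
  using tensor_eq.append[of R "sub P" "alg py C" "[(0[A], snd x)]" "[]"] tensor_eq.zero[of "snd x" "alg py C" R "sub P"] by auto
qed (simp add: tensor_eq.refl)

text \<open>Adding one generator \<open>m\<close> to \<open>P\<close>: the relations between \<open>P\<close> and \<open>Rm\<close> are given by the ideal
 \<open>J = (P : m)\<close>, and flatness allows to replace \<open>R\<close> by \<open>J\<close>.\<close>
lemma TEs_step:
 assumes P: "submod P" and m: "m : carrier A" and u: "set u <= P \<times> carrier C"
  and z: "TEs {p +[A] ph r *[A] m | p r. p : P & r : carrier R} u []"
 shows "TEs P u []"
proof -
 note PD = submodD[OF P] note PA[simp] = subsetD[OF PD(1)] note [simp] = m
 define J where "J = {r : carrier R. ph r *[A] m : P}"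
 have J: "ideal J R"
  by (rule idealI_cring[OF cR])
   (use PD in \<open>auto simp: J_def A.l_distr A.m_assoc\<close>)
 \<comment> \<open>The direct sum of P and R, which maps onto P + Rm by sending (p, r) to p + rm.
   The kernel consists of the pairs (-rm, r) with r in \<open>J\<close>; this is the set
   \<open>?Z\<close> below.\<close>
 define M :: "('r, 'a \<times> 'r) module" where "M = \<lparr>carrier = P \<times> carrier R, mult = undefined, one = undefined,
  zero = (0[A], 0[R]), add = (%x y. (fst x +[A] fst y, snd x +[R] snd y)),
  smult = (%r x. (ph r *[A] fst x, r *[R] snd x))\<rparr>"
 have M[simp]: "carrier M = P \<times> carrier R" "0[M] = (0[A], 0[R])" "x +[M] y = (fst x +[A] fst y, snd x +[R] snd y)"
  "r \<odot>\<^bsub>M\<^esub> x = (ph r *[A] fst x, r *[R] snd x)" for x y r by (simp_all add: M_def)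
 define g where "g r = ph (-[R] r) *[A] m" for r
 have gP: "g r : P" if "r : J" for r
  using submod_minus[OF P, of "ph r *[A] m"] that unfolding J_def g_def by (auto simp: A.l_minus)
 let ?pj = "%x. fst x +[A] ph (snd x) *[A] m" and ?Z = "(%r. (g r, r)) ` J"
 let ?u = "map (%x. ((fst x, 0[R]), snd x)) u" and ?P = "{p +[A] ph r *[A] m | p r. p : P & r : carrier R}"
 have upj: "map (%x. (?pj (fst x), snd x)) ?u = u" using u by (auto intro!: map_idI)
 obtain w w' where w: "set w <= ?Z \<times> carrier C" "set w' <= ?Z \<times> carrier C" "tensor_eq R M (alg py C) (?u @ w) w'"
 proof (rule tensor_eq_right_exact[of R M "alg py C" ?Z "sub ?P" ?pj ?u])
  show "act_closed R M" "act_closed R (alg py C)" using PD by (auto simp: act_closed_def)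
  show "?Z <= carrier M" using gP by (auto simp: J_def)
  show "EX a:carrier M. ?pj a = x" if "x : carrier (sub ?P)" for x
   using that by (auto intro!: bexI[of _ "(_, _)"])
  show "?pj a : carrier (sub ?P)" if "a : carrier M" for a
   using that by (simp, intro exI conjI) (rule HOL.refl, auto)
  show "?pj 0[M] = 0[sub ?P]" by simp
  show "?pj (a +[M] b) = ?pj a +[sub ?P] ?pj b" if "a : carrier M" "b : carrier M" for a b
   using that by (auto simp: A.l_distr A.a_ac)
  show "?pj (r \<odot>\<^bsub>M\<^esub> a) = r \<odot>\<^bsub>sub ?P\<^esub> ?pj a" if "r : carrier R" "a : carrier M" for r a
   using that by (auto simp: A.r_distr A.m_assoc)
  show "set ?u <= carrier M \<times> carrier (alg py C)" using u by auto
  show "tensor_eq R (sub ?P) (alg py C) (map (%x. (?pj (fst x), snd x)) ?u) []" unfolding upj by (rule z)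
  fix a b assume ab: "a : carrier M" "b : carrier M" "?pj a = ?pj b"
  obtain p r p' r' where e: "a = (p, r)" "b = (p', r')" by (cases a, cases b)
  have c: "p : P" "p' : P" "r : carrier R" "r' : carrier R" and e': "p +[A] ph r *[A] m = p' +[A] ph r' *[A] m" using ab e by auto
  let ?j = "-[R] r' +[R] r"
  have "ph ?j *[A] m = -[A] p +[A] (p +[A] ph r *[A] m) +[A] -[A] (ph r' *[A] m)"
   using c by (simp add: A.l_distr A.l_minus A.a_ac A.r_neg1 A.r_neg2)
  also have "... = -[A] p +[A] p'" unfolding e' using c by (simp add: A.a_assoc A.r_neg)
  finally have j: "ph ?j *[A] m = -[A] p +[A] p'" .
  then have "?j : J" unfolding J_def using c PD submod_minus[OF P] by auto
  moreover have "g ?j = -[A] p' +[A] p"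
  proof -
   have "g ?j = -[A] (ph ?j *[A] m)" unfolding g_def using c by (simp add: A.l_minus del: ph_simps(3))
   then show ?thesis unfolding j using c by (simp add: A.minus_add A.a_comm)
  qed
  ultimately show "EX z:?Z. a = b +[M] z" unfolding e using c
   by (intro bexI[OF _ imageI[of ?j]]) (simp_all add: A.r_neg2 R.r_neg2)
 qed auto
 \<comment> \<open>Projected to P, the relation says that u and the P-components of w add up to
   those of w'. Projected to R, it is a relation among elements of \<open>J\<close>, valid over R
   and by flatness over \<open>J\<close>; applying \<open>g\<close> turns it into equality of the
   P-components of w and w', up to terms with left factor 0. Cancelling these components leaves u =
   0.\<close>
 let ?p = "map (%x. (fst (fst x), snd x))" and ?r = "map (%x. (snd (fst x), snd x))" and ?g = "map (%x. (g (fst x), snd x))"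
 have "TEs P (?p (?u @ w)) (?p w')" by (rule tensor_eq_map[OF w(3)]) auto
 moreover have "?p ?u = u" by (auto intro!: map_idI)
 ultimately have 1: "TEs P (u @ ?p w) (?p w')" by (simp del: map_map)
 have "tensor_eq R (ideal_module R (carrier R)) (alg py C) (?r (?u @ w)) (?r w')" by (rule tensor_eq_map[OF w(3)]) auto
 moreover have "set (?r (?u @ w)) <= J \<times> carrier C" "set (?r w') <= J \<times> carrier C"
  using w u PD(2) by (auto simp: J_def)
 ultimately have "tensor_eq R (ideal_module R J) (alg py C) (?r (?u @ w)) (?r w')" by (intro flat_ideal[OF J])
 then have "TEs P (?g (?r (?u @ w))) (?g (?r w'))"
  by (rule tensor_eq_map) (use gP in \<open>auto simp: J_def g_def A.l_distr A.l_minus A.r_minus A.m_assoc A.minus_add\<close>)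
 moreover have "?g (?r w) = ?p w" "?g (?r w') = ?p w'" using w(1,2) by auto
 moreover have "?g (?r ?u) = map (%x. (0[A], snd x)) u" by (simp add: g_def)
 ultimately have 2: "TEs P (map (%x. (0[A], snd x)) u @ ?p w) (?p w')" by (simp del: map_map)
 have "TEs P u (map (%x. (0[A], snd x)) u)"
 proof (rule tensor_eq_cancel[of _ "a_inv A"])
  show "TEs P (u @ ?p w) (map (%x. (0[A], snd x)) u @ ?p w)" using 1 2 tensor_eq.sym tensor_eq.trans by blast
 qed (use submod_minus[OF P] PD u w gP in \<open>auto simp: A.l_neg\<close>)
 with TEs_zeros[of P u] PD(2) u show ?thesis using tensor_eq.trans by fastforce
qed

text \<open>A derivation mentions finitely many left factors. Any submodule containing them admits
  the same derivation, and \<open>F\<close> is such a finite set.\<close>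

definition "supp F u v \<longleftrightarrow> finite F & F <= carrier A & (ALL P. submod P --> F <= P --> TEs P u v)"

lemma suppD: "supp F u v ==> submod P ==> F <= P ==> TEs P u v" by (simp add: supp_def)

lemma suppI:
 assumes "finite F" "F <= carrier A" "!!P. submod P ==> F <= P ==> TEs P u v"
 shows "EX F. supp F u v"
 using assms unfolding supp_def by blast

lemma TE_support: "TE u v ==> EX F. supp F u v"
proof (induction rule: tensor_eq.induct)
 case (refl u)
 then show ?case by (intro suppI[of "fst ` set u"]) (auto intro!: tensor_eq.refl)
next
 case (sym u v)
 then obtain F where F: "supp F u v" by blast
 show ?case by (rule suppI[of F], use F in \<open>simp_all add: supp_def\<close>, rule tensor_eq.sym) (rule suppD[OF F])
next
 case (trans u v w)
 then obtain F G where FG: "supp F u v" "supp G v w" by blast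
 show ?case
  by (rule suppI[of "F Un G"]) (use FG tensor_eq.trans[OF suppD[OF FG(1)] suppD[OF FG(2)]] in \<open>auto simp: supp_def\<close>)
next
 case (append u u' v v')
 then obtain F G where FG: "supp F u u'" "supp G v v'" by blast
 show ?case
  by (rule suppI[of "F Un G"]) (use FG tensor_eq.append[OF suppD[OF FG(1)] suppD[OF FG(2)]] in \<open>auto simp: supp_def\<close>)
next
 case (comm u v)
 then show ?case by (intro suppI[of "fst ` set (u @ v)"]) (auto intro!: tensor_eq.comm)
next
 case (zero n)
 then show ?case using tensor_eq.zero[of n "alg py C" R "sub _"] by (intro suppI[of "{}"]) auto
next
 case (add_left m m' n)
 then show ?case using tensor_eq.add_left[of m "sub _" m' n "alg py C" R] by (intro suppI[of "{m, m'}"]) auto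
next
 case (add_right m n n')
 then show ?case using tensor_eq.add_right[of m "sub _" n "alg py C" n' R] by (intro suppI[of "{m}"]) auto
next
 case (balanced r m n)
 then show ?case using tensor_eq.balanced[of r R m "sub _" n "alg py C"] by (intro suppI[of "{m}"]) auto
qed

text \<open>Injectivity of P \<otimes> C -> A \<otimes> C for flat C. By \<open>TE_support\<close>
  the derivation already exists over every submodule that contains a certain finite set; its
  elements are adjoined to P one at a time and removed again with \<open>TEs_step\<close>.\<close>

lemma TE_TEs:
 assumes P: "submod P" and u: "set u <= P \<times> carrier C" and z: "TE u []"
 shows "TEs P u []"
proof -
 have "TEs P u []" if "finite F" "F <= carrier A" "!!Q. submod Q ==> P Un F <= Q ==> TEs Q u []" "submod P" "set u <= P \<times> carrier C" for F P
  using that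
 proof (induction F arbitrary: P rule: finite_induct)
  case (insert m F)
  let ?Q = "{p +[A] ph r *[A] m | p r. p : P & r : carrier R}"
  note PD = submodD[OF insert.prems(3)] and [simp] = subsetD[OF PD(1)]
  have m[simp]: "m : carrier A" using insert.prems by simp
  have PQ: "P <= ?Q" using PD by (force intro!: exI[of _ "0[R]"])
  have mQ: "m : ?Q" using PD by (force intro!: exI[of _ "0[A]"] exI[of _ "1[R]"])
  have Q: "submod ?Q"
  proof (rule submodI)
   show "?Q <= carrier A" by auto
   show "0[A] : ?Q" using PQ PD by blast
  next
   fix x y assume "x : ?Q" "y : ?Q"
   then obtain p r p' r' where "x = p +[A] ph r *[A] m" "y = p' +[A] ph r' *[A] m" "p : P" "p' : P" "r : carrier R" "r' : carrier R" by blast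
   then show "x +[A] y : ?Q"
    using PD(3) by (intro CollectI exI[of _ "p +[A] p'"] exI[of _ "r +[R] r'"]) (simp add: A.a_ac A.l_distr)
  next
   fix a x assume "a : carrier R" "x : ?Q"
   then obtain p r where "x = p +[A] ph r *[A] m" "p : P" "r : carrier R" "a : carrier R" by blast
   then show "ph a *[A] x : ?Q"
    using PD(4) by (intro CollectI exI[of _ "ph a *[A] p"] exI[of _ "a *[R] r"]) (simp add: A.m_assoc A.r_distr)
  qed
  have "TEs ?Q u []"
  proof (rule insert.IH[OF _ _ Q])
   show "set u <= ?Q \<times> carrier C" using insert.prems(4) PQ by blast
   show "TEs Q u []" if "submod Q" "?Q Un F <= Q" for Q
    by (rule insert.prems(2)[OF that(1)]) (use that(2) PQ mQ in blast)
  qed (use insert.prems in auto)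
  then show ?case by (rule TEs_step[OF insert.prems(3) m insert.prems(4)])
 qed simp
 with TE_support[OF z] P u show ?thesis unfolding supp_def by (metis le_sup_iff)
qed

end

text \<open>The map from N to A' sending n to q(n)b is a surjection onto its image followed by an
  inclusion. After tensoring with C, \<open>TE_TEs\<close> keeps the inclusion injective, and right
  exactness describes the kernel of the surjection; so the kernel of the tensored map comes from the
  kernel of the original one. It is applied with q a residue map, a quotient map, or the identity,
  where the kernel is an annihilator.\<close>

lemma flat_kernel:
 fixes R :: "'r ring" and A :: "'a ring" and A' :: "'b ring" and C :: "'c ring"
 assumes F: "flat_tensor R A C ph py" and A': "cring A'" and q: "q : ring_hom A A'" and b: "b : carrier A'"
  and N: "ideal N A" and u: "set u <= N \<times> carrier C"
  and z: "tensor_class R (alg (q o ph) A') (alg py C) (map (%x. (q (fst x) *[A'] b, snd x)) u)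
    = 0[tensor R (alg (q o ph) A') (alg py C)]"
 obtains w where "set w <= {n : N. q n *[A'] b = 0[A']} \<times> carrier C"
  "tensor_class R (alg ph A) (alg py C) u = tensor_class R (alg ph A) (alg py C) w"
proof -
 interpret flat_tensor R A C ph py by (rule F)
 interpret F': flat_tensor R A' C "q o ph" py
  by (intro flat_tensor.intro tensor_rings.intro flat_algebra_axioms cR cC A' py ring_hom_trans[OF ph q])
 interpret N: ideal N A by (rule N)
 note [simp] = hom_simps[OF q cA A'] N.Icarr b
 let ?th = "%n. q n *[A'] b" and ?Z = "{n : N. q n *[A'] b = 0[A']}"
 let ?u = "map (%x. (?th (fst x), snd x)) u"
 have Nc: "act_closed R (sub N)" unfolding act_closed_def using N.a_closed N.I_l_closed N.zero_closed by simp
 have th: "?th (x +[A] y) = ?th x +[A'] ?th y" "?th (ph r *[A] x) = (q o ph) r *[A'] ?th x"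
  if "x : N" "y : N" "r : carrier R" for x y r using that by (simp_all add: F'.A.l_distr F'.A.m_assoc)
 have P: "F'.submod (?th ` N)"
 proof (rule F'.submodI)
  show "0[A'] : ?th ` N" by (rule image_eqI[OF _ N.zero_closed]) simp
  show "x +[A'] y : ?th ` N" if "x : ?th ` N" "y : ?th ` N" for x y
  proof -
   from that obtain n n' where "x = ?th n" "y = ?th n'" "n : N" "n' : N" by blast
   then show ?thesis using th(1)[of n n' "0[R]"] by (intro image_eqI[of _ _ "n +[A] n'"]) (simp_all add: N.a_closed)
  qed
  show "(q o ph) r *[A'] x : ?th ` N" if "r : carrier R" "x : ?th ` N" for r x
  proof -
   from that obtain n where "x = ?th n" "n : N" by blast
   with th(2)[of n n r] that(1) have "(q o ph) r *[A'] x = ?th (ph r *[A] n)" by metis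
   then show ?thesis by (rule image_eqI[OF _ N.I_l_closed]) (use that \<open>n : N\<close> in simp_all)
  qed
 qed auto
 have uV: "?u : F'.V" using u by auto
 have "F'.TE ?u []" using z unfolding F'.T_zero F'.cls_eq_iff[OF uV] .
 then have z': "F'.TEs (?th ` N) ?u []" using u by (intro F'.TE_TEs[OF P]) auto
 obtain w w' where w: "set w <= ?Z \<times> carrier C" "set w' <= ?Z \<times> carrier C" "TEs N (u @ w) w'"
 proof (rule tensor_eq_right_exact[of R "sub N" "alg py C" ?Z "F'.sub (?th ` N)" ?th u])
  show "act_closed R (alg py C)" by (simp add: act_closed_def)
  show "EX z:?Z. x = y +[sub N] z" if "x : carrier (sub N)" "y : carrier (sub N)" "?th x = ?th y" for x y
  proof (intro bexI[of _ "-[A] y +[A] x"])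
   have "?th (-[A] y +[A] x) = -[A'] ?th y +[A'] ?th x" using that by (simp add: F'.A.l_distr F'.A.l_minus)
   then show "-[A] y +[A] x : ?Z" using that by (simp add: F'.A.l_neg N.a_closed)
   show "x = y +[sub N] (-[A] y +[A] x)" using that by (simp add: A.r_neg2)
  qed
 qed (use Nc z' u th in \<open>auto simp: F'.A.l_distr simp del: comp_apply\<close>)
 have "TE (map (%x. (id (fst x), snd x)) (u @ w)) (map (%x. (id (fst x), snd x)) w')" by (rule tensor_eq_map[OF w(3)]) auto
 then have TE: "TE (u @ w) w'" by simp
 have V: "u : V" "w : V" "w' : V" using u w by auto
 let ?n = "map (%x. (-[A] fst x, snd x)) w"
 have n: "set ?n <= ?Z \<times> carrier C" using w(1) by (auto simp: F'.A.l_minus)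
 then have nV: "?n : V" by auto
 have "cls ?n +[T] cls w = 0[T]" using TE_neg[OF V(2)] V nV cls_eq_iff[of "?n @ w" "[]"] by (simp add: T_zero)
 then have "cls u = (cls ?n +[T] cls w) +[T] cls u" using T.l_zero[OF cls_closed[OF V(1)]] by simp
 also have "... = cls ?n +[T] (cls u +[T] cls w)" using V nV by (simp only: T.a_ac cls_closed)
 also have "... = cls (?n @ w')" using TE V nV cls_eq_iff[of "u @ w" w'] by simp
 finally show thesis using n w(2) by (intro that[of "?n @ w'"]) auto
qed

section \<open>Locally ringed spaces\<close>

subsection \<open>Stalks\<close>

locale ringed =
 fixes X :: "('p, 'r) rspace"
 assumes rs: "ringed_space X"
begin

abbreviation "opn == is_open X"
abbreviation "Sec U == Scs X U"

lemmas rs_parts = rs[unfolded ringed_space_def]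

lemma sec_cring: "opn U ==> cring (sec X U)"
 and res_id: "opn U ==> s : Sec U ==> res X U U s = s"
 using rs_parts[THEN conjunct1] by auto

lemma res_hom: "opn U ==> opn V ==> V <= U ==> res X U V : ring_hom (sec X U) (sec X V)"
 using rs_parts[THEN conjunct2, THEN conjunct1] by auto

lemma res_res: "opn U ==> opn V ==> opn W ==> W <= V ==> V <= U ==> s : Sec U ==>
  res X V W (res X U V s) = res X U W s"
 using rs_parts[THEN conjunct2, THEN conjunct2, THEN conjunct1] by auto

lemma glue:
 assumes "!!U. U : UU ==> opn U & sg U : Sec U"
  and "!!U V. U : UU ==> V : UU ==> res X U (U Int V) (sg U) = res X V (U Int V) (sg V)"
 shows "EX! s. s : Sec (\<Union>UU) & (ALL U:UU. res X (\<Union>UU) U s = sg U)"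
 by (rule rs_parts[THEN conjunct2, THEN conjunct2, THEN conjunct2, rule_format]) (use assms in auto)

lemma res_closed: "opn U ==> opn V ==> V <= U ==> s : Sec U ==> res X U V s : Sec V"
 using res_hom ring_hom_closed by metis

lemma opn_sub: "opn U ==> U <= points X" by (rule openin_subset)
lemma opn_Int: "opn U ==> opn V ==> opn (U Int V)" by (rule openin_Int)
lemma opn_points: "opn (points X)" by (rule openin_topspace)

lemma germ_mem: "(V, t) : germ X x U s \<longleftrightarrow> opn V & x : V & t : Sec V &
  (EX W. opn W & x : W & W <= U Int V & res X U W s = res X V W t)"
 by (auto simp: germ_def)

lemma germ_mem_trans:
 assumes U: "opn U" "s : Sec U" and V: "(V, t) : germ X x U s" and V': "(V', t') : germ X x V t"
 shows "(V', t') : germ X x U s"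
proof -
 obtain W where W: "opn W" "x : W" "W <= U Int V" "res X U W s = res X V W t" and t: "opn V" "x : V" "t : Sec V"
  using V by (auto simp: germ_mem)
 obtain W' where W': "opn W'" "x : W'" "W' <= V Int V'" "res X V W' t = res X V' W' t'" and t': "opn V'" "x : V'" "t' : Sec V'"
  using V' by (auto simp: germ_mem)
 have "res X U (W Int W') s = res X W (W Int W') (res X U W s)" using U W W' by (subst res_res) (auto intro: opn_Int)
 also have "... = res X V (W Int W') t" unfolding W(4) using t W W' by (subst res_res) (auto intro: opn_Int)
 also have "... = res X W' (W Int W') (res X V W' t)" using t W W' by (subst res_res) (auto intro: opn_Int)
 also have "... = res X V' (W Int W') t'" unfolding W'(4) using t' W W' by (subst res_res) (auto intro: opn_Int)
 finally have "res X U (W Int W') s = res X V' (W Int W') t'" .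
 moreover have "opn (W Int W')" "x : W Int W'" "W Int W' <= U Int V'" using W W' by (auto intro: opn_Int)
 ultimately show ?thesis using t' unfolding germ_mem by blast
qed

lemma germ_self: "opn U ==> x : U ==> s : Sec U ==> (U, s) : germ X x U s"
 unfolding germ_mem by blast

lemma germ_mem_sym: "opn U ==> x : U ==> s : Sec U ==> (V, t) : germ X x U s ==> (U, s) : germ X x V t"
 unfolding germ_mem by (metis Int_commute)

lemma germ_mem_eq:
 assumes U: "opn U" "x : U" "s : Sec U" and m: "(V, t) : germ X x U s"
 shows "germ X x V t = germ X x U s"
proof
 have V: "opn V" "t : Sec V" using m by (simp_all add: germ_mem)
 show "germ X x V t <= germ X x U s"
  by (rule subrelI) (rule germ_mem_trans[OF U(1,3) m])
 show "germ X x U s <= germ X x V t"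
  by (rule subrelI) (rule germ_mem_trans[OF V germ_mem_sym[OF U m]])
qed

lemma germ_eq_iff:
 assumes "opn U" "x : U" "s : Sec U" "opn V" "x : V" "t : Sec V"
 shows "germ X x U s = germ X x V t \<longleftrightarrow> (EX W. opn W & x : W & W <= U Int V & res X U W s = res X V W t)"
proof -
 have "germ X x U s = germ X x V t \<longleftrightarrow> (V, t) : germ X x U s"
  using germ_self[OF assms(4-6)] germ_mem_eq[OF assms(1-3)] by metis
 then show ?thesis using assms by (simp add: germ_mem)
qed

lemma germ_res:
 assumes "opn U" "opn V" "V <= U" "x : V" "s : Sec U"
 shows "germ X x V (res X U V s) = germ X x U s"
proof -
 have "res X V V (res X U V s) = res X U V s" using assms by (intro res_id res_closed)
 then have "(V, res X U V s) : germ X x U s"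
  unfolding germ_mem using assms res_closed by (metis le_inf_iff subset_refl)
 then show ?thesis using germ_mem_eq assms by blast
qed

lemma germ_closed: "opn U ==> x : U ==> s : Sec U ==> germ X x U s : Stk X x"
 by (auto simp: stalk_def)

lemma stalk_cases:
 assumes "a : Stk X x"
 obtains U s where "opn U" "x : U" "s : Sec U" "a = germ X x U s"
 using assms by (auto simp: stalk_def)

text \<open>Addition and multiplication of germs are treated together: all that matters is that
  \<open>op\<close> preserves sections and commutes with restriction.\<close>

lemma stalk_op:
 assumes op: "!!W s t. opn W ==> s : Sec W ==> t : Sec W ==> op W s t : Sec W"
  "!!U W s t. opn U ==> opn W ==> W <= U ==> s : Sec U ==> t : Sec U ==> res X U W (op U s t) = op W (res X U W s) (res X U W t)"
  and U: "opn U" "x : U" "s : Sec U" "t : Sec U"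
 shows "(\<Union>(U', s')\<in>germ X x U s. \<Union>(V', t')\<in>germ X x U t. germ X x (U' Int V') (op (U' Int V') (res X U' (U' Int V') s') (res X V' (U' Int V') t')))
  = germ X x U (op U s t)"
proof -
 have "germ X x (U' Int V') (op (U' Int V') (res X U' (U' Int V') s') (res X V' (U' Int V') t')) = germ X x U (op U s t)"
  if s': "(U', s') : germ X x U s" and t': "(V', t') : germ X x U t" for U' s' V' t'
 proof -
  obtain W where W: "opn W" "x : W" "W <= U Int U'" "res X U W s = res X U' W s'" and A: "opn U'" "x : U'" "s' : Sec U'"
   using s' by (auto simp: germ_mem)
  obtain W' where W': "opn W'" "x : W'" "W' <= U Int V'" "res X U W' t = res X V' W' t'" and B: "opn V'" "x : V'" "t' : Sec V'"
   using t' by (auto simp: germ_mem)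
  let ?W = "W Int W'"
  have o: "opn ?W" "opn (U' Int V')" using W W' A B by (auto intro: opn_Int)
  have 1: "res X U ?W s = res X U' ?W s'"
   using res_res[of U W ?W s] res_res[of U' W ?W s'] W W' U A o by (metis inf_le1 le_inf_iff)
  have 2: "res X U ?W t = res X V' ?W t'"
   using res_res[of U W' ?W t] res_res[of V' W' ?W t'] W W' U B o by (metis inf_le2 le_inf_iff)
  have "res X (U' Int V') ?W (op (U' Int V') (res X U' (U' Int V') s') (res X V' (U' Int V') t')) = op ?W (res X U' ?W s') (res X V' ?W t')"
   using o A B W W' le_infI1[of W U' W'] le_infI2[of W' V' W] res_res[of U' "U' Int V'" ?W s'] res_res[of V' "U' Int V'" ?W t'] by (subst op(2)) (auto intro: res_closed)
  also have "... = res X U ?W (op U s t)" using 1 2 o U W by (subst op(2)) auto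
  finally have "EX Z. opn Z & x : Z & Z <= (U' Int V') Int U &
    res X (U' Int V') Z (op (U' Int V') (res X U' (U' Int V') s') (res X V' (U' Int V') t')) = res X U Z (op U s t)"
   using o W W' by (intro exI[of _ ?W]) auto
  moreover have "op (U' Int V') (res X U' (U' Int V') s') (res X V' (U' Int V') t') : Sec (U' Int V')"
   using op(1)[OF o(2) res_closed[OF A(1) o(2) _ A(3)] res_closed[OF B(1) o(2) _ B(3)]] by simp
  ultimately show ?thesis using o A B U op(1)[OF U(1,3,4)] by (subst germ_eq_iff) simp_all
 qed
 then show ?thesis using germ_self[OF U(1,2,3)] germ_self[OF U(1,2,4)] by fast
qed

lemma res_simps:
 assumes "opn U" "opn V" "V <= U"
 shows "s : Sec U ==> t : Sec U ==> res X U V (s *[sec X U] t) = res X U V s *[sec X V] res X U V t"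
  "s : Sec U ==> t : Sec U ==> res X U V (s +[sec X U] t) = res X U V s +[sec X V] res X U V t"
  "res X U V 1[sec X U] = 1[sec X V]" "res X U V 0[sec X U] = 0[sec X V]"
 using hom_simps[OF res_hom[OF assms] sec_cring[OF assms(1)] sec_cring[OF assms(2)]] by auto

lemma germ_mult: "opn U ==> x : U ==> s : Sec U ==> t : Sec U ==>
  germ X x U s *[stalk X x] germ X x U t = germ X x U (s *[sec X U] t)"
 using stalk_op[of "%U. mult (sec X U)" U x s t] cring.cring_simprules(5)[OF sec_cring] res_simps(1)
 by (simp add: stalk_def)

lemma germ_add: "opn U ==> x : U ==> s : Sec U ==> t : Sec U ==>
  germ X x U s +[stalk X x] germ X x U t = germ X x U (s +[sec X U] t)"
 using stalk_op[of "%U. add (sec X U)" U x s t] cring.cring_simprules(1)[OF sec_cring] res_simps(2)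
 by (simp add: stalk_def)

lemma germ_const: "opn U ==> x : U ==> germ X x U 1[sec X U] = 1[stalk X x]"
 "opn U ==> x : U ==> germ X x U 0[sec X U] = 0[stalk X x]"
 using germ_res[OF opn_points, of U x "1[sec X (points X)]"] germ_res[OF opn_points, of U x "0[sec X (points X)]"]
  res_simps(3,4)[OF opn_points, of U] opn_sub[of U] cring.cring_simprules(2,6)[OF sec_cring[OF opn_points]]
 by (simp_all add: stalk_def)

lemma stalk_common:
 assumes "a : Stk X x" "b : Stk X x" "c : Stk X x"
 obtains U s t u where "opn U" "x : U" "s : Sec U" "t : Sec U" "u : Sec U"
  "a = germ X x U s" "b = germ X x U t" "c = germ X x U u"
proof -
 obtain U s where a: "opn U" "x : U" "s : Sec U" "a = germ X x U s" by (rule stalk_cases[OF assms(1)])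
 obtain V t where b: "opn V" "x : V" "t : Sec V" "b = germ X x V t" by (rule stalk_cases[OF assms(2)])
 obtain W u where c: "opn W" "x : W" "u : Sec W" "c = germ X x W u" by (rule stalk_cases[OF assms(3)])
 let ?Z = "U Int V Int W"
 have o: "opn ?Z" using a b c by (intro opn_Int)
 have sub: "?Z <= U" "?Z <= V" "?Z <= W" and x: "x : ?Z" using a b c by auto
 show thesis
 proof (rule that[OF o x res_closed[OF a(1) o sub(1) a(3)] res_closed[OF b(1) o sub(2) b(3)] res_closed[OF c(1) o sub(3) c(3)]])
  show "a = germ X x ?Z (res X U ?Z s)" using germ_res[OF a(1) o sub(1) x a(3)] a(4) by simp
  show "b = germ X x ?Z (res X V ?Z t)" using germ_res[OF b(1) o sub(2) x b(3)] b(4) by simp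
  show "c = germ X x ?Z (res X W ?Z u)" using germ_res[OF c(1) o sub(3) x c(3)] c(4) by simp
 qed
qed

lemma stalk_cring: "x : points X ==> cring (stalk X x)"
proof (rule cringI)
 assume x: "x : points X"
 note C = cring.cring_simprules[OF sec_cring]
 show "abelian_group (stalk X x)"
 proof (rule abelian_groupI)
  show "0[stalk X x] : Stk X x"
   using germ_closed[OF opn_points x] germ_const(2)[OF opn_points x] C(2)[OF opn_points] by metis
  fix a assume a: "a : Stk X x"
  obtain U s where s: "opn U" "x : U" "s : Sec U" "a = germ X x U s" by (rule stalk_cases[OF a])
  show "0[stalk X x] +[stalk X x] a = a"
   unfolding germ_const(2)[OF s(1,2), symmetric] s(4) using s C by (subst germ_add) auto
  have "germ X x U (-[sec X U] s) +[stalk X x] a = 0[stalk X x]"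
   unfolding germ_const(2)[OF s(1,2), symmetric] s(4) using s C by (subst germ_add) auto
  then show "EX b:Stk X x. b +[stalk X x] a = 0[stalk X x]"
   using germ_closed[OF s(1,2) C(3)[OF s(1,3)]] by blast
  fix b assume b: "b : Stk X x"
  obtain U s t where s: "opn U" "x : U" "s : Sec U" "t : Sec U" "a = germ X x U s" "b = germ X x U t"
   by (rule stalk_common[OF a b b])
  show "a +[stalk X x] b : Stk X x" using s C by (simp add: germ_add germ_closed)
  show "a +[stalk X x] b = b +[stalk X x] a" using s C by (simp add: germ_add)
  fix c assume c: "c : Stk X x"
  obtain U s t u where s: "opn U" "x : U" "s : Sec U" "t : Sec U" "u : Sec U" "a = germ X x U s" "b = germ X x U t" "c = germ X x U u"
   by (rule stalk_common[OF a b c])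
  show "a +[stalk X x] b +[stalk X x] c = a +[stalk X x] (b +[stalk X x] c)" using s C by (simp add: germ_add)
 qed
 show "comm_monoid (stalk X x)"
 proof (rule comm_monoidI)
  show "1[stalk X x] : Stk X x"
   using germ_closed[OF opn_points x] germ_const(1)[OF opn_points x] C(6)[OF opn_points] by metis
  fix a assume a: "a : Stk X x"
  obtain U s where s: "opn U" "x : U" "s : Sec U" "a = germ X x U s" by (rule stalk_cases[OF a])
  show "1[stalk X x] *[stalk X x] a = a"
   unfolding germ_const(1)[OF s(1,2), symmetric] s(4) using s C by (subst germ_mult) auto
  fix b assume b: "b : Stk X x"
  obtain U s t where s: "opn U" "x : U" "s : Sec U" "t : Sec U" "a = germ X x U s" "b = germ X x U t"
   by (rule stalk_common[OF a b b])
  show "a *[stalk X x] b : Stk X x" using s C by (simp add: germ_mult germ_closed)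
  show "a *[stalk X x] b = b *[stalk X x] a" using s C(14)[OF s(1,3,4)] by (simp add: germ_mult)
  fix c assume c: "c : Stk X x"
  obtain U s t u where s: "opn U" "x : U" "s : Sec U" "t : Sec U" "u : Sec U" "a = germ X x U s" "b = germ X x U t" "c = germ X x U u"
   by (rule stalk_common[OF a b c])
  show "a *[stalk X x] b *[stalk X x] c = a *[stalk X x] (b *[stalk X x] c)" using s C by (simp add: germ_mult)
 qed
 fix a b c assume abc: "a : Stk X x" "b : Stk X x" "c : Stk X x"
 obtain U s t u where s: "opn U" "x : U" "s : Sec U" "t : Sec U" "u : Sec U" "a = germ X x U s" "b = germ X x U t" "c = germ X x U u"
  by (rule stalk_common[OF abc])
 show "(a +[stalk X x] b) *[stalk X x] c = a *[stalk X x] c +[stalk X x] b *[stalk X x] c"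
  using s C by (simp add: germ_mult germ_add)
qed

lemma germ_hom: "opn U ==> x : U ==> germ X x U : ring_hom (sec X U) (stalk X x)"
 by (rule ring_hom_memI) (simp_all add: germ_closed germ_mult germ_add germ_const)

text \<open>The open sets on which s and t agree cover U. Both sections glue the same family, and
  gluing is unique.\<close>

lemma sec_eqI:
 assumes U: "opn U" "s : Sec U" "t : Sec U" and eq: "!!x. x : U ==> germ X x U s = germ X x U t"
 shows "s = t"
proof -
 define UU where "UU = {W. opn W & W <= U & res X U W s = res X U W t}"
 have "EX W:UU. x : W" if "x : U" for x
  using eq[OF that] germ_eq_iff[OF U(1) that U(2) U(1) that U(3)] by (auto simp: UU_def)
 then have Un: "\<Union>UU = U" by (auto simp: UU_def)
 have compat: "res X W (W Int W') (res X U W s) = res X W' (W Int W') (res X U W' s)" if "W : UU" "W' : UU" for W W'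
  using that U by (subst (1 2) res_res) (auto simp: UU_def intro: opn_Int)
 have "EX! r. r : Sec (\<Union>UU) & (ALL W:UU. res X (\<Union>UU) W r = res X U W s)"
  using U by (intro glue compat) (auto simp: UU_def intro: res_closed)
 then have ex: "EX! r. r : Sec U & (ALL W:UU. res X U W r = res X U W s)" unfolding Un .
 have "t : Sec U & (ALL W:UU. res X U W t = res X U W s)" using U by (auto simp: UU_def)
 then show ?thesis using ex U(2) by blast
qed

text \<open>Local sections with the prescribed germs agree on overlaps by \<open>sec_eqI\<close>,
  hence glue. The sheaf axiom thereby becomes a statement on families of germs, the form in which
  morphisms are constructed.\<close>

lemma glue_germs:
 assumes U: "opn U" and ex: "!!x. x : U ==> EX V t. opn V & x : V & V <= U & t : Sec V & (ALL w:V. germ X w V t = gm w)"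
 obtains s where "s : Sec U" "!!x. x : U ==> germ X x U s = gm x"
proof -
 define UU where "UU = {V. opn V & V <= U & (EX t:Sec V. ALL w:V. germ X w V t = gm w)}"
 define sg where "sg V = (SOME t. t : Sec V & (ALL w:V. germ X w V t = gm w))" for V
 have sg: "sg V : Sec V" "w : V ==> germ X w V (sg V) = gm w" if "V : UU" for V w
  using that someI_ex[of "%t. t : Sec V & (ALL w:V. germ X w V t = gm w)"] unfolding UU_def sg_def by auto
 have Un: "\<Union>UU = U" using ex by (fastforce simp: UU_def)
 have compat: "res X V (V Int W) (sg V) = res X W (V Int W) (sg W)" if "V : UU" "W : UU" for V W
 proof (rule sec_eqI)
  have o: "opn V" "opn W" "opn (V Int W)" using that by (auto simp: UU_def intro: opn_Int)
  then show "opn (V Int W)" "res X V (V Int W) (sg V) : Sec (V Int W)" "res X W (V Int W) (sg W) : Sec (V Int W)"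
   using sg that by (auto intro: res_closed)
  fix x assume "x : V Int W"
  then show "germ X x (V Int W) (res X V (V Int W) (sg V)) = germ X x (V Int W) (res X W (V Int W) (sg W))"
   using o sg that by (simp add: germ_res)
 qed
 have "EX! s. s : Sec (\<Union>UU) & (ALL V:UU. res X (\<Union>UU) V s = sg V)"
  using sg(1) by (intro glue compat) (auto simp: UU_def)
 then obtain s where s: "s : Sec U" "!!V. V : UU ==> res X U V s = sg V" unfolding Un by blast
 show thesis
 proof (rule that[OF s(1)])
  fix x assume "x : U"
  then obtain V where V: "V : UU" "x : V" using Un by blast
  then have "germ X x U s = germ X x V (res X U V s)" using U s(1) by (intro germ_res[symmetric]) (auto simp: UU_def)
  then show "germ X x U s = gm x" using V s(2) sg by simp
 qed
qed

text \<open>Both the inverse germ and the equation st = 1 are realised on some neighbourhood of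
  x.\<close>

lemma unit_germ:
 assumes U: "opn U" "x : U" "s : Sec U" and unit: "germ X x U s : Units (stalk X x)"
 obtains W t where "opn W" "x : W" "W <= U" "t : Sec W" "res X U W s *[sec X W] t = 1[sec X W]"
proof -
 have xp: "x : points X" using U opn_sub by auto
 obtain b where b: "b : Stk X x" "germ X x U s *[stalk X x] b = 1[stalk X x]"
  using UnitsE[OF stalk_cring[OF xp] unit] by metis
 obtain V t0 where t0: "opn V" "x : V" "t0 : Sec V" "b = germ X x V t0" by (rule stalk_cases[OF b(1)])
 let ?Z = "U Int V"
 have Z: "opn ?Z" "x : ?Z" using U t0 by (auto intro: opn_Int)
 let ?s = "res X U ?Z s" and ?t = "res X V ?Z t0"
 have st: "?s : Sec ?Z" "?t : Sec ?Z" using U t0 Z by (auto intro: res_closed)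
 have "germ X x ?Z (?s *[sec X ?Z] ?t) = germ X x ?Z 1[sec X ?Z]"
  using b(2) U t0 Z st by (simp add: germ_mult[symmetric] germ_res germ_const)
 then obtain W where W: "opn W" "x : W" "W <= ?Z" "res X ?Z W (?s *[sec X ?Z] ?t) = res X ?Z W 1[sec X ?Z]"
  using germ_eq_iff[of ?Z x "?s *[sec X ?Z] ?t" ?Z "1[sec X ?Z]"] Z st cring.cring_simprules(5,6)[OF sec_cring[OF Z(1)]]
  by auto
 then have "res X U W s *[sec X W] res X V W t0 = 1[sec X W]"
  using U t0 Z st by (simp add: res_simps res_res)
 then show thesis using that[OF W(1,2) _ res_closed[OF t0(1) W(1) _ t0(3)]] W(3) by blast
qed

lemma unit_germ_nbhd:
 assumes "opn U" "s : Sec U" "opn W" "w : W" "W <= U" "t : Sec W" "res X U W s *[sec X W] t = 1[sec X W]"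
 shows "germ X w U s *[stalk X w] germ X w W t = 1[stalk X w]" "germ X w U s : Units (stalk X w)"
proof -
 have "germ X w W (res X U W s) *[stalk X w] germ X w W t = 1[stalk X w]"
  using assms by (subst germ_mult) (auto intro: res_closed simp: germ_const)
 then show *: "germ X w U s *[stalk X w] germ X w W t = 1[stalk X w]" using assms by (simp add: germ_res)
 have "w : points X" using assms opn_sub by blast
 then show "germ X w U s : Units (stalk X w)"
  using UnitsI[OF stalk_cring _ _ *] assms germ_closed by (meson subset_iff)
qed

end

locale lringed =
 fixes X :: "('p, 'r) rspace"
 assumes lrs: "lrsp X"
begin

sublocale ringed X using lrs by unfold_locales (simp add: locally_ringed_space_def)

lemma stalk_local: "x : points X ==> local_ring (stalk X x)"
 using lrs by (simp add: locally_ringed_space_def)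

lemma germ_max_iff: "opn U ==> x : U ==> s : Sec U ==>
  germ X x U s : Mst X x \<longleftrightarrow> germ X x U s ~: Units (stalk X x)"
 using max_ideal_iff[OF stalk_local germ_closed] opn_sub by blast

text \<open>Where the germ is a unit, an inverse exists on a whole neighbourhood and witnesses that
  the germ is a unit at all of its points.\<close>

lemma nonvanishing_open:
 assumes "opn U" "s : Sec U"
 shows "opn {x : U. germ X x U s ~: Mst X x}"
proof (subst openin_subopen, safe)
 fix x assume x: "x : U" "germ X x U s ~: Mst X x"
 then have "germ X x U s : Units (stalk X x)" using germ_max_iff assms by blast
 from unit_germ[OF assms(1) x(1) assms(2) this] obtain W t where
  W: "opn W" "x : W" "W <= U" "t : Sec W" "res X U W s *[sec X W] t = 1[sec X W]" .
 have "W <= {x : U. germ X x U s ~: Mst X x}"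
  using unit_germ_nbhd(2)[OF assms W(1) _ W(3-5)] W(3) germ_max_iff assms by blast
 then show "EX T. opn T & x : T & T <= {x : U. germ X x U s ~: Mst X x}" using W by blast
qed

end

subsection \<open>Morphisms\<close>

locale lmorph = X: lringed X + Y: lringed Y
 for X :: "('p, 'r) rspace" and Y :: "('q, 's) rspace" and h :: "('p, 'r, 'q, 's) morph" +
 assumes morph: "mor X Y h"
begin

lemma cont: "continuous_map (space_top X) (space_top Y) (pt h)"
 and com_hom: "Y.opn V ==> com h V : ring_hom (sec Y V) (sec X (preim X h V))"
 and com_res: "Y.opn V ==> Y.opn W ==> W <= V ==> s : Y.Sec V ==>
  com h W (res Y V W s) = res X (preim X h V) (preim X h W) (com h V s)"
 and stalk_map_local: "x : points X ==> smap X h x ` Mst Y (pt h x) <= Mst X x"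
 using morph[unfolded is_morphism_def] by simp_all

lemma pt_closed: "x : points X ==> pt h x : points Y"
 using cont by (auto simp: continuous_map_def)

lemma preim_open: "Y.opn V ==> X.opn (preim X h V)"
 using cont unfolding preim_def by (auto simp: continuous_map_def)

lemma preim_mono: "W <= V ==> preim X h W <= preim X h V" by (auto simp: preim_def)

lemma com_closed: "Y.opn V ==> s : Y.Sec V ==> com h V s : X.Sec (preim X h V)"
 using com_hom ring_hom_closed by metis

lemma stalk_map_germ:
 assumes x: "x : points X" and V: "Y.opn V" "pt h x : V" "s : Y.Sec V"
 shows "smap X h x (germ Y (pt h x) V s) = germ X x (preim X h V) (com h V s)"
proof -
 have px: "x : preim X h W" if "pt h x : W" for W using x that by (auto simp: preim_def)
 have "germ X x (preim X h V') (com h V' s') = germ X x (preim X h V) (com h V s)"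
  if m: "(V', s') : germ Y (pt h x) V s" for V' s'
 proof -
  obtain W where W: "Y.opn W" "pt h x : W" "W <= V Int V'" "res Y V W s = res Y V' W s'" and V': "Y.opn V'" "pt h x : V'" "s' : Y.Sec V'"
   using m by (auto simp: Y.germ_mem)
  have "preim X h W <= preim X h V Int preim X h V'" using W(3) by (auto simp: preim_def)
  moreover have "res X (preim X h V) (preim X h W) (com h V s) = res X (preim X h V') (preim X h W) (com h V' s')"
   using W V V' com_res[of V W s] com_res[of V' W s'] by auto
  ultimately show ?thesis
   using W V V' preim_open com_closed px
   by (subst X.germ_eq_iff) (simp_all, intro exI[of _ "preim X h W"], simp)
 qed
 then show ?thesis unfolding stalk_map_def using Y.germ_self[OF V] by fast
qed

lemma stalk_map_hom:
 assumes x: "x : points X"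
 shows "smap X h x : ring_hom (stalk Y (pt h x)) (stalk X x)"
proof (rule ring_hom_memI)
 have px: "x : preim X h W" if "pt h x : W" for W using x that by (auto simp: preim_def)
 fix a b assume ab: "a : Stk Y (pt h x)" "b : Stk Y (pt h x)"
 obtain U s t where s: "Y.opn U" "pt h x : U" "s : Y.Sec U" "t : Y.Sec U" "a = germ Y (pt h x) U s" "b = germ Y (pt h x) U t"
  by (rule Y.stalk_common[OF ab(1,2,2)])
 note C = cring.cring_simprules[OF Y.sec_cring]
 note [simp] = hom_simps[OF com_hom[OF s(1)] Y.sec_cring[OF s(1)] X.sec_cring[OF preim_open[OF s(1)]]]
 show "smap X h x a : Stk X x"
  using s x px preim_open by (simp add: stalk_map_germ X.germ_closed)
 show "smap X h x (a *[stalk Y (pt h x)] b) = smap X h x a *[stalk X x] smap X h x b"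
  using s x px preim_open C by (simp add: stalk_map_germ Y.germ_mult X.germ_mult)
 show "smap X h x (a +[stalk Y (pt h x)] b) = smap X h x a +[stalk X x] smap X h x b"
  using s x px preim_open C by (simp add: stalk_map_germ Y.germ_add X.germ_add)
next
 have y: "pt h x : points Y" using pt_closed[OF x] .
 then have px: "x : preim X h (points Y)" using x by (auto simp: preim_def)
 have "smap X h x 1[stalk Y (pt h x)] = smap X h x (germ Y (pt h x) (points Y) 1[sec Y (points Y)])"
  using Y.germ_const(1)[OF Y.opn_points y] by simp
 also have "... = germ X x (preim X h (points Y)) (com h (points Y) 1[sec Y (points Y)])"
  using x y Y.opn_points cring.cring_simprules(6)[OF Y.sec_cring[OF Y.opn_points]] by (intro stalk_map_germ)
 also have "... = 1[stalk X x]"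
  using ring_hom_one[OF com_hom[OF Y.opn_points]] X.germ_const(1)[OF preim_open[OF Y.opn_points] px] by simp
 finally show "smap X h x 1[stalk Y (pt h x)] = 1[stalk X x]" .
qed

lemma stalk_map_max_iff:
 "x : points X ==> a : Stk Y (pt h x) ==>
  smap X h x a : Mst X x \<longleftrightarrow> a : Mst Y (pt h x)"
 using local_hom_iff[OF Y.stalk_local[OF pt_closed] X.stalk_local stalk_map_hom stalk_map_local] by blast

lemma stalk_map_closed:
 "x : points X ==> a : Stk Y (pt h x) ==> smap X h x a : Stk X x"
 using stalk_map_hom ring_hom_closed by metis

end

text \<open>Morphisms are checked on stalks. A section is determined by its germs, so the
  homomorphism laws for \<open>com\<close> and its compatibility with restriction follow from the
  family \<open>ph\<close> of stalk maps.\<close>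

lemma is_morphismI:
 fixes X :: "('p, 'r) rspace" and Y :: "('q, 's) rspace"
 assumes X: "lrsp X" and Y: "lrsp Y"
  and cont: "continuous_map (space_top X) (space_top Y) (pt h)"
  and ph: "!!x. x : points X ==> ph x : ring_hom (stalk Y (pt h x)) (stalk X x)"
  and loc: "!!x a. x : points X ==> a : Mst Y (pt h x) ==> ph x a : Mst X x"
  and com: "!!V s. is_open Y V ==> s : Scs Y V ==> com h V s : Scs X (preim X h V)"
  and germ: "!!V s x. is_open Y V ==> s : Scs Y V ==> x : points X ==> pt h x : V ==>
   germ X x (preim X h V) (com h V s) = ph x (germ Y (pt h x) V s)"
 shows "mor X Y h" "!!x a. x : points X ==> a : Stk Y (pt h x) ==> smap X h x a = ph x a"
proof -
 interpret X: lringed X by unfold_locales (rule X)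
 interpret Y: lringed Y by unfold_locales (rule Y)
 have po: "X.opn (preim X h V)" if "Y.opn V" for V
  using cont that unfolding preim_def by (auto simp: continuous_map_def)
 have ptc: "pt h x : points Y" if "x : points X" for x using cont that by (auto simp: continuous_map_def)
 have pp: "x : points X" "pt h x : V" if "x : preim X h V" for x V using that by (auto simp: preim_def)
 have smap: "smap X h x a = ph x a" if x: "x : points X" and a: "a : Stk Y (pt h x)" for x a
 proof -
  obtain U s where s: "Y.opn U" "pt h x : U" "s : Y.Sec U" "a = germ Y (pt h x) U s" by (rule Y.stalk_cases[OF a])
  have "germ X x (preim X h V') (com h V' s') = ph x a" if "(V', s') : germ Y (pt h x) U s" for V' s'
   using that germ[of V' s' x] x s Y.germ_mem_eq[OF s(1-3) that] by (auto simp: Y.germ_mem)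
  then show ?thesis unfolding stalk_map_def s(4) using Y.germ_self[OF s(1-3)] by fast
 qed
 then show "!!x a. x : points X ==> a : Stk Y (pt h x) ==> smap X h x a = ph x a" .
 have eqI: "com h V s = y" if V: "Y.opn V" "s : Y.Sec V" and y: "y : X.Sec (preim X h V)"
   "!!x. x : preim X h V ==> germ X x (preim X h V) y = ph x (germ Y (pt h x) V s)" for V s y
  by (rule X.sec_eqI[OF po[OF V(1)] com[OF V] y(1)]) (use germ[OF V] y(2) pp in simp)
 have hom: "com h V : ring_hom (sec Y V) (sec X (preim X h V))" if V: "Y.opn V" for V
 proof (rule ring_hom_memI)
  note CY = cring.cring_simprules[OF Y.sec_cring[OF V]] and CX = cring.cring_simprules[OF X.sec_cring[OF po[OF V]]]
  show "com h V 1[sec Y V] = 1[sec X (preim X h V)]"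
   by (rule eqI[OF V CY(6) CX(6)]) (use V pp po[OF V] ring_hom_one[OF ph] in \<open>simp add: X.germ_const Y.germ_const\<close>)
  fix s t assume st: "s : Y.Sec V" "t : Y.Sec V"
  note c = com[OF V st(1)] com[OF V st(2)]
  have g: "germ Y (pt h x) V s : Stk Y (pt h x)" "germ Y (pt h x) V t : Stk Y (pt h x)" if "x : preim X h V" for x
   using Y.germ_closed[OF V pp(2)[OF that]] st by blast+
  show "com h V s : X.Sec (preim X h V)" by (rule c)
  show "com h V (s *[sec Y V] t) = com h V s *[sec X (preim X h V)] com h V t"
   by (rule eqI[OF V CY(5)[OF st] CX(5)[OF c]])
    (use V pp po[OF V] st c in \<open>simp add: X.germ_mult[symmetric] Y.germ_mult[symmetric] germ ring_hom_mult[OF ph g]\<close>)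
  show "com h V (s +[sec Y V] t) = com h V s +[sec X (preim X h V)] com h V t"
   by (rule eqI[OF V CY(1)[OF st] CX(1)[OF c]])
    (use V pp po[OF V] st c in \<open>simp add: X.germ_add[symmetric] Y.germ_add[symmetric] germ ring_hom_add[OF ph g]\<close>)
 qed
 have nat: "com h W (res Y V W s) = res X (preim X h V) (preim X h W) (com h V s)"
  if V: "Y.opn V" "Y.opn W" "W <= V" "s : Y.Sec V" for V W s
 proof -
  have sub: "preim X h W <= preim X h V" using V by (auto simp: preim_def)
  show ?thesis
   by (rule eqI[OF V(2) Y.res_closed[OF V] X.res_closed[OF po[OF V(1)] po[OF V(2)] sub com[OF V(1,4)]]])
    (use V pp sub po germ[OF V(1,4)] X.germ_res[OF po[OF V(1)] po[OF V(2)] sub _ com[OF V(1,4)]] Y.germ_res[OF V(1,2,3) _ V(4)] in auto)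
 qed
 show "mor X Y h" unfolding is_morphism_def
 proof (intro conjI allI impI ballI cont hom nat)
  fix x assume x: "x : points X"
  have "Mst Y (pt h x) <= Stk Y (pt h x)" using max_ideal_subset Y.stalk_local ptc x by blast
  then show "smap X h x ` Mst Y (pt h x) <= Mst X x"
   using smap[OF x] loc[OF x] by (auto simp: subset_iff)
 qed
qed

lemma morphism_cong:
 assumes X: "lrsp X" and Y: "lrsp Y" and h: "mor X Y h" and p: "pt k = pt h"
  and com: "!!V s. is_open Y V ==> s : Scs Y V ==> com k V s = com h V s"
 shows "mor X Y k" "!!x a. x : points X ==> a : Stk Y (pt h x) ==> smap X k x a = smap X h x a"
proof -
 interpret h: lmorph X Y h by unfold_locales (rule X, rule Y, rule h)
 have pre: "preim X k V = preim X h V" for V by (simp add: preim_def p)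
 note M = is_morphismI[OF X Y, of k "smap X h", unfolded p pre, OF h.cont h.stalk_map_hom]
 show "mor X Y k" by (rule M(1)) (use h.stalk_map_local h.com_closed h.stalk_map_germ com in auto)
 show "smap X k x a = smap X h x a" if "x : points X" "a : Stk Y (pt h x)" for x a
  by (rule M(2)[of x a]) (use that h.stalk_map_local h.com_closed h.stalk_map_germ com in auto)
qed

text \<open>Here \<open>com\<close> itself is constructed by gluing: a family of local homomorphisms
  on stalks comes from a morphism as soon as it sends each section to germs that are locally those
  of a section.\<close>

lemma morphism_exists:
 fixes X :: "('p, 'r) rspace" and Y :: "('q, 's) rspace"
 assumes X: "lrsp X" and Y: "lrsp Y"
  and cont: "continuous_map (space_top X) (space_top Y) p"
  and ph: "!!x. x : points X ==> ph x : ring_hom (stalk Y (p x)) (stalk X x)"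
  and loc: "!!x a. x : points X ==> a : Mst Y (p x) ==> ph x a : Mst X x"
  and ex: "!!V s x. is_open Y V ==> s : Scs Y V ==> x : points X ==> p x : V ==>
   EX W t. is_open X W & x : W & t : Scs X W & (ALL w:W. p w : V & germ X w W t = ph w (germ Y (p w) V s))"
 obtains h where "mor X Y h" "pt h = p" "!!x a. x : points X ==> a : Stk Y (p x) ==> smap X h x a = ph x a"
proof -
 interpret X: lringed X by unfold_locales (rule X)
 interpret Y: lringed Y by unfold_locales (rule Y)
 define P where "P V = {x : points X. p x : V}" for V
 define h :: "('p, 'r, 'q, 's) morph" where
  "h = \<lparr>pt = p, com = (%V s. SOME t. t : X.Sec (P V) & (ALL x:P V. germ X x (P V) t = ph x (germ Y (p x) V s)))\<rparr>"
 have [simp]: "pt h = p" "preim X h V = P V" for V by (simp_all add: h_def preim_def P_def)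
 have PO: "X.opn (P V)" if "Y.opn V" for V
  using cont that unfolding P_def by (auto simp: continuous_map_def)
 have *: "com h V s : X.Sec (P V) & (ALL x:P V. germ X x (P V) (com h V s) = ph x (germ Y (p x) V s))"
  if V: "Y.opn V" "s : Y.Sec V" for V s
 proof -
  have "EX t. t : X.Sec (P V) & (ALL x:P V. germ X x (P V) t = ph x (germ Y (p x) V s))"
  proof (rule X.glue_germs[OF PO[OF V(1)], where gm = "%x. ph x (germ Y (p x) V s)"])
   fix x assume "x : P V"
   then obtain W t where W: "X.opn W" "x : W" "t : X.Sec W" "ALL w:W. p w : V & germ X w W t = ph w (germ Y (p w) V s)"
    using ex[OF V, of x] by (auto simp: P_def)
   then have "W <= P V" using X.opn_sub[of W] by (auto simp: P_def)
   then show "EX W t. X.opn W & x : W & W <= P V & t : X.Sec W & (ALL w:W. germ X w W t = ph w (germ Y (p w) V s))"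
    using W by blast
  qed blast
  from someI_ex[OF this] show ?thesis by (simp add: h_def)
 qed
 show thesis
 proof (rule that[of h])
  show "mor X Y h"
   by (rule is_morphismI[OF X Y, where ph = ph]) (use * cont ph loc in \<open>auto simp: P_def\<close>)
  show "smap X h x a = ph x a" if "x : points X" "a : Stk Y (p x)" for x a
   by (rule is_morphismI(2)[OF X Y, where ph = ph]) (use * cont ph loc that in \<open>auto simp: P_def\<close>)
 qed simp
qed

text \<open>Sections are determined by their germs, so the map on points and the stalk maps
  determine a morphism.\<close>

lemma morph_eqI:
 assumes X: "lrsp X" and Y: "lrsp Y"
  and h: "mor X Y h" and k: "mor X Y k"
  and p: "!!x. x : points X ==> pt h x = pt k x"
  and s: "!!x a. x : points X ==> a : Stk Y (pt h x) ==> smap X h x a = smap X k x a"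
 shows "meq X Y h k"
proof -
 interpret h: lmorph X Y h by unfold_locales (rule X, rule Y, rule h)
 interpret k: lmorph X Y k by unfold_locales (rule k)
 have pr: "preim X h V = preim X k V" for V using p by (auto simp: preim_def)
 have "com h V s = com k V s" if V: "is_open Y V" "s : Scs Y V" for V s
 proof (rule h.X.sec_eqI)
  show "h.X.opn (preim X h V)" "com h V s : h.X.Sec (preim X h V)" using h.preim_open h.com_closed V by auto
  show "com k V s : h.X.Sec (preim X h V)" using k.com_closed V pr by auto
  fix x assume "x : preim X h V"
  then have x: "x : points X" "pt h x : V" by (auto simp: preim_def)
  have "germ X x (preim X h V) (com h V s) = smap X h x (germ Y (pt h x) V s)"
   using h.stalk_map_germ x V by simp
  also have "... = smap X k x (germ Y (pt k x) V s)" using s x V p h.Y.germ_closed by metis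
  also have "... = germ X x (preim X h V) (com k V s)" using k.stalk_map_germ x V p pr by simp
  finally show "germ X x (preim X h V) (com h V s) = germ X x (preim X h V) (com k V s)" .
 qed
 then show ?thesis using p by (auto simp: morph_eq_def)
qed

lemma morph_eqD:
 assumes X: "lrsp X" and Y: "lrsp Y"
  and h: "mor X Y h" and k: "mor X Y k" and eq: "meq X Y h k" and x: "x : points X"
 shows "pt h x = pt k x" "a : Stk Y (pt h x) ==> smap X h x a = smap X k x a"
proof -
 interpret h: lmorph X Y h by unfold_locales (rule X, rule Y, rule h)
 interpret k: lmorph X Y k by unfold_locales (rule k)
 show p: "pt h x = pt k x" using eq x by (auto simp: morph_eq_def)
 have pr: "preim X h V = preim X k V" for V using eq by (auto simp: preim_def morph_eq_def)
 assume "a : Stk Y (pt h x)"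
 then obtain U s where s: "h.Y.opn U" "pt h x : U" "s : h.Y.Sec U" "a = germ Y (pt h x) U s" by (rule h.Y.stalk_cases)
 then show "smap X h x a = smap X k x a"
  using h.stalk_map_germ[OF x s(1-3)] k.stalk_map_germ[OF x s(1)] p pr eq by (simp add: morph_eq_def)
qed

lemma comp_morphism:
 assumes X: "lrsp X" and Y: "lrsp Y" and Z: "lrsp Z"
  and h: "mor X Y h" and k: "mor Y Z k"
 shows "mor X Z (cmp Y k h)"
  "x : points X ==> a : Stk Z (pt k (pt h x)) ==>
   smap X (cmp Y k h) x a = smap X h x (smap Y k (pt h x) a)"
proof -
 interpret h: lmorph X Y h by unfold_locales (rule X, rule Y, rule h)
 interpret k: lmorph Y Z k by unfold_locales (rule Z, rule k)
 let ?c = "cmp Y k h"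
 have [simp]: "pt ?c = pt k o pt h" by (simp add: morph_comp_def)
 have pr: "preim X ?c W = preim X h (preim Y k W)" for W
  using h.pt_closed by (auto simp: preim_def)
 have com: "com ?c W s = com h (preim Y k W) (com k W s)" for W s by (simp add: morph_comp_def)
 have 1: "continuous_map (space_top X) (space_top Z) (pt ?c)"
  using continuous_map_compose[OF h.cont k.cont] by simp
 have 2: "smap X h x o smap Y k (pt h x) : ring_hom (stalk Z (pt ?c x)) (stalk X x)" if "x : points X" for x
  using ring_hom_trans[OF k.stalk_map_hom h.stalk_map_hom] that h.pt_closed by simp
 have 3: "(smap X h x o smap Y k (pt h x)) a : Mst X x"
  if "x : points X" "a : Mst Z (pt ?c x)" for x a
  using that h.stalk_map_local[OF that(1)] k.stalk_map_local[OF h.pt_closed[OF that(1)]] by auto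
 have 4: "com ?c V s : h.X.Sec (preim X ?c V)" if "k.Y.opn V" "s : k.Y.Sec V" for V s
  unfolding com pr using that h.com_closed k.com_closed k.preim_open by blast
 have 5: "germ X x (preim X ?c V) (com ?c V s) = (smap X h x o smap Y k (pt h x)) (germ Z (pt ?c x) V s)"
  if V: "k.Y.opn V" "s : k.Y.Sec V" "x : points X" "pt ?c x : V" for V s x
 proof -
  have "pt h x : preim Y k V" using V h.pt_closed by (auto simp: preim_def)
  then show ?thesis unfolding com pr
   using V k.stalk_map_germ[OF h.pt_closed[OF V(3)] V(1) _ V(2)] h.stalk_map_germ[OF V(3) k.preim_open[OF V(1)] _ k.com_closed[OF V(1,2)]]
   by simp
 qed
 from is_morphismI[OF X Z 1 2 3 4 5] show "mor X Z ?c"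
  "x : points X ==> a : Stk Z (pt k (pt h x)) ==>
   smap X (cmp Y k h) x a = smap X h x (smap Y k (pt h x) a)" by simp_all
qed

lemma pt_comp[simp]: "pt (cmp Y k h) x = pt k (pt h x)"
 by (simp add: morph_comp_def)

lemma id_morphism:
 assumes X: "lrsp X"
 shows "mor X X morph_id" "x : points X ==> a : Stk X x ==> smap X morph_id x a = a"
proof -
 interpret X: lringed X by unfold_locales (rule X)
 have [simp]: "pt (morph_id :: ('a, 'b, 'a, 'b) morph) = id" "com (morph_id :: ('a, 'b, 'a, 'b) morph) V = id" for V by (simp_all add: morph_id_def)
 have [simp]: "preim X morph_id V = V" if "X.opn V" for V using X.opn_sub[OF that] by (auto simp: preim_def)
 have 1: "continuous_map (space_top X) (space_top X) (pt (morph_id :: ('a, 'b, 'a, 'b) morph))"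
  by (simp add: id_def)
 have 2: "(%a. a) : ring_hom (stalk X (pt (morph_id :: ('a, 'b, 'a, 'b) morph) x)) (stalk X x)" for x
  using id_ring_hom[of "stalk X x"] by (simp add: id_def)
 from is_morphismI[OF X X 1, of "%_ a. a"] show "mor X X morph_id"
  "x : points X ==> a : Stk X x ==> smap X morph_id x a = a" using 2 by simp_all
qed

subsection \<open>Spaces of fractions\<close>

lemma inverse_hom:
 assumes "cring R" "j : ring_hom R A" "bij_betw j (carrier R) (carrier A)"
 obtains i where "i : ring_hom A R" "!!r. r : carrier R ==> i (j r) = r" "!!a. a : carrier A ==> j (i a) = a"
proof -
 interpret cring R by (rule assms(1))
 have "j : ring_iso R A" using assms unfolding ring_iso_def by blast
 then have "inv_into (carrier R) j : ring_hom A R" using ring_iso_set_sym[OF cring.axioms(1)[OF assms(1)]] unfolding ring_iso_def by blast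
 then show ?thesis using assms(3) by (intro that) (auto simp: bij_betw_def f_inv_into_f)
qed

lemma is_loc_transfer:
 assumes "is_loc D p L ddL" and B: "cring B" and v: "v : ring_hom B L" "bij_betw v (carrier B) (carrier L)"
  and dd: "!!d. d : carrier D ==> dd d : carrier B" "!!d. d : carrier D ==> v (dd d) = ddL d"
 shows "is_loc D p B dd"
proof -
 note L = is_locD[OF assms(1)]
 obtain i where i: "i : ring_hom L B" "!!b. b : carrier B ==> i (v b) = b" "!!l. l : carrier L ==> v (i l) = l"
  by (rule inverse_hom[OF B v]) (rule that)
 have hv: "i (ddL d) = dd d" if "d : carrier D" for d using i(2)[of "dd d"] dd[OF that] by simp
 have "bij_betw i (carrier L) (carrier B)"
  by (rule bij_betw_byWitness[where f' = v]) (use i ring_hom_closed[OF i(1)] ring_hom_closed[OF v(1)] in auto)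
 then have "is_loc D p B (i o ddL)" by (intro is_loc_comp_iso[OF assms(1) B i(1)])
 then show ?thesis
  using hv unfolding is_loc_def ring_hom_def by (auto simp: Pi_iff cring.cring_simprules(1,5,6))
qed

lemma (in prime_at) loc_neg: "a : carrier R ==> s : carrier R - I ==>
  -[loc R I] loc_frac R I a s = loc_frac R I (\<ominus> a) s"
proof -
 assume a: "a : carrier R" "s : carrier R - I"
 interpret L: cring "loc R I" by (rule loc_cring)
 have "loc_frac R I (\<ominus> a) s +[loc R I] loc_frac R I a s = 0[loc R I]"
  using a one_notin notin_mult[of s s] loc_frac_eqI[of "\<ominus> a \<otimes> s \<oplus> a \<otimes> s" \<zero> "s \<otimes> s" \<one>]
  by (subst loc_add) (auto simp: l_minus l_neg loc_zero)
 then show ?thesis using L.minus_equality a loc_frac_closed by simp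
qed

lemma (in prime_at) loc_frac_cancel:
 assumes "a : carrier R" "s : carrier R - I" "t : carrier R - I"
 shows "loc_frac R I (a \<otimes> t) (s \<otimes> t) = loc_frac R I a s"
 using assms notin_mult[of s t] by (intro loc_frac_eqI) (auto simp: m_ac)

text \<open>The common shape of \<open>Spec\<close> and of the fibre product: points carry rings \<open>D z\<close> with primes
 \<open>P z\<close>, the pairs \<open>(Dl, v) \<in> Fn\<close> are the available functions \<open>z \<mapsto> v z \<in> D z\<close> with their domains, and
 sections are locally quotients of such functions.\<close>
locale fraction_space =
 fixes T :: "'p topology" and D :: "'p => 'd ring" and P :: "'p => 'd set"
  and adm :: "'p set => ('p => ('d \<times> 'd) set) => bool" and Fn :: "('p set \<times> ('p => 'd)) set"
 assumes top: "T = topology_generated_by {{z : Dl. v z ~: P z} | Dl v. (Dl, v) : Fn}"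
  and adm: "!!V ta. openin T V ==> adm V ta \<longleftrightarrow> (EX Dl a b. (Dl, a) : Fn & (Dl, b) : Fn & V <= Dl &
    (ALL z:V. b z ~: P z & ta z = loc_frac (D z) (P z) (a z) (b z)))"
  and prime: "!!Dl v z. (Dl, v) : Fn ==> z : Dl ==> primeideal (P z) (D z)"
  and val: "!!Dl v z. (Dl, v) : Fn ==> z : Dl ==> v z : carrier (D z)"
  and Fn_one: "!!Dl v. (Dl, v) : Fn ==> (Dl, %z. 1[D z]) : Fn"
  and Fn_zero: "!!Dl v. (Dl, v) : Fn ==> (Dl, %z. 0[D z]) : Fn"
  and Fn_neg: "!!Dl v. (Dl, v) : Fn ==> (Dl, %z. -[D z] v z) : Fn"
  and Fn_add: "!!Dl v w. (Dl, v) : Fn ==> (Dl, w) : Fn ==> (Dl, %z. v z +[D z] w z) : Fn"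
  and Fn_mult: "!!Dl v w. (Dl, v) : Fn ==> (Dl, w) : Fn ==> (Dl, %z. v z *[D z] w z) : Fn"
  and Fn_restrict: "!!Dl v Dl' w. (Dl, v) : Fn ==> (Dl', w) : Fn ==> (Dl Int Dl', v) : Fn"
  and Fn_surj: "!!Dl v z d. (Dl, v) : Fn ==> z : Dl ==> d : carrier (D z) ==>
    EX Dl' w. (Dl', w) : Fn & z : Dl' & w z = d"
  and Fn_vanish: "!!Dl v z. (Dl, v) : Fn ==> z : Dl ==> v z = 0[D z] ==>
    EX Dl' w. (Dl', w) : Fn & z : Dl' & Dl' <= Dl & (ALL x:Dl'. v x = 0[D x])"
begin

abbreviation "L z == loc (D z) (P z)"
abbreviation "fr z d e == loc_frac (D z) (P z) d e"
abbreviation "bas Dl v == {z : Dl. v z ~: P z}"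

definition "Z = function_space T L adm"

lemma Z_simps[simp]: "space_top Z = T" "res Z U V = (%sg. restrict sg V)"
 by (simp_all add: Z_def function_space_def)

lemma prime_at: "(Dl, v) : Fn ==> z : Dl ==> prime_at (P z) (D z)"
 using prime prime_at.intro by blast

lemma one_notin: "(Dl, v) : Fn ==> z : Dl ==> 1[D z] ~: P z"
 using prime primeideal_one by blast

lemma topspace_eq: "topspace T = \<Union>(fst ` Fn)"
proof -
 have "\<Union>{bas Dl v | Dl v. (Dl, v) : Fn} = \<Union>(fst ` Fn)"
 proof (intro equalityI subsetI)
  fix z assume "z : \<Union>(fst ` Fn)"
  then obtain Dl v where "(Dl, v) : Fn" "z : Dl" by auto
  then have "z : bas Dl (%z. 1[D z])" "(Dl, %z. 1[D z]) : Fn" using one_notin Fn_one by auto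
  then show "z : \<Union>{bas Dl v | Dl v. (Dl, v) : Fn}" by blast
 qed force
 then show ?thesis unfolding top by simp
qed

lemma point_cases:
 assumes "z : topspace T" obtains Dl v where "(Dl, v) : Fn" "z : Dl"
 using assms unfolding topspace_eq by auto

lemma point_prime: "z : topspace T ==> primeideal (P z) (D z)"
 using prime point_cases by metis

lemma point_prime_at: "z : topspace T ==> prime_at (P z) (D z)"
 using point_prime prime_at.intro by blast

lemma point_cring: "z : topspace T ==> cring (D z)" "z : topspace T ==> cring (L z)"
 using prime_at.loc_cring[OF point_prime_at] primeideal.axioms(2)[OF point_prime] by blast+

lemma bas_open: "(Dl, v) : Fn ==> openin T (bas Dl v)"
 unfolding top by (rule topology_generated_by_Basis) blast

lemma dom_open: assumes "(Dl, v) : Fn" shows "openin T Dl"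
proof -
 have "bas Dl (%z. 1[D z]) = Dl" using one_notin assms by auto
 then show ?thesis using bas_open[OF Fn_one[OF assms]] by simp
qed

lemma surj:
 assumes "z : topspace T" "d : carrier (D z)"
 obtains Dl w where "(Dl, w) : Fn" "z : Dl" "w z = d"
 using point_cases[OF assms(1)] Fn_surj assms(2) by metis

lemma Fn_restrict2: "(Dl, v) : Fn ==> (Dl', w) : Fn ==> (Dl Int Dl', w) : Fn"
 using Fn_restrict[of Dl' w Dl v] by (simp add: Int_commute)

lemma bas_Int:
 assumes "(Dl, v) : Fn" "(Dl', w) : Fn"
 shows "bas (Dl Int Dl') (%z. v z *[D z] w z) = bas Dl v Int bas Dl' w"
proof -
 have "v z *[D z] w z : P z \<longleftrightarrow> v z : P z \<or> w z : P z" if "z : Dl" "z : Dl'" for z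
 proof -
  interpret primeideal "P z" "D z" using prime assms(1) that(1) .
  have c: "v z : carrier (D z)" "w z : carrier (D z)" using val assms that by auto
  show ?thesis using I_prime[OF c] I_l_closed[of "w z" "v z"] I_r_closed[of "v z" "w z"] c by blast
 qed
 then show ?thesis by auto
qed

text \<open>Basic sets are closed under intersection: since the ideals P z are prime, the product of
  two functions lies in P z exactly where one of the factors does.\<close>

lemma base:
 assumes "openin T U" "z : U"
 obtains Dl v where "(Dl, v) : Fn" "z : bas Dl v" "bas Dl v <= U"
proof -
 have "generate_topology_on {bas Dl v | Dl v. (Dl, v) : Fn} U"
  using assms(1) unfolding top by (rule openin_topology_generated_by)
 then have "ALL z:U. EX Dl v. (Dl, v) : Fn & z : bas Dl v & bas Dl v <= U"
 proof (induction rule: generate_topology_on.induct)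
  case (Int a b)
  show ?case
  proof
   fix z assume z: "z : a Int b"
   obtain Dl v where 1: "(Dl, v) : Fn" "z : bas Dl v" "bas Dl v <= a" using Int z by blast
   obtain Dl' v' where 2: "(Dl', v') : Fn" "z : bas Dl' v'" "bas Dl' v' <= b" using Int z by blast
   show "EX Dl v. (Dl, v) : Fn & z : bas Dl v & bas Dl v <= a Int b"
    using bas_Int[OF 1(1) 2(1)] Fn_mult[OF Fn_restrict[OF 1(1) 2(1)] Fn_restrict2[OF 1(1) 2(1)]] 1 2
    by (intro exI[of _ "Dl Int Dl'"] exI[of _ "%z. v z *[D z] v' z"]) auto
  qed
 next
  case (UN K)
  then show ?case by (meson Union_iff Union_upper subset_trans)
 qed blast+
 then show thesis using that assms(2) by blast
qed

definition "rep V Dl a b sg \<longleftrightarrow> openin T V & (Dl, a) : Fn & (Dl, b) : Fn & V <= Dl & (ALL w:V. b w ~: P w & sg w = fr w (a w) (b w))"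

lemma repI:
 "openin T V ==> (Dl, a) : Fn ==> (Dl, b) : Fn ==> V <= Dl ==> (!!w. w : V ==> b w ~: P w & sg w = fr w (a w) (b w)) ==> rep V Dl a b sg"
 unfolding rep_def by blast

lemma repD:
 assumes "rep V Dl a b sg"
 shows "openin T V" "(Dl, a) : Fn" "(Dl, b) : Fn" "V <= Dl"
 using assms unfolding rep_def by blast+

lemma repE:
 assumes "rep V Dl a b sg" "w : V"
 shows "a w : carrier (D w)" "b w : carrier (D w) - P w" "sg w = fr w (a w) (b w)" "w : Dl" "prime_at (P w) (D w)"
proof -
 note r = repD[OF assms(1)]
 show w: "w : Dl" using r(4) assms(2) by blast
 have "b w ~: P w & sg w = fr w (a w) (b w)" using assms unfolding rep_def by blast
 then show "a w : carrier (D w)" "b w : carrier (D w) - P w" "sg w = fr w (a w) (b w)" "prime_at (P w) (D w)"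
  using val[OF r(2) w] val[OF r(3) w] prime_at[OF r(2) w] by auto
qed

lemma rep_mono:
 assumes "rep V Dl a b sg" "openin T W" "W <= V" "!!w. w : W ==> ta w = sg w"
 shows "rep W Dl a b ta"
 using repD[OF assms(1)] repE[OF assms(1)] assms(2-4) by (intro repI) auto

lemma sec_closed: "openin T U ==> sg : Scs Z U ==> z : U ==> sg z : carrier (L z)"
 by (auto simp: Z_def function_space_def)

lemma sec_ext: "sg : Scs Z U ==> sg : extensional U"
 by (auto simp: Z_def function_space_def PiE_def)

lemma sec_cases:
 assumes "openin T U" "sg : Scs Z U" "z : U"
 obtains V Dl a b where "z : V" "V <= U" "rep V Dl a b sg"
proof -
 obtain V ta where V: "openin T V" "z : V" "V <= U" "adm V ta" "ALL w:V. sg w = ta w"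
  using assms unfolding Z_def function_space_def by auto
 obtain Dl a b where "(Dl, a) : Fn" "(Dl, b) : Fn" "V <= Dl" "ALL z:V. b z ~: P z & ta z = fr z (a z) (b z)"
  using adm[OF V(1), THEN iffD1, OF V(4)] by blast
 then have "rep V Dl a b sg" using V(1,5) by (intro repI) auto
 then show thesis by (rule that[OF V(2,3)])
qed

lemma secI:
 assumes "sg : extensional U" and *: "!!z. z : U ==> EX V Dl a b. z : V & V <= U & rep V Dl a b sg"
 shows "sg : Scs Z U"
proof -
 have "sg z : carrier (L z) & (EX V ta. openin T V & z : V & V <= U & adm V ta & (ALL w:V. sg w = ta w))" if z: "z : U" for z
 proof -
  from *[OF z] obtain V Dl a b where V: "z : V" "V <= U" "rep V Dl a b sg" by blast
  note E = repE[OF V(3,1)]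
  have "sg z : carrier (L z)" unfolding E(3) using prime_at.loc_frac_closed[OF E(5,1,2)] .
  moreover have "adm V sg" using V(3) adm unfolding rep_def by blast
  ultimately show ?thesis using V repD(1)[OF V(3)] by blast
 qed
 then show ?thesis using assms(1) by (simp add: Z_def function_space_def PiE_def)
qed

lemma sec_ops:
 "sg *[sec Z U] ta = (\<lambda>z\<in>U. sg z *[L z] ta z)" "sg +[sec Z U] ta = (\<lambda>z\<in>U. sg z +[L z] ta z)"
 "1[sec Z U] = (\<lambda>z\<in>U. 1[L z])" "0[sec Z U] = (\<lambda>z\<in>U. 0[L z])"
 by (simp_all add: Z_def function_space_def)

lemma sec_add_closed:
 assumes U: "openin T U" and s: "sg : Scs Z U" "ta : Scs Z U"
 shows "(\<lambda>z\<in>U. sg z +[L z] ta z) : Scs Z U" (is ?A) "(\<lambda>z\<in>U. sg z *[L z] ta z) : Scs Z U" (is ?M)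
proof -
 have *: "(EX V Dl a b. z : V & V <= U & rep V Dl a b (\<lambda>z\<in>U. sg z +[L z] ta z)) &
  (EX V Dl a b. z : V & V <= U & rep V Dl a b (\<lambda>z\<in>U. sg z *[L z] ta z))" if z: "z : U" for z
 proof -
  obtain V Dl a b where 1: "z : V" "V <= U" "rep V Dl a b sg" using sec_cases[OF U s(1) z] .
  obtain V' Dl' c d where 2: "z : V'" "V' <= U" "rep V' Dl' c d ta" using sec_cases[OF U s(2) z] .
  note R1 = repD[OF 1(3)] and R2 = repD[OF 2(3)]
  have o: "openin T (V Int V')" "V Int V' <= Dl Int Dl'" "z : V Int V'" "V Int V' <= U" using R1 R2 1 2 by auto
  note F = Fn_restrict[OF R1(2) R2(2)] Fn_restrict[OF R1(3) R2(2)] Fn_restrict2[OF R1(2) R2(2)] Fn_restrict2[OF R1(2) R2(3)]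
  have eq: "b w *[D w] d w ~: P w & (\<lambda>z\<in>U. sg z +[L z] ta z) w = fr w (a w *[D w] d w +[D w] c w *[D w] b w) (b w *[D w] d w)"
   "b w *[D w] d w ~: P w & (\<lambda>z\<in>U. sg z *[L z] ta z) w = fr w (a w *[D w] c w) (b w *[D w] d w)" if w: "w : V Int V'" for w
  proof -
   note A = repE[OF 1(3) IntD1[OF w]] and B = repE[OF 2(3) IntD2[OF w]]
   interpret prime_at "P w" "D w" by (rule A)
   have "w : U" "b w *[D w] d w ~: P w" using w 1(2) notin_mult[OF A(2) B(2)] by auto
   then show "b w *[D w] d w ~: P w & (\<lambda>z\<in>U. sg z +[L z] ta z) w = fr w (a w *[D w] d w +[D w] c w *[D w] b w) (b w *[D w] d w)"
    "b w *[D w] d w ~: P w & (\<lambda>z\<in>U. sg z *[L z] ta z) w = fr w (a w *[D w] c w) (b w *[D w] d w)"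
    using loc_add[OF A(1,2) B(1,2)] loc_mult[OF A(1,2) B(1,2)] A(3) B(3) by simp_all
  qed
  have "rep (V Int V') (Dl Int Dl') (%w. a w *[D w] d w +[D w] c w *[D w] b w) (%w. b w *[D w] d w) (\<lambda>z\<in>U. sg z +[L z] ta z)"
   "rep (V Int V') (Dl Int Dl') (%w. a w *[D w] c w) (%w. b w *[D w] d w) (\<lambda>z\<in>U. sg z *[L z] ta z)"
   by (rule repI[OF o(1) _ _ o(2) eq(1)], (intro Fn_add Fn_mult F | assumption)+, rule repI[OF o(1) _ _ o(2) eq(2)], (intro Fn_mult F | assumption)+)
  with o(3,4) show ?thesis by blast
 qed
 show ?A ?M by (rule secI, simp, rule *[THEN conjunct1] *[THEN conjunct2], assumption)+
qed

lemma sec_fracI: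
 assumes U: "openin T U" and F: "(Dl, a) : Fn" "(Dl, b) : Fn" "U <= bas Dl b"
 shows "(\<lambda>z\<in>U. fr z (a z) (b z)) : Scs Z U"
proof (rule secI)
 have "rep U Dl a b (\<lambda>z\<in>U. fr z (a z) (b z))" using F(3) by (intro repI U F(1,2)) auto
 then show "EX V Dl a' b'. z : V & V <= U & rep V Dl a' b' (\<lambda>z\<in>U. fr z (a z) (b z))" if "z : U" for z
  using that by blast
qed simp

lemma sec_const_closed:
 assumes U: "openin T U"
 shows "(\<lambda>z\<in>U. 1[L z]) : Scs Z U" "(\<lambda>z\<in>U. 0[L z]) : Scs Z U"
proof -
 have *: "(EX V Dl a b. z : V & V <= U & rep V Dl a b (\<lambda>z\<in>U. 1[L z])) &
  (EX V Dl a b. z : V & V <= U & rep V Dl a b (\<lambda>z\<in>U. 0[L z]))" if z: "z : U" for z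
 proof -
  obtain Dl v where v: "(Dl, v) : Fn" "z : Dl" by (rule point_cases[OF subsetD[OF openin_subset[OF U] z]])
  have o: "openin T (U Int Dl)" "z : U Int Dl" "U Int Dl <= U" using U dom_open[OF v(1)] v(2) z by blast+
  have "rep (U Int Dl) Dl (%z. 1[D z]) (%z. 1[D z]) (\<lambda>z\<in>U. 1[L z])" "rep (U Int Dl) Dl (%z. 0[D z]) (%z. 1[D z]) (\<lambda>z\<in>U. 0[L z])"
   using one_notin[OF v(1)] prime_at.loc_one[OF prime_at[OF v(1)]] prime_at.loc_zero[OF prime_at[OF v(1)]]
   by (intro repI o Fn_one[OF v(1)] Fn_zero[OF v(1)]; simp)+
  with o(2,3) show ?thesis by blast
 qed
 show "(\<lambda>z\<in>U. 1[L z]) : Scs Z U" "(\<lambda>z\<in>U. 0[L z]) : Scs Z U"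
  by (rule secI, simp, rule *[THEN conjunct1] *[THEN conjunct2], assumption)+
qed

lemma sec_neg_closed:
 assumes U: "openin T U" and s: "sg : Scs Z U"
 shows "(\<lambda>z\<in>U. -[L z] sg z) : Scs Z U"
proof (rule secI)
 fix z assume z: "z : U"
 obtain V Dl a b where 1: "z : V" "V <= U" "rep V Dl a b sg" using sec_cases[OF U s z] .
 note R = repD[OF 1(3)]
 have "rep V Dl (%z. -[D z] a z) b (\<lambda>z\<in>U. -[L z] sg z)"
  using repE[OF 1(3)] 1(2) by (intro repI R Fn_neg) (auto simp: prime_at.loc_neg)
 with 1 show "EX V Dl a b. z : V & V <= U & rep V Dl a b (\<lambda>z\<in>U. -[L z] sg z)" by blast
qed simp

lemma Z_sec_cring: assumes U: "openin T U" shows "cring (sec Z U)"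
proof -
 note cl = sec_closed[OF U] and U' = openin_subset[OF U]
 have C: "cring (L z)" if "z : U" for z using point_cring(2) U' that by blast
 note Cs = cring.cring_simprules[OF C]
 show ?thesis
 proof (rule cringI)
  show "abelian_group (sec Z U)"
  proof (rule abelian_groupI)
   fix x assume x: "x : Scs Z U"
   show "0[sec Z U] +[sec Z U] x = x"
    unfolding sec_ops using x cl[OF x] Cs by (intro extensionalityI[OF _ sec_ext[OF x]]) auto
   have "(\<lambda>z\<in>U. -[L z] x z) +[sec Z U] x = 0[sec Z U]"
    unfolding sec_ops using cl[OF x] Cs by (intro restrict_ext) auto
   then show "EX y:Scs Z U. y +[sec Z U] x = 0[sec Z U]" using sec_neg_closed[OF U x] by blast
   fix y assume y: "y : Scs Z U"
   show "x +[sec Z U] y : Scs Z U" unfolding sec_ops by (rule sec_add_closed[OF U x y])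
   show "x +[sec Z U] y = y +[sec Z U] x" unfolding sec_ops using cl x y Cs(10) by (intro restrict_ext) auto
   fix z assume z: "z : Scs Z U"
   show "x +[sec Z U] y +[sec Z U] z = x +[sec Z U] (y +[sec Z U] z)"
    unfolding sec_ops using cl x y z Cs(7) by (intro restrict_ext) auto
  next
   show "0[sec Z U] : Scs Z U" unfolding sec_ops by (rule sec_const_closed[OF U])
  qed
  show "comm_monoid (sec Z U)"
  proof (rule comm_monoidI)
   fix x assume x: "x : Scs Z U"
   show "1[sec Z U] *[sec Z U] x = x"
    unfolding sec_ops using x cl[OF x] Cs by (intro extensionalityI[OF _ sec_ext[OF x]]) auto
   fix y assume y: "y : Scs Z U"
   show "x *[sec Z U] y : Scs Z U" unfolding sec_ops by (rule sec_add_closed[OF U x y])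
   show "x *[sec Z U] y = y *[sec Z U] x" unfolding sec_ops using cl x y Cs(14) by (intro restrict_ext) auto
   fix z assume z: "z : Scs Z U"
   show "x *[sec Z U] y *[sec Z U] z = x *[sec Z U] (y *[sec Z U] z)"
    unfolding sec_ops using cl x y z Cs(11) by (intro restrict_ext) auto
  next
   show "1[sec Z U] : Scs Z U" unfolding sec_ops by (rule sec_const_closed[OF U])
  qed
  fix x y z assume "x : Scs Z U" "y : Scs Z U" "z : Scs Z U"
  then show "(x +[sec Z U] y) *[sec Z U] z = x *[sec Z U] z +[sec Z U] y *[sec Z U] z"
   unfolding sec_ops using cl Cs(13) by (intro restrict_ext) auto
 qed
qed

lemma restrict_sec:
 assumes "openin T U" "openin T V" "V <= U" "sg : Scs Z U"
 shows "restrict sg V : Scs Z V"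
proof (rule secI)
 fix z assume z: "z : V"
 obtain W Dl a b where 1: "z : W" "W <= U" "rep W Dl a b sg" by (rule sec_cases[OF assms(1,4) subsetD[OF assms(3) z]])
 have "rep (V Int W) Dl a b (restrict sg V)" by (rule rep_mono[OF 1(3)]) (use assms(2) repD(1)[OF 1(3)] in auto)
 then show "EX W Dl a b. z : W & W <= V & rep W Dl a b (restrict sg V)" using 1(1) z by blast
qed simp

lemma Z_ringed: "ringed_space Z"
proof -
 have glue: "EX! s. s : Scs Z (\<Union>UU) & (ALL U:UU. restrict s U = sg U)"
  if U: "!!U. U : UU ==> openin T U & sg U : Scs Z U"
   and compat: "!!U V. U : UU ==> V : UU ==> restrict (sg U) (U Int V) = restrict (sg V) (U Int V)" for UU sg
 proof -
  \<comment> \<open>Glued pointwise: the value at z comes from any member of the family that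
    contains z.\<close>
  define s where "s = (\<lambda>z\<in>\<Union>UU. sg (SOME U. U : UU & z : U) z)"
  have s: "s z = sg U z" if "U : UU" "z : U" for U z
  proof -
   let ?V = "SOME U. U : UU & z : U"
   have V: "?V : UU & z : ?V" using that by (intro someI[of "%U. U : UU & z : U" U]) blast
   have "restrict (sg ?V) (?V Int U) z = restrict (sg U) (?V Int U) z" using compat[of ?V U] V that by simp
   then show ?thesis using V that by (auto simp: s_def)
  qed
  have rs: "restrict s U = sg U" if "U : UU" for U
   using s that sec_ext[of "sg U" U] U by (intro extensionalityI[of _ U]) auto
  have "s : Scs Z (\<Union>UU)"
  proof (rule secI)
   fix z assume "z : \<Union>UU"
   then obtain V where V: "V : UU" "z : V" by blast
   obtain W Dl a b where 1: "z : W" "W <= V" "rep W Dl a b (sg V)" by (rule sec_cases[OF U[OF V(1), THEN conjunct1] U[OF V(1), THEN conjunct2] V(2)])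
   have "rep W Dl a b s" by (rule rep_mono[OF 1(3) repD(1)[OF 1(3)] subset_refl]) (use 1(2) V(1) s in blast)
   then show "EX W Dl a b. z : W & W <= \<Union>UU & rep W Dl a b s" using 1 V(1) by blast
  qed (simp add: s_def)
  moreover have "t = s" if t: "t : Scs Z (\<Union>UU) & (ALL U:UU. restrict t U = sg U)" for t
  proof (rule extensionalityI[of _ "\<Union>UU"])
   show "t : extensional (\<Union>UU)" "s : extensional (\<Union>UU)" using t sec_ext by (auto simp: s_def)
   fix z assume "z : \<Union>UU"
   then obtain U where "U : UU" "z : U" by blast
   then show "t z = s z" using t s by (metis restrict_apply')
  qed
  ultimately show ?thesis using rs by blast
 qed
 show ?thesis unfolding ringed_space_def Z_simps
 proof (intro conjI allI impI)
  show "cring (sec Z U)" if "openin T U" for U using Z_sec_cring that .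
  show "ALL s:Scs Z U. restrict s U = s" for U using sec_ext extensional_restrict by blast
  show "ALL s:Scs Z U. restrict (restrict s V) W = restrict s W" if "W <= V" for U V W
   using that by (simp add: Int_absorb1)
  show "(%sg. restrict sg V) : ring_hom (sec Z U) (sec Z V)" if "openin T U" "openin T V" "V <= U" for U V
  proof (rule ring_hom_memI)
   show "restrict x V : Scs Z V" if "x : Scs Z U" for x
    using restrict_sec \<open>openin T U\<close> \<open>openin T V\<close> \<open>V <= U\<close> that .
  qed (use that in \<open>auto simp: sec_ops fun_eq_iff restrict_def\<close>)
 next
  fix UU sg
  assume "ALL U:UU. openin T U & sg U : Scs Z U"
   and "ALL U:UU. ALL V:UU. restrict (sg U) (U Int V) = restrict (sg V) (U Int V)"
  then show "EX! s. s : Scs Z (\<Union>UU) & (ALL U:UU. restrict s U = sg U)"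
   by (intro glue) auto
 qed
qed

sublocale Z: ringed Z by unfold_locales (rule Z_ringed)

text \<open>A germ is determined by its value at z, and this is what identifies stalks with
  localisations. If a/b = c/d at z, then u(ad - cb) = 0 for some u outside P z. Realise u by a
  function \<open>e\<close>. By \<open>Fn_vanish\<close> the equation persists near z, and so does
  nonvanishing of \<open>e\<close>; hence the fractions agree on a neighbourhood.\<close>

lemma germ_eq_val:
 assumes U: "openin T U" "z : U" "sg : Scs Z U" and V: "openin T V" "z : V" "ta : Scs Z V"
 shows "germ Z z U sg = germ Z z V ta \<longleftrightarrow> sg z = ta z"
proof
 assume "germ Z z U sg = germ Z z V ta"
 then obtain W where "openin T W" "z : W" "W <= U Int V" "restrict sg W = restrict ta W"
  using Z.germ_eq_iff U V by auto
 then show "sg z = ta z" by (metis restrict_apply')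
next
 assume eq: "sg z = ta z"
 obtain V1 Dl a b where 1: "z : V1" "V1 <= U" "rep V1 Dl a b sg" using sec_cases[OF U(1,3,2)] .
 obtain V2 Dl' c d where 2: "z : V2" "V2 <= V" "rep V2 Dl' c d ta" using sec_cases[OF V(1,3,2)] .
 note F = repD(2,3)[OF 1(3)] repD(2,3)[OF 2(3)]
 note A = repE[OF 1(3,1)] and B = repE[OF 2(3,1)]
 interpret z: prime_at "P z" "D z" by (rule A)
 obtain u where u: "u : carrier (D z) - P z" "u *[D z] (a z *[D z] d z) = u *[D z] (c z *[D z] b z)"
  using eq A B z.loc_frac_eq_iff[of "a z" "c z" "b z" "d z"] by auto
 obtain E e where e: "(E, e) : Fn" "z : E" "e z = u" by (rule surj[OF subsetD[OF openin_subset[OF U(1)] U(2)] DiffD1[OF u(1)]])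
 define G where "G = E Int (Dl Int Dl')"
 have FG: "(G, a) : Fn" "(G, b) : Fn" "(G, c) : Fn" "(G, d) : Fn" "(G, e) : Fn"
  unfolding G_def using Fn_restrict2[OF e(1) Fn_restrict[OF F(1,3)]] Fn_restrict2[OF e(1) Fn_restrict[OF F(2,3)]]
   Fn_restrict2[OF e(1) Fn_restrict2[OF F(1,3)]] Fn_restrict2[OF e(1) Fn_restrict2[OF F(1,4)]] Fn_restrict[OF e(1) Fn_restrict[OF F(1,3)]] by auto
 define v where "v = (%z. e z *[D z] (a z *[D z] d z) +[D z] -[D z] (e z *[D z] (c z *[D z] b z)))"
 have "(G, v) : Fn" unfolding v_def using FG by (intro Fn_add Fn_neg Fn_mult)
 moreover have "z : G" using A B e(2) by (auto simp: G_def)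
 moreover have "v z = 0[D z]" unfolding v_def e(3) u(2) using u(1) A B by (intro z.r_neg) auto
 ultimately obtain H w where H: "(H, w) : Fn" "z : H" "H <= G" "!!x. x : H ==> v x = 0[D x]" using Fn_vanish[of G v z] by blast
 define W where "W = H Int bas E e Int V1 Int V2"
 have W: "openin T W" unfolding W_def by (intro openin_Int dom_open[OF H(1)] bas_open e(1) repD(1)[OF 1(3)] repD(1)[OF 2(3)])
 have zW: "z : W" using H(2) e u 1 2 by (auto simp: W_def)
 have WUV: "W <= U Int V" using 1(2) 2(2) by (auto simp: W_def)
 have "sg x = ta x" if x: "x : W" for x
 proof -
  have x': "x : V1" "x : V2" "x : H" "x : bas E e" using x by (auto simp: W_def)
  note A' = repE[OF 1(3) x'(1)] and B' = repE[OF 2(3) x'(2)]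
  interpret x: prime_at "P x" "D x" by (rule A')
  have ex: "e x : carrier (D x) - P x" using val[OF e(1)] x'(4) by auto
  have "e x *[D x] (a x *[D x] d x) = e x *[D x] (c x *[D x] b x)"
   using H(4)[OF x'(3)] ex A' B' x.r_right_minus_eq[of "e x *[D x] (a x *[D x] d x)" "e x *[D x] (c x *[D x] b x)"]
   by (simp add: v_def a_minus_def)
  then show ?thesis unfolding A'(3) B'(3) using A' B' ex by (subst x.loc_frac_eq_iff) auto
 qed
 then have "restrict sg W = restrict ta W" by (intro restrict_ext) auto
 then show "germ Z z U sg = germ Z z V ta" using Z.germ_eq_iff U V W zW WUV by auto
qed

definition "hat Dl v = (\<lambda>z\<in>Dl. fr z (v z) 1[D z])"
text \<open>A choice is involved because d names a value and not a function. By
  \<open>germ_eq_val\<close> every function with value d at z yields the same germ.\<close>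

definition "dd z d = (SOME gm. EX Dl v. (Dl, v) : Fn & z : Dl & v z = d & gm = germ Z z Dl (hat Dl v))"

lemma hat_sec: "(Dl, v) : Fn ==> hat Dl v : Scs Z Dl"
 unfolding hat_def using one_notin by (intro sec_fracI[OF dom_open _ Fn_one]) auto

lemma dd_germ:
 assumes "(Dl, v) : Fn" "z : Dl"
 shows "dd z (v z) = germ Z z Dl (hat Dl v)"
proof -
 have "EX gm Dl' v'. (Dl', v') : Fn & z : Dl' & v' z = v z & gm = germ Z z Dl' (hat Dl' v')" using assms by blast
 from someI_ex[OF this] obtain Dl' v' where w: "(Dl', v') : Fn" "z : Dl'" "v' z = v z" "dd z (v z) = germ Z z Dl' (hat Dl' v')"
  unfolding dd_def by blast
 show ?thesis unfolding w(4)
  using germ_eq_val[OF dom_open[OF w(1)] w(2) hat_sec[OF w(1)] dom_open[OF assms(1)] assms(2) hat_sec[OF assms(1)]] w assms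
  by (simp add: hat_def)
qed

definition "ev z gm = (SOME x. EX U sg. openin T U & z : U & sg : Scs Z U & gm = germ Z z U sg & x = sg z)"

lemma ev_germ:
 assumes "openin T U" "z : U" "sg : Scs Z U"
 shows "ev z (germ Z z U sg) = sg z"
proof -
 have "EX x U' ta. openin T U' & z : U' & ta : Scs Z U' & germ Z z U sg = germ Z z U' ta & x = ta z" using assms by blast
 from someI_ex[OF this] obtain U' ta where "openin T U'" "z : U'" "ta : Scs Z U'" "germ Z z U sg = germ Z z U' ta" "ev z (germ Z z U sg) = ta z"
  unfolding ev_def by blast
 then show ?thesis using germ_eq_val[OF assms] by auto
qed

lemma dd_closed: "z : topspace T ==> d : carrier (D z) ==> dd z d : Stk Z z"
 and ev_dd: "z : topspace T ==> d : carrier (D z) ==> ev z (dd z d) = fr z d 1[D z]"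
proof -
 assume z: "z : topspace T" and "d : carrier (D z)"
 then obtain Dl v where v: "(Dl, v) : Fn" "z : Dl" "v z = d" by (rule surj)
 show "dd z d : Stk Z z"
  using dd_germ[OF v(1,2)] v Z.germ_closed[OF _ v(2) hat_sec[OF v(1)]] dom_open[OF v(1)] by simp
 show "ev z (dd z d) = fr z d 1[D z]"
  using dd_germ[OF v(1,2)] v ev_germ[OF dom_open[OF v(1)] v(2) hat_sec[OF v(1)]] by (simp add: hat_def)
qed

lemma ev_hom: assumes z: "z : topspace T" shows "ev z : ring_hom (stalk Z z) (L z)"
proof (rule ring_hom_memI)
 fix x y assume x: "x : Stk Z z" and y: "y : Stk Z z"
 obtain U s t where s: "openin T U" "z : U" "s : Scs Z U" "t : Scs Z U" "x = germ Z z U s" "y = germ Z z U t"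
  using Z.stalk_common[OF x y y] by (metis Z_simps(1))
 note c = cring.cring_simprules[OF Z_sec_cring[OF s(1)]]
 show "ev z x : carrier (L z)" using s ev_germ sec_closed by simp
 show "ev z (x *[stalk Z z] y) = ev z x *[L z] ev z y"
  using s c(5)[OF s(3,4)] by (simp add: Z.germ_mult ev_germ) (simp add: sec_ops)
 show "ev z (x +[stalk Z z] y) = ev z x +[L z] ev z y"
  using s c(1)[OF s(3,4)] by (simp add: Z.germ_add ev_germ) (simp add: sec_ops)
next
 have o: "openin T (topspace T)" by simp
 show "ev z 1[stalk Z z] = 1[L z]"
  using Z.germ_const(1)[of "topspace T" z] z ev_germ[OF o z cring.cring_simprules(6)[OF Z_sec_cring[OF o]]] by (simp add: sec_ops)
qed

lemma ev_inj: "inj_on (ev z) (Stk Z z)"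
proof (rule inj_onI)
 fix x y assume x: "x : Stk Z z" and y: "y : Stk Z z" and e: "ev z x = ev z y"
 obtain U s t where s: "openin T U" "z : U" "s : Scs Z U" "t : Scs Z U" "x = germ Z z U s" "y = germ Z z U t"
  using Z.stalk_common[OF x y y] by (metis Z_simps(1))
 then show "x = y" using e germ_eq_val[OF s(1-3) s(1,2,4)] by (simp add: ev_germ)
qed

text \<open>Evaluation at z is an isomorphism from the stalk onto the localisation: injective by
  \<open>germ_eq_val\<close>, and surjective because numerator and denominator of a fraction extend
  to functions near z.\<close>

lemma stalk_is_loc:
 assumes z: "z : topspace T"
 shows "is_loc (D z) (P z) (stalk Z z) (dd z)"
proof (rule is_loc_transfer)
 interpret z: prime_at "P z" "D z" using point_prime_at[OF z] .
 show "is_loc (D z) (P z) (L z) (%a. fr z a 1[D z])" by (rule z.is_loc_loc)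
 show "cring (stalk Z z)" using Z.stalk_cring z by simp
 have o: "openin T (topspace T)" by simp
 show "ev z : ring_hom (stalk Z z) (L z)" by (rule ev_hom[OF z])
 show "bij_betw (ev z) (Stk Z z) (carrier (L z))"
  unfolding bij_betw_def
 proof
  show "inj_on (ev z) (Stk Z z)" by (rule ev_inj)
  show "ev z ` Stk Z z = carrier (L z)"
  proof (intro equalityI subsetI)
   fix x assume "x : ev z ` Stk Z z"
   then obtain gm where g: "gm : Stk Z z" "x = ev z gm" by blast
   obtain U s where s: "openin T U" "z : U" "s : Scs Z U" "gm = germ Z z U s"
    using Z.stalk_cases[OF g(1)] by (metis Z_simps(1))
   then show "x : carrier (L z)" using g ev_germ sec_closed by simp
  next
   fix x assume "x : carrier (L z)"
   then obtain a s where x: "x = fr z a s" "a : carrier (D z)" "s : carrier (D z) - P z" by (rule z.loc_cases)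
   obtain Dl v where v: "(Dl, v) : Fn" "z : Dl" "v z = a" using surj[OF z x(2)] .
   obtain Dl' w where w: "(Dl', w) : Fn" "z : Dl'" "w z = s" by (rule surj[OF z DiffD1[OF x(3)]])
   let ?E = "Dl Int Dl'"
   have F: "(?E, v) : Fn" "(?E, w) : Fn" using Fn_restrict[OF v(1) w(1)] Fn_restrict2[OF v(1) w(1)] .
   have o: "openin T (bas ?E w)" "z : bas ?E w" using bas_open[OF F(2)] v w x by auto
   have sc: "(\<lambda>z\<in>bas ?E w. fr z (v z) (w z)) : Scs Z (bas ?E w)" by (intro sec_fracI[OF o(1) F]) auto
   have "ev z (germ Z z (bas ?E w) (\<lambda>z\<in>bas ?E w. fr z (v z) (w z))) = x"
    unfolding ev_germ[OF o sc] using o v w x by simp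
   then show "x : ev z ` Stk Z z" using Z.germ_closed[OF _ o(2) sc] o by force
  qed
 qed
 show "dd z d : Stk Z z" "ev z (dd z d) = fr z d 1[D z]" if "d : carrier (D z)" for d
  using dd_closed[OF z that] ev_dd[OF z that] .
qed

lemma Z_lrs: "lrsp Z"
 unfolding locally_ringed_space_def using Z_ringed is_loc_local(1)[OF stalk_is_loc] by simp

sublocale Z: lringed Z by unfold_locales (rule Z_lrs)

text \<open>Serves for both projections of a fibre product. Their \<open>com\<close> sends a section
  to a function with denominator 1, which is what \<open>hat\<close> expresses.\<close>

lemma projection_morphism:
 assumes X: "lrsp X" and p: "!!z. z : topspace T ==> pt k z : points X"
  and th: "!!z. z : topspace T ==> th z : ring_hom (stalk X (pt k z)) (D z)"
  and loc: "!!z a. z : topspace T ==> a : Mst X (pt k z) ==> th z a : P z"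
  and Fn: "!!U s. is_open X U ==> s : Scs X U ==> (preim Z k U, %z. th z (germ X (pt k z) U s)) : Fn"
  and com: "!!U s. is_open X U ==> s : Scs X U ==> com k U s = hat (preim Z k U) (%z. th z (germ X (pt k z) U s))"
 shows "mor Z X k" "z : topspace T ==> a : Stk X (pt k z) ==> smap Z k z a = dd z (th z a)"
proof -
 interpret X: lringed X by unfold_locales (rule X)
 have hom: "dd z o th z : ring_hom (stalk X (pt k z)) (stalk Z z)" if "z : topspace T" for z
  by (rule ring_hom_trans[OF th[OF that] is_locD(4)[OF stalk_is_loc[OF that]]])
 have loc': "(dd z o th z) a : Mst Z z" if z: "z : topspace T" and a: "a : Mst X (pt k z)" for z a
  using is_loc_local(2)[OF stalk_is_loc[OF z], of "th z a"] loc[OF z a] ideal.Icarr[OF primeideal.axioms(1)[OF point_prime[OF z]]] by auto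
 have cont: "continuous_map (space_top Z) (space_top X) (pt k)"
  unfolding continuous_map_def
 proof (intro conjI allI impI)
  show "pt k : points Z \<rightarrow> points X" using p by simp
  show "is_open Z {z : points Z. pt k z : U}" if U: "X.opn U" for U
   using dom_open[OF Fn[OF U cring.cring_simprules(6)[OF X.sec_cring[OF U]]]] by (simp add: preim_def)
 qed
 note M = is_morphismI[OF Z_lrs X cont, of "%z. dd z o th z", unfolded Z_simps(1), OF hom loc']
 have c: "com k U s : Scs Z (preim Z k U)" if "X.opn U" "s : X.Sec U" for U s
  unfolding com[OF that] by (rule hat_sec[OF Fn[OF that]])
 have g: "germ Z z (preim Z k U) (com k U s) = (dd z o th z) (germ X (pt k z) U s)"
  if "X.opn U" "s : X.Sec U" "z : topspace T" "pt k z : U" for U s z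
  unfolding com[OF that(1,2)] using dd_germ[OF Fn[OF that(1,2)], of z] that(3,4) by (simp add: preim_def)
 show "mor Z X k" by (rule M(1)) (assumption | rule c g)+
 show "smap Z k z a = dd z (th z a)" if "z : topspace T" "a : Stk X (pt k z)"
  by (subst M(2)[of z a]) (use that c g in simp_all)
qed

lemma germ_frac:
 assumes U: "openin T U" "z : U" "sg : Scs Z U"
  and d: "d : carrier (D z)" "e : carrier (D z) - P z" "sg z = fr z d e"
 shows "germ Z z U sg *[stalk Z z] dd z e = dd z d"
proof (rule inj_onD[OF ev_inj])
 have z: "z : topspace T" using openin_subset[OF U(1)] U(2) by blast
 interpret z: prime_at "P z" "D z" by (rule point_prime_at[OF z])
 interpret S: cring "stalk Z z" using Z.stalk_cring z by simp
 have g: "germ Z z U sg : Stk Z z" using Z.germ_closed[of U z sg] U by simp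
 note dde = dd_closed[OF z DiffD1[OF d(2)]] and ddd = dd_closed[OF z d(1)]
 show "germ Z z U sg *[stalk Z z] dd z e : Stk Z z" "dd z d : Stk Z z" using g dde ddd by auto
 have "fr z d e *[L z] fr z e 1[D z] = fr z (d *[D z] e) (e *[D z] 1[D z])"
  using d z.one_notin by (intro z.loc_mult) auto
 also have "... = fr z d 1[D z]" using d z.one_notin by (intro z.loc_frac_eqI) auto
 finally show "ev z (germ Z z U sg *[stalk Z z] dd z e) = ev z (dd z d)"
  unfolding ring_hom_mult[OF ev_hom[OF z] g dde] ev_germ[OF U] ev_dd[OF z d(1)] ev_dd[OF z DiffD1[OF d(2)]] d(3) .
qed

text \<open>The criterion for mapping into a space of fractions: ring maps out of the rings D that
  pull the maximal ideals back to P, such that functions go locally to sections. The stalk maps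
  arise from the universal property of localisation, and continuity from the openness of
  nonvanishing loci.\<close>

lemma morph_into_exists:
 fixes X :: "('x, 'a) rspace"
 assumes X: "lrsp X" and p: "!!x. x : points X ==> p x : topspace T"
  and th: "!!x. x : points X ==> th x : ring_hom (D (p x)) (stalk X x)"
  and pr: "!!x d. x : points X ==> d : carrier (D (p x)) ==> th x d : Mst X x \<longleftrightarrow> d : P (p x)"
  and ex: "!!Dl v x. (Dl, v) : Fn ==> x : points X ==> p x : Dl ==>
   EX W s. is_open X W & x : W & s : Scs X W & (ALL w:W. p w : Dl & germ X w W s = th w (v (p w)))"
 obtains h where "mor X Z h" "pt h = p"
  "!!x d. x : points X ==> d : carrier (D (p x)) ==> smap X h x (dd (p x) d) = th x d"
proof -
 interpret X: lringed X by unfold_locales (rule X)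
 have unit: "th x d : Units (stalk X x) \<longleftrightarrow> d ~: P (p x)" if "x : points X" "d : carrier (D (p x))" for x d
  using pr[OF that] max_ideal_iff[OF X.stalk_local[OF that(1)] ring_hom_closed[OF th[OF that(1)] that(2)]] by blast
 have "EX ph. ph : ring_hom (stalk Z (p x)) (stalk X x) & (ALL d:carrier (D (p x)). ph (dd (p x) d) = th x d)" if x: "x : points X" for x
 proof -
  have u: "!!e. e : carrier (D (p x)) ==> e ~: P (p x) ==> th x e : Units (stalk X x)" using unit[OF x] by simp
  obtain ph where "ph : ring_hom (stalk Z (p x)) (stalk X x)" "!!d. d : carrier (D (p x)) ==> ph (dd (p x) d) = th x d"
   using is_loc_hom_exists[OF stalk_is_loc[OF p[OF x]] X.stalk_cring[OF x] th[OF x] u] by blast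
  then show ?thesis by blast
 qed
 then obtain ph where ph: "!!x. x : points X ==> ph x : ring_hom (stalk Z (p x)) (stalk X x)"
  and phdd: "!!x d. x : points X ==> d : carrier (D (p x)) ==> ph x (dd (p x) d) = th x d" by metis
 have loc: "ph x a : Mst X x" if x: "x : points X" and a: "a : Mst Z (p x)" for x a
 proof -
  note L = stalk_is_loc[OF p[OF x]]
  have lZ: "local_ring (stalk Z (p x))" using is_loc_local(1)[OF L] .
  have aZ: "a : Stk Z (p x)" using a max_ideal_subset[OF lZ] by blast
  obtain d e where d: "d : carrier (D (p x))" "e : carrier (D (p x))" "e ~: P (p x)" "a *[stalk Z (p x)] dd (p x) e = dd (p x) d"
   using is_loc_cases[OF L aZ] .
  have de: "dd (p x) e : Stk Z (p x)" using ring_hom_closed[OF is_locD(4)[OF L] d(2)] .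
  have "dd (p x) d : Mst Z (p x)"
   unfolding d(4)[symmetric] using ideal.I_r_closed[OF max_ideal_ideal[OF lZ] a de] .
  then have "th x d ~: Units (stalk X x)" using is_loc_local(2)[OF L d(1)] unit[OF x d(1)] by simp
  moreover have "ph x a *[stalk X x] th x e = th x d"
   using ring_hom_mult[OF ph[OF x] aZ de] d phdd[OF x] by simp
  moreover have "ph x a : Stk X x" "th x e : Stk X x"
   using ring_hom_closed[OF ph[OF x] aZ] ring_hom_closed[OF th[OF x] d(2)] .
  ultimately have "ph x a ~: Units (stalk X x)"
   using Units_mult_iff[OF X.stalk_cring[OF x]] unit[OF x d(2)] d(3) by metis
  then show ?thesis using max_ideal_iff[OF X.stalk_local[OF x]] \<open>ph x a : Stk X x\<close> by blast
 qed
 have cont: "continuous_map (space_top X) (space_top Z) p"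
  unfolding Z_simps(1)
 proof (subst top, rule continuous_on_generated_topo)
  show "p ` points X <= \<Union>{bas Dl v | Dl v. (Dl, v) : Fn}" using p unfolding top by auto
  fix U assume "U : {bas Dl v | Dl v. (Dl, v) : Fn}"
  then obtain Dl v where U: "U = bas Dl v" "(Dl, v) : Fn" by blast
  show "X.opn (p -` U Int points X)"
  proof (subst openin_subopen, safe)
   fix x assume x: "x : points X" "p x : U"
   then have "p x : Dl" using U(1) by simp
   from ex[OF U(2) x(1) this] obtain W s where W': "X.opn W" "x : W" "s : X.Sec W" "ALL w:W. p w : Dl & germ X w W s = th w (v (p w))"
    by (elim exE conjE)
   note W = W'(1-3) bspec[OF W'(4)]
   let ?N = "{w : W. germ X w W s ~: Mst X w}"
   have "w : ?N \<longleftrightarrow> w : W & v (p w) ~: P (p w)" for w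
    using W(4)[of w] pr[of w "v (p w)"] X.opn_sub[OF W(1)] val[OF U(2)] by auto
   then have "x : ?N" "?N <= p -` U Int points X" using x W X.opn_sub[OF W(1)] U(1) by auto
   then show "EX T. X.opn T & x : T & T <= p -` U Int points X" using X.nonvanishing_open[OF W(1,3)] by blast
  qed
 qed
 have cond: "EX W t. X.opn W & x : W & t : X.Sec W & (ALL w:W. p w : V & germ X w W t = ph w (germ Z (p w) V s))"
  if V: "is_open Z V" "s : Scs Z V" "x : points X" "p x : V" for V s x
 proof -
  note V' = V(1)[unfolded Z_simps(1)]
  obtain V0 Dl a b where 0: "p x : V0" "V0 <= V" "rep V0 Dl a b s" by (rule sec_cases[OF V' V(2,4)])
  note F = repD(2,3)[OF 0(3)] and px = repE(4)[OF 0(3,1)]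
  have eq: "germ Z w V s *[stalk Z w] dd w (b w) = dd w (a w)" if w: "w : V0" for w
   by (rule germ_frac[OF V' subsetD[OF 0(2) w] V(2) repE(1-3)[OF 0(3) w]])
  from ex[OF F(1) V(3) px] obtain W1 s1 where W1': "X.opn W1" "x : W1" "s1 : X.Sec W1" "ALL w:W1. p w : Dl & germ X w W1 s1 = th w (a (p w))"
   by (elim exE conjE)
  note W1 = W1'(1-3) bspec[OF W1'(4)]
  from ex[OF F(2) V(3) px] obtain W2 s2 where W2': "X.opn W2" "x : W2" "s2 : X.Sec W2" "ALL w:W2. p w : Dl & germ X w W2 s2 = th w (b (p w))"
   by (elim exE conjE)
  note W2 = W2'(1-3) bspec[OF W2'(4)]
  have "germ X x W2 s2 : Units (stalk X x)" using W2(2,4) unit[OF V(3) val[OF F(2) px]] repE(2)[OF 0(3,1)] by auto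
  from X.unit_germ[OF W2(1,2,3) this] obtain W3 t where W3: "X.opn W3" "x : W3" "W3 <= W2" "t : X.Sec W3"
   "res X W2 W3 s2 *[sec X W3] t = 1[sec X W3]" .
  have W4: "X.opn {x : points X. p x : V0}" using cont repD(1)[OF 0(3)] unfolding continuous_map_def by simp
  \<comment> \<open>Numerator and denominator of the local fraction are carried to the sections s1
    and s2, and \<open>t\<close> inverts s2 on W3; the image of the fraction is represented by the
    product of s1 and t.\<close>
  let ?W = "W1 Int W3 Int {x : points X. p x : V0}"
  have o: "X.opn ?W" "x : ?W" using X.opn_Int[OF X.opn_Int[OF W1(1) W3(1)] W4] W1(2) W3(2) V(3) 0(1) by auto
  have s: "?W <= W1" "?W <= W3" by blast+
  note r = X.res_closed[OF W1(1) o(1) s(1) W1(3)] X.res_closed[OF W3(1) o(1) s(2) W3(4)]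
  let ?t = "res X W1 ?W s1 *[sec X ?W] res X W3 ?W t"
  have tS: "?t : X.Sec ?W" using cring.cring_simprules(5)[OF X.sec_cring[OF o(1)] r] .
  have "p w : V & germ X w ?W ?t = ph w (germ Z (p w) V s)" if w: "w : ?W" for w
  proof -
   have wX: "w : points X" using X.opn_sub[OF o(1)] w by blast
   have w': "w : W1" "w : W2" "w : W3" using w W3(3) by auto
   interpret S: cring "stalk X w" by (rule X.stalk_cring[OF wX])
   note inv = X.unit_germ_nbhd[OF W2(1,3) W3(1) w'(3) W3(3-5)]
   have d: "p w : Dl" "germ X w W1 s1 = th w (a (p w))" "germ X w W2 s2 = th w (b (p w))" using W1(4) W2(4) w' by auto
   have pw: "p w : V0" using w by blast
   then have pV: "p w : V" using 0(2) by blast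
   let ?g = "germ Z (p w) V s"
   have gZ: "?g : Stk Z (p w)" using Z.germ_closed[OF V(1) pV V(2)] .
   have dc: "a (p w) : carrier (D (p w))" "b (p w) : carrier (D (p w))" using val F d by blast+
   have ddc: "dd (p w) (b (p w)) : Stk Z (p w)" using ring_hom_closed[OF is_locD(4)[OF stalk_is_loc[OF p[OF wX]]] dc(2)] .
   have 1: "ph w ?g *[stalk X w] th w (b (p w)) = th w (a (p w))"
    using ring_hom_mult[OF ph[OF wX] gZ ddc] eq[OF pw] phdd[OF wX dc(1)] phdd[OF wX dc(2)] by simp
   have cs: "ph w ?g : Stk X w" "th w (b (p w)) : Stk X w" "germ X w W3 t : Stk X w"
    using ring_hom_closed[OF ph[OF wX] gZ] ring_hom_closed[OF th[OF wX] dc(2)] X.germ_closed[OF W3(1) w'(3) W3(4)] .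
   have "germ X w ?W ?t = germ X w W1 s1 *[stalk X w] germ X w W3 t"
    using X.germ_mult[OF o(1) w r] X.germ_res[OF W1(1) o(1) s(1) w W1(3)] X.germ_res[OF W3(1) o(1) s(2) w W3(4)] by simp
   also have "... = ph w ?g *[stalk X w] (th w (b (p w)) *[stalk X w] germ X w W3 t)"
    unfolding d(2) 1[symmetric] using cs by (rule S.m_assoc)
   also have "... = ph w ?g" using inv(1) d(3) cs by simp
   finally show ?thesis using pV by simp
  qed
  then show ?thesis using o tS by blast
 qed
 obtain h where h: "mor X Z h" "pt h = p" "!!x a. x : points X ==> a : Stk Z (p x) ==> smap X h x a = ph x a"
  using morphism_exists[OF X Z_lrs cont ph loc cond] by blast
 show thesis
 proof (rule that[OF h(1,2)])
  fix x d assume x: "x : points X" "d : carrier (D (p x))"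
  then show "smap X h x (dd (p x) d) = th x d"
   using h(3)[OF x(1) ring_hom_closed[OF is_locD(4)[OF stalk_is_loc[OF p[OF x(1)]]] x(2)]] phdd by simp
 qed
qed

lemma morph_into_point:
 assumes X: "lrsp X" and h: "mor X Z h" and x: "x : points X" and d: "d : carrier (D (pt h x))"
 shows "smap X h x (dd (pt h x) d) : Mst X x \<longleftrightarrow> d : P (pt h x)"
proof -
 interpret h: lmorph X Z h by unfold_locales (rule X, rule h)
 note L = stalk_is_loc[OF h.pt_closed[OF x, simplified]]
 show ?thesis using h.stalk_map_max_iff[OF x ring_hom_closed[OF is_locD(4)[OF L] d]] is_loc_local(2)[OF L d] by simp
qed

lemma morph_into_eqI:
 assumes X: "lrsp X" and h: "mor X Z h" and k: "mor X Z k"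
  and p: "!!x. x : points X ==> pt h x = pt k x"
  and eq: "!!x d. x : points X ==> d : carrier (D (pt h x)) ==>
   smap X h x (dd (pt h x) d) = smap X k x (dd (pt k x) d)"
 shows "meq X Z h k"
proof (rule morph_eqI[OF X Z_lrs h k p])
 interpret h: lmorph X Z h by unfold_locales (rule X, rule h)
 interpret k: lmorph X Z k by unfold_locales (rule k)
 fix x a assume x: "x : points X" and a: "a : Stk Z (pt h x)"
 have pz: "pt h x : topspace T" using h.pt_closed[OF x] by simp
 have kh: "smap X k x : ring_hom (stalk Z (pt h x)) (stalk X x)" using k.stalk_map_hom[OF x] p[OF x] by simp
 show "smap X h x a = smap X k x a"
  by (rule is_loc_hom_unique[OF stalk_is_loc[OF pz] h.X.stalk_cring[OF x] h.stalk_map_hom[OF x] kh _ a])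
   (use eq[OF x] p[OF x] in simp)
qed

end

subsection \<open>Spectra\<close>

locale spec_ring =
 fixes R :: "'a ring"
 assumes R: "cring R"
begin

sublocale R: cring R by (rule R)

definition "primes = {p. primeideal p R}"
text \<open>Spec R becomes a space of fractions in which every point carries the same ring R and the
  available functions are the elements of R.\<close>

definition "const_fns = {(Dl, v). Dl = primes & (EX a:carrier R. ALL p:primes. v p = a)}"
abbreviation "spec_top == topology_generated_by {{p. primeideal p R & a ~: p} | a. a : carrier R}"
abbreviation "spec_adm V ta == EX a:carrier R. EX s:carrier R. ALL p:V. s ~: p & ta p = loc_frac R p a s"

lemma const_mem: "a : carrier R ==> (primes, %_. a) : const_fns" by (auto simp: const_fns_def)

lemma spec_topspace: "topspace spec_top = primes"
 using primeideal_one unfolding topology_generated_by_topspace primes_def by blast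

lemma fraction_space: "fraction_space spec_top (%_. R) (%p. p) (%V ta. spec_adm V ta) const_fns"
proof (rule fraction_space.intro)
 have "{{z : Dl. v z ~: z} | Dl v. (Dl, v) : const_fns} = {{p. primeideal p R & a ~: p} | a. a : carrier R}"
 proof (intro equalityI subsetI)
  fix U assume "U : {{z : Dl. v z ~: z} | Dl v. (Dl, v) : const_fns}"
  then obtain v a where "U = {z : primes. v z ~: z}" "a : carrier R" "ALL p:primes. v p = a" by (auto simp: const_fns_def)
  then have "U = {p. primeideal p R & a ~: p}" by (auto simp: primes_def)
  then show "U : {{p. primeideal p R & a ~: p} | a. a : carrier R}" using \<open>a : carrier R\<close> by blast
 next
  fix U assume "U : {{p. primeideal p R & a ~: p} | a. a : carrier R}"
  then obtain a where a: "U = {p. primeideal p R & a ~: p}" "a : carrier R" by blast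
  then have "U = {z : primes. (%_. a) z ~: z}" by (auto simp: primes_def)
  then show "U : {{z : Dl. v z ~: z} | Dl v. (Dl, v) : const_fns}"
   using const_mem[OF a(2)] by (intro CollectI exI[of _ primes] exI[of _ "%_. a"] conjI)
 qed
 then show "spec_top = topology_generated_by {{z : Dl. v z ~: z} | Dl v. (Dl, v) : const_fns}" by simp
next
 fix V ta assume V: "openin spec_top V"
 then have sub: "V <= primes" using openin_subset spec_topspace by blast
 show "spec_adm V ta \<longleftrightarrow> (EX Dl a b. (Dl, a) : const_fns & (Dl, b) : const_fns & V <= Dl & (ALL z:V. b z ~: z & ta z = loc_frac R z (a z) (b z)))"
 proof
  assume "spec_adm V ta"
  then obtain a s where as: "a : carrier R" "s : carrier R" "ALL p:V. s ~: p & ta p = loc_frac R p a s" by (elim bexE)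
  show "EX Dl a b. (Dl, a) : const_fns & (Dl, b) : const_fns & V <= Dl & (ALL z:V. b z ~: z & ta z = loc_frac R z (a z) (b z))"
   by (intro exI[of _ primes] exI[of _ "%_. a"] exI[of _ "%_. s"] conjI const_mem as sub)
 next
  assume "EX Dl a b. (Dl, a) : const_fns & (Dl, b) : const_fns & V <= Dl & (ALL z:V. b z ~: z & ta z = loc_frac R z (a z) (b z))"
  then obtain Dl v w where *: "(Dl, v) : const_fns" "(Dl, w) : const_fns" "ALL z:V. w z ~: z & ta z = loc_frac R z (v z) (w z)"
   by (elim exE conjE)
  obtain a where a: "a : carrier R" "ALL p:primes. v p = a" using *(1) unfolding const_fns_def by blast
  obtain s where s: "s : carrier R" "ALL p:primes. w p = s" using *(2) unfolding const_fns_def by blast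
  have "s ~: z & ta z = loc_frac R z a s" if "z : V" for z
   using bspec[OF *(3) that] bspec[OF a(2), of z] bspec[OF s(2), of z] subsetD[OF sub that] by simp
  then show "spec_adm V ta" using a(1) s(1) by (intro bexI[of _ a] bexI[of _ s] ballI)
 qed
next
 show "EX Dl' w. (Dl', w) : const_fns & z : Dl' & w z = d" if "(Dl, v) : const_fns" "z : Dl" "d : carrier R" for Dl v z d
  using that const_mem[OF that(3)] by (intro exI[of _ primes] exI[of _ "%_. d"] conjI) (simp_all add: const_fns_def)
 show "EX Dl' w. (Dl', w) : const_fns & z : Dl' & Dl' <= Dl & (ALL x:Dl'. v x = 0[R])"
  if "(Dl, v) : const_fns" "z : Dl" "v z = 0[R]" for Dl v z
 proof -
  have "ALL x:Dl. v x = 0[R]" using that unfolding const_fns_def by auto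
  then show ?thesis using that by (intro exI[of _ Dl] exI[of _ v] conjI subset_refl)
 qed
 show "(Dl, %z. v z +[R] w z) : const_fns" if "(Dl, v) : const_fns" "(Dl, w) : const_fns" for Dl v w
  using that R.a_closed by (fastforce simp: const_fns_def)
 show "(Dl, %z. v z *[R] w z) : const_fns" if "(Dl, v) : const_fns" "(Dl, w) : const_fns" for Dl v w
  using that R.m_closed by (fastforce simp: const_fns_def)
 show "(Dl, %z. -[R] v z) : const_fns" if "(Dl, v) : const_fns" for Dl v
  using that R.a_inv_closed by (fastforce simp: const_fns_def)
qed (auto simp: const_fns_def primes_def)

sublocale S: fraction_space spec_top "%_. R" "%p. p" "%V ta. spec_adm V ta" const_fns
 by (rule fraction_space)

lemma Z_eq: "S.Z = Spec R"
 unfolding S.Z_def Spec_def by simp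

lemma spec_points: "points (Spec R) = {p. primeideal p R}"
 using S.Z_simps(1) spec_topspace unfolding Z_eq primes_def by simp

lemmas spec_lrs = S.Z_lrs[unfolded Z_eq]
lemmas spec_top_eq = S.Z_simps(1)[unfolded Z_eq]

end

text \<open>The localisation map from R to the stalk at p. Taking the germ of the global section a/1
  avoids the choice made in \<open>S.dd\<close>, with which it agrees.\<close>

definition spec_germ :: "'a ring => 'a set => 'a => ('a set, 'a set => ('a \<times> 'a) set) germ" where
 "spec_germ R p a = germ (Spec R) p (points (Spec R)) (\<lambda>q\<in>points (Spec R). loc_frac R q a 1[R])"

context spec_ring begin

lemma dd_eq: "primeideal p R ==> a : carrier R ==> S.dd p a = spec_germ R p a"
 using S.dd_germ[OF const_mem[of a], of p] unfolding Z_eq spec_germ_def spec_points S.hat_def primes_def by simp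

lemma spec_hat: "a : carrier R ==> (\<lambda>q\<in>points (Spec R). loc_frac R q a 1[R]) : Scs (Spec R) (points (Spec R))"
 using S.hat_sec[OF const_mem[of a]] unfolding Z_eq spec_points S.hat_def primes_def by simp

lemma spec_is_loc:
 assumes "primeideal p R" shows "is_loc R p (stalk (Spec R) p) (spec_germ R p)"
proof -
 have "is_loc R p (stalk (Spec R) p) (S.dd p)"
  using S.stalk_is_loc[of p] assms unfolding Z_eq spec_topspace primes_def by simp
 then show ?thesis
  using dd_eq[OF assms] unfolding is_loc_def ring_hom_def by (auto simp: Pi_iff)
qed

lemma spec_germ_frac:
 assumes "is_open (Spec R) U" "p : U" "sg : Scs (Spec R) U" "a : carrier R" "s : carrier R" "s ~: p" "sg p = loc_frac R p a s"
 shows "germ (Spec R) p U sg *[stalk (Spec R) p] spec_germ R p s = spec_germ R p a"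
proof -
 have p: "primeideal p R" using openin_subset[OF assms(1)] assms(2) spec_points by blast
 show ?thesis using S.germ_frac[of U p sg a s] assms dd_eq[OF p] spec_top_eq unfolding Z_eq by simp
qed

text \<open>Equality on points is part of what is proved: the prime \<open>pt h x\<close> is
  recovered as the set of those r whose image lies in the maximal ideal of the stalk at x.\<close>

lemma morph_into_spec_eqI:
 assumes X: "lrsp X" and h: "mor X (Spec R) h" and k: "mor X (Spec R) k"
  and eq: "!!x r. x : points X ==> r : carrier R ==>
   smap X h x (spec_germ R (pt h x) r) = smap X k x (spec_germ R (pt k x) r)"
 shows "meq X (Spec R) h k"
proof -
 have pr: "primeideal (pt l x) R" if "x : points X" "mor X (Spec R) l" for x l
  using that spec_points unfolding is_morphism_def continuous_map_def by auto
 have mem: "r : pt l x \<longleftrightarrow> r : carrier R & smap X l x (spec_germ R (pt l x) r) : Mst X x"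
  if l: "x : points X" "mor X (Spec R) l" for x l r
  using S.morph_into_point[OF X _ l(1), of l r] l(2) dd_eq[OF pr[OF l]] ideal.Icarr[OF primeideal.axioms(1)[OF pr[OF l]]]
  unfolding Z_eq by auto
 have p: "pt h x = pt k x" if "x : points X" for x
  using mem[OF that h] mem[OF that k] eq[OF that] by auto
 show ?thesis
  using S.morph_into_eqI[of X h k] X h k p eq dd_eq pr unfolding Z_eq by auto
qed

end

lemma loc_map_frac:
 assumes R: "cring R" and A: "cring A" and ph: "ph : ring_hom R A" and q: "primeideal q A"
  and a: "a : carrier R" "s : carrier R" "ph s ~: q"
 shows "loc_map A ph q (loc_frac R {r : carrier R. ph r : q} a s) = loc_frac A q (ph a) (ph s)"
proof -
 define p where "p = {r : carrier R. ph r : q}"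
 interpret q: prime_at q A using q by (rule prime_at.intro)
 interpret p: prime_at p R using primeideal_vimage[OF ph R A q, folded p_def] by (rule prime_at.intro)
 note H = hom_simps[OF ph R A]
 have "loc_frac A q (ph b) (ph t) = loc_frac A q (ph a) (ph s)" if m: "(b, t) : loc_frac R p a s" for b t
 proof -
  obtain u where u: "u : carrier R - p" "u *[R] (a *[R] t) = u *[R] (b *[R] s)" and b: "b : carrier R" "t : carrier R - p"
   using m unfolding p.loc_frac_mem by blast
  have c: "u : carrier R" "t : carrier R" using u(1) b by blast+
  have "ph (u *[R] (a *[R] t)) = ph (u *[R] (b *[R] s))" by (rule arg_cong[OF u(2)])
  then have "ph u *[A] (ph a *[A] ph t) = ph u *[A] (ph b *[A] ph s)"
   by (simp only: H p.m_closed c a b)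
  moreover have "ph u ~: q" "ph t ~: q" using u(1) b c unfolding p_def by blast+
  ultimately show ?thesis
   using q.loc_frac_eq_iff[of "ph b" "ph a" "ph t" "ph s"] H(1)[OF a(1)] H(1)[OF a(2)] H(1)[OF b(1)] H(1)[OF c(1)] H(1)[OF c(2)] a(3)
   by (metis DiffI)
 qed
 moreover have "(a, s) : loc_frac R p a s" using a unfolding p_def by (intro p.loc_frac_self[unfolded p_def]) blast+
 ultimately show ?thesis unfolding loc_map_def p_def by fast
qed

text \<open>The mapping criterion yields some morphism \<open>h\<close> with the required points and
  stalk maps. The explicit \<open>com\<close> of \<open>Spec_map\<close> is then identified with
  that of \<open>h\<close>, value by value.\<close>

lemma Spec_map_morphism:
 assumes R: "cring R" and A: "cring A" and ph: "ph : ring_hom R A"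
 shows "mor (Spec A) (Spec R) (Spec_map R A ph)"
  "primeideal q A ==> r : carrier R ==>
   smap (Spec A) (Spec_map R A ph) q (spec_germ R {r : carrier R. ph r : q} r) = spec_germ A q (ph r)"
proof -
 interpret R: spec_ring R by (rule spec_ring.intro, rule R)
 interpret A: spec_ring A by (rule spec_ring.intro, rule A)
 interpret SR: lringed "Spec R" by unfold_locales (rule R.spec_lrs)
 interpret SA: lringed "Spec A" by unfold_locales (rule A.spec_lrs)
 note [simp] = hom_simps[OF ph R A]
 let ?p = "%q. {r : carrier R. ph r : q}" and ?th = "%q. spec_germ A q o ph"
 have q: "primeideal q A" "primeideal (?p q) R" if "q : points (Spec A)" for q
  using that A.spec_points primeideal_vimage[OF ph R A] by blast+
 obtain h where h: "mor (Spec A) (Spec R) h" "pt h = ?p"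
  and "!!q d. q : points (Spec A) ==> d : carrier R ==> smap (Spec A) h q (R.S.dd (?p q) d) = ?th q d"
 proof (rule R.S.morph_into_exists[OF A.spec_lrs, of ?p ?th, unfolded R.Z_eq])
  fix q assume qA: "q : points (Spec A)"
  note L = A.spec_is_loc[OF q(1)[OF qA]]
  show "?p q : topspace R.spec_top" using q(2)[OF qA] R.spec_topspace unfolding R.primes_def by simp
  show "?th q : ring_hom R (stalk (Spec A) q)" by (rule ring_hom_trans[OF ph is_locD(4)[OF L]])
  show "?th q d : Mst (Spec A) q \<longleftrightarrow> d : ?p q" if "d : carrier R" for d
   using is_loc_local(2)[OF L, of "ph d"] that by simp
  fix Dl v assume v: "(Dl, v) : R.const_fns" "?p q : Dl"
  then obtain a where a: "Dl = R.primes" "a : carrier R" "!!p. primeideal p R ==> v p = a"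
   unfolding R.const_fns_def R.primes_def by auto
  show "EX W s. is_open (Spec A) W & q : W & s : Scs (Spec A) W & (ALL w:W. ?p w : Dl & germ (Spec A) w W s = ?th w (v (?p w)))"
   using qA q(2) a A.spec_hat[of "ph a"]
   by (intro exI[of _ "points (Spec A)"] exI[of _ "\<lambda>q\<in>points (Spec A). loc_frac A q (ph a) 1[A]"]) (simp add: spec_germ_def R.primes_def)
 qed (rule that)
 then have hs: "smap (Spec A) h q (spec_germ R (?p q) d) = spec_germ A q (ph d)" if "q : points (Spec A)" "d : carrier R" for q d
  using that R.dd_eq[OF q(2)] by simp
 interpret h: lmorph "Spec A" "Spec R" h by unfold_locales (rule h)
 have com: "com (Spec_map R A ph) V sg = com h V sg" if V: "is_open (Spec R) V" "sg : Scs (Spec R) V" for V sg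
 proof (rule extensionalityI)
  note V' = V(1)[unfolded R.spec_top_eq] and po = h.preim_open[OF V(1)] and cs = h.com_closed[OF V]
  show "com (Spec_map R A ph) V sg : extensional (preim (Spec A) h V)" by (simp add: Spec_map_def preim_def h(2))
  show "com h V sg : extensional (preim (Spec A) h V)" using A.S.sec_ext[of "com h V sg"] cs unfolding A.Z_eq by blast
  fix w assume w: "w : preim (Spec A) h V"
  then have wA: "w : points (Spec A)" and wV: "?p w : V" by (auto simp: preim_def h(2))
  note w' = q[OF wA] and LA = A.spec_is_loc[OF q(1)[OF wA]] and LR = R.spec_is_loc[OF q(2)[OF wA]]
  have "sg (?p w) : carrier (loc R (?p w))" using R.S.sec_closed[OF V' _ wV] V(2) unfolding R.Z_eq by blast
  then obtain a s where as: "sg (?p w) = loc_frac R (?p w) a s" "a : carrier R" "s : carrier R - ?p w"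
   by (rule prime_at.loc_cases[OF prime_at.intro[OF w'(2)]])
  have "com h V sg w : carrier (loc A w)" using A.S.sec_closed[OF po[unfolded A.spec_top_eq] _ w] cs unfolding A.Z_eq by blast
  then obtain b t where bt: "com h V sg w = loc_frac A w b t" "b : carrier A" "t : carrier A - w"
   by (rule prime_at.loc_cases[OF prime_at.intro[OF w'(1)]])
  let ?g = "germ (Spec A) w (preim (Spec A) h V) (com h V sg)" and ?A = "stalk (Spec A) w" and ?i = "spec_germ A w"
  interpret B: cring ?A by (rule is_locD(2)[OF LA])
  have g: "?g : carrier ?A" by (rule SA.germ_closed[OF po w cs])
  note i = hom_simps[OF is_locD(4)[OF LA] A.R is_locD(2)[OF LA]]
  have "germ (Spec R) (?p w) V sg *[stalk (Spec R) (?p w)] spec_germ R (?p w) s = spec_germ R (?p w) a"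
   using as by (intro R.spec_germ_frac[OF V(1) wV V(2)]) auto
  \<comment> \<open>The germ \<open>?g\<close> is described twice: equation 1 comes from the
    fraction a/s representing \<open>sg\<close>, equation 2 from the fraction b/t representing
    \<open>com h V sg\<close>. Cross-multiplication gives equality of ph(a)/ph(s) and b/t.\<close>
  from arg_cong[OF this, of "smap (Spec A) h w"] have 1: "?g *[?A] ?i (ph s) = ?i (ph a)"
   using h.stalk_map_hom[OF wA] h.stalk_map_germ[OF wA V(1) _ V(2)] SR.germ_closed[OF V(1) wV V(2)] ring_hom_closed[OF is_locD(4)[OF LR]]
    hs[OF wA] as(2,3) wV by (simp add: h(2) ring_hom_mult)
  have 2: "?g *[?A] ?i t = ?i b" using bt by (intro A.spec_germ_frac[OF po w cs]) auto
  have ts: "t : carrier A" "ph s : carrier A" "ph s ~: w" "ph a : carrier A" using bt as by auto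
  have "?i (ph a *[A] t) = (?g *[?A] ?i (ph s)) *[?A] ?i t" using ts i 1 by simp
  also have "... = (?g *[?A] ?i t) *[?A] ?i (ph s)" using ts i g by (simp add: B.m_ac)
  also have "... = ?i (b *[A] ph s)" using 2 ts i bt by simp
  finally have e: "?i (ph a *[A] t) = ?i (b *[A] ph s)" .
  obtain u where "u : carrier A" "u ~: w" "u *[A] (ph a *[A] t) = u *[A] (b *[A] ph s)"
   by (rule is_loc_eqD[OF LA _ _ e]) (use ts bt in auto)
  then have "loc_frac A w (ph a) (ph s) = loc_frac A w b t"
   using prime_at.loc_frac_eq_iff[OF prime_at.intro[OF w'(1)], of "ph a" b "ph s" t] ts bt by auto
  moreover have "com (Spec_map R A ph) V sg w = loc_map A ph w (sg (?p w))" using wA wV by (simp add: Spec_map_def)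
  moreover have "... = loc_frac A w (ph a) (ph s)" unfolding as(1) using as by (intro loc_map_frac[OF R A ph w'(1)]) auto
  ultimately show "com (Spec_map R A ph) V sg w = com h V sg w" using bt(1) by simp
 qed
 note M = morphism_cong[OF A.spec_lrs R.spec_lrs h(1) _ com, unfolded h(2)]
 show "mor (Spec A) (Spec R) (Spec_map R A ph)" by (rule M(1)) (simp_all add: Spec_map_def)
 assume q': "primeideal q A" and r: "r : carrier R"
 then have qA: "q : points (Spec A)" using A.spec_points by blast
 show "smap (Spec A) (Spec_map R A ph) q (spec_germ R (?p q) r) = spec_germ A q (ph r)"
  by (subst M(2)[OF _ _ _ qA ring_hom_closed[OF is_locD(4)[OF R.spec_is_loc[OF q(2)[OF qA]]] r]])
   (simp_all add: hs[OF qA r] Spec_map_def)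
qed

lemma pt_Spec_map[simp]: "pt (Spec_map R A ph) q = {r : carrier R. ph r : q}"
 by (simp add: Spec_map_def)

lemma Spec_map_comp:
 assumes R: "cring R" and A: "cring A" and B: "cring B" and ph: "ph : ring_hom R A" and ci: "ci : ring_hom A B"
  and py: "!!r. r : carrier R ==> py r = ci (ph r)"
 shows "meq (Spec B) (Spec R) (cmp (Spec A) (Spec_map R A ph) (Spec_map A B ci)) (Spec_map R B py)"
proof -
 interpret R: spec_ring R by (rule spec_ring.intro, rule R)
 interpret A: spec_ring A by (rule spec_ring.intro, rule A)
 interpret B: spec_ring B by (rule spec_ring.intro, rule B)
 have pyh: "py : ring_hom R B"
  using ring_hom_trans[OF ph ci] py R.R.ring_simprules unfolding ring_hom_def by (auto simp: Pi_iff)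
 note C = comp_morphism[OF B.spec_lrs A.spec_lrs R.spec_lrs Spec_map_morphism(1)[OF A B ci] Spec_map_morphism(1)[OF R A ph]]
 show ?thesis
 proof (rule R.morph_into_spec_eqI[OF B.spec_lrs C(1) Spec_map_morphism(1)[OF R B pyh]])
  fix q r assume q: "q : points (Spec B)" and r: "r : carrier R"
  have q': "primeideal q B" using q B.spec_points by blast
  let ?q = "{a : carrier A. ci a : q}"
  have qA: "primeideal ?q A" using primeideal_vimage[OF ci A B q'] .
  have pe: "{r : carrier R. ph r : ?q} = {r : carrier R. py r : q}" using py ring_hom_closed[OF ph] by auto
  have "primeideal {r : carrier R. ph r : ?q} R" using primeideal_vimage[OF ph R A qA] .
  then have g: "spec_germ R {r : carrier R. ph r : ?q} r : carrier (stalk (Spec R) {r : carrier R. ph r : ?q})"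
   using ring_hom_closed[OF is_locD(4)[OF R.spec_is_loc] r] by blast
  have "smap (Spec B) (cmp (Spec A) (Spec_map R A ph) (Spec_map A B ci)) q (spec_germ R {r : carrier R. ph r : ?q} r)
   = spec_germ B q (ci (ph r))"
   using C(2)[OF q, of "spec_germ R {r : carrier R. ph r : ?q} r"] g Spec_map_morphism(2)[OF R A ph qA r]
    Spec_map_morphism(2)[OF A B ci q' ring_hom_closed[OF ph r]] by simp
  then show "smap (Spec B) (cmp (Spec A) (Spec_map R A ph) (Spec_map A B ci)) q
     (spec_germ R (pt (cmp (Spec A) (Spec_map R A ph) (Spec_map A B ci)) q) r) =
    smap (Spec B) (Spec_map R B py) q (spec_germ R (pt (Spec_map R B py) q) r)"
   using Spec_map_morphism(2)[OF R B pyh q' r] py[OF r] by simp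
 qed
qed

lemma pt_morph_id[simp]: "pt morph_id x = x"
 by (simp add: morph_id_def)

lemma Spec_map_id:
 assumes R: "cring R" and ph: "!!r. r : carrier R ==> ph r = r"
 shows "meq (Spec R) (Spec R) (Spec_map R R ph) morph_id"
proof -
 interpret R: spec_ring R by (rule spec_ring.intro, rule R)
 have h: "ph : ring_hom R R" using ph R.R.ring_simprules by (auto simp: ring_hom_def)
 note I = id_morphism[OF R.spec_lrs]
 show ?thesis
 proof (rule R.morph_into_spec_eqI[OF R.spec_lrs Spec_map_morphism(1)[OF R R h] I(1)])
  fix q r assume q: "q : points (Spec R)" and r: "r : carrier R"
  have q': "primeideal q R" using q R.spec_points by blast
  have g: "spec_germ R q r : Stk (Spec R) q"
   using ring_hom_closed[OF is_locD(4)[OF R.spec_is_loc[OF q']] r] .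
  have "{r : carrier R. ph r : q} = q" using ph ideal.Icarr[OF primeideal.axioms(1)[OF q']] by auto
  then show "smap (Spec R) (Spec_map R R ph) q (spec_germ R (pt (Spec_map R R ph) q) r) =
    smap (Spec R) morph_id q (spec_germ R (pt morph_id q) r)"
   using Spec_map_morphism(2)[OF R R h q' r] ph[OF r] I(2)[OF q g] by simp
 qed
qed

subsection \<open>Residue fields\<close>

context lringed begin

abbreviation "ka x == residue_field X x"
definition "resid x = (+>\<^bsub>stalk X x\<^esub>) (Mst X x)"

lemma resid_field: "x : points X ==> field (ka x)"
 unfolding residue_field_def
 using maximalideal.quotient_is_field[OF local_ringD(2)[OF stalk_local] stalk_cring] .

lemma resid_hom: "x : points X ==> resid x : ring_hom (stalk X x) (ka x)"
 unfolding residue_field_def resid_def using ideal.rcos_ring_hom[OF max_ideal_ideal[OF stalk_local]] .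

lemma resid_cring: "x : points X ==> cring (ka x)"
 using resid_field field.axioms(1) domain.axioms(1) by blast

lemma resid_surj:
 assumes "c : carrier (ka x)" obtains a where "a : Stk X x" "c = resid x a"
 using assms unfolding residue_field_def resid_def FactRing_def by (auto simp: A_RCOSETS_def')

lemma resid_zero_iff:
 assumes x: "x : points X" and a: "a : Stk X x"
 shows "resid x a = 0[ka x] \<longleftrightarrow> a : Mst X x"
proof -
 interpret I: ideal "Mst X x" "stalk X x" using max_ideal_ideal[OF stalk_local[OF x]] .
 show ?thesis unfolding resid_def residue_field_def FactRing_def
  using I.rcos_const_imp_mem[OF a] I.a_rcos_const by auto
qed

end

context lmorph begin

text \<open>\<open>residue_map\<close> acts on a coset as a set, giving n + f(m + a). Locality puts
  f(m) into n, so this is the coset of f(a).\<close>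

lemma residue_map_resid:
 assumes x: "x : points X" and a: "a : Stk Y (pt h x)"
 shows "residue_map X Y h x (Y.resid (pt h x) a) = X.resid x (smap X h x a)"
proof -
 let ?A = "stalk Y (pt h x)" and ?B = "stalk X x" and ?f = "smap X h x"
 let ?m = "max_ideal ?A" and ?n = "max_ideal ?B"
 have y: "pt h x : points Y" using pt_closed[OF x] .
 note f = hom_simps[OF stalk_map_hom[OF x] Y.stalk_cring[OF y] X.stalk_cring[OF x]]
 interpret m: ideal ?m ?A using max_ideal_ideal[OF Y.stalk_local[OF y]] .
 interpret n: ideal ?n ?B using max_ideal_ideal[OF X.stalk_local[OF x]] .
 have "{u +[?B] ?f (v +[?A] a) | u v. u : ?n & v : ?m} = {u +[?B] ?f a | u. u : ?n}"
 proof (intro equalityI subsetI)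
  fix c assume "c : {u +[?B] ?f (v +[?A] a) | u v. u : ?n & v : ?m}"
  then obtain u v where uv: "c = u +[?B] ?f (v +[?A] a)" "u : ?n" "v : ?m" by blast
  have "?f v : ?n" using stalk_map_local[OF x] uv(3) by blast
  moreover have "c = (u +[?B] ?f v) +[?B] ?f a"
   using uv a m.Icarr n.Icarr f by (simp add: n.a_assoc)
  ultimately show "c : {u +[?B] ?f a | u. u : ?n}" using additive_subgroup.a_closed[OF n.additive_subgroup_axioms uv(2)] by blast
 next
  fix c assume "c : {u +[?B] ?f a | u. u : ?n}"
  then obtain u where u: "c = u +[?B] ?f a" "u : ?n" by blast
  have "0[?A] +[?A] a = a" using a by simp
  then show "c : {u +[?B] ?f (v +[?A] a) | u v. u : ?n & v : ?m}" using u m.zero_closed by (intro CollectI exI[of _ u] exI[of _ "0[?A]"]) simp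
 qed
 moreover have "residue_map X Y h x (Y.resid (pt h x) a) = {u +[?B] ?f (v +[?A] a) | u v. u : ?n & v : ?m}"
  unfolding residue_map_def Y.resid_def set_add_def' a_r_coset_def' by blast
 moreover have "X.resid x (?f a) = {u +[?B] ?f a | u. u : ?n}"
  unfolding X.resid_def a_r_coset_def' by blast
 ultimately show ?thesis by simp
qed

lemma residue_map_hom:
 assumes x: "x : points X"
 shows "residue_map X Y h x : ring_hom (residue_field Y (pt h x)) (residue_field X x)"
proof -
 have y: "pt h x : points Y" using pt_closed[OF x] .
 interpret A: cring "stalk Y (pt h x)" by (rule Y.stalk_cring[OF y])
 note f = hom_simps[OF stalk_map_hom[OF x] Y.stalk_cring[OF y] X.stalk_cring[OF x]]
 note ry = hom_simps[OF Y.resid_hom[OF y] Y.stalk_cring[OF y] Y.resid_cring[OF y]]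
 note rx = hom_simps[OF X.resid_hom[OF x] X.stalk_cring[OF x] X.resid_cring[OF x]]
 note rm = residue_map_resid[OF x]
 show ?thesis
 proof (rule ring_hom_memI)
  fix c d assume "c : carrier (residue_field Y (pt h x))" "d : carrier (residue_field Y (pt h x))"
  then obtain a b where ab: "a : Stk Y (pt h x)" "c = Y.resid (pt h x) a"
   "b : Stk Y (pt h x)" "d = Y.resid (pt h x) b" by (metis Y.resid_surj)
  show "residue_map X Y h x c : carrier (residue_field X x)" using ab rm f rx by simp
  show "residue_map X Y h x (c *[residue_field Y (pt h x)] d) = residue_map X Y h x c *[residue_field X x] residue_map X Y h x d"
   using ab rm f rx(2) by (simp flip: ry(2))
  show "residue_map X Y h x (c +[residue_field Y (pt h x)] d) = residue_map X Y h x c +[residue_field X x] residue_map X Y h x d"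
   using ab rm f rx(3) by (simp flip: ry(3))
 next
  show "residue_map X Y h x 1[residue_field Y (pt h x)] = 1[residue_field X x]"
   using rm[OF A.one_closed] ry(4) rx(4) f(4) by simp
 qed
qed

end

lemma field_spec_point:
 assumes "field K" shows "points (Spec K) = {{0[K]}}"
proof -
 interpret field K by fact
 interpret spec_ring K by (rule spec_ring.intro, rule is_cring)
 show ?thesis unfolding spec_points using field_prime_iff[OF assms] by auto
qed

context lringed begin

lemma point_map_morphism:
 assumes x: "x : points X"
 shows "mor (Spec (ka x)) X (point_map X x)"
  "a : Stk X x ==>
   smap (Spec (ka x)) (point_map X x) {0[ka x]} a = spec_germ (ka x) {0[ka x]} (resid x a)"
proof -
 interpret K: spec_ring "ka x" by (rule spec_ring.intro, rule resid_cring[OF x])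
 let ?h = "point_map X x" and ?K = "ka x" and ?S = "Spec (ka x)" and ?z0 = "{0[ka x]}"
 have pts: "points ?S = {?z0}" using field_spec_point[OF resid_field[OF x]] .
 have pr: "primeideal ?z0 ?K" using pts K.spec_points by blast
 note L = K.spec_is_loc[OF pr]
 interpret S: lringed ?S by unfold_locales (rule K.spec_lrs)
 have [simp]: "pt ?h = (%_. x)" by (simp add: point_map_def)
 have pre: "preim ?S ?h V = (if x : V then points ?S else {})" for V by (auto simp: preim_def)
 have cont: "continuous_map (space_top ?S) (space_top X) (pt ?h)" using x by simp
 have hom: "spec_germ ?K ?z0 o resid x : ring_hom (stalk X x) (stalk ?S ?z0)"
  by (rule ring_hom_trans[OF resid_hom[OF x] is_locD(4)[OF L]])
 have loc: "(spec_germ ?K ?z0 o resid x) a : Mst ?S ?z0" if "a : Mst X x" for a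
 proof -
  have "a : Stk X x" using that max_ideal_subset[OF stalk_local[OF x]] by blast
  then have "resid x a = 0[?K]" using resid_zero_iff[OF x] that by blast
  then show ?thesis using is_loc_local(2)[OF L, of "0[?K]"] by simp
 qed
 have rc: "resid x (germ X x V s) : carrier ?K" if "opn V" "x : V" "s : Sec V" for V s
  using ring_hom_closed[OF resid_hom[OF x] germ_closed[OF that]] .
 have comx: "com ?h V s = (\<lambda>p\<in>points ?S. loc_frac ?K p (resid x (germ X x V s)) 1[?K])" if "x : V" for V s
  using that by (simp add: point_map_def resid_def)
 have com: "com ?h V s : Scs ?S (preim ?S ?h V)" if V: "opn V" "s : Sec V" for V s
 proof (cases "x : V")
  case True
  then show ?thesis unfolding pre comx[OF True] using K.spec_hat[OF rc[OF V(1) True V(2)]] by simp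
 next
  \<comment> \<open>The preimage of V is empty, and \<open>com\<close> has to be a section over the
    empty set.\<close>
  case False
  have "com ?h V s : extensional {}" unfolding point_map_def using False by (auto simp: extensional_def)
  then show ?thesis unfolding pre using False K.S.secI[of _ "{}", unfolded K.Z_eq] by simp
 qed
 have germ: "germ ?S p (preim ?S ?h V) (com ?h V s) = (spec_germ ?K ?z0 o resid x) (germ X (pt ?h p) V s)"
  if V: "opn V" "s : Sec V" "p : points ?S" "pt ?h p : V" for V s p
  using V pts by (simp add: pre comx spec_germ_def)
 note M = is_morphismI[OF K.spec_lrs lrs cont, of "%_. spec_germ ?K ?z0 o resid x", OF _ _ com germ]
 show "mor ?S X ?h" by (rule M(1)) (use hom loc pts in auto)
 show "smap ?S ?h ?z0 a = spec_germ ?K ?z0 (resid x a)" if "a : Stk X x"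
  by (subst M(2)) (use hom loc pts that in auto)
qed

end

lemma pt_point_map[simp]: "pt (point_map X x) p = x"
 by (simp add: point_map_def)

text \<open>Both composites send a germ a at the image of x to the residue class, at x, of the
  pullback of a.\<close>

lemma (in lmorph) point_map_square:
 assumes x: "x : points X"
 shows "meq (Spec (residue_field X x)) Y (cmp X h (point_map X x))
  (cmp (Spec (residue_field Y (pt h x))) (point_map Y (pt h x))
    (Spec_map (residue_field Y (pt h x)) (residue_field X x) (residue_map X Y h x)))"
proof -
 let ?K = "residue_field X x" and ?k = "residue_field Y (pt h x)" and ?ph = "residue_map X Y h x"
 have y: "pt h x : points Y" using pt_closed[OF x] .
 interpret K: spec_ring ?K by (rule spec_ring.intro, rule X.resid_cring[OF x])
 interpret k: spec_ring ?k by (rule spec_ring.intro, rule Y.resid_cring[OF y])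
 have pts: "points (Spec ?K) = {{0[?K]}}" "points (Spec ?k) = {{0[?k]}}"
  using field_spec_point X.resid_field[OF x] Y.resid_field[OF y] by blast+
 note M = Spec_map_morphism[OF k.R K.R residue_map_hom[OF x]]
 have pr: "primeideal {0[?K]} ?K" using pts K.spec_points by blast
 have v: "{r : carrier ?k. ?ph r : {0[?K]}} = {0[?k]}"
  by (rule field_prime_iff[OF Y.resid_field[OF y], THEN iffD1, OF primeideal_vimage[OF residue_map_hom[OF x] k.R K.R pr]])
 note C1 = comp_morphism[OF K.spec_lrs X.lrs Y.lrs X.point_map_morphism(1)[OF x] morph]
 note C2 = comp_morphism[OF K.spec_lrs k.spec_lrs Y.lrs M(1) Y.point_map_morphism(1)[OF y]]
 show ?thesis
 proof (rule morph_eqI[OF K.spec_lrs Y.lrs C1(1) C2(1)])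
  fix p a assume p: "p : points (Spec ?K)" and "a : carrier (stalk Y (pt (cmp X h (point_map X x)) p))"
  then have a: "a : Stk Y (pt h x)" by simp
  have p0: "p = {0[?K]}" using p pts by simp
  have "smap (Spec ?K) (cmp X h (point_map X x)) p a = spec_germ ?K p (X.resid x (smap X h x a))"
   using C1(2)[OF p, of a] a X.point_map_morphism(2)[OF x stalk_map_closed[OF x a]] p0 by simp
  moreover have "smap (Spec ?K) (cmp (Spec ?k) (point_map Y (pt h x)) (Spec_map ?k ?K ?ph)) p a =
    spec_germ ?K p (?ph (Y.resid (pt h x) a))"
   using C2(2)[OF p, of a] a Y.point_map_morphism(2)[OF y a] M(2)[OF pr ring_hom_closed[OF Y.resid_hom[OF y] a]] p0 v by simp
  ultimately show "smap (Spec ?K) (cmp X h (point_map X x)) p a =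
    smap (Spec ?K) (cmp (Spec ?k) (point_map Y (pt h x)) (Spec_map ?k ?K ?ph)) p a"
   using residue_map_resid[OF x a] by simp
 qed simp
qed

section \<open>Tensors of germs and their behaviour at neighbouring pairs of points\<close>

locale fp_pair = f: lmorph X S f + g: lmorph Y S g
 for X :: "('x, 'a) rspace" and Y :: "('y, 'b) rspace" and S :: "('s, 'o) rspace"
  and f :: "('x, 'a, 's, 'o) morph" and g :: "('y, 'b, 's, 'o) morph"
begin

abbreviation "PT == fp_points X f S Y g"
abbreviation "FR == fp_ring X f S Y g"
abbreviation "FC == fp_class X f S Y g"
abbreviation "FG == fp_germ X f S Y g"
abbreviation "FS == fp_sums X Y"
text \<open>The list of germs before passing to its class \<open>FG\<close>. Equality of two such
  lists is a statement on finitely many germs and so persists nearby, which cannot be seen on the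
  classes.\<close>

definition "G U V l x y = map (map_prod (germ X x U) (germ Y y V)) l"
definition "rel x y \<longleftrightarrow> x : points X & y : points Y & pt f x = pt g y"

lemma TR: "rel x y ==> tensor_rings (stalk S (pt f x)) (stalk X x) (stalk Y y) (smap X f x) (smap Y g y)"
 unfolding rel_def tensor_rings_def
 using f.stalk_map_hom[of x] g.stalk_map_hom[of y] f.X.stalk_cring[of x] g.X.stalk_cring[of y] f.Y.stalk_cring[of "pt f x"] f.pt_closed[of x]
 by simp

lemma FR_eq: "FR x y = tensor (stalk S (pt f x)) (alg (smap X f x) (stalk X x)) (alg (smap Y g y) (stalk Y y))"
 and FC_eq: "FC x y = tensor_class (stalk S (pt f x)) (alg (smap X f x) (stalk X x)) (alg (smap Y g y) (stalk Y y))"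
 by (simp_all add: fp_ring_def fp_class_def fun_eq_iff)

lemma FG_eq: "FG U V l x y = FC x y (G U V l x y)"
 by (simp add: fp_germ_def G_def)

lemma PT_rel: "(x, y, p) : PT ==> rel x y" and PT_prime: "(x, y, p) : PT ==> primeideal p (FR x y)"
 by (auto simp: fp_points_def rel_def)

lemma FR_cring: "rel x y ==> cring (FR x y)"
 unfolding FR_eq by (rule tensor_rings.cT, rule TR)

lemma FS_iff: "l : FS U V \<longleftrightarrow> set l <= f.X.Sec U \<times> g.X.Sec V" by (simp add: fp_sums_def)

lemma G_closed:
 "f.X.opn U ==> g.X.opn V ==> x : U ==> y : V ==> l : FS U V ==>
  set (G U V l x y) <= Stk X x \<times> Stk Y y"
 unfolding G_def FS_iff by (auto dest!: subsetD intro: f.X.germ_closed g.X.germ_closed)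

definition "rs U V U' V' = map (map_prod (res X U U') (res Y V V'))"

lemma rs:
 assumes "f.X.opn U" "g.X.opn V" "f.X.opn U'" "g.X.opn V'" "U' <= U" "V' <= V" "l : FS U V"
 shows "rs U V U' V' l : FS U' V'"
  "x : U' ==> y : V' ==> G U' V' (rs U V U' V' l) x y = G U V l x y"
proof -
 have p: "s : f.X.Sec U" "t : g.X.Sec V" if "(s, t) : set l" for s t
  using assms(7) that unfolding FS_iff by blast+
 show "rs U V U' V' l : FS U' V'" unfolding rs_def FS_iff
  using f.X.res_closed[OF assms(1,3,5)] g.X.res_closed[OF assms(2,4,6)] p by auto
 show "x : U' ==> y : V' ==> G U' V' (rs U V U' V' l) x y = G U V l x y"
  unfolding rs_def G_def
  using f.X.germ_res[OF assms(1,3,5)] g.X.germ_res[OF assms(2,4,6)] p by auto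
qed

definition "nb x y U V \<longleftrightarrow> f.X.opn U & g.X.opn V & x : U & y : V"

lemma nb_Int: "nb x y U V ==> nb x y U' V' ==> nb x y (U Int U') (V Int V')"
 by (auto simp: nb_def)

text \<open>Finitely many germs have representatives on one common pair of neighbourhoods.\<close>

lemma lift_exists:
 assumes "x : points X" "y : points Y" "set u <= Stk X x \<times> Stk Y y"
 obtains U V l where "nb x y U V" "l : FS U V" "G U V l x y = u"
proof -
 have "EX U V l. nb x y U V & l : FS U V & G U V l x y = u"
  using assms(3)
 proof (induction u)
  case Nil
  show ?case using assms by (intro exI[of _ "points X"] exI[of _ "points Y"] exI[of _ "[]"]) (simp add: nb_def FS_iff G_def)
 next
  case (Cons c u)
  then obtain U V l where l: "nb x y U V" "l : FS U V" "G U V l x y = u" by auto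
  obtain a b where c: "c = (a, b)" "a : Stk X x" "b : Stk Y y" using Cons.prems by (cases c) auto
  obtain U1 s where s: "f.X.opn U1" "x : U1" "s : f.X.Sec U1" "a = germ X x U1 s" by (rule f.X.stalk_cases[OF c(2)])
  obtain V1 t where t: "g.X.opn V1" "y : V1" "t : g.X.Sec V1" "b = germ Y y V1 t" by (rule g.X.stalk_cases[OF c(3)])
  let ?U = "U Int U1" and ?V = "V Int V1"
  have n: "nb x y U1 V1" using s t by (simp add: nb_def)
  note n' = nb_Int[OF l(1) n]
  note n = l(1)[unfolded nb_def] n[unfolded nb_def] n'[unfolded nb_def]
  have 1: "rs U V ?U ?V l : FS ?U ?V" "G ?U ?V (rs U V ?U ?V l) x y = u"
   using rs[of U V ?U ?V l] n l by auto
  have 2: "rs U1 V1 ?U ?V [(s, t)] : FS ?U ?V" "G ?U ?V (rs U1 V1 ?U ?V [(s, t)]) x y = [c]"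
   using rs[of U1 V1 ?U ?V "[(s, t)]"] n s t c by (auto simp: FS_iff G_def)
  show ?case using 1 2 n' by (intro exI[of _ ?U] exI[of _ ?V] exI[of _ "rs U1 V1 ?U ?V [(s, t)] @ rs U V ?U ?V l"])
   (auto simp: FS_iff G_def)
 qed
 then show ?thesis using that by blast
qed

text \<open>The lists agree entry by entry, and each of the finitely many equalities of germs holds
  on a neighbourhood.\<close>

lemma lift_unique:
 assumes "nb x y U V" "l : FS U V" "m : FS U V" "G U V l x y = G U V m x y"
 obtains U' V' where "nb x y U' V'" "U' <= U" "V' <= V" "!!x' y'. x' : U' ==> y' : V' ==> G U V l x' y' = G U V m x' y'"
proof -
 have "EX U' V'. nb x y U' V' & U' <= U & V' <= V & (ALL x':U'. ALL y':V'. G U V l x' y' = G U V m x' y')"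
  using assms(2-4)
 proof (induction l arbitrary: m)
  case Nil
  then show ?case using assms(1) by (intro exI[of _ U] exI[of _ V]) (simp add: G_def)
 next
  case (Cons c l)
  obtain d m' where m: "m = d # m'" using Cons.prems(3) by (cases m) (auto simp: G_def)
  obtain U1 V1 where 1: "nb x y U1 V1" "U1 <= U" "V1 <= V" "ALL x':U1. ALL y':V1. G U V l x' y' = G U V m' x' y'"
   using Cons.IH[of m'] Cons.prems m by (auto simp: G_def FS_iff)
  have cd: "fst c : f.X.Sec U" "snd c : g.X.Sec V" "fst d : f.X.Sec U" "snd d : g.X.Sec V"
   "germ X x U (fst c) = germ X x U (fst d)" "germ Y y V (snd c) = germ Y y V (snd d)"
   using Cons.prems m by (auto simp: G_def FS_iff)
  note n = assms(1)[unfolded nb_def]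
  obtain U2 where U2: "f.X.opn U2" "x : U2" "U2 <= U" "res X U U2 (fst c) = res X U U2 (fst d)"
   using f.X.germ_eq_iff[of U x "fst c" U "fst d"] cd n by auto
  obtain V2 where V2: "g.X.opn V2" "y : V2" "V2 <= V" "res Y V V2 (snd c) = res Y V V2 (snd d)"
   using g.X.germ_eq_iff[of V y "snd c" V "snd d"] cd n by auto
  have "germ X x' U (fst c) = germ X x' U (fst d)" if "x' : U2" for x'
   using f.X.germ_res[of U U2 x' "fst c"] f.X.germ_res[of U U2 x' "fst d"] U2 cd n that by simp
  moreover have "germ Y y' V (snd c) = germ Y y' V (snd d)" if "y' : V2" for y'
   using g.X.germ_res[of V V2 y' "snd c"] g.X.germ_res[of V V2 y' "snd d"] V2 cd n that by simp
  moreover have "nb x y U2 V2" using U2 V2 by (simp add: nb_def)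
  ultimately show ?case using 1 nb_Int[OF 1(1), of U2 V2] U2(3) V2(3) unfolding m
   by (intro exI[of _ "U1 Int U2"] exI[of _ "V1 Int V2"]) (auto simp: G_def map_prod_def split_beta)
 qed
 then show ?thesis using that by blast
qed

text \<open>The equality of two tensors at one pair of points spreads out to a neighbourhood, since its
 derivation involves finitely many germs.\<close>
definition "spread x y u v \<longleftrightarrow> (EX U V l m. nb x y U V & l : FS U V & m : FS U V & G U V l x y = u & G U V m x y = v &
 (ALL x':U. ALL y':V. rel x' y' --> FG U V l x' y' = FG U V m x' y'))"

lemma spreadI: "nb x y U V ==> l : FS U V ==> m : FS U V ==> G U V l x y = u ==> G U V m x y = v ==>
 (!!x' y'. x' : U ==> y' : V ==> rel x' y' ==> FG U V l x' y' = FG U V m x' y') ==> spread x y u v"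
 unfolding spread_def by blast

lemma spread_restrict:
 assumes "nb x y U V" "l : FS U V" "m : FS U V" "nb x y U' V'" "U' <= U" "V' <= V"
  and "!!x' y'. x' : U' ==> y' : V' ==> rel x' y' ==> FG U V l x' y' = FG U V m x' y'"
 shows "spread x y (G U V l x y) (G U V m x y)"
 using assms rs[of U V U' V' l] rs[of U V U' V' m] unfolding nb_def FG_eq
 by (intro spreadI[of x y U' V' "rs U V U' V' l" "rs U V U' V' m"]) (auto simp: nb_def FG_eq)

lemma spread_meet:
 assumes "spread x y u u'" "spread x y v v'"
 obtains U V l m n k where "nb x y U V" "{l, m, n, k} <= FS U V"
  "G U V l x y = u" "G U V m x y = u'" "G U V n x y = v" "G U V k x y = v'"
  "ALL x':U. ALL y':V. rel x' y' --> FG U V l x' y' = FG U V m x' y' & FG U V n x' y' = FG U V k x' y'"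
proof -
 obtain U V l m where 1: "nb x y U V" "l : FS U V" "m : FS U V" "G U V l x y = u" "G U V m x y = u'"
  "ALL x':U. ALL y':V. rel x' y' --> FG U V l x' y' = FG U V m x' y'" using assms(1) unfolding spread_def by blast
 obtain U1 V1 n k where 2: "nb x y U1 V1" "n : FS U1 V1" "k : FS U1 V1" "G U1 V1 n x y = v" "G U1 V1 k x y = v'"
  "ALL x':U1. ALL y':V1. rel x' y' --> FG U1 V1 n x' y' = FG U1 V1 k x' y'" using assms(2) unfolding spread_def by blast
 let ?U = "U Int U1" and ?V = "V Int V1"
 have N: "nb x y ?U ?V" using nb_Int[OF 1(1) 2(1)] .
 note o = N[unfolded nb_def] 1(1)[unfolded nb_def] 2(1)[unfolded nb_def]
 note r1 = rs[of U V ?U ?V, OF _ _ _ _ Int_lower1 Int_lower1] and r2 = rs[of U1 V1 ?U ?V, OF _ _ _ _ Int_lower2 Int_lower2]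
 have R: "rs U V ?U ?V l : FS ?U ?V" "rs U V ?U ?V m : FS ?U ?V" "rs U1 V1 ?U ?V n : FS ?U ?V" "rs U1 V1 ?U ?V k : FS ?U ?V"
  using o by (blast intro: r1(1) r2(1) 1(2,3) 2(2,3))+
 have E: "G ?U ?V (rs U V ?U ?V l) x' y' = G U V l x' y'" "G ?U ?V (rs U V ?U ?V m) x' y' = G U V m x' y'"
  "G ?U ?V (rs U1 V1 ?U ?V n) x' y' = G U1 V1 n x' y'" "G ?U ?V (rs U1 V1 ?U ?V k) x' y' = G U1 V1 k x' y'"
  if "x' : ?U" "y' : ?V" for x' y'
  using r1(2)[OF _ _ _ _ 1(2) that] r1(2)[OF _ _ _ _ 1(3) that] r2(2)[OF _ _ _ _ 2(2) that] r2(2)[OF _ _ _ _ 2(3) that] o by blast+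
 show ?thesis
  by (rule that[OF N, of "rs U V ?U ?V l" "rs U V ?U ?V m" "rs U1 V1 ?U ?V n" "rs U1 V1 ?U ?V k"])
   (use R E[of x y] E 1(4-6) 2(4-6) o in \<open>simp_all add: FG_eq\<close>)
qed

text \<open>The two hypotheses lift the middle list \<open>v\<close> by different sections. Their
  germs agree at (x, y), hence nearby by \<open>lift_unique\<close>, and there the two equalities
  can be chained.\<close>

lemma spread_trans:
 assumes "spread x y u v" "spread x y v w" shows "spread x y u w"
proof -
 obtain U V l m n k where 1: "nb x y U V" "{l, m, n, k} <= FS U V"
  "G U V l x y = u" "G U V m x y = v" "G U V n x y = v" "G U V k x y = w"
  "ALL x':U. ALL y':V. rel x' y' --> FG U V l x' y' = FG U V m x' y' & FG U V n x' y' = FG U V k x' y'"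
  by (rule spread_meet[OF assms]) (rule that)
 have F: "l : FS U V" "m : FS U V" "n : FS U V" "k : FS U V" using 1(2) by auto
 obtain U' V' where 3: "nb x y U' V'" "U' <= U" "V' <= V"
  "!!x' y'. x' : U' ==> y' : V' ==> G U V m x' y' = G U V n x' y'"
  using lift_unique[OF 1(1) F(2,3)] 1(4,5) by metis
 have "spread x y (G U V l x y) (G U V k x y)"
 proof (rule spread_restrict[OF 1(1) F(1,4) 3(1-3)])
  fix x' y' assume x': "x' : U'" "y' : V'" "rel x' y'"
  show "FG U V l x' y' = FG U V k x' y'"
   using 1(7)[rule_format, OF subsetD[OF 3(2) x'(1)] subsetD[OF 3(3) x'(2)] x'(3)] 3(4)[OF x'(1,2)] unfolding FG_eq by simp
 qed
 then show ?thesis using 1(3,6) by simp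
qed

text \<open>Induction on the derivation: each rule is realised by sections near (x, y), and the same
  rule then applies at every nearby pair of points over one point of S.\<close>

lemma tensor_eq_spread:
 assumes xy: "rel x y"
  and "tensor_eq (stalk S (pt f x)) (alg (smap X f x) (stalk X x)) (alg (smap Y g y) (stalk Y y)) u v"
 shows "spread x y u v"
 using assms(2)
proof (induction rule: tensor_eq.induct)
 note P = xy[unfolded rel_def]
 {
  case (refl u)
  then show ?case
   using lift_exists[of x y u] P by (metis alg_simps(1) spreadI)
 next
  case (sym u v)
  then show ?case unfolding spread_def by metis
 next
  case (trans u v w)
  then show ?case using spread_trans by blast
 next
  case (append u u' v v')
  obtain U V l m n k where 1: "nb x y U V" "{l, m, n, k} <= FS U V"
   "G U V l x y = u" "G U V m x y = u'" "G U V n x y = v" "G U V k x y = v'"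
   "ALL x':U. ALL y':V. rel x' y' --> FG U V l x' y' = FG U V m x' y' & FG U V n x' y' = FG U V k x' y'"
   by (rule spread_meet[OF append.IH]) (rule that)
  have Ga: "G U V (k @ k') x y = G U V k x y @ G U V k' x y" for k k' x y by (simp add: G_def)
  show ?case
  proof (rule spreadI[OF 1(1), of "l @ n" "m @ k"])
   fix x' y' assume x': "x' : U" "y' : V" "rel x' y'"
   interpret T: tensor_rings "stalk S (pt f x')" "stalk X x'" "stalk Y y'" "smap X f x'" "smap Y g y'" by (rule TR[OF x'(3)])
   have cl: "set (G U V k x' y') <= Stk X x' \<times> Stk Y y'" if "k : FS U V" for k
    using G_closed[OF _ _ _ _ that] 1(1) x' by (auto simp: nb_def)
   show "FG U V (l @ n) x' y' = FG U V (m @ k) x' y'"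
    using 1(2,7) x' cl[of l] cl[of m] cl[of n] cl[of k] unfolding FG_eq FC_eq Ga by (simp flip: T.T_add)
  qed (use 1(2-6) in \<open>auto simp: FS_iff Ga\<close>)
 next
  case (comm u v)
  have "set (u @ v) <= Stk X x \<times> Stk Y y" using comm by simp
  then obtain U V l where l: "nb x y U V" "l : FS U V" "G U V l x y = u @ v" using lift_exists P by metis
  let ?a = "take (length u) l" and ?b = "drop (length u) l"
  have sp: "l = ?a @ ?b" by simp
  have m: "?b @ ?a : FS U V" using l(2) set_take_subset[of "length u" l] set_drop_subset[of "length u" l] unfolding FS_iff by auto
  have "G U V ?a x y = take (length u) (u @ v)" "G U V ?b x y = drop (length u) (u @ v)"
   unfolding l(3)[symmetric] G_def by (simp_all add: take_map drop_map)
  then have e: "G U V (?b @ ?a) x y = v @ u" by (simp add: G_def)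
  show ?case
  proof (rule spreadI[OF l(1,2) m l(3) e])
   fix x' y' assume x': "x' : U" "y' : V" "rel x' y'"
   interpret T: tensor_rings "stalk S (pt f x')" "stalk X x'" "stalk Y y'" "smap X f x'" "smap Y g y'" by (rule TR[OF x'(3)])
   have "T.TE (G U V l x' y') (G U V (?b @ ?a) x' y')"
   proof (rule T.TE_mset)
    show "mset (G U V l x' y') = mset (G U V (?b @ ?a) x' y')"
     unfolding G_def by (subst sp) (simp only: map_append mset_append add.commute)
   qed (use G_closed[of U V x' y' l] l x' in \<open>auto simp: nb_def\<close>)
   then show "FG U V l x' y' = FG U V (?b @ ?a) x' y'" unfolding FG_eq FC_eq
    using T.cls_eq_iff[of "G U V l x' y'"] T.TE_V by blast
  qed
 next
  case (zero n)
  have z: "0[stalk X x] : Stk X x" using f.X.stalk_cring P by (simp add: cring.cring_simprules)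
  have "n : Stk Y y" using zero by simp
  then obtain V t where t: "g.X.opn V" "y : V" "t : g.X.Sec V" "n = germ Y y V t" by (rule g.X.stalk_cases)
  have U: "f.X.opn (points X)" by simp
  note zs = cring.cring_simprules(2)[OF f.X.sec_cring[OF U]]
  show ?case
  proof (rule spreadI[of x y "points X" V "[(0[sec X (points X)], t)]" "[]"])
   fix x' y' assume x': "x' : points X" "y' : V" "rel x' y'"
   interpret T: tensor_rings "stalk S (pt f x')" "stalk X x'" "stalk Y y'" "smap X f x'" "smap Y g y'" by (rule TR[OF x'(3)])
   show "FG (points X) V [(0[sec X (points X)], t)] x' y' = FG (points X) V [] x' y'"
    unfolding FG_eq FC_eq G_def using T.pure_zero_left[OF g.X.germ_closed[OF t(1) x'(2) t(3)]] f.X.germ_const(2)[OF U x'(1)] T.T_zero by simp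
  qed (use t P zs f.X.germ_const(2)[OF U] in \<open>auto simp: nb_def FS_iff G_def\<close>)
 next
  case (add_left m m' n)
  then have c: "m : Stk X x" "m' : Stk X x" "n : Stk Y y" by simp_all
  obtain U s s' s'' where s: "f.X.opn U" "x : U" "s : f.X.Sec U" "s' : f.X.Sec U" "m = germ X x U s" "m' = germ X x U s'"
   by (rule f.X.stalk_common[OF c(1,2,1)])
  obtain V t where t: "g.X.opn V" "y : V" "t : g.X.Sec V" "n = germ Y y V t" by (rule g.X.stalk_cases[OF c(3)])
  interpret U: cring "sec X U" by (rule f.X.sec_cring[OF s(1)])
  show ?case
  proof (rule spreadI[of x y U V "[(s +[sec X U] s', t)]" "[(s, t), (s', t)]"])
   fix x' y' assume x': "x' : U" "y' : V" "rel x' y'"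
   interpret T: tensor_rings "stalk S (pt f x')" "stalk X x'" "stalk Y y'" "smap X f x'" "smap Y g y'" by (rule TR[OF x'(3)])
   show "FG U V [(s +[sec X U] s', t)] x' y' = FG U V [(s, t), (s', t)] x' y'"
    unfolding FG_eq FC_eq G_def
    using T.pure_add_left[OF f.X.germ_closed[OF s(1) x'(1) s(3)] f.X.germ_closed[OF s(1) x'(1) s(4)] g.X.germ_closed[OF t(1) x'(2) t(3)]]
     f.X.germ_add[OF s(1) x'(1) s(3,4)] f.X.germ_closed[OF s(1) x'(1) s(3)] f.X.germ_closed[OF s(1) x'(1) s(4)] g.X.germ_closed[OF t(1) x'(2) t(3)] by simp
  qed (use s t f.X.germ_add[OF s(1-4)] in \<open>auto simp: nb_def FS_iff G_def\<close>)
 next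
  case (add_right m n n')
  then have c: "m : Stk X x" "n : Stk Y y" "n' : Stk Y y" by simp_all
  obtain V t t' t'' where t: "g.X.opn V" "y : V" "t : g.X.Sec V" "t' : g.X.Sec V" "n = germ Y y V t" "n' = germ Y y V t'"
   by (rule g.X.stalk_common[OF c(2,3,2)])
  obtain U s where s: "f.X.opn U" "x : U" "s : f.X.Sec U" "m = germ X x U s" by (rule f.X.stalk_cases[OF c(1)])
  interpret V: cring "sec Y V" by (rule g.X.sec_cring[OF t(1)])
  show ?case
  proof (rule spreadI[of x y U V "[(s, t +[sec Y V] t')]" "[(s, t), (s, t')]"])
   fix x' y' assume x': "x' : U" "y' : V" "rel x' y'"
   interpret T: tensor_rings "stalk S (pt f x')" "stalk X x'" "stalk Y y'" "smap X f x'" "smap Y g y'" by (rule TR[OF x'(3)])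
   show "FG U V [(s, t +[sec Y V] t')] x' y' = FG U V [(s, t), (s, t')] x' y'"
    unfolding FG_eq FC_eq G_def
    using T.pure_add_right[OF f.X.germ_closed[OF s(1) x'(1) s(3)] g.X.germ_closed[OF t(1) x'(2) t(3)] g.X.germ_closed[OF t(1) x'(2) t(4)]]
     g.X.germ_add[OF t(1) x'(2) t(3,4)] f.X.germ_closed[OF s(1) x'(1) s(3)] g.X.germ_closed[OF t(1) x'(2) t(3)] g.X.germ_closed[OF t(1) x'(2) t(4)] by simp
  qed (use s t g.X.germ_add[OF t(1-4)] in \<open>auto simp: nb_def FS_iff G_def\<close>)
 next
  case (balanced r m n)
  then have c: "r : Stk S (pt f x)" "m : Stk X x" "n : Stk Y y" by simp_all
  obtain W q where q: "f.Y.opn W" "pt f x : W" "q : f.Y.Sec W" "r = germ S (pt f x) W q" by (rule f.Y.stalk_cases[OF c(1)])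
  obtain U0 s0 where s0: "f.X.opn U0" "x : U0" "s0 : f.X.Sec U0" "m = germ X x U0 s0" by (rule f.X.stalk_cases[OF c(2)])
  obtain V0 t0 where t0: "g.X.opn V0" "y : V0" "t0 : g.X.Sec V0" "n = germ Y y V0 t0" by (rule g.X.stalk_cases[OF c(3)])
  \<comment> \<open>Cutting down to the preimages of W makes the scalar q act through sections a and
    b on both sides, so that balancedness holds at all pairs of points of U and V with the same
    image in S.\<close>
  define U where "U = U0 Int preim X f W"
  define V where "V = V0 Int preim Y g W"
  have o: "f.X.opn U" "g.X.opn V" unfolding U_def V_def using f.preim_open g.preim_open q s0 t0 by auto
  have xU: "x : U" "y : V" unfolding U_def V_def preim_def using P q s0 t0 by auto
  define s t a b where "s = res X U0 U s0" and "t = res Y V0 V t0"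
   and "a = res X (preim X f W) U (com f W q)" and "b = res Y (preim Y g W) V (com g W q)"
  have sec: "s : f.X.Sec U" "a : f.X.Sec U" "t : g.X.Sec V" "b : g.X.Sec V"
   unfolding s_def t_def a_def b_def
   using o s0 t0 f.com_closed[OF q(1,3)] g.com_closed[OF q(1,3)] f.preim_open[OF q(1)] g.preim_open[OF q(1)]
   by (auto intro!: f.X.res_closed g.X.res_closed simp: U_def V_def)
  have ga: "germ X x' U a = smap X f x' (germ S (pt f x') W q)" if "x' : U" for x'
   unfolding a_def using f.stalk_map_germ[of x' W q] q that o f.com_closed[OF q(1,3)] f.preim_open[OF q(1)]
    f.X.germ_res[of "preim X f W" U x' "com f W q"] by (auto simp: U_def preim_def)
  have gb: "germ Y y' V b = smap Y g y' (germ S (pt g y') W q)" if "y' : V" for y'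
   unfolding b_def using g.stalk_map_germ[of y' W q] q that o g.com_closed[OF q(1,3)] g.preim_open[OF q(1)]
    g.X.germ_res[of "preim Y g W" V y' "com g W q"] by (auto simp: V_def preim_def)
  have gs: "m = germ X x U s" "n = germ Y y V t" unfolding s_def t_def
   using f.X.germ_res[of U0 U x s0] g.X.germ_res[of V0 V y t0] s0 t0 o xU by (auto simp: U_def V_def)
  interpret U: cring "sec X U" by (rule f.X.sec_cring[OF o(1)])
  interpret V: cring "sec Y V" by (rule g.X.sec_cring[OF o(2)])
  show ?case
  proof (rule spreadI[of x y U V "[(a *[sec X U] s, t)]" "[(s, b *[sec Y V] t)]"])
   fix x' y' assume x': "x' : U" "y' : V" "rel x' y'"
   interpret T: tensor_rings "stalk S (pt f x')" "stalk X x'" "stalk Y y'" "smap X f x'" "smap Y g y'" by (rule TR[OF x'(3)])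
   have r: "germ S (pt f x') W q : Stk S (pt f x')" using x'(1) q by (intro f.Y.germ_closed) (auto simp: U_def preim_def)
   show "FG U V [(a *[sec X U] s, t)] x' y' = FG U V [(s, b *[sec Y V] t)] x' y'"
    unfolding FG_eq FC_eq G_def
    using T.pure_balanced[OF r f.X.germ_closed[OF o(1) x'(1) sec(1)] g.X.germ_closed[OF o(2) x'(2) sec(3)]] x'(3)
     f.X.germ_mult[OF o(1) x'(1) sec(2,1)] g.X.germ_mult[OF o(2) x'(2) sec(4,3)] ga[OF x'(1)] gb[OF x'(2)] by (simp add: rel_def)
  qed (use o xU sec gs q(4) P f.X.germ_mult[OF o(1) xU(1) sec(2,1)] g.X.germ_mult[OF o(2) xU(2) sec(4,3)] ga[OF xU(1)] gb[OF xU(2)] in \<open>auto simp: nb_def FS_iff G_def\<close>)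
 }
qed

end

section \<open>The functions that generate topology and sheaf of the fibre product\<close>

context fp_pair begin

lemma FR_cases:
 assumes "rel x y" "d : carrier (FR x y)"
 obtains u where "set u <= Stk X x \<times> Stk Y y" "d = FC x y u"
proof -
 interpret T: tensor_rings "stalk S (pt f x)" "stalk X x" "stalk Y y" "smap X f x" "smap Y g y" by (rule TR[OF assms(1)])
 show ?thesis by (rule T.T_cases[OF assms(2)[unfolded FR_eq]], rule that) (simp_all add: FC_eq)
qed

definition "Dm U V = {z : PT. fst z : U & fst (snd z) : V}"
text \<open>Values are prescribed only on the domain, so that pointwise sums, products and negatives
  of members are members again.\<close>

definition "fns = {(Dl, v). EX U V l. f.X.opn U & g.X.opn V & l : FS U V & Dl = Dm U V &
 (ALL z:Dl. v z = FG U V l (fst z) (fst (snd z)))}"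
abbreviation "DD z == FR (fst z) (fst (snd z))"
abbreviation "PP z == snd (snd z)"
abbreviation "fp_top == topology_generated_by
 {fp_basic X f S Y g U V l | U V l. f.X.opn U & g.X.opn V & l : FS U V}"
abbreviation "fp_adm Om ta == EX U V k l. f.X.opn U & g.X.opn V & k : FS U V & l : FS U V &
 Om <= fp_basic X f S Y g U V l & (ALL (x, y, p):Om. ta (x, y, p) = loc_frac (FR x y) p (FG U V k x y) (FG U V l x y))"

lemma fnsI: "f.X.opn U ==> g.X.opn V ==> l : FS U V ==> (!!z. z : Dm U V ==> v z = FG U V l (fst z) (fst (snd z))) ==> (Dm U V, v) : fns"
 unfolding fns_def by blast

lemma fns_common:
 assumes "(Dl, v) : fns" "(Dl', w) : fns"
 obtains U V l m where "f.X.opn U" "g.X.opn V" "l : FS U V" "m : FS U V" "Dl Int Dl' = Dm U V"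
  "!!z. z : Dm U V ==> v z = FG U V l (fst z) (fst (snd z))" "!!z. z : Dm U V ==> w z = FG U V m (fst z) (fst (snd z))"
proof -
 obtain U V l where 1: "f.X.opn U" "g.X.opn V" "l : FS U V" "Dl = Dm U V" "!!z. z : Dl ==> v z = FG U V l (fst z) (fst (snd z))"
  using assms(1) unfolding fns_def by blast
 obtain U' V' m where 2: "f.X.opn U'" "g.X.opn V'" "m : FS U' V'" "Dl' = Dm U' V'" "!!z. z : Dl' ==> w z = FG U' V' m (fst z) (fst (snd z))"
  using assms(2) unfolding fns_def by blast
 have o: "f.X.opn (U Int U')" "g.X.opn (V Int V')" using 1 2 by auto
 have e: "Dl Int Dl' = Dm (U Int U') (V Int V')" unfolding 1 2 Dm_def by blast
 have i: "z : Dl & z : Dl' & fst z : U Int U' & fst (snd z) : V Int V'" if "z : Dm (U Int U') (V Int V')" for z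
  using that unfolding 1(4) 2(4) Dm_def by blast
 note r1 = rs[OF 1(1,2) o _ _ 1(3)] and r2 = rs[OF 2(1,2) o _ _ 2(3)]
 show ?thesis
  by (rule that[OF o r1(1) r2(1) e]) (use i 1(5) 2(5) r1(2) r2(2) in \<open>simp_all add: FG_eq\<close>)
qed

lemma Dm_rel: "z : Dm U V ==> rel (fst z) (fst (snd z)) & fst z : U & fst (snd z) : V & primeideal (PP z) (DD z)"
 using PT_rel PT_prime by (cases z) (auto simp: Dm_def)

definition "sneg U = map (%c. (-[sec X U] fst c, snd c))"
definition "smul U V l m = map (%(c, d). (fst c *[sec X U] fst d, snd c *[sec Y V] snd d)) (List.product l m)"
abbreviation "sone U V == [(1[sec X U], 1[sec Y V])]"

lemma FS_ops:
 assumes "f.X.opn U" "g.X.opn V" "l : FS U V" "m : FS U V"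
 shows "l @ m : FS U V" "sneg U l : FS U V" "smul U V l m : FS U V" "sone U V : FS U V" "[] : FS U V"
proof -
 interpret U: cring "sec X U" by (rule f.X.sec_cring[OF assms(1)])
 interpret V: cring "sec Y V" by (rule g.X.sec_cring[OF assms(2)])
 have p: "fst c : f.X.Sec U" "snd c : g.X.Sec V" if "c : set l Un set m" for c
  using that assms(3,4) unfolding FS_iff by auto
 show "l @ m : FS U V" using assms by (simp add: FS_iff)
 show "sneg U l : FS U V" using p by (auto simp: FS_iff sneg_def)
 show "smul U V l m : FS U V" unfolding FS_iff smul_def
  by (auto intro!: U.m_closed V.m_closed intro: p(1)[of "(a, b)" for a b, simplified] p(2)[of "(a, b)" for a b, simplified])
qed (simp_all add: FS_iff cring.cring_simprules f.X.sec_cring[OF assms(1)] g.X.sec_cring[OF assms(2)])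

lemma FG_ops:
 assumes o: "f.X.opn U" "g.X.opn V" and l: "l : FS U V" and m: "m : FS U V" and x: "x : U" and y: "y : V" and r: "rel x y"
 shows "FG U V l x y : carrier (FR x y)" "FG U V [] x y = 0[FR x y]" "FG U V (sone U V) x y = 1[FR x y]"
  "FG U V (l @ m) x y = FG U V l x y +[FR x y] FG U V m x y"
  "FG U V (sneg U l) x y = -[FR x y] FG U V l x y"
  "FG U V (smul U V l m) x y = FG U V l x y *[FR x y] FG U V m x y"
proof -
 interpret T: tensor_rings "stalk S (pt f x)" "stalk X x" "stalk Y y" "smap X f x" "smap Y g y" by (rule TR[OF r])
 note c = G_closed[OF o x y l] G_closed[OF o x y m]
 note gx = hom_simps[OF f.X.germ_hom[OF o(1) x] f.X.sec_cring[OF o(1)] T.cA]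
  and gy = hom_simps[OF g.X.germ_hom[OF o(2) y] g.X.sec_cring[OF o(2)] T.cC]
 show cl: "FG U V l x y : carrier (FR x y)" using c unfolding FG_eq FC_eq FR_eq by simp
 show "FG U V [] x y = 0[FR x y]" unfolding FG_eq FC_eq FR_eq G_def T.T_zero by simp
 show "FG U V (sone U V) x y = 1[FR x y]" unfolding FG_eq FC_eq FR_eq G_def T.T_one using gx(4) gy(4) by simp
 have "G U V (l @ m) x y = G U V l x y @ G U V m x y" by (simp add: G_def)
 then show "FG U V (l @ m) x y = FG U V l x y +[FR x y] FG U V m x y" unfolding FG_eq FC_eq FR_eq using c by simp
 have p: "fst c : f.X.Sec U" "snd c : g.X.Sec V" if "c : set l Un set m" for c
  using that l m unfolding FS_iff by auto
 have n: "G U V (sneg U l) x y = map (%c. (-[stalk X x] fst c, snd c)) (G U V l x y)"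
  using p gx(6) by (simp add: G_def sneg_def map_prod_def split_beta)
 have nV: "set (map (%c. (-[stalk X x] fst c, snd c)) (G U V l x y)) <= Stk X x \<times> Stk Y y"
  using c(1) by auto
 have "T.cls (map (%c. (-[stalk X x] fst c, snd c)) (G U V l x y)) +[T.T] T.cls (G U V l x y) = 0[T.T]"
  unfolding T.T_zero using T.TE_neg[of "G U V l x y"] c(1) nV T.cls_eq_iff by (simp add: image_subset_iff)
 then show "FG U V (sneg U l) x y = -[FR x y] FG U V l x y"
  unfolding FG_eq FC_eq FR_eq n by (rule T.T.minus_equality[symmetric]) (use nV c(1) in simp_all)
 have mu: "G U V (smul U V l m) x y = T.fm (G U V l x y) (G U V m x y)"
  using p
 proof (induction l)
  case (Cons c l)
  have "G U V (smul U V (c # l) m) x y = G U V (map (%d. (fst c *[sec X U] fst d, snd c *[sec Y V] snd d)) m) x y @ G U V (smul U V l m) x y"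
   by (simp add: smul_def G_def comp_def)
  moreover have "G U V (map (%d. (fst c *[sec X U] fst d, snd c *[sec Y V] snd d)) m) x y =
    map (%d. (germ X x U (fst c) *[stalk X x] fst d, germ Y y V (snd c) *[stalk Y y] snd d)) (G U V m x y)"
   using Cons.prems gx(2) gy(2) by (simp add: G_def map_prod_def split_beta)
  moreover have "G U V (c # l) x y = (germ X x U (fst c), germ Y y V (snd c)) # G U V l x y" by (simp add: G_def map_prod_def split_beta)
  ultimately show ?case using Cons by simp
 qed (simp add: smul_def G_def)
 show "FG U V (smul U V l m) x y = FG U V l x y *[FR x y] FG U V m x y"
  unfolding FG_eq FC_eq FR_eq mu using c by simp
qed

text \<open>This clause is the reason for spreading derivations: a tensor that is zero at one pair
  of points has a finite derivation of this fact, and it remains valid nearby.\<close>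

lemma fns_vanish:
 assumes "(Dl, v) : fns" "z : Dl" "v z = 0[DD z]"
 shows "EX Dl' w. (Dl', w) : fns & z : Dl' & Dl' <= Dl & (ALL x:Dl'. v x = 0[DD x])"
proof -
 obtain U V l where 1: "f.X.opn U" "g.X.opn V" "l : FS U V" "Dl = Dm U V" "!!z. z : Dl ==> v z = FG U V l (fst z) (fst (snd z))"
  using assms(1) unfolding fns_def by blast
 define x y where "x = fst z" and "y = fst (snd z)"
 have r: "rel x y" "x : U" "y : V" using Dm_rel assms(2) unfolding 1 x_def y_def by blast+
 interpret T: tensor_rings "stalk S (pt f x)" "stalk X x" "stalk Y y" "smap X f x" "smap Y g y" by (rule TR[OF r(1)])
 have "T.cls (G U V l x y) = T.cls []" using 1(5)[OF assms(2)] assms(3) unfolding FG_eq FC_eq FR_eq x_def[symmetric] y_def[symmetric] T.T_zero by simp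
 then have "T.TE (G U V l x y) []" using T.cls_eq_iff G_closed[OF 1(1,2) r(2,3) 1(3)] by simp
 from tensor_eq_spread[OF r(1) this] obtain U1 V1 l1 m1 where 2: "nb x y U1 V1" "l1 : FS U1 V1" "G U1 V1 l1 x y = G U V l x y" "G U1 V1 m1 x y = []"
  "ALL x':U1. ALL y':V1. rel x' y' --> FG U1 V1 l1 x' y' = FG U1 V1 m1 x' y'" unfolding spread_def by blast
 have m1: "m1 = []" using 2(4) by (simp add: G_def)
 have n0: "nb x y U V" using 1 r by (simp add: nb_def)
 let ?U = "U Int U1" and ?V = "V Int V1"
 have n: "nb x y ?U ?V" using nb_Int[OF n0 2(1)] .
 note nn = n[unfolded nb_def] 2(1)[unfolded nb_def]
 have r1: "rs U V ?U ?V l : FS ?U ?V" "x' : ?U ==> y' : ?V ==> G ?U ?V (rs U V ?U ?V l) x' y' = G U V l x' y'" for x' y'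
  using rs[of U V ?U ?V l] nn 1 by auto
 have r2: "rs U1 V1 ?U ?V l1 : FS ?U ?V" "x' : ?U ==> y' : ?V ==> G ?U ?V (rs U1 V1 ?U ?V l1) x' y' = G U1 V1 l1 x' y'" for x' y'
  using rs[of U1 V1 ?U ?V l1] nn 2 by auto
 \<comment> \<open>The spread comes with its own lift l1 of the germs of l at (x, y). By
   \<open>lift_unique\<close> the two lifts have the same germs at all points nearby.\<close>
 obtain U' V' where 3: "nb x y U' V'" "U' <= ?U" "V' <= ?V"
  "!!x' y'. x' : U' ==> y' : V' ==> G ?U ?V (rs U V ?U ?V l) x' y' = G ?U ?V (rs U1 V1 ?U ?V l1) x' y'"
  by (rule lift_unique[OF n r1(1) r2(1)]) (use r1(2) r2(2) nn 2(3) in auto)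
 have "v w = 0[DD w]" if w: "w : Dm U' V'" for w
 proof -
  note R = Dm_rel[OF w]
  have i: "fst w : ?U" "fst (snd w) : ?V" using R 3 by blast+
  have "v w = FG U V l (fst w) (fst (snd w))" using w i unfolding 1(4) by (intro 1(5)) (simp add: 1(4) Dm_def)
  also have "... = FG U1 V1 l1 (fst w) (fst (snd w))" unfolding FG_eq using 3(4)[of "fst w" "fst (snd w)"] r1(2)[OF i] r2(2)[OF i] R by simp
  also have "... = FG U1 V1 [] (fst w) (fst (snd w))" using 2(5) R i m1 by auto
  also have "... = 0[DD w]" using FG_ops(2)[of U1 V1 "[]" "[]"] nn i R by (simp add: FS_iff)
  finally show ?thesis .
 qed
 moreover have "(Dm U' V', %z. FG U' V' [] (fst z) (fst (snd z))) : fns" using 3(1) by (intro fnsI) (auto simp: nb_def FS_iff)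
 moreover have "z : Dm U' V'" using assms(2) 3(1) unfolding 1 Dm_def nb_def x_def y_def by simp
 moreover have "Dm U' V' <= Dl" using 3(2,3) unfolding 1 Dm_def by blast
 ultimately show ?thesis by blast
qed

lemma fp_basic_eq: "fp_basic X f S Y g U V l = {z : Dm U V. FG U V l (fst z) (fst (snd z)) ~: PP z}"
 by (auto simp: fp_basic_def Dm_def)

lemma fns_cases:
 assumes "(Dl, v) : fns"
 obtains U V l where "f.X.opn U" "g.X.opn V" "l : FS U V" "Dl = Dm U V" "!!z. z : Dm U V ==> v z = FG U V l (fst z) (fst (snd z))"
 using assms unfolding fns_def by blast

lemma fp_fraction_space: "fraction_space fp_top DD PP (%V ta. fp_adm V ta) fns"
proof (rule fraction_space.intro)
 have "{fp_basic X f S Y g U V l | U V l. f.X.opn U & g.X.opn V & l : FS U V} = {{z : Dl. v z ~: PP z} | Dl v. (Dl, v) : fns}" (is "?A = ?B")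
 proof (intro equalityI subsetI)
  fix B assume "B : ?A"
  then obtain U V l where B: "B = fp_basic X f S Y g U V l" "f.X.opn U" "g.X.opn V" "l : FS U V" by blast
  have "(Dm U V, %z. FG U V l (fst z) (fst (snd z))) : fns" by (rule fnsI[OF B(2-4)]) simp
  then show "B : ?B" unfolding B fp_basic_eq
   by (intro CollectI exI[of _ "Dm U V"] exI[of _ "%z. FG U V l (fst z) (fst (snd z))"] conjI HOL.refl)
 next
  fix B assume "B : ?B"
  then obtain Dl v where B: "B = {z : Dl. v z ~: PP z}" "(Dl, v) : fns" by blast
  obtain U V l where 1: "f.X.opn U" "g.X.opn V" "l : FS U V" "Dl = Dm U V" "!!z. z : Dm U V ==> v z = FG U V l (fst z) (fst (snd z))"
   by (rule fns_cases[OF B(2)], rule that)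
  have "B = fp_basic X f S Y g U V l" unfolding B fp_basic_eq 1(4) using 1(5) by auto
  then show "B : ?A" using 1(1-3) by (intro CollectI exI[of _ U] exI[of _ V] exI[of _ l] conjI)
 qed
 then show "fp_top = topology_generated_by {{z : Dl. v z ~: PP z} | Dl v. (Dl, v) : fns}" by simp
next
 fix V ta assume "openin fp_top V"
 show "fp_adm V ta \<longleftrightarrow> (EX Dl a b. (Dl, a) : fns & (Dl, b) : fns & V <= Dl &
    (ALL z:V. b z ~: PP z & ta z = loc_frac (DD z) (PP z) (a z) (b z)))" (is "_ \<longleftrightarrow> ?R")
 proof
  assume "fp_adm V ta"
  then obtain U W k l where 1: "f.X.opn U" "g.X.opn W" "k : FS U W" "l : FS U W" "V <= fp_basic X f S Y g U W l"
    "ALL (x, y, p):V. ta (x, y, p) = loc_frac (FR x y) p (FG U W k x y) (FG U W l x y)" by (elim exE conjE)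
  have s: "V <= Dm U W" "ALL z:V. FG U W l (fst z) (fst (snd z)) ~: PP z" using 1(5) unfolding fp_basic_eq by blast+
  show ?R
  proof (intro exI conjI)
   show "(Dm U W, %z. FG U W k (fst z) (fst (snd z))) : fns" by (rule fnsI[OF 1(1-3)]) simp
   show "(Dm U W, %z. FG U W l (fst z) (fst (snd z))) : fns" by (rule fnsI[OF 1(1,2,4)]) simp
  qed (use s 1(6) in auto)
 next
  assume ?R
  then obtain Dl a b where 1: "(Dl, a) : fns" "(Dl, b) : fns" "V <= Dl" "ALL z:V. b z ~: PP z & ta z = loc_frac (DD z) (PP z) (a z) (b z)"
   by (elim exE conjE)
  obtain U W k l where 2: "f.X.opn U" "g.X.opn W" "k : FS U W" "l : FS U W" "Dl Int Dl = Dm U W"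
   "!!z. z : Dm U W ==> a z = FG U W k (fst z) (fst (snd z))" "!!z. z : Dm U W ==> b z = FG U W l (fst z) (fst (snd z))"
   by (rule fns_common[OF 1(1,2)], rule that)
  have s: "z : Dm U W" if "z : V" for z using 1(3) 2(5) that by blast
  show "fp_adm V ta"
  proof (intro exI conjI)
   show "V <= fp_basic X f S Y g U W l" unfolding fp_basic_eq using s 1(4) 2(7) by auto
   show "ALL (x, y, p):V. ta (x, y, p) = loc_frac (FR x y) p (FG U W k x y) (FG U W l x y)"
    using s 1(4) 2(6,7) by fastforce
  qed (use 2 in blast)+
 qed
next
 fix Dl v z assume v: "(Dl, v) : fns" and z: "z : Dl"
 obtain U V l where 1: "f.X.opn U" "g.X.opn V" "l : FS U V" "Dl = Dm U V" "!!z. z : Dm U V ==> v z = FG U V l (fst z) (fst (snd z))"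
  by (rule fns_cases[OF v], rule that)
 note R = Dm_rel[OF z[unfolded 1(4)]]
 show "primeideal (PP z) (DD z)" using R by blast
 show "v z : carrier (DD z)" using 1(5) z[unfolded 1(4)] FG_ops(1)[OF 1(1-3,3)] R by simp
 fix d assume "d : carrier (DD z)"
 obtain u where u: "set u <= Stk X (fst z) \<times> Stk Y (fst (snd z))" "d = FC (fst z) (fst (snd z)) u"
  by (rule FR_cases[OF conjunct1[OF R] \<open>d : carrier (DD z)\<close>])
 obtain U' V' l' where 2: "nb (fst z) (fst (snd z)) U' V'" "l' : FS U' V'" "G U' V' l' (fst z) (fst (snd z)) = u"
  using lift_exists[OF _ _ u(1)] R unfolding rel_def by metis
 show "EX Dl' w. (Dl', w) : fns & z : Dl' & w z = d"
 proof (intro exI conjI)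
  show "(Dm U' V', %z. FG U' V' l' (fst z) (fst (snd z))) : fns" using 2 by (intro fnsI) (auto simp: nb_def)
  show "z : Dm U' V'" using 2(1) z unfolding 1 Dm_def nb_def by blast
  show "FG U' V' l' (fst z) (fst (snd z)) = d" unfolding FG_eq 2(3) u(2) by simp
 qed
next
 fix Dl v assume v: "(Dl, v) : fns"
 obtain U V l where 1: "f.X.opn U" "g.X.opn V" "l : FS U V" "Dl = Dm U V" "!!z. z : Dm U V ==> v z = FG U V l (fst z) (fst (snd z))"
  by (rule fns_cases[OF v], rule that)
 note o = FS_ops[OF 1(1-3,3)] and p = FG_ops[OF 1(1-3,3)]
 show "(Dl, %z. 1[DD z]) : fns" unfolding 1(4) by (rule fnsI[OF 1(1,2) o(4)]) (use p(3) Dm_rel in force)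
 show "(Dl, %z. 0[DD z]) : fns" unfolding 1(4) by (rule fnsI[OF 1(1,2) o(5)]) (use p(2) Dm_rel in force)
 show "(Dl, %z. -[DD z] v z) : fns" unfolding 1(4) by (rule fnsI[OF 1(1,2) o(2)]) (use 1(5) p(5) Dm_rel in force)
next
 fix Dl v w assume v: "(Dl, v) : fns" and w: "(Dl, w) : fns"
 obtain U V k l where 2: "f.X.opn U" "g.X.opn V" "k : FS U V" "l : FS U V" "Dl Int Dl = Dm U V"
   "!!z. z : Dm U V ==> v z = FG U V k (fst z) (fst (snd z))" "!!z. z : Dm U V ==> w z = FG U V l (fst z) (fst (snd z))"
  by (rule fns_common[OF v w], rule that)
 have e: "Dl = Dm U V" using 2(5) by blast
 note o = FS_ops[OF 2(1-4)] and p = FG_ops[OF 2(1-4)]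
 show "(Dl, %z. v z +[DD z] w z) : fns" unfolding e by (rule fnsI[OF 2(1,2) o(1)]) (use 2(6,7) p(4) Dm_rel in force)
 show "(Dl, %z. v z *[DD z] w z) : fns" unfolding e by (rule fnsI[OF 2(1,2) o(3)]) (use 2(6,7) p(6) Dm_rel in force)
next
 fix Dl v Dl' w assume v: "(Dl, v) : fns" and w: "(Dl', w) : fns"
 obtain U V k l where 2: "f.X.opn U" "g.X.opn V" "k : FS U V" "l : FS U V" "Dl Int Dl' = Dm U V"
   "!!z. z : Dm U V ==> v z = FG U V k (fst z) (fst (snd z))" "!!z. z : Dm U V ==> w z = FG U V l (fst z) (fst (snd z))"
  by (rule fns_common[OF v w], rule that)
 show "(Dl Int Dl', v) : fns" unfolding 2(5) by (rule fnsI[OF 2(1-3,6)])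
next
 show "EX Dl' w. (Dl', w) : fns & z : Dl' & Dl' <= Dl & (ALL x:Dl'. v x = 0[DD x])"
  if "(Dl, v) : fns" "z : Dl" "v z = 0[DD z]" for Dl v z using fns_vanish[OF that] .
qed

sublocale F: fraction_space fp_top DD PP "%V ta. fp_adm V ta" fns by (rule fp_fraction_space)

abbreviation "FP == fibre_product X f S Y g"

lemma Z_eq: "F.Z = FP"
proof -
 have "(%z. loc (DD z) (PP z)) = (%(x, y, p). loc (FR x y) p)" by auto
 then show ?thesis unfolding F.Z_def fibre_product_def by simp
qed

lemmas fp_lrs = F.Z_lrs[unfolded Z_eq]
lemmas fp_top_eq = F.Z_simps(1)[unfolded Z_eq]

lemma fp_points_eq: "points FP = PT"
proof -
 have "\<Union>(fst ` fns) <= PT" unfolding fns_def Dm_def by auto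
 moreover have "(Dm (points X) (points Y), %z. FG (points X) (points Y) [] (fst z) (fst (snd z))) : fns"
  by (rule fnsI) (auto simp: FS_iff)
 moreover have "PT <= Dm (points X) (points Y)" by (auto simp: Dm_def fp_points_def)
 ultimately have "\<Union>(fst ` fns) = PT" by force
 then show ?thesis unfolding fp_top_eq F.topspace_eq .
qed

abbreviation "fin x y a == FC x y [(a, 1[stalk Y y])]"
abbreviation "fir x y b == FC x y [(1[stalk X x], b)]"

lemma fin_hom: assumes "rel x y"
 shows "fin x y : ring_hom (stalk X x) (FR x y)" "fir x y : ring_hom (stalk Y y) (FR x y)"
  "r : Stk S (pt f x) ==> fin x y (smap X f x r) = fir x y (smap Y g y r)"
proof -
 interpret T: tensor_rings "stalk S (pt f x)" "stalk X x" "stalk Y y" "smap X f x" "smap Y g y" by (rule TR[OF assms])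
 have e: "fin x y = T.inl" "fir x y = T.inr" by (auto simp: FC_eq T.inl_def T.inr_def)
 show "fin x y : ring_hom (stalk X x) (FR x y)" "fir x y : ring_hom (stalk Y y) (FR x y)"
  unfolding e FR_eq using T.inl_hom T.inr_hom by blast+
 show "r : Stk S (pt f x) ==> fin x y (smap X f x r) = fir x y (smap Y g y r)" using T.inl_inr by (simp add: FC_eq T.inl_def T.inr_def)
qed

lemma FR_hom_eqI:
 assumes r: "rel x y" and h: "h : ring_hom (FR x y) B" and k: "k : ring_hom (FR x y) B" and B: "cring B"
  and "!!a. a : Stk X x ==> h (fin x y a) = k (fin x y a)"
  and "!!c. c : Stk Y y ==> h (fir x y c) = k (fir x y c)" and d: "d : carrier (FR x y)"
 shows "h d = k d"
proof -
 interpret T: tensor_rings "stalk S (pt f x)" "stalk X x" "stalk Y y" "smap X f x" "smap Y g y" by (rule TR[OF r])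
 show ?thesis using T.T_hom_eqI[of h B k d] assms unfolding FR_eq FC_eq T.inl_def T.inr_def by blast
qed

lemma FR_lift:
 assumes r: "rel x y" and B: "cring B" and al: "al : ring_hom (stalk X x) B" and bx: "bx : ring_hom (stalk Y y) B"
  and eq: "!!r. r : Stk S (pt f x) ==> al (smap X f x r) = bx (smap Y g y r)"
 obtains h where "h : ring_hom (FR x y) B"
  "!!u. set u <= Stk X x \<times> Stk Y y ==> h (FC x y u) = lsum B (%c. al (fst c) *[B] bx (snd c)) u"
  "!!a. a : Stk X x ==> h (fin x y a) = al a"
  "!!c. c : Stk Y y ==> h (fir x y c) = bx c"
proof -
 interpret T: tensor_rings "stalk S (pt f x)" "stalk X x" "stalk Y y" "smap X f x" "smap Y g y" by (rule TR[OF r])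
 obtain h where h: "h : ring_hom T.T B" "!!u. u : T.V ==> h (T.cls u) = lsum B (%x. al (fst x) *[B] bx (snd x)) u"
  "!!a. a : Stk X x ==> h (T.inl a) = al a" "!!c. c : Stk Y y ==> h (T.inr c) = bx c"
  using T.T_lift[OF B al bx eq] by blast
 show ?thesis by (rule that[of h]) (use h in \<open>simp_all add: FR_eq FC_eq T.inl_def T.inr_def\<close>)
qed

lemma PT_iff: "(x, y, p) : PT \<longleftrightarrow> rel x y & primeideal p (FR x y) &
  (ALL a:Stk X x. fin x y a : p \<longleftrightarrow> a : Mst X x) &
  (ALL b:Stk Y y. fir x y b : p \<longleftrightarrow> b : Mst Y y)"
proof -
 have *: "{a : carrier R. P a} = max_ideal R \<longleftrightarrow> (ALL a:carrier R. P a \<longleftrightarrow> a : max_ideal R)" if "local_ring R" for R :: "'z ring" and P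
  using max_ideal_subset[OF that] by blast
 show ?thesis
 proof (cases "rel x y")
  case True
  then have "local_ring (stalk X x)" "local_ring (stalk Y y)" unfolding rel_def using f.X.stalk_local g.X.stalk_local by blast+
  then show ?thesis using True unfolding fp_points_def rel_def mem_Collect_eq prod.case by (simp only: * simp_thms)
 qed (auto simp: PT_rel)
qed

lemmas fp_topspace = fp_points_eq[unfolded fp_top_eq]

lemma fp_is_loc: "z : PT ==> is_loc (DD z) (PP z) (stalk FP z) (F.dd z)"
 by (rule F.stalk_is_loc[unfolded Z_eq fp_topspace])

end

section \<open>Projections and universal property of the fibre product\<close>

context fp_pair begin

abbreviation "FX == fp_proj1 X f S Y g"
abbreviation "FY == fp_proj2 X f S Y g"

lemma germ1:
 assumes "x : points X" shows "germ X x (points X) 1[sec X (points X)] = 1[stalk X x]"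
 using f.X.germ_const(1)[of "points X" x] assms by simp

lemma germ2:
 assumes "y : points Y" shows "germ Y y (points Y) 1[sec Y (points Y)] = 1[stalk Y y]"
 using g.X.germ_const(1)[of "points Y" y] assms by simp

lemma fns_fin:
 assumes "f.X.opn U" "s : f.X.Sec U"
 shows "(Dm U (points Y), %z. fin (fst z) (fst (snd z)) (germ X (fst z) U s)) : fns"
proof (rule fnsI[of _ _ "[(s, 1[sec Y (points Y)])]"])
 show "[(s, 1[sec Y (points Y)])] : FS U (points Y)"
  using assms g.X.sec_cring[OF g.X.opn_points] by (simp add: FS_iff cring.cring_simprules)
 fix z assume "z : Dm U (points Y)"
 then show "fin (fst z) (fst (snd z)) (germ X (fst z) U s) = FG U (points Y) [(s, 1[sec Y (points Y)])] (fst z) (fst (snd z))"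
  using germ2 Dm_rel[of z U "points Y"] by (simp add: FG_eq G_def)
qed (use assms in auto)

lemma fns_fir:
 assumes "g.X.opn V" "s : g.X.Sec V"
 shows "(Dm (points X) V, %z. fir (fst z) (fst (snd z)) (germ Y (fst (snd z)) V s)) : fns"
proof (rule fnsI[of _ _ "[(1[sec X (points X)], s)]"])
 show "[(1[sec X (points X)], s)] : FS (points X) V"
  using assms f.X.sec_cring[OF f.X.opn_points] by (simp add: FS_iff cring.cring_simprules)
 fix z assume "z : Dm (points X) V"
 then show "fir (fst z) (fst (snd z)) (germ Y (fst (snd z)) V s) = FG (points X) V [(1[sec X (points X)], s)] (fst z) (fst (snd z))"
  using germ1 Dm_rel[of z "points X" V] by (simp add: FG_eq G_def)
qed (use assms in auto)

lemma pt_FX[simp]: "pt FX z = fst z" and pt_FY[simp]: "pt FY z = fst (snd z)"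
 by (simp_all add: fp_proj1_def fp_proj2_def split_beta)

lemma PT_relD: "z : PT ==> rel (fst z) (fst (snd z))"
 using PT_rel by (cases z) auto

lemma PT_max:
 assumes "z : PT"
 shows "a : Stk X (fst z) ==> fin (fst z) (fst (snd z)) a : PP z \<longleftrightarrow> a : Mst X (fst z)"
  "b : Stk Y (fst (snd z)) ==> fir (fst z) (fst (snd z)) b : PP z \<longleftrightarrow> b : Mst Y (fst (snd z))"
 using assms PT_iff[of "fst z" "fst (snd z)" "PP z"] by auto

lemma FX_morphism:
 shows "mor FP X FX"
  "z : PT ==> a : Stk X (fst z) ==> smap FP FX z a = F.dd z (fin (fst z) (fst (snd z)) a)"
proof -
 have pre: "preim FP FX U = Dm U (points Y)" for U
  unfolding preim_def fp_points_eq using PT_relD by (auto simp: Dm_def rel_def)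
 have com: "com FX U s = F.hat (Dm U (points Y)) (%z. fin (fst z) (fst (snd z)) (germ X (fst z) U s))" for U s
  unfolding fp_proj1_def F.hat_def using PT_relD by (fastforce simp: fun_eq_iff restrict_def Dm_def rel_def)
 have loc: "fin (fst z) (fst (snd z)) a : PP z" if z: "z : PT" and a: "a : Mst X (fst z)" for z a
  using PT_max(1)[OF z] a max_ideal_subset[OF f.X.stalk_local] PT_relD[OF z] unfolding rel_def by blast
 note M = F.projection_morphism[unfolded Z_eq fp_topspace, OF f.X.lrs, of FX "%z. fin (fst z) (fst (snd z))", unfolded pt_FX, OF _ fin_hom(1)[OF PT_relD] loc fns_fin[folded pre] com[folded pre]]
 show "mor FP X FX" by (rule M(1)) (use PT_relD rel_def in blast)+
 show "z : PT ==> a : Stk X (fst z) ==> smap FP FX z a = F.dd z (fin (fst z) (fst (snd z)) a)"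
  by (rule M(2)) (use PT_relD rel_def in blast)+
qed

lemma FY_morphism:
 shows "mor FP Y FY"
  "z : PT ==> b : Stk Y (fst (snd z)) ==> smap FP FY z b = F.dd z (fir (fst z) (fst (snd z)) b)"
proof -
 have pre: "preim FP FY V = Dm (points X) V" for V
  unfolding preim_def fp_points_eq using PT_relD by (auto simp: Dm_def rel_def)
 have com: "com FY V s = F.hat (Dm (points X) V) (%z. fir (fst z) (fst (snd z)) (germ Y (fst (snd z)) V s))" for V s
  unfolding fp_proj2_def F.hat_def using PT_relD by (fastforce simp: fun_eq_iff restrict_def Dm_def rel_def)
 have loc: "fir (fst z) (fst (snd z)) b : PP z" if z: "z : PT" and b: "b : Mst Y (fst (snd z))" for z b
  using PT_max(2)[OF z] b max_ideal_subset[OF g.X.stalk_local] PT_relD[OF z] unfolding rel_def by blast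
 note M = F.projection_morphism[unfolded Z_eq fp_topspace, OF g.X.lrs, of FY "%z. fir (fst z) (fst (snd z))", unfolded pt_FY, OF _ fin_hom(2)[OF PT_relD] loc fns_fir[folded pre] com[folded pre]]
 show "mor FP Y FY" by (rule M(1)) (use PT_relD rel_def in blast)+
 show "z : PT ==> b : Stk Y (fst (snd z)) ==> smap FP FY z b = F.dd z (fir (fst z) (fst (snd z)) b)"
  by (rule M(2)) (use PT_relD rel_def in blast)+
qed

lemma fp_square: "meq FP S (cmp X f FX) (cmp Y g FY)"
proof -
 note C1 = comp_morphism[OF fp_lrs f.X.lrs f.Y.lrs FX_morphism(1) f.morph, unfolded fp_points_eq pt_FX]
  and C2 = comp_morphism[OF fp_lrs g.X.lrs f.Y.lrs FY_morphism(1) g.morph, unfolded fp_points_eq pt_FY]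
 show ?thesis
 proof (rule morph_eqI[OF fp_lrs f.Y.lrs C1(1) C2(1), unfolded fp_points_eq])
  fix z assume z: "z : PT"
  note R = PT_relD[OF z] PT_relD[OF z, unfolded rel_def]
  show "pt (cmp X f FX) z = pt (cmp Y g FY) z" using R by simp
  fix a assume "a : Stk S (pt (cmp X f FX) z)"
  then have a: "a : Stk S (pt f (fst z))" by simp
  show "smap FP (cmp X f FX) z a = smap FP (cmp Y g FY) z a"
   using C1(2)[OF z a] C2(2)[OF z, of a] a R FX_morphism(2)[OF z f.stalk_map_closed[of "fst z" a]]
    FY_morphism(2)[OF z g.stalk_map_closed[of "fst (snd z)" a]] fin_hom(3)[OF R(1) a] by simp
 qed
qed

text \<open>The stalk maps of h and k agree on both factors of the tensor ring, hence on all of it.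
  The primes are preimages of the same maximal ideal, so the points coincide as well.\<close>

lemma fp_monic:
 assumes T: "lrsp T" and h: "mor T FP h" and k: "mor T FP k"
  and X: "meq T X (cmp FP FX h) (cmp FP FX k)"
  and Y: "meq T Y (cmp FP FY h) (cmp FP FY k)"
 shows "meq T FP h k"
proof -
 interpret h: lmorph T FP h by unfold_locales (use T h fp_lrs in auto)
 interpret k: lmorph T FP k by unfold_locales (rule k)
 note H1 = comp_morphism[OF T fp_lrs f.X.lrs h FX_morphism(1), unfolded pt_FX] and K1 = comp_morphism[OF T fp_lrs f.X.lrs k FX_morphism(1), unfolded pt_FX]
 note H2 = comp_morphism[OF T fp_lrs g.X.lrs h FY_morphism(1), unfolded pt_FY] and K2 = comp_morphism[OF T fp_lrs g.X.lrs k FY_morphism(1), unfolded pt_FY]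
 note E1 = morph_eqD[OF T f.X.lrs H1(1) K1(1) X] and E2 = morph_eqD[OF T g.X.lrs H2(1) K2(1) Y]
 have main: "pt h t = pt k t & (ALL d:carrier (DD (pt h t)). smap T h t (F.dd (pt h t) d) = smap T k t (F.dd (pt k t) d))"
  if t: "t : points T" for t
 proof -
  have z: "pt h t : PT" "pt k t : PT" using h.pt_closed[OF t] k.pt_closed[OF t] fp_points_eq by auto
  define x y where "x = fst (pt h t)" and "y = fst (snd (pt h t))"
  have e: "fst (pt k t) = x" "fst (snd (pt k t)) = y" using E1(1)[OF t] E2(1)[OF t] by (simp_all add: x_def y_def)
  have r: "rel x y" using PT_relD[OF z(1)] unfolding x_def y_def .
  note Lh = fp_is_loc[OF z(1), folded x_def y_def] and Lk = fp_is_loc[OF z(2), unfolded e]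
  have hh: "smap T h t o F.dd (pt h t) : ring_hom (FR x y) (stalk T t)" by (rule ring_hom_trans[OF is_locD(4)[OF Lh] h.stalk_map_hom[OF t]])
  have kh: "smap T k t o F.dd (pt k t) : ring_hom (FR x y) (stalk T t)" by (rule ring_hom_trans[OF is_locD(4)[OF Lk] k.stalk_map_hom[OF t]])
  have eq: "(smap T h t o F.dd (pt h t)) d = (smap T k t o F.dd (pt k t)) d" if "d : carrier (FR x y)" for d
  proof (rule FR_hom_eqI[OF r hh kh h.X.stalk_cring[OF t] _ _ that])
   fix a assume a: "a : Stk X x"
   show "(smap T h t o F.dd (pt h t)) (fin x y a) = (smap T k t o F.dd (pt k t)) (fin x y a)"
    using E1(2)[OF t, of a] H1(2)[OF t, of a] K1(2)[OF t, of a] FX_morphism(2)[OF z(1), of a] FX_morphism(2)[OF z(2), of a] a e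
    by (simp flip: x_def y_def)
  next
   fix a assume a: "a : Stk Y y"
   show "(smap T h t o F.dd (pt h t)) (fir x y a) = (smap T k t o F.dd (pt k t)) (fir x y a)"
    using E2(2)[OF t, of a] H2(2)[OF t, of a] K2(2)[OF t, of a] FY_morphism(2)[OF z(1), of a] FY_morphism(2)[OF z(2), of a] a e
    by (simp flip: x_def y_def)
  qed
  have mem: "d : PP (pt h t) \<longleftrightarrow> d : PP (pt k t)" if "d : carrier (FR x y)" for d
   using F.morph_into_point[unfolded Z_eq, OF T h t, of d] F.morph_into_point[unfolded Z_eq, OF T k t, of d] that eq[OF that] e
   by (simp flip: x_def y_def)
  have "PP (pt h t) <= carrier (FR x y)" "PP (pt k t) <= carrier (FR x y)"
   using ideal.Icarr[OF primeideal.axioms(1)[OF is_locD(3)[OF Lh]]] ideal.Icarr[OF primeideal.axioms(1)[OF is_locD(3)[OF Lk]]] by blast+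
  then have "PP (pt h t) = PP (pt k t)" using mem by blast
  then have "pt h t = pt k t" using e unfolding x_def y_def by (simp add: prod_eq_iff)
  then show ?thesis using eq unfolding x_def y_def by simp
 qed
 show ?thesis by (rule F.morph_into_eqI[unfolded Z_eq, OF T h k]) (use main in blast)+
qed

text \<open>At t the stalk maps of a and b combine to a map \<open>th t\<close> from the tensor
  ring, and the point \<open>p t\<close> carries the preimage of the maximal ideal. The criterion
  \<open>morph_into_exists\<close> then asks for sections that realise the functions in
  \<open>fns\<close>.\<close>

lemma fp_univ:
 fixes T :: "('t, 'u) rspace"
 assumes T: "lrsp T" and a: "mor T X a" and b: "mor T Y b"
  and eq: "meq T S (cmp X f a) (cmp Y g b)"
 obtains h where "mor T FP h" "meq T X (cmp FP FX h) a" "meq T Y (cmp FP FY h) b"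
proof -
 interpret a: lmorph T X a by unfold_locales (use T a in auto)
 interpret b: lmorph T Y b by unfold_locales (rule b)
 note CA = comp_morphism[OF T f.X.lrs f.Y.lrs a f.morph] and CB = comp_morphism[OF T g.X.lrs f.Y.lrs b g.morph]
 note E = morph_eqD[OF T f.Y.lrs CA(1) CB(1) eq]
 have r: "rel (pt a t) (pt b t)" if "t : points T" for t
  using E(1)[OF that] a.pt_closed[OF that] b.pt_closed[OF that] by (simp add: rel_def)
 \<comment> \<open>The lift is fixed together with its formula on lists, which is needed to compare
   it with germs of sections.\<close>
 define Q where "Q t h \<longleftrightarrow> h : ring_hom (FR (pt a t) (pt b t)) (stalk T t) &
  (ALL u. set u <= Stk X (pt a t) \<times> Stk Y (pt b t) -->
    h (FC (pt a t) (pt b t) u) = lsum (stalk T t) (%c. smap T a t (fst c) *[stalk T t] smap T b t (snd c)) u) &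
  (ALL c:Stk X (pt a t). h (fin (pt a t) (pt b t) c) = smap T a t c) &
  (ALL c:Stk Y (pt b t). h (fir (pt a t) (pt b t) c) = smap T b t c)" for t h
 have ex: "EX h. Q t h" if t: "t : points T" for t
 proof -
  have "smap T a t (smap X f (pt a t) d) = smap T b t (smap Y g (pt b t) d)" if "d : Stk S (pt f (pt a t))" for d
   using E(1)[OF t] E(2)[OF t, of d] CA(2)[OF t, of d] CB(2)[OF t, of d] that by simp
  note L = FR_lift[OF r[OF t] a.X.stalk_cring[OF t] a.stalk_map_hom[OF t] b.stalk_map_hom[OF t] this]
  show ?thesis unfolding Q_def by (rule L, assumption, rule exI, intro conjI allI impI ballI, assumption, simp_all)
 qed
 define th where "th t = (SOME h. Q t h)" for t
 have Q: "Q t (th t)" if "t : points T" for t unfolding th_def by (rule someI_ex[OF ex[OF that]])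
 have th: "th t : ring_hom (FR (pt a t) (pt b t)) (stalk T t)" if "t : points T" for t
  using Q[OF that] unfolding Q_def by (elim conjE)
 have thu: "th t (FC (pt a t) (pt b t) u) = lsum (stalk T t) (%c. smap T a t (fst c) *[stalk T t] smap T b t (snd c)) u"
  if "t : points T" "set u <= Stk X (pt a t) \<times> Stk Y (pt b t)" for t u
  using Q[OF that(1)] that(2) unfolding Q_def by simp
 have thl: "th t (fin (pt a t) (pt b t) c) = smap T a t c" if "t : points T" "c : Stk X (pt a t)" for t c
  using Q[OF that(1)] that(2) unfolding Q_def by simp
 have thr: "th t (fir (pt a t) (pt b t) c) = smap T b t c" if "t : points T" "c : Stk Y (pt b t)" for t c
  using Q[OF that(1)] that(2) unfolding Q_def by simp
 define p where "p t = (pt a t, pt b t, {d : carrier (FR (pt a t) (pt b t)). th t d : Mst T t})" for t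
 have pp: "p t : PT" if t: "t : points T" for t
  unfolding p_def PT_iff
 proof (intro conjI ballI)
  show "primeideal {d : carrier (FR (pt a t) (pt b t)). th t d : Mst T t} (FR (pt a t) (pt b t))"
   by (rule primeideal_vimage[OF th[OF t] FR_cring[OF r[OF t]] a.X.stalk_cring[OF t] max_ideal_prime[OF a.X.stalk_local[OF t]]])
 next
  fix c assume "c : Stk X (pt a t)"
  then show "fin (pt a t) (pt b t) c : {d : carrier (FR (pt a t) (pt b t)). th t d : Mst T t} \<longleftrightarrow> c : Mst X (pt a t)"
   using thl[OF t] a.stalk_map_max_iff[OF t] ring_hom_closed[OF fin_hom(1)[OF r[OF t]]] by simp
 next
  fix c assume "c : Stk Y (pt b t)"
  then show "fir (pt a t) (pt b t) c : {d : carrier (FR (pt a t) (pt b t)). th t d : Mst T t} \<longleftrightarrow> c : Mst Y (pt b t)"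
   using thr[OF t] b.stalk_map_max_iff[OF t] ring_hom_closed[OF fin_hom(2)[OF r[OF t]]] by simp
 qed (rule r[OF t])
 have ex: "EX W s. is_open T W & t : W & s : Scs T W & (ALL w:W. p w : Dl & germ T w W s = th w (v (p w)))"
  if v: "(Dl, v) : fns" and t: "t : points T" "p t : Dl" for Dl v t
 proof -
  obtain U V l where 1: "f.X.opn U" "g.X.opn V" "l : FS U V" "Dl = Dm U V" "!!z. z : Dm U V ==> v z = FG U V l (fst z) (fst (snd z))"
   by (rule fns_cases[OF v], rule that)
  define W where "W = preim T a U Int preim T b V"
  have W: "is_open T W" unfolding W_def by (rule a.X.opn_Int[OF a.preim_open[OF 1(1)] b.preim_open[OF 1(2)]])
  have Wp: "w : points T" "pt a w : U" "pt b w : V" if "w : W" for w using that unfolding W_def preim_def by auto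
  have sa: "res T (preim T a U) W (com a U s) : Scs T W" "w : W ==> germ T w W (res T (preim T a U) W (com a U s)) = smap T a w (germ X (pt a w) U s)"
   if "s : f.X.Sec U" for s w
   using a.X.res_closed[OF a.preim_open[OF 1(1)] W _ a.com_closed[OF 1(1) that]] a.X.germ_res[OF a.preim_open[OF 1(1)] W _ _ a.com_closed[OF 1(1) that], of w]
    a.stalk_map_germ[OF Wp(1) 1(1) Wp(2) that, of w] by (auto simp: W_def)
  have sb: "res T (preim T b V) W (com b V s) : Scs T W" "w : W ==> germ T w W (res T (preim T b V) W (com b V s)) = smap T b w (germ Y (pt b w) V s)"
   if "s : g.X.Sec V" for s w
   using a.X.res_closed[OF b.preim_open[OF 1(2)] W _ b.com_closed[OF 1(2) that]] a.X.germ_res[OF b.preim_open[OF 1(2)] W _ _ b.com_closed[OF 1(2) that], of w]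
    b.stalk_map_germ[OF Wp(1) 1(2) Wp(3) that, of w] by (auto simp: W_def)
  have cW: "cring (sec T W)" by (rule a.X.sec_cring[OF W])
  \<comment> \<open>A pair of sections pulls back to the product of the two pullbacks; summed over
    the list, these give the required section on \<open>W\<close>.\<close>
  define sg where "sg c = res T (preim T a U) W (com a U (fst c)) *[sec T W] res T (preim T b V) W (com b V (snd c))" for c
  have lc: "fst c : f.X.Sec U" "snd c : g.X.Sec V" if "c : set l" for c using 1(3) that unfolding FS_iff by auto
  have sg: "sg c : Scs T W" if "c : set l" for c
   unfolding sg_def using sa(1) sb(1) lc[OF that] cring.cring_simprules(5)[OF cW] by blast
  have "germ T w W (lsum (sec T W) sg l) = th w (v (p w)) & p w : Dl" if w: "w : W" for w
  proof -
   have z: "p w : Dm U V" using pp[OF Wp(1)[OF w]] Wp(2,3)[OF w] by (simp add: Dm_def p_def)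
   note gh = a.X.germ_hom[OF W w]
   have "germ T w W (lsum (sec T W) sg l) = lsum (stalk T w) (%c. germ T w W (sg c)) l"
    by (rule hom_lsum[OF gh cW a.X.stalk_cring[OF Wp(1)[OF w]]]) (rule sg)
   also have "... = lsum (stalk T w) (%c. smap T a w (germ X (pt a w) U (fst c)) *[stalk T w] smap T b w (germ Y (pt b w) V (snd c))) l"
    using lc sa sb w ring_hom_mult[OF gh] by (intro lsum_cong) (simp add: sg_def)
   also have "... = lsum (stalk T w) (%c. smap T a w (fst c) *[stalk T w] smap T b w (snd c)) (G U V l (pt a w) (pt b w))"
    unfolding G_def by (simp add: lsum_map comp_def)
   also have "... = th w (FG U V l (pt a w) (pt b w))"
    unfolding FG_eq by (rule thu[symmetric, OF Wp(1)[OF w] G_closed[OF 1(1,2) Wp(2,3)[OF w] 1(3)]])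
   finally show ?thesis using 1(5)[OF z] z unfolding 1(4) by (simp add: p_def)
  qed
  moreover have "t : W" using t unfolding 1(4) Dm_def W_def preim_def p_def by simp
  moreover have "lsum (sec T W) sg l : Scs T W" by (rule cring.lsum_closed[OF cW]) (use sg in blast)
  ultimately show ?thesis using W by (intro exI[of _ W] exI[of _ "lsum (sec T W) sg l"] conjI ballI) blast+
 qed
 have D: "DD (p t) = FR (pt a t) (pt b t)" "PP (p t) = {d : carrier (FR (pt a t) (pt b t)). th t d : Mst T t}" for t by (simp_all add: p_def)
 obtain h where h: "mor T FP h" "pt h = p" "!!t d. t : points T ==> d : carrier (DD (p t)) ==> smap T h t (F.dd (p t) d) = th t d"
  by (rule F.morph_into_exists[OF T, of p th, unfolded Z_eq fp_topspace]) (use pp th ex D that in \<open>simp_all\<close>)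
 note H1 = comp_morphism[OF T fp_lrs f.X.lrs h(1) FX_morphism(1), unfolded pt_FX] and H2 = comp_morphism[OF T fp_lrs g.X.lrs h(1) FY_morphism(1), unfolded pt_FY]
 show ?thesis
 proof (rule that[OF h(1)])
  show "meq T X (cmp FP FX h) a"
  proof (rule morph_eqI[OF T f.X.lrs H1(1) a])
   fix t c assume t: "t : points T" and "c : Stk X (pt (cmp FP FX h) t)"
   then have c: "c : Stk X (pt a t)" by (simp add: h(2) p_def)
   show "smap T (cmp FP FX h) t c = smap T a t c"
    using H1(2)[OF t, of c] FX_morphism(2)[OF pp[OF t], of c] h(3)[OF t, of "fin (pt a t) (pt b t) c"] c thl[OF t c]
     ring_hom_closed[OF fin_hom(1)[OF r[OF t]] c] by (simp add: h(2) p_def)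
  qed (simp add: h(2) p_def)
  show "meq T Y (cmp FP FY h) b"
  proof (rule morph_eqI[OF T g.X.lrs H2(1) b])
   fix t c assume t: "t : points T" and "c : Stk Y (pt (cmp FP FY h) t)"
   then have c: "c : Stk Y (pt b t)" by (simp add: h(2) p_def)
   show "smap T (cmp FP FY h) t c = smap T b t c"
    using H2(2)[OF t, of c] FY_morphism(2)[OF pp[OF t], of c] h(3)[OF t, of "fir (pt a t) (pt b t) c"] c thr[OF t c]
     ring_hom_closed[OF fin_hom(2)[OF r[OF t]] c] by (simp add: h(2) p_def)
  qed (simp add: h(2) p_def)
 qed
qed

end

subsection \<open>Charts of schemes\<close>

lemma local_ring_iso:
 assumes R: "local_ring R" and S: "cring S" and h: "h : ring_hom R S" and b: "bij_betw h (carrier R) (carrier S)"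
 shows "local_ring S" "r : carrier R ==> h r : max_ideal S \<longleftrightarrow> r : max_ideal R"
proof -
 note cR = local_ringD(1)[OF R]
 obtain i where i: "i : ring_hom S R" "!!r. r : carrier R ==> i (h r) = r" "!!s. s : carrier S ==> h (i s) = s"
  by (rule inverse_hom[OF cR h b]) (rule that)
 have u: "s : Units S \<longleftrightarrow> i s : Units R" if "s : carrier S" for s
  using hom_Units[OF i(1) S cR, of s] hom_Units[OF h cR S, of "i s"] i(3)[OF that] by auto
 let ?M = "{s : carrier S. i s : max_ideal R}"
 have I: "ideal ?M S" by (rule primeideal.axioms(1)[OF primeideal_vimage[OF i(1) S cR max_ideal_prime[OF R]]])
 have M: "s : ?M \<longleftrightarrow> s ~: Units S" if "s : carrier S" for s
  using u[OF that] max_ideal_iff[OF R ring_hom_closed[OF i(1) that]] that by simp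
 note L = local_ringI[OF S I M]
 show "local_ring S" by (rule L(1))
 show "r : carrier R ==> h r : max_ideal S \<longleftrightarrow> r : max_ideal R" using i(2) ring_hom_closed[OF h] by (simp add: L(2))
qed

context lringed begin

lemma sub_simps:
 assumes "opn U"
 shows "is_open (osub X U) V \<longleftrightarrow> opn V & V <= U" "points (osub X U) = U"
  "sec (osub X U) = sec X" "res (osub X U) = res X"
 using assms opn_sub[OF assms] unfolding open_subspace_def
 by (auto simp: openin_open_subtopology Int_absorb1)

lemma sub_ringed: assumes U: "opn U" shows "ringed_space (osub X U)"
proof -
 have "EX! s. s : Sec (\<Union>UU) & (ALL W:UU. res X (\<Union>UU) W s = sg W)"
  if "ALL W:UU. (opn W & W <= U) & sg W : Sec W" "ALL W:UU. ALL V:UU. res X W (W Int V) (sg W) = res X V (W Int V) (sg V)" for UU sg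
  by (rule glue) (use that in blast)+
 then show ?thesis unfolding ringed_space_def sub_simps[OF U] using sec_cring res_id res_hom res_res by simp
qed

abbreviation "sub_stalk U a == {(V, s) : a. V <= U}"

lemma sub_germ:
 assumes U: "opn U" and "V <= U"
 shows "germ (osub X U) y V s = sub_stalk U (germ X y V s)"
 unfolding germ_def sub_simps[OF U] using assms by auto

lemma sub_stalk_iso:
 assumes U: "opn U" "y : U"
 shows "sub_stalk U : ring_hom (stalk X y) (stalk (osub X U) y)"
  "bij_betw (sub_stalk U) (Stk X y) (Stk (osub X U) y)"
proof -
 interpret W: ringed "osub X U" by unfold_locales (rule sub_ringed[OF U(1)])
 note S = sub_simps[OF U(1)] and G = sub_germ[OF U(1)]
 have y: "y : points X" using opn_sub[OF U(1)] U(2) by blast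
 have cs: "EX V s. opn V & V <= U & y : V & s : Sec V & a = germ X y V s" if a: "a : Stk X y" for a
 proof -
  obtain V s where v: "opn V" "y : V" "s : Sec V" "a = germ X y V s" by (rule stalk_cases[OF a])
  have i: "opn (V Int U)" "V Int U <= V" "y : V Int U" using v U by auto
  show ?thesis using res_closed[OF v(1) i(1,2) v(3)] germ_res[OF v(1) i v(3)] i v(4)
   by (intro exI[of _ "V Int U"] exI[of _ "res X V (V Int U) s"]) simp
 qed
 have cs2: "EX V s t. opn V & V <= U & y : V & s : Sec V & t : Sec V & a = germ X y V s & b = germ X y V t"
  if ab: "a : Stk X y" "b : Stk X y" for a b
 proof -
  obtain V s t u where v: "opn V" "y : V" "s : Sec V" "t : Sec V" "a = germ X y V s" "b = germ X y V t"
   by (rule stalk_common[OF ab(1) ab(2) ab(1)])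
  have i: "opn (V Int U)" "V Int U <= V" "y : V Int U" using v U by auto
  show ?thesis using res_closed[OF v(1) i(1,2)] germ_res[OF v(1) i] i v
   by (intro exI[of _ "V Int U"] exI[of _ "res X V (V Int U) s"] exI[of _ "res X V (V Int U) t"]) simp
 qed
 show hom: "sub_stalk U : ring_hom (stalk X y) (stalk (osub X U) y)"
 proof (rule ring_hom_memI)
  fix a assume "a : Stk X y"
  then obtain V s where v: "opn V" "V <= U" "y : V" "s : Sec V" "a = germ X y V s" using cs by blast
  show "sub_stalk U a : Stk (osub X U) y"
   unfolding v(5) G[OF v(2), symmetric] using v by (intro W.germ_closed) (simp_all add: S)
 next
  fix a b assume ab: "a : Stk X y" "b : Stk X y"
  obtain V s t where v: "opn V" "V <= U" "y : V" "s : Sec V" "t : Sec V" "a = germ X y V s" "b = germ X y V t" using cs2[OF ab] by blast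
  have W: "W.opn V" "s : W.Sec V" "t : W.Sec V" using v by (simp_all add: S)
  show "sub_stalk U (a *[stalk X y] b) = sub_stalk U a *[stalk (osub X U) y] sub_stalk U b"
   using W.germ_mult[OF W(1) v(3) W(2,3)] unfolding v(6,7) germ_mult[OF v(1,3,4,5)] G[OF v(2)] S by simp
  show "sub_stalk U (a +[stalk X y] b) = sub_stalk U a +[stalk (osub X U) y] sub_stalk U b"
   using W.germ_add[OF W(1) v(3) W(2,3)] unfolding v(6,7) germ_add[OF v(1,3,4,5)] G[OF v(2)] S by simp
 next
  have W: "W.opn U" using U by (simp add: S)
  show "sub_stalk U 1[stalk X y] = 1[stalk (osub X U) y]"
   using W.germ_const(1)[OF W U(2)] germ_const(1)[OF U] G[of U] by (simp add: S)
 qed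
 show "bij_betw (sub_stalk U) (Stk X y) (Stk (osub X U) y)"
  unfolding bij_betw_def
 proof
  show "inj_on (sub_stalk U) (Stk X y)"
  proof (rule inj_onI)
  fix a b assume ab: "a : Stk X y" "b : Stk X y" "sub_stalk U a = sub_stalk U b"
  obtain V s t where v: "opn V" "V <= U" "y : V" "s : Sec V" "t : Sec V" "a = germ X y V s" "b = germ X y V t" using cs2[OF ab(1,2)] by blast
  have "(V, s) : sub_stalk U a" using germ_self[OF v(1,3,4)] v by simp
  then have "(V, s) : b" using ab(3) by auto
  then show "a = b" using germ_mem_eq[OF v(1,3,5)] v by simp
  qed
  show "sub_stalk U ` Stk X y = Stk (osub X U) y"
  proof (rule subset_antisym; rule subsetI)
   fix c assume "c : sub_stalk U ` Stk X y"
   then show "c : Stk (osub X U) y" using ring_hom_closed[OF hom] by blast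
 next
  fix c assume "c : Stk (osub X U) y"
  then obtain V s where v: "W.opn V" "y : V" "s : W.Sec V" "c = germ (osub X U) y V s" by (rule W.stalk_cases)
  have "c = sub_stalk U (germ X y V s)" using v G by (simp add: S)
  then show "c : sub_stalk U ` Stk X y" using germ_closed[of V y s] v by (simp add: S image_iff) blast
  qed
 qed
qed

lemma sub_lrs: assumes U: "opn U" shows "lrsp (osub X U)"
proof -
 interpret W: ringed "osub X U" by unfold_locales (rule sub_ringed[OF U])
 have "local_ring (stalk (osub X U) y)" if y: "y : U" for y
  using local_ring_iso(1)[OF stalk_local W.stalk_cring sub_stalk_iso[OF U y]] y opn_sub[OF U] sub_simps(2)[OF U] by blast
 then show ?thesis unfolding locally_ringed_space_def sub_simps(2)[OF U] using W.rs by blast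
qed

end

lemma isomorphism_facts:
 assumes X: "lrsp X" and Y: "lrsp Y" and h: "mor X Y h" and k: "mor Y X k"
  and kh: "meq X X (cmp Y k h) morph_id" and hk: "meq Y Y (cmp X h k) morph_id"
 shows "x : points X ==> pt k (pt h x) = x" "y : points Y ==> pt h (pt k y) = y"
  "x : points X ==> bij_betw (smap X h x) (Stk Y (pt h x)) (Stk X x)"
proof -
 interpret h: lmorph X Y h by unfold_locales (use X Y h in auto)
 interpret k: lmorph Y X k by unfold_locales (rule k)
 note A = comp_morphism[OF X Y X h k] and B = comp_morphism[OF Y X Y k h]
 note iX = id_morphism[OF X] and iY = id_morphism[OF Y]
 note A' = morph_eqD[OF X X A(1) iX(1) kh] and B' = morph_eqD[OF Y Y B(1) iY(1) hk]
 show p: "pt k (pt h x) = x" if "x : points X" for x using A'(1)[OF that] by simp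
 show q: "pt h (pt k y) = y" if "y : points Y" for y using B'(1)[OF that] by simp
 assume x: "x : points X"
 note y = h.pt_closed[OF x] and kx = p[OF x]
 have 1: "smap X h x (smap Y k (pt h x) a) = a" if "a : Stk X x" for a
  using A(2)[OF x, of a] A'(2)[OF x, of a] iX(2)[OF x that] that kx by simp
 have 2: "smap Y k (pt h x) (smap X h x b) = b" if "b : Stk Y (pt h x)" for b
  using B(2)[OF y, of b] B'(2)[OF y, of b] iY(2)[OF y that] that kx by simp
 show "bij_betw (smap X h x) (Stk Y (pt h x)) (Stk X x)"
  by (rule bij_betw_byWitness[where f' = "smap Y k (pt h x)"])
   (use 1 2 h.stalk_map_closed[OF x] k.stalk_map_closed[OF y] kx in auto)
qed

text \<open>What is used of an affine open subset U = Spec R: \<open>Q\<close> identifies its points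
  with the primes of R, \<open>py\<close> turns elements of R into sections, stalks are
  localisations, and the nonvanishing loci form a base.\<close>

locale chart = lringed X for X :: "('p, 'r) rspace" +
 fixes U :: "'p set" and R :: "'c ring" and py :: "'c => 'r" and Q :: "'p => 'c set"
 assumes U: "opn U" and py: "r : carrier R ==> py r : Sec U"
  and Q_inj: "y : U ==> y' : U ==> Q y = Q y' ==> y = y'"
  and Q_surj: "primeideal q R ==> EX y:U. Q y = q"
  and loc: "y : U ==> is_loc R (Q y) (stalk X y) (%r. germ X y U (py r))"
  and base: "opn W ==> y : W ==> y : U ==> EX r:carrier R. r ~: Q y & (ALL w:U. r ~: Q w --> w : W)"

lemma (in lringed) affine_chart:
 assumes "affine_open X U"
 obtains py Q where "chart X U (sec X U) py Q"
proof -
 have U: "opn U" and iso: "isomorphic (osub X U) (Spec (sec X U))" using assms unfolding affine_open_def by blast+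
 let ?W = "osub X U" and ?R = "sec X U"
 note cR = sec_cring[OF U]
 interpret R: spec_ring ?R by (rule spec_ring.intro, rule cR)
 interpret W: lringed ?W by unfold_locales (rule sub_lrs[OF U])
 obtain h k where hk: "mor ?W (Spec ?R) h" "mor (Spec ?R) ?W k"
  "meq ?W ?W (cmp (Spec ?R) k h) morph_id" "meq (Spec ?R) (Spec ?R) (cmp ?W h k) morph_id"
  using iso unfolding isomorphic_def by blast
 interpret h: lmorph ?W "Spec ?R" h by unfold_locales (use R.spec_lrs hk in auto)
 interpret k: lmorph "Spec ?R" ?W k by unfold_locales (rule hk)
 note I = isomorphism_facts[OF W.lrs R.spec_lrs hk, unfolded sub_simps[OF U]]
 define hat where "hat r = (\<lambda>q\<in>points (Spec ?R). loc_frac ?R q r 1[?R])" for r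
 define py where "py r = com h (points (Spec ?R)) (hat r)" for r
 have pre: "preim ?W h (points (Spec ?R)) = U"
  unfolding preim_def using h.pt_closed sub_simps(2)[OF U] by auto
 have hat: "hat r : Scs (Spec ?R) (points (Spec ?R))" if "r : carrier ?R" for r
  using R.spec_hat[OF that] unfolding hat_def .
 have py: "py r : Sec U" if "r : carrier ?R" for r
  using h.com_closed[OF openin_topspace hat[OF that]] unfolding pre py_def sub_simps(3)[OF U] .
 have prim: "primeideal (pt h y) ?R" if "y : U" for y
  using h.pt_closed[of y] that R.spec_points unfolding sub_simps(2)[OF U] by blast
 have g: "germ ?W y U (py r) = smap ?W h y (spec_germ ?R (pt h y) r)" if "y : U" "r : carrier ?R" for y r
  using h.stalk_map_germ[OF _ openin_topspace _ hat[OF that(2)], of y] that(1) h.pt_closed[of y]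
  unfolding sub_simps(2)[OF U] pre py_def spec_germ_def hat_def[symmetric] by simp
 have loc: "is_loc ?R (pt h y) (stalk X y) (%r. germ X y U (py r))" if y: "y : U" for y
 proof -
  have yp: "y : points ?W" "y : points X" using y opn_sub[OF U] by (auto simp: sub_simps[OF U])
  have "is_loc ?R (pt h y) (stalk ?W y) (smap ?W h y o spec_germ ?R (pt h y))"
   by (rule is_loc_comp_iso[OF R.spec_is_loc[OF prim[OF y]] W.stalk_cring[OF yp(1)] h.stalk_map_hom[OF yp(1)] I(3)[OF y]])
  then show ?thesis
   by (rule is_loc_transfer[OF _ stalk_cring[OF yp(2)] sub_stalk_iso[OF U y]])
    (use germ_closed[OF U y py] g[OF y] sub_germ[OF U subset_refl] in simp_all)
 qed
 have "chart X U ?R py (pt h)"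
 proof unfold_locales
  show "opn U" "!!r. r : carrier ?R ==> py r : Sec U" "!!y. y : U ==> is_loc ?R (pt h y) (stalk X y) (%r. germ X y U (py r))"
   using U py loc by blast+
  show "y = y'" if "y : U" "y' : U" "pt h y = pt h y'" for y y'
   by (metis I(1) that)
  show "EX y:U. pt h y = q" if "primeideal q ?R" for q
   using that R.spec_points by (intro bexI[of _ "pt k q"] I(2) k.pt_closed[unfolded sub_simps(2)[OF U]]) simp_all
  fix Wo y assume W: "opn Wo" "y : Wo" "y : U"
  have o: "is_open ?W (Wo Int U)" using opn_Int[OF W(1) U] by (simp add: sub_simps[OF U])
  have "is_open (Spec ?R) (preim (Spec ?R) k (Wo Int U))" by (rule k.preim_open[OF o])
  moreover have "pt h y : preim (Spec ?R) k (Wo Int U)" using W I(1)[OF W(3)] h.pt_closed[of y] by (simp add: preim_def sub_simps[OF U])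
  ultimately obtain Dl v where b: "(Dl, v) : R.const_fns" "pt h y : {z : Dl. v z ~: z}" "{z : Dl. v z ~: z} <= preim (Spec ?R) k (Wo Int U)"
   by (rule R.S.base[folded R.spec_top_eq])
  obtain a where a: "Dl = R.primes" "a : carrier ?R" "!!p. p : R.primes ==> v p = a" using b(1) unfolding R.const_fns_def by auto
  have "w : Wo" if w: "w : U" "a ~: pt h w" for w
  proof -
   have "pt h w : {z : Dl. v z ~: z}" using prim[OF w(1)] w(2) a(3) unfolding a(1) R.primes_def by simp
   then have "pt k (pt h w) : Wo" using b(3) unfolding preim_def by blast
   then show ?thesis using I(1)[OF w(1)] by simp
  qed
  moreover have "a ~: pt h y" using b(2) a(3)[of "pt h y"] unfolding a(1) by auto
  ultimately show "EX r:carrier ?R. r ~: pt h y & (ALL w:U. r ~: pt h w --> w : Wo)" using a(2) by blast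
 qed
 then show ?thesis by (rule that)
qed

subsection \<open>Specialisation\<close>

context lringed begin

definition "gen y y' \<longleftrightarrow> y : points X & y' : points X & (ALL V. opn V --> y : V --> y' : V)"
text \<open>The cospecialisation map from the stalk at y to the stalk at a generisation y'. The
  union is a single germ whenever \<open>gen y y'\<close> holds.\<close>

definition "sp y' a = (\<Union>(V, s)\<in>a. germ X y' V s)"

lemma gen_closure: "y' : points X ==> y : space_top X closure_of {y'} \<longleftrightarrow> gen y y'"
 by (auto simp: gen_def in_closure_of)

lemma sp_germ:
 assumes "gen y y'" and V: "opn V" "y : V" "s : Sec V"
 shows "sp y' (germ X y V s) = germ X y' V s"
proof -
 have g: "opn W ==> y : W ==> y' : W" for W using assms(1) unfolding gen_def by blast
 have "germ X y' W t = germ X y' V s" if m: "(W, t) : germ X y V s" for W t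
 proof -
  obtain W' where w: "opn W" "y : W" "t : Sec W" "opn W'" "y : W'" "W' <= V Int W" "res X V W' s = res X W W' t"
   using m unfolding germ_mem by blast
  show ?thesis using germ_eq_iff[of V y' s W t] w V g by blast
 qed
 then have "sp y' (germ X y V s) = (\<Union>c\<in>germ X y V s. germ X y' V s)"
  unfolding sp_def by (intro SUP_cong HOL.refl) (simp add: split_beta)
 then show ?thesis using germ_self[OF V] by (metis UN_constant empty_iff)
qed

lemma sp_hom: assumes g: "gen y y'" shows "sp y' : ring_hom (stalk X y) (stalk X y')"
proof -
 have m: "opn W ==> y : W ==> y' : W" for W using g unfolding gen_def by blast
 note S = sp_germ[OF g]
 show ?thesis
 proof (rule ring_hom_memI)
  show "sp y' a : Stk X y'" if "a : Stk X y" for a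
   by (rule stalk_cases[OF that]) (use S m germ_closed in simp)
  fix a b assume ab: "a : Stk X y" "b : Stk X y"
  obtain V s t u where v: "opn V" "y : V" "s : Sec V" "t : Sec V" "a = germ X y V s" "b = germ X y V t"
   by (rule stalk_common[OF ab(1) ab(2) ab(1)])
  interpret V: cring "sec X V" by (rule sec_cring[OF v(1)])
  show "sp y' (a *[stalk X y] b) = sp y' a *[stalk X y'] sp y' b"
   using germ_mult[OF v(1-4)] germ_mult[OF v(1) m[OF v(1,2)] v(3,4)] S[OF v(1-3)] S[OF v(1,2,4)] S[OF v(1,2) V.m_closed[OF v(3,4)]] v by simp
  show "sp y' (a +[stalk X y] b) = sp y' a +[stalk X y'] sp y' b"
   using germ_add[OF v(1-4)] germ_add[OF v(1) m[OF v(1,2)] v(3,4)] S[OF v(1-3)] S[OF v(1,2,4)] S[OF v(1,2) V.a_closed[OF v(3,4)]] v by simp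
 next
  have o: "opn (points X)" "y : points X" "y' : points X" using g unfolding gen_def by auto
  interpret V: cring "sec X (points X)" by (rule sec_cring[OF o(1)])
  show "sp y' 1[stalk X y] = 1[stalk X y']"
   using germ_const(1)[OF o(1,2)] germ_const(1)[OF o(1,3)] S[OF o(1,2) V.one_closed] by simp
 qed
qed

end

lemma (in lmorph)
 assumes g: "X.gen x x'"
 shows gen_image: "Y.gen (pt h x) (pt h x')"
  and sp_stalk_map: "a : Stk Y (pt h x) ==> X.sp x' (smap X h x a) = smap X h x' (Y.sp (pt h x') a)"
proof -
 have p: "x : points X" "x' : points X" using g unfolding X.gen_def by auto
 have "pt h x' : V" if "Y.opn V" "pt h x : V" for V
  using g preim_open[OF that(1)] that(2) p unfolding X.gen_def preim_def by blast
 then show g': "Y.gen (pt h x) (pt h x')" using pt_closed p unfolding Y.gen_def by blast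
 assume "a : Stk Y (pt h x)"
 then obtain V s where v: "Y.opn V" "pt h x : V" "s : Y.Sec V" "a = germ Y (pt h x) V s" by (rule Y.stalk_cases)
 have v': "pt h x' : V" using g' v unfolding Y.gen_def by blast
 have "x : preim X h V" using v p by (simp add: preim_def)
 then show "X.sp x' (smap X h x a) = smap X h x' (Y.sp (pt h x') a)"
  unfolding v(4) Y.sp_germ[OF g' v(1-3)] stalk_map_germ[OF p(1) v(1-3)] stalk_map_germ[OF p(2) v(1) v' v(3)]
  using X.sp_germ[OF g preim_open[OF v(1)] _ com_closed[OF v(1,3)]] by blast
qed

context chart begin

lemma basic_open: assumes "r : carrier R" shows "opn {w : U. r ~: Q w}"
proof -
 have "{w : U. r ~: Q w} = {w : U. germ X w U (py r) ~: Mst X w}"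
  using is_loc_local(2)[OF loc assms] by blast
 then show ?thesis using nonvanishing_open[OF U py[OF assms]] by simp
qed

lemma gen_iff:
 assumes "y : U" shows "gen y y' \<longleftrightarrow> y' : U & Q y' <= Q y"
proof
 assume g: "gen y y'"
 have m: "opn W ==> y : W ==> y' : W" for W using g unfolding gen_def by blast
 have y': "y' : U" using m[OF U assms] .
 have "r : Q y" if "r : Q y'" for r
 proof (rule ccontr)
  have "r : carrier R" using that ideal.Icarr[OF primeideal.axioms(1)[OF is_locD(3)[OF loc[OF y']]]] by blast
  moreover assume "r ~: Q y"
  ultimately show False using m[OF basic_open, of r] assms that by blast
 qed
 then show "y' : U & Q y' <= Q y" using y' by blast
next
 assume "y' : U & Q y' <= Q y"
 then show "gen y y'" using base[OF _ _ assms] opn_sub[OF U] assms unfolding gen_def by blast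
qed

lemma sp_mem:
 assumes "gen y y'" "y : U" "r : carrier R"
 shows "sp y' (germ X y U (py r)) : Mst X y' \<longleftrightarrow> r : Q y'"
 using sp_germ[OF assms(1) U assms(2) py[OF assms(3)]] is_loc_local(2)[OF loc assms(3)] gen_iff[OF assms(2)] assms(1) by simp

text \<open>The germs at y that fall into the maximal ideal at y' recover the prime of y' in the
  chart. In \<open>generise\<close> this shows that points of S obtained in different ways are
  equal.\<close>

lemma gen_unique:
 assumes "gen y y'" "gen y y''" "y : U"
  and "!!a. a : Stk X y ==> sp y' a : Mst X y' \<longleftrightarrow> sp y'' a : Mst X y''"
 shows "y' = y''"
proof -
 have i: "y' : U" "y'' : U" using gen_iff[OF assms(3)] assms(1,2) by blast+
 have "r : Q y' \<longleftrightarrow> r : Q y''" if "r : carrier R" for r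
  using sp_mem[OF assms(1,3) that] sp_mem[OF assms(2,3) that] assms(4)[OF germ_closed[OF U assms(3) py[OF that]]] by simp
 moreover have "Q y' <= carrier R" "Q y'' <= carrier R"
  using ideal.Icarr[OF primeideal.axioms(1)[OF is_locD(3)[OF loc[OF i(1)]]]] ideal.Icarr[OF primeideal.axioms(1)[OF is_locD(3)[OF loc[OF i(2)]]]] by blast+
 ultimately show ?thesis using Q_inj[OF i] by blast
qed

text \<open>Generisations of y correspond to primes of its stalk: the prime is contracted to R,
  where the chart provides the point, and cospecialisation becomes the localisation map.\<close>

lemma gen_exists:
 assumes y: "y : U" and P: "primeideal P (stalk X y)"
 obtains y' where "gen y y'" "is_loc (stalk X y) P (stalk X y') (sp y')"
proof -
 note L = loc[OF y]
 let ?dd = "%r. germ X y U (py r)"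
 have "primeideal {r : carrier R. ?dd r : P} R" by (rule primeideal_vimage[OF is_locD(4,1,2)[OF L] P])
 then obtain y' where y': "y' : U" "Q y' = {r : carrier R. ?dd r : P}" using Q_surj by blast
 note L' = loc[OF y'(1)]
 interpret A: cring "stalk X y" by (rule is_locD(2)[OF L])
 interpret B: cring "stalk X y'" by (rule is_locD(2)[OF L'])
 interpret P: primeideal P "stalk X y" by (rule P)
 have nu: "a ~: P" if "a : Units (stalk X y)" for a
  using that P.I_l_closed[of a "inv\<^bsub>stalk X y\<^esub> a"] A.Units_l_inv[of a] primeideal_one[OF P] A.Units_inv_closed by auto
 have sub: "Q y' <= Q y" using y'(2) nu is_locD(5)[OF L] by blast
 have g: "gen y y'" using gen_iff[OF y] sub y' by blast
 note sh = sp_hom[OF g]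
 note [simp] = hom_simps[OF sh A.is_cring B.is_cring]
 have sdd: "sp y' (?dd r) = germ X y' U (py r)" if "r : carrier R" for r by (rule sp_germ[OF g U y py[OF that]])
 have dc: "?dd r : Stk X y" if "r : carrier R" for r by (rule germ_closed[OF U y py[OF that]])
 have "is_loc (stalk X y) P (stalk X y') (sp y')"
  unfolding is_loc_def
 proof (intro conjI ballI impI)
  show "cring (stalk X y)" "cring (stalk X y')" by unfold_locales
  show "primeideal P (stalk X y)" "sp y' : ring_hom (stalk X y) (stalk X y')" by (rule P, rule sh)
 next
  fix a assume a: "a : Stk X y - P"
  then obtain d e where de: "d : carrier R" "e : carrier R" "e ~: Q y" "a *[stalk X y] ?dd e = ?dd d" using is_loc_cases[OF L] by blast
  have "?dd e ~: P" using nu is_locD(5)[OF L de(2,3)] .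
  then have "?dd d ~: P" using primeideal.I_prime[OF P _ dc[OF de(2)]] a de(4) by auto
  then have "d ~: Q y'" unfolding y'(2) by simp
  then have "sp y' a *[stalk X y'] sp y' (?dd e) : Units (stalk X y')"
   using is_locD(5)[OF L' de(1)] sdd[OF de(1)] de(4) a dc[OF de(2)] by (metis DiffD1 ring_hom_mult sh)
  then show "sp y' a : Units (stalk X y')" using Units_mult_iff[OF B.is_cring] a dc[OF de(2)] by simp
 next
  fix b assume "b : Stk X y'"
  then obtain d e where de: "d : carrier R" "e : carrier R" "e ~: Q y'" "b *[stalk X y'] germ X y' U (py e) = germ X y' U (py d)"
   using is_loc_cases[OF L'] by blast
  then show "EX d:Stk X y. EX e:Stk X y - P. b *[stalk X y'] sp y' e = sp y' d"
   using sdd dc y'(2) by (intro bexI[of _ "?dd d"] bexI[of _ "?dd e"]) auto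
 next
  fix a assume a: "a : Stk X y" "sp y' a = 0[stalk X y']"
  then obtain d e where de: "d : carrier R" "e : carrier R" "e ~: Q y" "a *[stalk X y] ?dd e = ?dd d" using is_loc_cases[OF L] by blast
  have "sp y' (a *[stalk X y] ?dd e) = 0[stalk X y']" using a dc[OF de(2)] by simp
  then have "germ X y' U (py d) = 0[stalk X y']" unfolding de(4) sdd[OF de(1)] .
  then obtain u where u: "u : carrier R" "u ~: Q y'" "u *[R] d = 0[R]" using is_locD(6)[OF L' de(1)] by blast
  note dh = hom_simps[OF is_locD(4,1,2)[OF L]]
  have "(?dd u *[stalk X y] a) *[stalk X y] ?dd e = ?dd (u *[R] d)"
   using dh(2)[OF u(1) de(1)] de(4) a dc[OF u(1)] dc[OF de(2)] by (simp add: A.m_assoc)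
  also have "... = 0[stalk X y] *[stalk X y] ?dd e" using u(3) dh(5) dc[OF de(2)] by simp
  finally have "?dd u *[stalk X y] a = 0[stalk X y]"
   using Units_cancel[OF A.is_cring is_locD(5)[OF L de(2,3)]] a dc[OF u(1)] by simp
  then show "EX u:Stk X y - P. u *[stalk X y] a = 0[stalk X y]" using dc[OF u(1)] u y'(2) by (intro bexI[of _ "?dd u"]) auto
 qed
 then show ?thesis by (rule that[OF g])
qed

end

subsection \<open>Integral and locally Noetherian schemes\<close>

text \<open>On a disjoint union of two nonempty opens, the sections that are 1 on one part and 0 on
  the other are nonzero with product zero.\<close>

lemma (in lringed) integral_meet:
 assumes W: "opn W" "W ~= {}" and U: "opn U" "U ~= {}" and dom: "!!V. opn V ==> V ~= {} ==> domain (sec X V)"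
 shows "W Int U ~= {}"
proof
 assume e: "W Int U = {}"
 have o: "opn (W Un U)" using W U by auto
 interpret D: domain "sec X (W Un U)" by (rule dom[OF o]) (use W in blast)
 have ex: "EX s:Sec (W Un U). (ALL x:W. germ X x (W Un U) s = 1[stalk X x]) & (ALL x:U. germ X x (W Un U) s = 0[stalk X x])"
  if W: "opn W" and U: "opn U" and o: "opn (W Un U)" and e: "W Int U = {}" for W U
 proof -
  define gm where "gm x = (if x : W then 1[stalk X x] else 0[stalk X x])" for x
  have exx: "EX V t. opn V & x : V & V <= W Un U & t : Sec V & (ALL w:V. germ X w V t = gm w)" if x: "x : W Un U" for x
  proof (cases "x : W")
   case True
   then show ?thesis using W germ_const(1)[OF W] cring.cring_simprules(6)[OF sec_cring[OF W]]
    by (intro exI[of _ W] exI[of _ "1[sec X W]"]) (auto simp: gm_def)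
  next
   case False
   then show ?thesis using U x e germ_const(2)[OF U] cring.cring_simprules(2)[OF sec_cring[OF U]]
    by (intro exI[of _ U] exI[of _ "0[sec X U]"]) (auto simp: gm_def)
  qed
  obtain s where s: "s : Sec (W Un U)" "!!x. x : W Un U ==> germ X x (W Un U) s = gm x" by (rule glue_germs[OF o exx], assumption, rule that)
  show ?thesis by (rule bexI[OF _ s(1)]) (use s(2) e in \<open>auto simp: gm_def\<close>)
 qed
 obtain s where s: "s : Sec (W Un U)" "ALL x:W. germ X x (W Un U) s = 1[stalk X x]" "ALL x:U. germ X x (W Un U) s = 0[stalk X x]"
  using ex[OF W(1) U(1) o e] by blast
 obtain t where t: "t : Sec (W Un U)" "ALL x:W. germ X x (W Un U) t = 0[stalk X x]" "ALL x:U. germ X x (W Un U) t = 1[stalk X x]"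
  using ex[OF U(1) W(1)] o e by (auto simp: Un_commute Int_commute)
 have z: "germ X x (W Un U) 0[sec X (W Un U)] = 0[stalk X x]" if "x : W Un U" for x using germ_const(2)[OF o that] .
 have c: "cring (stalk X x)" "1[stalk X x] ~= 0[stalk X x]" if "x : W Un U" for x
 proof -
  have x: "x : points X" using that opn_sub[OF o] by blast
  show "cring (stalk X x)" by (rule stalk_cring[OF x])
  show "1[stalk X x] ~= 0[stalk X x]"
   using primeideal_one[OF max_ideal_prime[OF stalk_local[OF x]]] additive_subgroup.zero_closed[OF ideal.axioms(1)[OF max_ideal_ideal[OF stalk_local[OF x]]]] by auto
 qed
 have "s *[sec X (W Un U)] t = 0[sec X (W Un U)]"
 proof (rule sec_eqI[OF o])
  fix x assume x: "x : W Un U"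
  interpret A: cring "stalk X x" by (rule c[OF x])
  have "germ X x (W Un U) s *[stalk X x] germ X x (W Un U) t = 0[stalk X x]" using x s(2,3) t(2,3) by auto
  then show "germ X x (W Un U) (s *[sec X (W Un U)] t) = germ X x (W Un U) 0[sec X (W Un U)]"
   using germ_mult[OF o x s(1) t(1)] z[OF x] by simp
 qed (use s t in auto)
 then have "s = 0[sec X (W Un U)] \<or> t = 0[sec X (W Un U)]" using D.integral s(1) t(1) by blast
 moreover obtain w u where "w : W" "u : U" using W U by blast
 ultimately show False using s(2) t(3) z[of w] z[of u] c(2)[of w] c(2)[of u] by auto
qed

lemma (in lringed) generic_iff:
 "generic_point X z \<longleftrightarrow> z : points X & (ALL W. opn W --> W ~= {} --> z : W)"
proof -
 have "space_top X closure_of {z} = points X \<longleftrightarrow> (ALL W. opn W --> W ~= {} --> z : W)" if "z : points X"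
  using closure_of_subset_topspace[of "space_top X" "{z}"] opn_sub unfolding closure_of_def by blast
 then show ?thesis unfolding generic_point_def by blast
qed

lemma (in chart) chart_domain:
 assumes D: "domain R" and y: "y : U"
 shows "domain (stalk X y)" "Mst X y = {0[stalk X y]} \<longleftrightarrow> Q y = {0[R]}"
proof -
 note L = loc[OF y]
 let ?dd = "%r. germ X y U (py r)"
 interpret R: domain R by (rule D)
 interpret A: cring "stalk X y" by (rule is_locD(2)[OF L])
 note H = hom_simps[OF is_locD(4,1,2)[OF L]]
 note pQ = is_locD(3)[OF L]
 have z: "0[R] : Q y" using additive_subgroup.zero_closed[OF ideal.axioms(1)[OF primeideal.axioms(1)[OF pQ]]] .
 have dd0: "d = 0[R]" if d: "d : carrier R" "?dd d = 0[stalk X y]" for d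
 proof -
  obtain u where "u : carrier R" "u ~: Q y" "u *[R] d = 0[R]" using is_locD(6)[OF L d] by blast
  then show ?thesis using R.integral[of u d] d(1) z by blast
 qed
 have b0: "b = 0[stalk X y]" if "b : Stk X y" "e : carrier R" "e ~: Q y" "b *[stalk X y] ?dd e = 0[stalk X y]" for b e
  using Units_cancel[OF A.is_cring is_locD(5)[OF L that(2,3)] that(1) A.zero_closed] that(4) H(1)[OF that(2)] by simp
 have one: "1[stalk X y] ~= 0[stalk X y]" using dd0[OF R.one_closed] H(4) R.one_not_zero by auto
 show "domain (stalk X y)"
 proof (rule domain.intro[OF A.is_cring], rule domain_axioms.intro[OF one])
  fix a b assume ab: "a *[stalk X y] b = 0[stalk X y]" "a : Stk X y" "b : Stk X y"
  obtain d e where de: "d : carrier R" "e : carrier R" "e ~: Q y" "a *[stalk X y] ?dd e = ?dd d" using is_loc_cases[OF L ab(2)] by blast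
  obtain d' e' where de': "d' : carrier R" "e' : carrier R" "e' ~: Q y" "b *[stalk X y] ?dd e' = ?dd d'" using is_loc_cases[OF L ab(3)] by blast
  note c = H(1)[OF de(2)] H(1)[OF de'(2)] ab(2,3)
  have "?dd (d *[R] d') = (a *[stalk X y] b) *[stalk X y] (?dd e *[stalk X y] ?dd e')"
   unfolding H(2)[OF de(1) de'(1)] de(4)[symmetric] de'(4)[symmetric] using c by (simp add: A.m_ac)
  then have "d *[R] d' = 0[R]" using dd0 ab(1) c de(1) de'(1) by simp
  then have "d = 0[R] \<or> d' = 0[R]" using R.integral de(1) de'(1) by blast
  then show "a = 0[stalk X y] \<or> b = 0[stalk X y]"
   using b0[OF ab(2) de(2,3)] b0[OF ab(3) de'(2,3)] de(4) de'(4) H(5) by auto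
 qed
 show "Mst X y = {0[stalk X y]} \<longleftrightarrow> Q y = {0[R]}"
 proof
  assume m: "Mst X y = {0[stalk X y]}"
  have "r = 0[R]" if "r : Q y" for r
  proof -
   have r: "r : carrier R" using that ideal.Icarr[OF primeideal.axioms(1)[OF pQ]] by blast
   show ?thesis using dd0[OF r] is_loc_local(2)[OF L r] that m by simp
  qed
  then show "Q y = {0[R]}" using z by blast
 next
  assume q: "Q y = {0[R]}"
  note lo = is_loc_local(1)[OF L]
  have "b = 0[stalk X y]" if b: "b : Mst X y" for b
  proof -
   have bc: "b : Stk X y" using b max_ideal_subset[OF lo] by blast
   obtain d e where de: "d : carrier R" "e : carrier R" "e ~: Q y" "b *[stalk X y] ?dd e = ?dd d" using is_loc_cases[OF L bc] by blast
   have "?dd d : Mst X y" using ideal.I_r_closed[OF max_ideal_ideal[OF lo] b H(1)[OF de(2)]] de(4) by simp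
   then have "d = 0[R]" using is_loc_local(2)[OF L de(1)] q by simp
   then show ?thesis using b0[OF bc de(2,3)] de(4) H(5) by simp
  qed
  then show "Mst X y = {0[stalk X y]}"
   using additive_subgroup.zero_closed[OF ideal.axioms(1)[OF max_ideal_ideal[OF lo]]] by blast
 qed
qed

text \<open>Every chart ring is a domain, and within a chart the generic point is the point of the
  zero ideal: it lies in every nonempty basic open of the chart, and by \<open>integral_meet\<close>
  every nonempty open of X meets the chart.\<close>

lemma (in lringed) integral_points:
 assumes F: "integral_scheme X"
 shows "EX! z. generic_point X z"
  "z : points X ==> domain (stalk X z)"
  "z : points X ==> generic_point X z \<longleftrightarrow> Mst X z = {0[stalk X z]}"
proof -
 have dom: "!!V. opn V ==> V ~= {} ==> domain (sec X V)" and ne: "points X ~= {}"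
  and ex: "!!x. x : points X ==> EX U. x : U & affine_open X U"
  using F unfolding integral_scheme_def scheme_def by blast+
 have ch: "EX U py Q. chart X U (sec X U) py Q & z : U & domain (sec X U)" if z: "z : points X" for z
 proof -
  obtain U where U: "z : U" "affine_open X U" using ex[OF z] by blast
  obtain py Q where "chart X U (sec X U) py Q" by (rule affine_chart[OF U(2)])
  moreover have "domain (sec X U)" using dom U unfolding affine_open_def by blast
  ultimately show ?thesis using U(1) by blast
 qed
 have gQ: "generic_point X z \<longleftrightarrow> Q z = {0[R]}" if c: "chart X U R py Q" and z: "z : U" and D: "domain R" for U R py Q z
 proof -
  interpret c: chart X U R py Q by (rule c)
  interpret R: domain R by (rule D)
  have z0: "0[R] : Q y" if "y : U" for y
   using additive_subgroup.zero_closed[OF ideal.axioms(1)[OF primeideal.axioms(1)[OF is_locD(3)[OF c.loc[OF that]]]]] .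
  have zp: "z : points X" using opn_sub[OF c.U] z by blast
  show ?thesis
  proof
   assume g: "generic_point X z"
   have "r = 0[R]" if r: "r : Q z" for r
   proof (rule ccontr)
    assume nz: "r ~= 0[R]"
    have rc: "r : carrier R" using r ideal.Icarr[OF primeideal.axioms(1)[OF is_locD(3)[OF c.loc[OF z]]]] by blast
    \<comment> \<open>The point of the zero ideal shows that the nonvanishing locus of r is
      nonempty. The generic point z would have to lie in it, although r is in
      \<open>Q z\<close>.\<close>
    obtain w where w: "w : U" "Q w = {0[R]}" using c.Q_surj[OF R.zeroprimeideal] by blast
    have "z : {w : U. r ~: Q w}" using g c.basic_open[OF rc] w nz unfolding generic_iff by blast
    then show False using r by blast
   qed
   then show "Q z = {0[R]}" using z0[OF z] by blast
  next
   assume q: "Q z = {0[R]}"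
   have "z : W" if W: "opn W" "W ~= {}" for W
   proof -
    have "W Int U ~= {}" using integral_meet[OF W c.U _ dom] z by blast
    then obtain w where w: "w : W" "w : U" by blast
    obtain r where r: "r : carrier R" "r ~: Q w" "ALL v:U. r ~: Q v --> v : W" using c.base[OF W(1) w] by blast
    show ?thesis using r z0[OF w(2)] z q by auto
   qed
   then show "generic_point X z" unfolding generic_iff using zp by blast
  qed
 qed
 {
  assume "z : points X"
  then obtain U py Q where c: "chart X U (sec X U) py Q" "z : U" "domain (sec X U)" using ch by blast
  have "domain (stalk X z) & (generic_point X z \<longleftrightarrow> Mst X z = {0[stalk X z]})"
   using chart.chart_domain[OF c(1,3,2)] gQ[OF c] by simp
 }
 then show "z : points X ==> domain (stalk X z)"
  "z : points X ==> generic_point X z \<longleftrightarrow> Mst X z = {0[stalk X z]}" by simp_all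
 obtain x where "x : points X" using ne by blast
 then obtain U py Q where c: "chart X U (sec X U) py Q" "x : U" "domain (sec X U)" using ch by blast
 interpret c: chart X U "sec X U" py Q by (rule c(1))
 interpret R: domain "sec X U" by (rule c(3))
 obtain w where w: "w : U" "Q w = {0[sec X U]}" using c.Q_surj[OF R.zeroprimeideal] by blast
 have "z = w" if "generic_point X z" for z
 proof -
  have zU: "z : U" using that c.U c(2) unfolding generic_iff by blast
  show ?thesis by (rule c.Q_inj[OF zU w(1)]) (use that gQ[OF c(1) zU c(3)] w(2) in simp)
 qed
 then show "EX! z. generic_point X z" using gQ[OF c(1) w(1) c(3)] w(2) by blast
qed

text \<open>The finite set consists of the images of generators of the prime \<open>Q x\<close> in a
  noetherian chart. The ring elements that kill b form an ideal, so it contains \<open>Q x\<close>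
  as soon as it contains the generators.\<close>

lemma (in lringed) noetherian_stalk:
 assumes N: "locally_noetherian X" and x: "x : points X"
 obtains A where "finite A" "A <= Mst X x"
  "!!a b. a : Mst X x ==> b : Stk X x ==> ALL c:A. c *[stalk X x] b = 0[stalk X x] ==>
   a *[stalk X x] b = 0[stalk X x]"
proof -
 obtain U where U: "x : U" "affine_open X U" "noetherian_ring (sec X U)" using N x unfolding locally_noetherian_def by blast
 obtain py Q where "chart X U (sec X U) py Q" by (rule affine_chart[OF U(2)])
 then interpret c: chart X U "sec X U" py Q .
 note L = c.loc[OF U(1)]
 let ?dd = "%r. germ X x U (py r)" and ?R = "sec X U"
 interpret A: cring "stalk X x" by (rule is_locD(2)[OF L])
 interpret R: cring ?R by (rule is_locD(1)[OF L])
 note H = hom_simps[OF is_locD(4,1,2)[OF L]]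
 have I: "ideal (Q x) ?R" using primeideal.axioms(1)[OF is_locD(3)[OF L]] .
 obtain B where B: "B <= carrier ?R" "finite B" "Q x = Idl\<^bsub>?R\<^esub> B" using noetherian_ring.finetely_gen[OF U(3) I] by blast
 have BQ: "B <= Q x" unfolding B(3) by (rule R.genideal_self[OF B(1)])
 show ?thesis
 proof (rule that[of "?dd ` B"])
  show "finite (?dd ` B)" using B(2) by simp
  show "?dd ` B <= Mst X x" using is_loc_local(2)[OF L] BQ B(1) by blast
  fix a b assume ab: "a : Mst X x" "b : Stk X x"
   and k: "ALL c:?dd ` B. c *[stalk X x] b = 0[stalk X x]"
  note lo = is_loc_local(1)[OF L]
  have ac: "a : Stk X x" using ab(1) max_ideal_subset[OF lo] by blast
  have "ideal {r : carrier ?R. ?dd r *[stalk X x] b = 0[stalk X x]} ?R"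
   by (rule idealI_cring[OF R.is_cring]) (use H ab(2) in \<open>auto simp: A.l_distr A.m_assoc\<close>)
  moreover have "B <= {r : carrier ?R. ?dd r *[stalk X x] b = 0[stalk X x]}" using k B(1) by blast
  ultimately have Qk: "Q x <= {r : carrier ?R. ?dd r *[stalk X x] b = 0[stalk X x]}" unfolding B(3) by (rule R.genideal_minimal)
  obtain d e where de: "d : carrier ?R" "e : carrier ?R" "e ~: Q x" "a *[stalk X x] ?dd e = ?dd d" using is_loc_cases[OF L ac] by blast
  have "?dd d : Mst X x" using ideal.I_r_closed[OF max_ideal_ideal[OF lo] ab(1) H(1)[OF de(2)]] de(4) by simp
  then have "?dd d *[stalk X x] b = 0[stalk X x]" using is_loc_local(2)[OF L de(1)] Qk by blast
  then have "(a *[stalk X x] b) *[stalk X x] ?dd e = 0[stalk X x]"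
   unfolding de(4)[symmetric] using ac ab(2) H(1)[OF de(2)] by (simp add: A.m_ac)
  then show "a *[stalk X x] b = 0[stalk X x]"
   using Units_cancel[OF A.is_cring is_locD(5)[OF L de(2,3)], of "a *[stalk X x] b" "0[stalk X x]"] ac ab(2) H(1)[OF de(2)] by simp
 qed
qed

section \<open>Transport of integrality along isomorphisms\<close>

lemma isomorphic_trans_half:
 assumes X: "lrsp X" and Y: "lrsp Y" and Z: "lrsp Z"
  and h: "mor X Y h" "mor Y X k" "meq X X (cmp Y k h) morph_id"
  and h': "mor Y Z h'" "mor Z Y k'" "meq Y Y (cmp Z k' h') morph_id"
 shows "mor X Z (cmp Y h' h) & meq X X (cmp Z (cmp Y k k') (cmp Y h' h)) morph_id"
proof -
 interpret h: lmorph X Y h by unfold_locales (use X Y h in auto)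
 interpret h': lmorph Y Z h' by unfold_locales (use Z h' in auto)
 interpret k: lmorph Y X k by unfold_locales (rule h(2))
 interpret k': lmorph Z Y k' by unfold_locales (rule h'(2))
 note a = comp_morphism[OF X Y Z h(1) h'(1)] and b = comp_morphism[OF Z Y X h'(2) h(2)]
 note c = comp_morphism[OF X Z X a(1) b(1)] and iX = id_morphism[OF X] and iY = id_morphism[OF Y]
 note d = comp_morphism[OF X Y X h(1,2)] and e = comp_morphism[OF Y Z Y h'(1,2)]
 note d' = morph_eqD[OF X X d(1) iX(1) h(3)] and e' = morph_eqD[OF Y Y e(1) iY(1) h'(3)]
 have "meq X X (cmp Z (cmp Y k k') (cmp Y h' h)) morph_id"
 proof (rule morph_eqI[OF X X c(1) iX(1)])
  fix x assume x: "x : points X"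
  note y = h.pt_closed[OF x] and z = h'.pt_closed[OF h.pt_closed[OF x]]
  have q: "pt k' (pt h' (pt h x)) = pt h x" "pt k (pt h x) = x" using e'(1)[OF y] d'(1)[OF x] by simp_all
  then show "pt (cmp Z (cmp Y k k') (cmp Y h' h)) x = pt morph_id x" by simp
  fix r assume "r : carrier (stalk X (pt (cmp Z (cmp Y k k') (cmp Y h' h)) x))"
  then have r: "r : Stk X x" using q by simp
  have kr: "smap Y k (pt h x) r : Stk Y (pt h x)" using k.stalk_map_closed[OF y] r q by simp
  have kkr: "smap Z k' (pt h' (pt h x)) (smap Y k (pt h x) r) : Stk Z (pt h' (pt h x))"
   using k'.stalk_map_closed[OF z] kr q by simp
  show "smap X (cmp Z (cmp Y k k') (cmp Y h' h)) x r = smap X morph_id x r"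
   using c(2)[OF x, of r] b(2)[OF z, of r] a(2)[OF x kkr] e(2)[OF y, of "smap Y k (pt h x) r"] e'(2)[OF y, of "smap Y k (pt h x) r"]
    d(2)[OF x, of r] d'(2)[OF x, of r] r q kr iY(2)[OF y kr] by simp
 qed
 then show ?thesis using a(1) by blast
qed

lemma isomorphic_trans:
 assumes X: "lrsp X" and Y: "lrsp Y" and Z: "lrsp Z"
  and XY: "isomorphic X Y" and YZ: "isomorphic Y Z"
 shows "isomorphic X Z"
proof -
 obtain h k where h: "mor X Y h" "mor Y X k"
  "meq X X (cmp Y k h) morph_id" "meq Y Y (cmp X h k) morph_id" using XY unfolding isomorphic_def by blast
 obtain h' k' where h': "mor Y Z h'" "mor Z Y k'"
  "meq Y Y (cmp Z k' h') morph_id" "meq Z Z (cmp Y h' k') morph_id" using YZ unfolding isomorphic_def by blast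
 show ?thesis unfolding isomorphic_def
  using isomorphic_trans_half[OF X Y Z h(1-3) h'(1-3)] isomorphic_trans_half[OF Z Y X h'(2,1,4) h(2,1,4)] by blast
qed

lemma sub_morphism:
 assumes X: "lrsp X" and Y: "lrsp Y" and m: "mor X Y m" and V: "is_open Y V"
 shows "mor (osub X (preim X m V)) (osub Y V) m"
proof -
 interpret m: lmorph X Y m by unfold_locales (use X Y m in auto)
 define W where "W = preim X m V"
 have oW: "is_open X W" unfolding W_def by (rule m.preim_open[OF V])
 note sX = m.X.sub_simps[OF oW] and sY = m.Y.sub_simps[OF V]
 have WX: "x : W \<longleftrightarrow> x : points X & pt m x : V" for x unfolding W_def preim_def by blast
 have pre: "preim (osub X W) m V' = preim X m V'" if "V' <= V" for V'
  using that WX unfolding preim_def sX by blast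
 have sub: "preim X m V' <= W" if "V' <= V" for V' using that WX unfolding preim_def by blast
 have sm: "smap (osub X W) m x ` Mst (osub Y V) (pt m x) <= Mst (osub X W) x"
  if x: "x : W" for x
 proof (rule image_subsetI)
  have x': "x : points X" "pt m x : V" "pt m x : points Y" using x WX m.pt_closed by blast+
  interpret SX: lringed "osub X W" by unfold_locales (rule m.X.sub_lrs[OF oW])
  interpret SY: lringed "osub Y V" by unfold_locales (rule m.Y.sub_lrs[OF V])
  have xs: "x : points (osub X W)" "pt m x : points (osub Y V)" using x x' sX sY by auto
  note iX = m.X.sub_stalk_iso[OF oW x] and iY = m.Y.sub_stalk_iso[OF V x'(2)]
  note lX = local_ring_iso(2)[OF m.X.stalk_local[OF x'(1)] SX.stalk_cring[OF xs(1)] iX]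
   and lY = local_ring_iso(2)[OF m.Y.stalk_local[OF x'(3)] SY.stalk_cring[OF xs(2)] iY]
  fix a assume a: "a : Mst (osub Y V) (pt m x)"
  have "a : m.Y.sub_stalk V ` Stk Y (pt m x)"
   unfolding bij_betw_imp_surj_on[OF iY(2)] using a max_ideal_subset[OF SY.stalk_local[OF xs(2)]] by blast
  then obtain b where b: "a = m.Y.sub_stalk V b" "b : Stk Y (pt m x)" by (rule imageE)
  have bm: "smap X m x b : Mst X x" using a lY[OF b(2)] m.stalk_map_max_iff[OF x'(1) b(2)] unfolding b(1) by simp
  \<comment> \<open>A germ is nonempty; otherwise the union that defines the stalk map would be
    empty instead of a germ.\<close>
  have ne: "a ~= {}"
  proof -
   have "a : Stk (osub Y V) (pt m x)" using a max_ideal_subset[OF SY.stalk_local[OF xs(2)]] by blast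
   then show ?thesis by (rule SY.stalk_cases) (use SY.germ_self in blast)
  qed
  have e: "germ (osub X W) x (preim (osub X W) m (fst c)) (com m (fst c) (snd c)) = m.X.sub_stalk W (smap X m x b)"
   if c: "c : a" for c
  proof -
   have c': "(fst c, snd c) : b" "fst c <= V" using c unfolding b(1) by auto
   obtain V' s where v: "is_open Y V'" "pt m x : V'" "s : Scs Y V'" "b = germ Y (pt m x) V' s" by (rule m.Y.stalk_cases[OF b(2)])
   have d: "is_open Y (fst c)" "pt m x : fst c" "snd c : Scs Y (fst c)" using c'(1) unfolding v(4) m.Y.germ_mem by blast+
   have "germ Y (pt m x) (fst c) (snd c) = b" using m.Y.germ_mem_eq[OF v(1-3)] c'(1) unfolding v(4) by blast
   then show ?thesis using m.stalk_map_germ[OF x'(1) d] m.X.sub_germ[OF oW sub[OF c'(2)]] pre[OF c'(2)] by simp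
  qed
  have "smap (osub X W) m x a = (\<Union>c\<in>a. m.X.sub_stalk W (smap X m x b))"
   unfolding stalk_map_def[of "osub X W"]
  proof (rule SUP_cong[OF HOL.refl])
   fix c assume "c : a"
   then show "(case c of (V, s) => germ (osub X W) x (preim (osub X W) m V) (com m V s)) = m.X.sub_stalk W (smap X m x b)"
    using e[of c] by (cases c) simp
  qed
  also have "... = m.X.sub_stalk W (smap X m x b)" using ne by simp
  finally show "smap (osub X W) m x a : Mst (osub X W) x"
   using lX[OF m.stalk_map_closed[OF x'(1) b(2)]] bm by simp
 qed
 have tX: "space_top (osub X W) = subtopology (space_top X) W" and tY: "space_top (osub Y V) = subtopology (space_top Y) V"
  by (simp_all add: open_subspace_def)
 have c: "continuous_map (space_top (osub X W)) (space_top (osub Y V)) (pt m)"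
  unfolding tX tY continuous_map_in_subtopology
 proof
  show "continuous_map (subtopology (space_top X) W) (space_top Y) (pt m)" by (rule continuous_map_from_subtopology[OF m.cont])
  show "pt m : topspace (subtopology (space_top X) W) \<rightarrow> V" using WX by auto
 qed
 have "mor (osub X W) (osub Y V) m"
  unfolding is_morphism_def
 proof (intro conjI allI impI ballI)
  show "com m V' : ring_hom (sec (osub Y V) V') (sec (osub X W) (preim (osub X W) m V'))"
   if "is_open (osub Y V) V'" for V' using m.com_hom[of V'] that pre[of V'] by (simp add: sX sY)
  show "com m V'' (res (osub Y V) V' V'' s) = res (osub X W) (preim (osub X W) m V') (preim (osub X W) m V'') (com m V' s)"
   if "is_open (osub Y V) V'" "is_open (osub Y V) V''" "V'' <= V'" "s : Scs (osub Y V) V'" for V' V'' s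
   using m.com_res[of V' V'' s] that pre[of V'] pre[of V''] by (simp add: sX sY)
 qed (use c sm sX in simp_all)
 then show ?thesis unfolding W_def .
qed

lemma sub_inverse:
 assumes X: "lrsp X" and Y: "lrsp Y" and h: "mor X Y h" and k: "mor Y X k"
  and kh: "meq X X (cmp Y k h) morph_id" and U: "is_open Y U" and V: "is_open X V"
  and UV: "!!W. W <= V ==> preim Y k W <= U"
 shows "meq (osub X V) (osub X V) (cmp (osub Y U) k h) morph_id"
proof -
 interpret h: lmorph X Y h by unfold_locales (use X Y h in auto)
 have "preim (osub Y U) k W = preim Y k W" if "W <= V" for W
  using UV[OF that] unfolding preim_def h.Y.sub_simps[OF U] using h.Y.opn_sub[OF U] by blast
 then show ?thesis using kh h.X.opn_sub[OF V] unfolding morph_eq_def morph_comp_def morph_id_def h.X.sub_simps[OF V] by auto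
qed

lemma isomorphic_restrict:
 assumes X: "lrsp X" and Y: "lrsp Y" and h: "mor X Y h" "mor Y X k"
  "meq X X (cmp Y k h) morph_id" "meq Y Y (cmp X h k) morph_id"
  and U: "is_open Y U"
 shows "isomorphic (osub X (preim X h U)) (osub Y U)"
  "EX j. j : ring_hom (sec Y U) (sec X (preim X h U)) & bij_betw j (Scs Y U) (Scs X (preim X h U))"
proof -
 interpret h: lmorph X Y h by unfold_locales (use X Y h in auto)
 interpret k: lmorph Y X k by unfold_locales (rule h(2))
 note I = isomorphism_facts[OF X Y h]
 let ?U = "preim X h U"
 have oU: "is_open X ?U" by (rule h.preim_open[OF U])
 have kp: "preim Y k ?U = U" unfolding preim_def using I(2) k.pt_closed h.Y.opn_sub[OF U] by auto
 have kh: "com h (preim Y k V) (com k V s) = s" if "is_open X V" "s : Scs X V" for V s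
  using h(3) that unfolding morph_eq_def morph_comp_def morph_id_def by simp
 have hk: "com k (preim X h V) (com h V s) = s" if "is_open Y V" "s : Scs Y V" for V s
  using h(4) that unfolding morph_eq_def morph_comp_def morph_id_def by simp
 show "EX j. j : ring_hom (sec Y U) (sec X ?U) & bij_betw j (Scs Y U) (Scs X ?U)"
 proof (intro exI conjI)
  show "com h U : ring_hom (sec Y U) (sec X ?U)" by (rule h.com_hom[OF U])
  show "bij_betw (com h U) (Scs Y U) (Scs X ?U)"
   by (rule bij_betw_byWitness[where f' = "com k ?U"])
    (use kh[OF oU] hk[OF U] h.com_closed[OF U] k.com_closed[OF oU] kp in auto)
 qed
 show "isomorphic (osub X ?U) (osub Y U)" unfolding isomorphic_def
 proof (intro exI conjI)
  show "mor (osub X ?U) (osub Y U) h" by (rule sub_morphism[OF X Y h(1) U])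
  show "mor (osub Y U) (osub X ?U) k" using sub_morphism[OF Y X h(2) oU] unfolding kp .
  show "meq (osub X ?U) (osub X ?U) (cmp (osub Y U) k h) morph_id"
   by (rule sub_inverse[OF X Y h(1-3) U oU]) (use k.preim_mono kp in blast)
  show "meq (osub Y U) (osub Y U) (cmp (osub X ?U) h k) morph_id"
   by (rule sub_inverse[OF Y X h(2,1,4) oU U]) (rule h.preim_mono)
 qed
qed

lemma Spec_map_inv:
 assumes R: "cring R" and A: "cring A" and ph: "ph : ring_hom R A" and ci: "ci : ring_hom A R"
  and inv: "!!r. r : carrier R ==> ci (ph r) = r"
 shows "meq (Spec R) (Spec R) (cmp (Spec A) (Spec_map R A ph) (Spec_map A R ci)) morph_id"
proof -
 interpret R: spec_ring R by (rule spec_ring.intro, rule R)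
 have id: "(%r. r) : ring_hom R R" by (simp add: ring_hom_def)
 have "meq (Spec R) (Spec R) (cmp (Spec A) (Spec_map R A ph) (Spec_map A R ci)) (Spec_map R R (%r. r))"
  by (rule Spec_map_comp[OF R A R ph ci]) (simp add: inv)
 then show ?thesis using Spec_map_id[OF R, of "%r. r"] unfolding morph_eq_def by auto
qed

lemma isomorphic_Spec:
 assumes R: "cring R" and A: "cring A" and j: "j : ring_hom R A" "bij_betw j (carrier R) (carrier A)"
 shows "isomorphic (Spec A) (Spec R)"
proof -
 obtain i where i: "i : ring_hom A R" and ij: "!!r. r : carrier R ==> i (j r) = r" and ji: "!!a. a : carrier A ==> j (i a) = a"
  by (rule inverse_hom[OF R j]) (rule that)
 show ?thesis unfolding isomorphic_def
  by (intro exI conjI, rule Spec_map_morphism(1)[OF R A j(1)], rule Spec_map_morphism(1)[OF A R i])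
   (rule Spec_map_inv[OF A R i j(1)], use ji in simp, rule Spec_map_inv[OF R A j(1) i], use ij in simp)
qed

text \<open>Affine opens of Y are pulled back to X. As \<open>affine_open\<close> refers to the
  spectrum of the sections on the open set itself, the isomorphism of section rings has to be turned
  into one of spectra.\<close>

lemma integral_scheme_iso:
 assumes X: "lrsp X" and iso: "isomorphic X Y" and Y: "integral_scheme Y"
 shows "integral_scheme X"
proof -
 have lY: "lrsp Y" and afY: "!!y. y : points Y ==> EX U. y : U & affine_open Y U" and neY: "points Y ~= {}"
  and dY: "!!U. is_open Y U ==> U ~= {} ==> domain (sec Y U)" using Y unfolding integral_scheme_def scheme_def by blast+
 obtain h k where h: "mor X Y h" "mor Y X k"
  "meq X X (cmp Y k h) morph_id" "meq Y Y (cmp X h k) morph_id" using iso unfolding isomorphic_def by blast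
 interpret h: lmorph X Y h by unfold_locales (use X lY h in auto)
 interpret k: lmorph Y X k by unfold_locales (rule h(2))
 note I = isomorphism_facts[OF X lY h] and res = isomorphic_restrict[OF X lY h]
 have af: "EX V. x : V & affine_open X V" if x: "x : points X" for x
 proof -
  obtain U where U: "pt h x : U" "affine_open Y U" using afY[OF h.pt_closed[OF x]] by blast
  have oU: "is_open Y U" and aU: "isomorphic (osub Y U) (Spec (sec Y U))" using U(2) unfolding affine_open_def by blast+
  let ?V = "preim X h U"
  have oV: "is_open X ?V" by (rule h.preim_open[OF oU])
  obtain j where j: "j : ring_hom (sec Y U) (sec X ?V)" "bij_betw j (Scs Y U) (Scs X ?V)" using res(2)[OF oU] by blast
  interpret R: spec_ring "sec Y U" by (rule spec_ring.intro, rule h.Y.sec_cring[OF oU])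
  interpret A: spec_ring "sec X ?V" by (rule spec_ring.intro, rule h.X.sec_cring[OF oV])
  have "isomorphic (Spec (sec Y U)) (Spec (sec X ?V))" using isomorphic_Spec[OF R.R A.R j] unfolding isomorphic_def by blast
  then have "isomorphic (osub X ?V) (Spec (sec X ?V))"
   using isomorphic_trans[OF h.X.sub_lrs[OF oV] h.Y.sub_lrs[OF oU] A.spec_lrs res(1)[OF oU]]
    isomorphic_trans[OF h.Y.sub_lrs[OF oU] R.spec_lrs A.spec_lrs aU] by blast
  moreover have "x : ?V" using U(1) x by (simp add: preim_def)
  ultimately show ?thesis using oV unfolding affine_open_def by (intro exI[of _ ?V] conjI)
 qed
 have "domain (sec X V)" if V: "is_open X V" "V ~= {}" for V
 proof -
  let ?U = "preim Y k V"
  have oU: "is_open Y ?U" by (rule k.preim_open[OF V(1)])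
  have e: "preim X h ?U = V" using I(1) h.pt_closed h.X.opn_sub[OF V(1)] unfolding preim_def by auto
  obtain v where "v : V" using V by blast
  then have "pt h v : ?U" using I(1)[of v] h.pt_closed[of v] h.X.opn_sub[OF V(1)] unfolding preim_def by auto
  then interpret D: domain "sec Y ?U" using dY[OF oU] by blast
  obtain j where j: "j : ring_hom (sec Y ?U) (sec X V)" "bij_betw j (Scs Y ?U) (Scs X V)" using res(2)[OF oU] unfolding e by blast
  interpret A: cring "sec X V" by (rule h.X.sec_cring[OF V(1)])
  obtain i where i: "i : ring_hom (sec X V) (sec Y ?U)" "!!a. a : Scs X V ==> j (i a) = a"
   by (rule inverse_hom[OF D.is_cring j]) (rule that)
  note H = hom_simps[OF i(1) A.is_cring D.is_cring] and jz = hom_zero[OF j(1) D.is_cring A.is_cring]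
  show ?thesis
  proof (rule domain.intro[OF A.is_cring], rule domain_axioms.intro)
   show "1[sec X V] ~= 0[sec X V]" using H(4,5) D.one_not_zero by auto
   fix a b assume ab: "a *[sec X V] b = 0[sec X V]" "a : Scs X V" "b : Scs X V"
   then have "i a = 0[sec Y ?U] \<or> i b = 0[sec Y ?U]" using D.integral[of "i a" "i b"] H(1,5) H(2)[OF ab(2,3)] by simp
   then show "a = 0[sec X V] \<or> b = 0[sec X V]" using i(2)[OF ab(2)] i(2)[OF ab(3)] jz by auto
  qed
 qed
 moreover have "points X ~= {}" using neY k.pt_closed by blast
 ultimately show ?thesis using af X unfolding integral_scheme_def scheme_def by blast
qed

subsection \<open>Base change of fibres\<close>

lemma morph_eq_refl: "meq X Y h h"
 and morph_eq_sym: "meq X Y h k ==> meq X Y k h"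
 and morph_eq_trans[trans]: "meq X Y h k ==> meq X Y k l ==> meq X Y h l"
 by (simp_all add: morph_eq_def)

lemma comp_cong_left:
 assumes k: "mor Y Z k" and e: "meq X Y h h'"
 shows "meq X Z (cmp Y k h) (cmp Y k h')"
proof -
 have "com h (preim Y k W) (com k W s) = com h' (preim Y k W) (com k W s)" if W: "is_open Z W" "s : Scs Z W" for W s
 proof -
  have "is_open Y (preim Y k W)" using k W(1) unfolding is_morphism_def preim_def continuous_map_def by simp
  moreover have "com k W s : Scs Y (preim Y k W)"
   by (rule ring_hom_closed[OF _ W(2)]) (use k W(1) in \<open>simp add: is_morphism_def\<close>)
  ultimately show ?thesis using e by (simp add: morph_eq_def)
 qed
 then show ?thesis using e unfolding morph_eq_def morph_comp_def by simp
qed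

lemma comp_cong_right:
 assumes h: "mor X Y h" and e: "meq Y Z k k'"
 shows "meq X Z (cmp Y k h) (cmp Y k' h)"
proof -
 have "pt h x : points Y" if "x : points X" for x using h that by (auto simp: is_morphism_def continuous_map_def)
 moreover have "preim Y k W = preim Y k' W" for W using e unfolding morph_eq_def preim_def by auto
 ultimately show ?thesis using e unfolding morph_eq_def morph_comp_def by simp
qed

text \<open>A genuine equality and not merely \<open>morph_eq\<close>, so that composites can be
  rebracketed by unfolding.\<close>

lemma comp_assoc:
 assumes k: "mor Y Z k"
 shows "cmp Z l (cmp Y k h) = cmp Y (cmp Z l k) h"
proof -
 have "preim Y k (preim Z l W) = preim Y (cmp Z l k) W" for W
  using k unfolding preim_def is_morphism_def continuous_map_def by auto
 then show ?thesis unfolding morph_comp_def by (auto simp: fun_eq_iff preim_def)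
qed

lemma comp_id_left:
 assumes "mor X Y h" "meq Y Y i morph_id"
 shows "meq X Y (cmp Y i h) h"
proof -
 have "preim Y i V = V" if "is_open Y V" for V
  using assms(2) openin_subset[OF that] unfolding preim_def morph_eq_def morph_id_def by auto
 moreover have "pt h x : points Y" if "x : points X" for x using assms(1) that by (auto simp: is_morphism_def continuous_map_def)
 ultimately show ?thesis using assms(2) unfolding morph_eq_def morph_comp_def morph_id_def by simp
qed

locale at_point = P: fp_pair X Y S f g
 for X :: "('x, 'a) rspace" and Y :: "('y, 'b) rspace" and S :: "('s, 'o) rspace"
  and f :: "('x, 'a, 's, 'o) morph" and g :: "('y, 'b, 's, 'o) morph" +
 fixes et :: 'x
 assumes et: "et : points X"
begin

abbreviation "s0 == pt f et"
abbreviation "k == residue_field S s0"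
abbreviation "K == residue_field X et"
abbreviation "ph == residue_map X S f et"
abbreviation "SK == Spec K"
abbreviation "Sk == Spec k"
abbreviation "pX == point_map X et"
abbreviation "pS == point_map S s0"
abbreviation "mK == cmp X f pX"
abbreviation "Ys == fibre Y g S s0"
abbreviation "AX == fp_proj1 Y g S Sk pS"
abbreviation "AY == fibre_str Y g S s0"

lemma s0: "s0 : points S" by (rule P.f.pt_closed[OF et])
lemma K_field: "field K" and k_field: "field k" using P.f.X.resid_field[OF et] P.f.Y.resid_field[OF s0] .
lemma K_cring: "cring K" and k_cring: "cring k" using P.f.X.resid_cring[OF et] P.f.Y.resid_cring[OF s0] .
lemma SK_lrs: "lrsp SK" and Sk_lrs: "lrsp Sk"
 using spec_ring.spec_lrs[OF spec_ring.intro] K_cring k_cring by blast+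
lemma pX: "mor SK X pX" and pS: "mor Sk S pS"
 using P.f.X.point_map_morphism(1)[OF et] P.f.Y.point_map_morphism(1)[OF s0] .
lemma mK: "mor SK S mK" by (rule comp_morphism(1)[OF SK_lrs P.f.X.lrs P.f.Y.lrs pX P.f.morph])

text \<open>\<open>A\<close> is the fibre Y_s over s = f(et), and \<open>C\<close> is Spec
  \<kappa>(et) \<times>_S Y, the model of (Y_s)_\<eta> in which the proof computes.\<close>

sublocale A: fp_pair Y Sk S g pS
 by unfold_locales (use P.g.X.lrs P.f.Y.lrs P.g.morph Sk_lrs pS in auto)
sublocale C: fp_pair SK Y S mK g
 by unfold_locales (use SK_lrs mK in auto)

lemma Ys_eq: "A.FP = Ys" and AY_eq: "A.FY = AY" by (simp_all add: fibre_def fibre_str_def)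
lemmas Ys_lrs = A.fp_lrs[unfolded Ys_eq]
lemmas AX = A.FX_morphism(1)[unfolded Ys_eq]
lemmas AY = A.FY_morphism(1)[unfolded Ys_eq AY_eq]
lemmas A_square = A.fp_square[unfolded Ys_eq AY_eq]
lemmas A_univ = A.fp_univ[unfolded Ys_eq AY_eq]
lemmas A_monic = A.fp_monic[unfolded Ys_eq AY_eq]

end

text \<open>\<open>K'\<close> is a copy of the residue field K by way of \<open>j\<close>. There are
  two instances: the image of K in the type for which geometric integrality is assumed, and K
  itself, which gives \<open>fibre_at\<close>.\<close>

locale base_changed = at_point X Y S f g et
 for X :: "('x, 'a) rspace" and Y :: "('y, 'b) rspace" and S :: "('s, 'o) rspace"
  and f :: "('x, 'a, 's, 'o) morph" and g :: "('y, 'b, 's, 'o) morph" and et :: 'x +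
 fixes K' :: "'k ring" and j :: "('x, 'a) residue => 'k" and ph' :: "('s, 'o) residue => 'k"
 assumes K': "cring K'" and j: "j : ring_hom K K'" "bij_betw j (carrier K) (carrier K')"
  and ph': "c : carrier k ==> ph' c = j (ph c)"
begin

lemma ph'_hom: "ph' : ring_hom k K'"
proof -
 have "j o ph : ring_hom k K'" by (rule ring_hom_trans[OF P.f.residue_map_hom[OF et] j(1)])
 moreover have "cring k" by (rule k_cring)
 ultimately show ?thesis using ph' cring.cring_simprules(1,5,6)[of k] unfolding ring_hom_def by (auto simp: Pi_iff)
qed

abbreviation "SK' == Spec K'"
abbreviation "e == Spec_map k K ph"
abbreviation "e' == Spec_map k K' ph'"
abbreviation "jj == Spec_map K K' j"

lemma SK'_lrs: "lrsp SK'" using spec_ring.spec_lrs[OF spec_ring.intro] K' by blast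
lemma e: "mor SK Sk e" by (rule Spec_map_morphism(1)[OF k_cring K_cring P.f.residue_map_hom[OF et]])
lemma e': "mor SK' Sk e'" by (rule Spec_map_morphism(1)[OF k_cring K' ph'_hom])
lemma jj: "mor SK' SK jj" by (rule Spec_map_morphism(1)[OF K_cring K' j(1)])
lemma ej: "meq SK' Sk (cmp SK e jj) e'"
 by (rule Spec_map_comp[OF k_cring K_cring K' P.f.residue_map_hom[OF et] j(1) ph'])
lemma sq: "meq SK S mK (cmp Sk pS e)" by (rule P.f.point_map_square[OF et])

sublocale B: fp_pair Ys SK' Sk AY e'
 by unfold_locales (use Ys_lrs AY SK'_lrs e' Sk_lrs in auto)

lemma B_eq: "base_change k Ys AY K' ph' = B.FP" by (simp add: base_change_def)

abbreviation "cX == cmp SK' jj B.FY"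
abbreviation "cY == cmp Ys AX B.FX"

lemma cX: "mor B.FP SK cX" and cY: "mor B.FP Y cY"
 using comp_morphism(1)[OF B.fp_lrs SK'_lrs SK_lrs B.FY_morphism(1) jj]
  comp_morphism(1)[OF B.fp_lrs Ys_lrs P.g.X.lrs B.FX_morphism(1) AX] .

lemma e_cX: "meq B.FP Sk (cmp SK e cX) (cmp SK' e' B.FY)"
 unfolding comp_assoc[OF jj] by (rule comp_cong_right[OF B.FY_morphism(1) ej])

lemma c_square: "meq B.FP S (cmp SK mK cX) (cmp Y g cY)"
proof -
 have "meq B.FP S (cmp SK mK cX) (cmp SK (cmp Sk pS e) cX)" by (rule comp_cong_right[OF cX sq])
 also have "meq B.FP S ... (cmp Sk pS (cmp SK e cX))" unfolding comp_assoc[OF e] by (rule morph_eq_refl)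
 also have "meq B.FP S ... (cmp Sk pS (cmp SK' e' B.FY))" by (rule comp_cong_left[OF pS e_cX])
 also have "meq B.FP S ... (cmp Sk pS (cmp Ys AY B.FX))" by (rule comp_cong_left[OF pS morph_eq_sym[OF B.fp_square]])
 also have "meq B.FP S ... (cmp Ys (cmp Y g AX) B.FX)"
  unfolding comp_assoc[OF AY] by (rule comp_cong_right[OF B.FX_morphism(1) morph_eq_sym[OF A_square]])
 also have "meq B.FP S ... (cmp Y g cY)" unfolding comp_assoc[OF AX] by (rule morph_eq_refl)
 finally show ?thesis .
qed

text \<open>Transitivity of base change: Spec K -> S factors through Spec k, so base change of Y_s
  from k to K' is the same as base change of Y from S to Spec K. The two morphisms come from
  universal properties, and their composites are identities because they are so after each
  projection.\<close>

lemma base_change_iso: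
 obtains h h' where "mor B.FP C.FP h" "mor C.FP B.FP h'"
  "meq B.FP B.FP (cmp C.FP h' h) morph_id" "meq C.FP C.FP (cmp B.FP h h') morph_id"
  "meq B.FP SK (cmp C.FP C.FX h) cX" "meq B.FP Y (cmp C.FP C.FY h) cY"
proof -
 obtain h where h: "mor B.FP C.FP h" "meq B.FP SK (cmp C.FP C.FX h) cX" "meq B.FP Y (cmp C.FP C.FY h) cY"
  by (rule C.fp_univ[OF B.fp_lrs cX cY c_square])
 obtain i where i: "i : ring_hom K' K" "!!r. r : carrier K ==> i (j r) = r" "!!a. a : carrier K' ==> j (i a) = a"
  by (rule inverse_hom[OF K_cring j]) (rule that)
 let ?i = "Spec_map K' K i"
 have ii: "mor SK SK' ?i" by (rule Spec_map_morphism(1)[OF K' K_cring i(1)])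
 have ji: "meq SK SK (cmp SK' jj ?i) morph_id" by (rule Spec_map_inv[OF K_cring K' j(1) i(1,2)])
 have ij: "meq SK' SK' (cmp SK ?i jj) morph_id" by (rule Spec_map_inv[OF K' K_cring i(1) j(1) i(3)])
 have e'i: "meq SK Sk (cmp SK' e' ?i) e"
  by (rule Spec_map_comp[OF k_cring K' K_cring ph'_hom i(1)]) (use ph' i(2) ring_hom_closed[OF P.f.residue_map_hom[OF et]] in simp)
 note CX = C.FX_morphism(1) and CY = C.FY_morphism(1) and BX = B.FX_morphism(1) and BY = B.FY_morphism(1)
 have eCX: "mor C.FP Sk (cmp SK e C.FX)" by (rule comp_morphism(1)[OF C.fp_lrs SK_lrs Sk_lrs CX e])
 have "meq C.FP S (cmp Y g C.FY) (cmp SK mK C.FX)" by (rule morph_eq_sym[OF C.fp_square])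
 also have "meq C.FP S ... (cmp Sk pS (cmp SK e C.FX))" unfolding comp_assoc[OF e] by (rule comp_cong_right[OF CX sq])
 \<comment> \<open>The inverse is built from two components: \<open>l\<close>, to Y_s, and the
   projection to Spec K followed by the inverse of \<open>jj\<close>.\<close>
 finally obtain l where l: "mor C.FP Ys l" "meq C.FP Y (cmp Ys AX l) C.FY" "meq C.FP Sk (cmp Ys AY l) (cmp SK e C.FX)"
  by (rule A_univ[OF C.fp_lrs CY eCX])
 have iCX: "mor C.FP SK' (cmp SK ?i C.FX)" by (rule comp_morphism(1)[OF C.fp_lrs SK_lrs SK'_lrs CX ii])
 have "meq C.FP Sk (cmp Ys AY l) (cmp SK e C.FX)" by (rule l(3))
 also have "meq C.FP Sk ... (cmp SK' e' (cmp SK ?i C.FX))"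
  unfolding comp_assoc[OF ii] by (rule comp_cong_right[OF CX morph_eq_sym[OF e'i]])
 finally obtain h' where h': "mor C.FP B.FP h'" "meq C.FP Ys (cmp B.FP B.FX h') l" "meq C.FP SK' (cmp B.FP B.FY h') (cmp SK ?i C.FX)"
  by (rule B.fp_univ[OF C.fp_lrs l(1) iCX])
 have hh': "mor C.FP C.FP (cmp B.FP h h')" and h'h: "mor B.FP B.FP (cmp C.FP h' h)"
  by (rule comp_morphism(1)[OF C.fp_lrs B.fp_lrs C.fp_lrs h'(1) h(1)], rule comp_morphism(1)[OF B.fp_lrs C.fp_lrs B.fp_lrs h(1) h'(1)])
 note idC = id_morphism(1)[OF C.fp_lrs] and idB = id_morphism(1)[OF B.fp_lrs]
 have idr: "meq T Z m (cmp T m morph_id)" if "mor T Z m" for T Z m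
 proof -
  have "preim T m W <= points T" for W unfolding preim_def by blast
  then show ?thesis unfolding morph_eq_def morph_comp_def morph_id_def by simp
 qed
 have 1: "meq C.FP C.FP (cmp B.FP h h') morph_id"
 proof (rule C.fp_monic[OF C.fp_lrs hh' idC])
  have "meq C.FP SK (cmp C.FP C.FX (cmp B.FP h h')) (cmp B.FP cX h')"
   unfolding comp_assoc[OF h(1)] by (rule comp_cong_right[OF h'(1) h(2)])
  also have "meq C.FP SK ... (cmp SK' jj (cmp B.FP B.FY h'))" unfolding comp_assoc[OF BY] by (rule morph_eq_refl)
  also have "meq C.FP SK ... (cmp SK' jj (cmp SK ?i C.FX))" by (rule comp_cong_left[OF jj h'(3)])
  also have "meq C.FP SK ... C.FX" unfolding comp_assoc[OF ii] by (rule comp_id_left[OF CX ji])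
  finally show "meq C.FP SK (cmp C.FP C.FX (cmp B.FP h h')) (cmp C.FP C.FX morph_id)"
   by (rule morph_eq_trans[OF _ idr[OF CX]])
  have "meq C.FP Y (cmp C.FP C.FY (cmp B.FP h h')) (cmp B.FP cY h')"
   unfolding comp_assoc[OF h(1)] by (rule comp_cong_right[OF h'(1) h(3)])
  also have "meq C.FP Y ... (cmp Ys AX (cmp B.FP B.FX h'))" unfolding comp_assoc[OF BX] by (rule morph_eq_refl)
  also have "meq C.FP Y ... (cmp Ys AX l)" by (rule comp_cong_left[OF AX h'(2)])
  also note l(2)
  finally show "meq C.FP Y (cmp C.FP C.FY (cmp B.FP h h')) (cmp C.FP C.FY morph_id)"
   by (rule morph_eq_trans[OF _ idr[OF CY]])
 qed
 \<comment> \<open>The component to Y_s is a morphism into a fibre product, so equality is tested on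
   the two projections of Y_s.\<close>
 have lh: "meq B.FP Ys (cmp C.FP l h) B.FX"
 proof (rule A_monic[OF B.fp_lrs comp_morphism(1)[OF B.fp_lrs C.fp_lrs Ys_lrs h(1) l(1)] BX])
  have "meq B.FP Y (cmp Ys AX (cmp C.FP l h)) (cmp C.FP C.FY h)"
   unfolding comp_assoc[OF l(1)] by (rule comp_cong_right[OF h(1) l(2)])
  also note h(3)
  finally show "meq B.FP Y (cmp Ys AX (cmp C.FP l h)) cY" .
  have "meq B.FP Sk (cmp Ys AY (cmp C.FP l h)) (cmp C.FP (cmp SK e C.FX) h)"
   unfolding comp_assoc[OF l(1)] by (rule comp_cong_right[OF h(1) l(3)])
  also have "meq B.FP Sk ... (cmp SK e cX)" unfolding comp_assoc[OF CX, symmetric] by (rule comp_cong_left[OF e h(2)])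
  also note e_cX
  also have "meq B.FP Sk (cmp SK' e' B.FY) (cmp Ys AY B.FX)" by (rule morph_eq_sym[OF B.fp_square])
  finally show "meq B.FP Sk (cmp Ys AY (cmp C.FP l h)) (cmp Ys AY B.FX)" .
 qed
 have 2: "meq B.FP B.FP (cmp C.FP h' h) morph_id"
 proof (rule B.fp_monic[OF B.fp_lrs h'h idB])
  have "meq B.FP Ys (cmp B.FP B.FX (cmp C.FP h' h)) (cmp C.FP l h)"
   unfolding comp_assoc[OF h'(1)] by (rule comp_cong_right[OF h(1) h'(2)])
  also note lh
  finally show "meq B.FP Ys (cmp B.FP B.FX (cmp C.FP h' h)) (cmp B.FP B.FX morph_id)"
   by (rule morph_eq_trans[OF _ idr[OF BX]])
  have "meq B.FP SK' (cmp B.FP B.FY (cmp C.FP h' h)) (cmp C.FP (cmp SK ?i C.FX) h)"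
   unfolding comp_assoc[OF h'(1)] by (rule comp_cong_right[OF h(1) h'(3)])
  also have "meq B.FP SK' ... (cmp SK ?i cX)" unfolding comp_assoc[OF CX, symmetric] by (rule comp_cong_left[OF ii h(2)])
  also have "meq B.FP SK' ... B.FY" unfolding comp_assoc[OF jj] by (rule comp_id_left[OF BY ij])
  finally show "meq B.FP SK' (cmp B.FP B.FY (cmp C.FP h' h)) (cmp B.FP B.FY morph_id)"
   by (rule morph_eq_trans[OF _ idr[OF BY]])
 qed
 show ?thesis by (rule that[OF h(1) h'(1) 2 1 h(2,3)])
qed

end

subsection \<open>Associated primes of a flat base change\<close>

text \<open>\<open>alg\<close> contains the structure map as a function, whereas the stalk map of
  Spec \<kappa>(et) -> S is known to equal the composite through the stalk at et only on the
  carrier.\<close>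

lemma tensor_alg_cong:
 assumes R: "cring R" and A: "cring A" and C: "cring C"
  and ph: "ph : ring_hom R A" "ph' : ring_hom R A" and e: "!!r. r : carrier R ==> ph r = ph' r"
 shows "tensor_class R (alg ph A) N = tensor_class R (alg ph' A) N" "tensor R (alg ph A) N = tensor R (alg ph' A) N"
proof -
 have half: "tensor_eq R (alg ph' A) N u v" if "tensor_eq R (alg ph A) N u v" and e: "!!r. r : carrier R ==> ph r = ph' r" for ph ph' u v
  using tensor_eq_map[OF that(1), of id "alg ph' A"] e by simp
 have "tensor_eq R (alg ph A) N = tensor_eq R (alg ph' A) N"
  by (intro ext iffI) (erule half, simp add: e)+
 then show 1: "tensor_class R (alg ph A) N = tensor_class R (alg ph' A) N"
  unfolding tensor_class_def by simp
 have "formal_mult (alg ph A) N = formal_mult (alg ph' A) N" by (intro ext) (simp add: formal_mult_def)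
 then show "tensor R (alg ph A) N = tensor R (alg ph' A) N" unfolding tensor_def 1 by simp
qed

lemma tensor_rings_comp:
 assumes "tensor_rings R A C ph py" "cring A'" "q : ring_hom A A'"
 shows "tensor_rings R A' C (q o ph) py"
 using assms ring_hom_trans unfolding tensor_rings_def by blast

lemma (in tensor_rings) inl_mult_cls:
 assumes a: "a : carrier A" and v: "v : V"
 shows "inl a *[T] cls v = cls (map (%x. (a *[A] fst x, snd x)) v)"
proof -
 have "snd x : carrier C" if "x : set v" for x using v that by auto
 then have "fm [(a, 1[C])] v = map (%x. (a *[A] fst x, snd x)) v" by simp
 moreover have "inl a *[T] cls v = cls (fm [(a, 1[C])] v)" unfolding inl_def using a v by (intro T_mult) auto
 ultimately show ?thesis by (simp only:)
qed

lemma (in tensor_rings) T_map: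
 assumes A': "cring A'" and q: "q : ring_hom A A'"
 obtains Q where "Q : ring_hom T (tensor R (alg (q o ph) A') (alg py C))"
  "!!v. v : V ==> Q (cls v) = tensor_class R (alg (q o ph) A') (alg py C) (map (%x. (q (fst x), snd x)) v)"
  "!!a. a : carrier A ==> Q (inl a) = tensor_rings.inl R A' C (q o ph) py (q a)"
  "!!c. c : carrier C ==> Q (inr c) = tensor_rings.inr R A' C (q o ph) py c"
proof -
 interpret T': tensor_rings R A' C "q o ph" py by (rule tensor_rings_comp[OF tensor_rings_axioms A' q])
 have h: "T'.inl o q : ring_hom A T'.T" by (rule ring_hom_trans[OF q T'.inl_hom])
 have eq: "(T'.inl o q) (ph r) = T'.inr (py r)" if "r : carrier R" for r using T'.inl_inr[OF that] by simp
 obtain Q where Q: "Q : ring_hom T T'.T" "!!u. u : V ==> Q (cls u) = lsum T'.T (%x. (T'.inl o q) (fst x) *[T'.T] T'.inr (snd x)) u"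
  "!!a. a : carrier A ==> Q (inl a) = (T'.inl o q) a" "!!c. c : carrier C ==> Q (inr c) = T'.inr c"
  by (rule T_lift[OF T'.cT h T'.inr_hom eq]) (assumption, rule that)
 show ?thesis
 proof (rule that[OF Q(1) _ _ Q(4)])
  fix v assume v: "v : V"
  let ?w = "map (%x. (q (fst x), snd x)) v"
  have p: "q (fst x) : carrier A'" "snd x : carrier C" if "x : set v" for x using v that ring_hom_closed[OF q] by auto
  then have w: "?w : T'.V" by auto
  have "T'.cls ?w = lsum T'.T (%x. T'.pure (fst x) (snd x)) ?w" by (rule T'.cls_lsum[OF w])
  also have "... = lsum T'.T (%x. T'.pure (q (fst x)) (snd x)) v" by (simp add: lsum_map comp_def)
  also have "... = lsum T'.T (%x. (T'.inl o q) (fst x) *[T'.T] T'.inr (snd x)) v" using p T'.pure_eq by (intro lsum_cong) simp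
  finally show "Q (cls v) = T'.cls ?w" using Q(2)[OF v] by simp
 qed (use Q(3) in simp)
qed

text \<open>The algebra at one point of the fibre over et: K plays the residue field of A, while B
  and B' are the local rings of this point on X \<times>_S Y and on the fibre. That p' pulls back to
  p is required of every map with the values of the canonical one, since that map is obtained only
  afterwards, as \<open>mm\<close>.\<close>

locale flat_point = flat_tensor R A C ph py
 for R :: "'r ring" and A :: "'a ring" and C :: "'c ring" and ph py +
 fixes K :: "'k ring" and ka :: "'a => 'k"
  and p and B :: "'b ring" and dd and p' and B' :: "'d ring" and dd'
 assumes A_local: "local_ring A" and K: "cring K" and ka: "ka : ring_hom A K"
  and ka_surj: "c : carrier K ==> EX a:carrier A. ka a = c"
  and ka_ker: "a : carrier A ==> ka a = 0[K] \<longleftrightarrow> a : max_ideal A"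
  and B: "is_loc T p B dd" and B': "is_loc (tensor R (alg (ka o ph) K) (alg py C)) p' B' dd'"
  and p_eq: "!!Q d. Q : ring_hom T (tensor R (alg (ka o ph) K) (alg py C)) ==>
   (!!a. a : carrier A ==> Q (inl a) = tensor_rings.inl R K C (ka o ph) py (ka a)) ==>
   (!!c. c : carrier C ==> Q (inr c) = tensor_rings.inr R K C (ka o ph) py c) ==>
   d : carrier T ==> d : p \<longleftrightarrow> Q d : p'"
begin

sublocale T': tensor_rings R K C "ka o ph" py by (rule tensor_rings_comp[OF tensor_rings_axioms K ka])

abbreviation "m == max_ideal A"

lemma m_ideal: "ideal m A" and m_sub: "m <= carrier A" and m_one: "1[A] ~: m"
 using max_ideal_ideal[OF A_local] max_ideal_subset[OF A_local] primeideal_one[OF max_ideal_prime[OF A_local]] .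

definition "is_map Q \<longleftrightarrow> Q : ring_hom T T'.T & (ALL v:V. Q (cls v) = T'.cls (map (%x. (ka (fst x), snd x)) v)) &
  (ALL d:carrier T. d : p \<longleftrightarrow> Q d : p')"
definition "mm = (SOME Q. is_map Q)"

lemma mm: "mm : ring_hom T T'.T" "v : V ==> mm (cls v) = T'.cls (map (%x. (ka (fst x), snd x)) v)"
 "d : carrier T ==> d : p \<longleftrightarrow> mm d : p'"
proof -
 obtain Q where Q: "Q : ring_hom T T'.T" "!!v. v : V ==> Q (cls v) = T'.cls (map (%x. (ka (fst x), snd x)) v)"
  "!!a. a : carrier A ==> Q (inl a) = T'.inl (ka a)" "!!c. c : carrier C ==> Q (inr c) = T'.inr c"
  by (rule T_map[OF K ka]) (rule that)
 have "is_map Q" unfolding is_map_def using Q(1,2) p_eq[OF Q(1,3,4)] by (intro conjI ballI)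
 then have "is_map mm" unfolding mm_def using someI[of is_map Q] by simp
 then show "mm : ring_hom T T'.T" "v : V ==> mm (cls v) = T'.cls (map (%x. (ka (fst x), snd x)) v)"
  "d : carrier T ==> d : p \<longleftrightarrow> mm d : p'" unfolding is_map_def by simp_all
qed

lemmas mm_simps = hom_simps[OF mm(1) cT T'.cT]

lemma mm_surj: assumes "d' : carrier T'.T" obtains d where "d : carrier T" "mm d = d'"
proof -
 obtain u where u: "u : T'.V" "d' = T'.cls u" by (rule T'.T_cases[OF assms])
 have "EX v:V. map (%x. (ka (fst x), snd x)) v = u" using u(1)
 proof (induction u)
  case (Cons c u)
  then obtain v where v: "v : V" "map (%x. (ka (fst x), snd x)) v = u" by auto
  obtain a where a: "a : carrier A" "ka a = fst c" using ka_surj[of "fst c"] Cons.prems by auto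
  show ?case using v a Cons.prems by (intro bexI[of _ "(a, snd c) # v"]) auto
 qed simp
 then obtain v where v: "v : V" "map (%x. (ka (fst x), snd x)) v = u" by (rule bexE)
 show ?thesis by (rule that[OF cls_closed[OF v(1)]]) (unfold mm(2)[OF v(1)] v(2) u(2), rule HOL.refl)
qed

abbreviation "eo d == dd' (mm d)"
lemma eo_hom: "(%d. eo d) : ring_hom T B'"
 using ring_hom_trans[OF mm(1) is_locD(4)[OF B']] by (simp add: comp_def)
lemmas eo_simps = hom_simps[OF eo_hom cT is_locD(2)[OF B']]
lemmas dd_simps = hom_simps[OF is_locD(4)[OF B] cT is_locD(2)[OF B]]

lemma eo_p: "d : carrier T ==> eo d : max_ideal B' \<longleftrightarrow> d : p"
 using is_loc_local(2)[OF B' mm_simps(1)] mm(3) by simp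

lemma eo_unit: "d : carrier T ==> d ~: p ==> eo d : Units B'"
 using is_locD(5)[OF B' mm_simps(1)] mm(3) by simp

text \<open>An element of T vanishes in B' if a multiple of it vanishes in K \<otimes> C, and
  \<open>flat_kernel\<close> with b = 1 rewrites such a multiple with left factors in
  \<open>m\<close>. So, up to factors outside p, the kernel of T -> B' is generated by
  \<open>m\<close>.\<close>

lemma eo_zero:
 assumes "d : carrier T" "eo d = 0[B']"
 obtains u w where "u : carrier T" "u ~: p" "set w <= m \<times> carrier C" "u *[T] d = cls w"
proof -
 obtain u' where u': "u' : carrier T'.T" "u' ~: p'" "u' *[T'.T] mm d = 0[T'.T]"
  using is_locD(6)[OF B' mm_simps(1)[OF assms(1)] assms(2)] by blast
 obtain u where u: "u : carrier T" "mm u = u'" by (rule mm_surj[OF u'(1)])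
 have up: "u ~: p" using mm(3)[OF u(1)] u(2) u'(2) by simp
 obtain v where v: "v : V" "u *[T] d = cls v" by (rule T_cases[OF T.m_closed[OF u(1) assms(1)]])
 have "T'.cls (map (%x. (ka (fst x), snd x)) v) = 0[T'.T]"
  using mm(2)[OF v(1)] v(2) mm_simps(2)[OF u(1) assms(1)] u(2) u'(3) by simp
 moreover have "map (%x. (ka (fst x), snd x)) v = map (%x. (ka (fst x) *[K] 1[K], snd x)) v"
  using v(1) ring_hom_closed[OF ka] by (auto simp: T'.A.r_one)
 ultimately have z: "T'.cls (map (%x. (ka (fst x) *[K] 1[K], snd x)) v) = 0[T'.T]" by simp
 have v': "set v <= carrier A \<times> carrier C" using v(1) by simp
 obtain w where w: "set w <= {n : carrier A. ka n *[K] 1[K] = 0[K]} \<times> carrier C" "cls v = cls w"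
  by (rule flat_kernel[OF flat_tensor_axioms K ka T'.A.one_closed A.oneideal v' z])
 have "{n : carrier A. ka n *[K] 1[K] = 0[K]} <= m" using ka_ker ring_hom_closed[OF ka] by auto
 then show ?thesis using that[OF u(1) up _ HOL.trans[OF v(2) w(2)]] w(1) by blast
qed

lemma eo_m: assumes "set w <= m \<times> carrier C" shows "eo (cls w) = 0[B']"
proof -
 have w: "w : V" and sC: "!!x. x : set w ==> snd x : carrier C" using assms m_sub by auto
 have k0: "ka a = 0[K]" if "a : m" for a using ka_ker m_sub that by blast
 have "T'.cls (map (%x. (ka (fst x), snd x)) w) = T'.cls (map (%x. (0[K], snd x)) w)"
  using assms k0 by (intro arg_cong[of _ _ T'.cls] map_cong HOL.refl) force
 also have "... = lsum T'.T (%x. T'.pure (fst x) (snd x)) (map (%x. (0[K], snd x)) w)" using assms by (intro T'.cls_lsum) auto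
 also have "... = lsum T'.T (%x. 0[T'.T]) w" unfolding lsum_map using sC by (intro lsum_cong) (simp add: T'.pure_zero_left)
 also have "... = 0[T'.T]" by (rule T'.T.lsum_zero) simp
 finally show ?thesis using mm(2)[OF w] hom_simps(5)[OF is_locD(4,1,2)[OF B']] by simp
qed

lemma kill_m:
 assumes "a : carrier A" "!!c. c : m ==> c *[A] a = 0[A]" "set w <= m \<times> carrier C"
 shows "inl a *[T] cls w = 0[T]"
proof -
 have w: "w : V" and sC: "!!x. x : set w ==> snd x : carrier C" using assms m_sub by auto
 have "inl a *[T] cls w = cls (map (%x. (a *[A] fst x, snd x)) w)" by (rule inl_mult_cls[OF assms(1) w])
 also have "... = cls (map (%x. (0[A], snd x)) w)"
  using assms m_sub by (intro arg_cong[of _ _ cls] map_cong HOL.refl) (force simp: A.m_comm[of a])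
 also have "... = lsum T (%x. pure (fst x) (snd x)) (map (%x. (0[A], snd x)) w)" using assms by (intro cls_lsum) auto
 also have "... = lsum T (%x. 0[T]) w" unfolding lsum_map comp_def using sC by (intro lsum_cong) (simp add: pure_zero_left)
 also have "... = 0[T]" by (rule T.lsum_zero) simp
 finally show ?thesis .
qed

text \<open>The case q = id of \<open>flat_kernel\<close>, in which the kernel on N is the
  annihilator of \<open>a\<close> in N.\<close>

lemma kill_inl:
 assumes a: "a : carrier A" and N: "ideal N A" and v: "set v <= N \<times> carrier C" and z: "inl a *[T] cls v = 0[T]"
 obtains w where "set w <= {n : N. n *[A] a = 0[A]} \<times> carrier C" "cls v = cls w"
proof -
 have vV: "v : V" using v ideal.Icarr[OF N] by blast
 have "map (%x. (a *[A] fst x, snd x)) v = map (%x. (id (fst x) *[A] a, snd x)) v"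
  using vV a by (intro map_cong HOL.refl) (force simp: A.m_comm)
 then have "cls (map (%x. (id (fst x) *[A] a, snd x)) v) = 0[T]" using z unfolding inl_mult_cls[OF a vV] by (simp only:)
 moreover have "id : ring_hom A A" by (simp add: ring_hom_def)
 ultimately obtain w where "set w <= {n : N. id n *[A] a = 0[A]} \<times> carrier C" "cls v = cls w"
  by (rule_tac flat_kernel[OF flat_tensor_axioms cA _ a N v, of id]) (simp_all add: id_comp)
 then show ?thesis using that by simp
qed

text \<open>The witness is the image of a \<otimes> 1. As the maximal ideal of B' is zero, a
  multiple of each element of p by something outside p comes from m \<otimes> C, which kills a
  \<otimes> 1. Conversely, whatever kills a \<otimes> 1 in T comes from ann(a) \<otimes> C = m
  \<otimes> C and lies in p.\<close>

lemma ass_from_fibre: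
 assumes a: "a : carrier A" "m = annihilator A a" and z: "max_ideal B' = {0[B']}"
 shows "EX b:carrier B. max_ideal B = annihilator B b"
proof
 interpret B: cring B by (rule is_locD(2)[OF B])
 note lB = is_loc_local(1)[OF B]
 have am: "c *[A] a = 0[A]" if "c : m" for c using that a(2) unfolding annihilator_def by blast
 let ?b = "dd (inl a)"
 show b: "?b : carrier B" using dd_simps(1) a(1) by simp
 have k: "b *[B] ?b = 0[B]" if bm: "b : max_ideal B" for b
 proof -
  have bc: "b : carrier B" using bm max_ideal_subset[OF lB] by blast
  obtain d e where de: "d : carrier T" "e : carrier T" "e ~: p" "b *[B] dd e = dd d" by (rule is_loc_cases[OF B bc])
  have "dd d : max_ideal B" using ideal.I_r_closed[OF max_ideal_ideal[OF lB] bm dd_simps(1)[OF de(2)]] de(4) by simp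
  then have "eo d = 0[B']" using is_loc_local(2)[OF B de(1)] eo_p[OF de(1)] z by simp
  then obtain u w where u: "u : carrier T" "u ~: p" "set w <= m \<times> carrier C" "u *[T] d = cls w" by (rule eo_zero[OF de(1)])
  have "inl a *[T] (u *[T] d) = 0[T]" unfolding u(4) by (rule kill_m[OF a(1) am u(3)])
  then have "dd (inl a *[T] (u *[T] d)) = 0[B]" using dd_simps(5) by simp
  then have "(?b *[B] dd d) *[B] dd u = 0[B] *[B] dd u"
   using dd_simps(1,2) u(1) de(1) a(1) by (simp add: B.m_ac)
  then have "?b *[B] dd d = 0[B]"
   using Units_cancel[OF B.is_cring is_locD(5)[OF B u(1,2)]] dd_simps(1)[OF de(1)] b by simp
  then have "(b *[B] ?b) *[B] dd e = 0[B] *[B] dd e"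
   unfolding de(4)[symmetric] using dd_simps(1)[OF de(2)] b bc by (simp add: B.m_ac)
  then show ?thesis using Units_cancel[OF B.is_cring is_locD(5)[OF B de(2,3)]] b bc by simp
 qed
 have n: "b : max_ideal B" if bc: "b : carrier B" "b *[B] ?b = 0[B]" for b
 proof (rule ccontr)
  assume "b ~: max_ideal B"
  then have "b : Units B" using max_ideal_iff[OF lB bc(1)] by blast
  then have "?b = 0[B]" using Units_cancel[OF B.is_cring _ b B.zero_closed, of b] bc b by (simp add: B.m_comm)
  then obtain u where u: "u : carrier T" "u ~: p" "u *[T] inl a = 0[T]" using is_locD(6)[OF B, of "inl a"] a(1) by auto
  obtain v where v: "v : V" "u = cls v" by (rule T_cases[OF u(1)])
  have "inl a *[T] cls v = 0[T]" using u v a(1) by (simp add: T.m_comm)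
  then obtain w where w: "set w <= {n : carrier A. n *[A] a = 0[A]} \<times> carrier C" "cls v = cls w"
   by (rule kill_inl[OF a(1) A.oneideal, rotated]) (use v in auto)
  have "eo u = 0[B']" unfolding v(2) w(2) by (rule eo_m) (use w(1) a(2) in \<open>auto simp: annihilator_def\<close>)
  then show False using eo_p[OF u(1)] z u(2) by simp
 qed
 show "max_ideal B = annihilator B ?b" unfolding annihilator_def using k n max_ideal_subset[OF lB] by blast
qed

end

text \<open>Recursion along the list lets \<open>torsion\<close> split off one generator at a time.
  Two instances occur: \<open>h = inl\<close> with coefficients in the tensor ring, and the identity
  with coefficients in A.\<close>

primrec lin :: "'t ring => ('a => 't) => 'a list => 't => bool" where
 "lin T h [] x \<longleftrightarrow> x = 0[T]"
| "lin T h (a # as) x \<longleftrightarrow> (EX d:carrier T. EX y. lin T h as y & x = h a *[T] d +[T] y)"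

context
 fixes T :: "'t ring" and h :: "'a => 't"
 assumes T: "cring T"
begin

interpretation cring T by (rule T)

lemma lin_closed: "lin T h as x ==> h ` set as <= carrier T ==> x : carrier T"
 by (induction as arbitrary: x) auto

lemma lin_zero: "h ` set as <= carrier T ==> lin T h as 0[T]"
proof (induction as)
 case (Cons a as)
 then show ?case by (auto intro!: bexI[of _ "0[T]"] exI[of _ "0[T]"])
qed simp

lemma lin_add: "lin T h as x ==> lin T h as y ==> h ` set as <= carrier T ==> lin T h as (x +[T] y)"
proof (induction as arbitrary: x y)
 case (Cons a as)
 obtain d u where d: "d : carrier T" "lin T h as u" "x = h a *[T] d +[T] u" using Cons.prems(1) by auto
 obtain e v where e: "e : carrier T" "lin T h as v" "y = h a *[T] e +[T] v" using Cons.prems(2) by auto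
 have c: "h a : carrier T" "u : carrier T" "v : carrier T" using Cons.prems(3) lin_closed[OF d(2)] lin_closed[OF e(2)] by auto
 have "x +[T] y = h a *[T] (d +[T] e) +[T] (u +[T] v)" unfolding d(3) e(3) using c d(1) e(1) by (simp add: r_distr a_ac)
 then show ?case using Cons.IH[OF d(2) e(2)] Cons.prems(3) d(1) e(1) by (auto intro!: bexI[of _ "d +[T] e"] exI[of _ "u +[T] v"])
qed simp

lemma lin_mult: "lin T h as x ==> c : carrier T ==> h ` set as <= carrier T ==> lin T h as (c *[T] x)"
proof (induction as arbitrary: x)
 case (Cons a as)
 obtain d u where d: "d : carrier T" "lin T h as u" "x = h a *[T] d +[T] u" using Cons.prems(1) by auto
 have c: "h a : carrier T" "u : carrier T" using Cons.prems(3) lin_closed[OF d(2)] by auto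
 have "c *[T] x = h a *[T] (c *[T] d) +[T] c *[T] u" unfolding d(3) using c d(1) Cons.prems(2) by (simp add: r_distr m_ac)
 then show ?case using Cons.IH[OF d(2)] Cons.prems(2,3) d(1) by (auto intro!: bexI[of _ "c *[T] d"] exI[of _ "c *[T] u"])
qed simp

lemma lin_mem: "a : set as ==> h ` set as <= carrier T ==> lin T h as (h a)"
proof (induction as)
 case (Cons b as)
 show ?case
 proof (cases "a = b")
  case True
  then show ?thesis using Cons.prems lin_zero[of as] by (auto intro!: bexI[of _ "1[T]"] exI[of _ "0[T]"])
 next
  case False
  then have "lin T h as (h a)" using Cons by simp
  then show ?thesis using Cons.prems lin_closed[of as "h a"] by (auto intro!: bexI[of _ "0[T]"] exI[of _ "h a"])
 qed
qed simp

lemma lin_ideal: "h ` set as <= carrier T ==> ideal {x. lin T h as x} T"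
 by (rule idealI_cring[OF T]) (use lin_closed lin_zero lin_add lin_mult in auto)

lemma lin_vanish:
 assumes "Q : ring_hom T T'" "cring T'" "lin T h as x" "h ` set as <= carrier T" "!!a. a : set as ==> Q (h a) = 0[T']"
 shows "Q x = 0[T']"
proof -
 interpret T': cring T' by (rule assms(2))
 note H = hom_simps[OF assms(1) T assms(2)]
 show ?thesis using assms(3-5)
 proof (induction as arbitrary: x)
  case (Cons a as)
  obtain d u where d: "d : carrier T" "lin T h as u" "x = h a *[T] d +[T] u" using Cons.prems(1) by auto
  have c: "h a : carrier T" "u : carrier T" using Cons.prems(2) lin_closed[OF d(2)] by auto
  show ?case unfolding d(3) using c d(1) Cons.IH[OF d(2)] Cons.prems(2,3) H by simp
 qed (use H in simp)
qed

end

section \<open>The socle and the descent of associated points to the base\<close>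

context flat_point begin

abbreviation "lT == lin T inl"

lemma inl_sub: "set as <= carrier A ==> inl ` set as <= carrier T" by auto

lemma lin_cls: "w : V ==> lT (map fst w) (cls w)"
proof (induction w)
 case (Cons c w)
 have c: "fst c : carrier A" "snd c : carrier C" "w : V" using Cons.prems by auto
 have "cls (c # w) = cls [c] +[T] cls w" using Cons.prems by simp
 also have "cls [c] = inl (fst c) *[T] inr (snd c)" using pure_eq[OF c(1,2)] by simp
 finally show ?case using Cons.IH[OF c(3)] c by (auto intro!: bexI[of _ "inr (snd c)"] exI[of _ "cls w"])
qed (simp add: T_zero)

lemma lin_inl:
 assumes "lin A (%a. a) as a" "set as <= carrier A" "d : carrier T" shows "lT as (inl a *[T] d)"
 using assms(1,2)
proof (induction as arbitrary: a)
 case Nil then show ?case using assms(3) by simp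
next
 case (Cons b as)
 obtain r u where r: "r : carrier A" "lin A (%a. a) as u" "a = b *[A] r +[A] u" using Cons.prems(1) by auto
 have c: "b : carrier A" "u : carrier A" using Cons.prems(2) lin_closed[OF cA r(2)] by auto
 have "inl a *[T] d = inl b *[T] (inl r *[T] d) +[T] inl u *[T] d"
  unfolding r(3) using c r(1) assms(3) by (simp add: T.l_distr T.m_assoc)
 then show ?case using Cons.IH[OF r(2)] Cons.prems(2) r(1) assms(3) by (auto intro!: bexI[of _ "inl r *[T] d"] exI[of _ "inl u *[T] d"])
qed

definition "soc = {n : carrier A. ALL a:m. a *[A] n = 0[A]}"

lemma unit_notin: "a : carrier A ==> a ~: m ==> a : Units A" using max_ideal_iff[OF A_local] by blast

text \<open>The socle of \<open>A\<close> is a vector space over the residue field, so its base change is a free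
 module over the domain \<open>B'\<close>, up to localisation.\<close>
lemma torsion:
 assumes dom: "domain B'" and t: "t : carrier T" "eo t ~= 0[B']"
 shows "set as <= soc ==> lT as x ==> t *[T] x = 0[T] ==> EX u:carrier T. u ~: p & u *[T] x = 0[T]"
proof (induction as arbitrary: x)
 case Nil
 then show ?case using primeideal_one[OF is_locD(3)[OF B]] by (intro bexI[of _ "1[T]"]) auto
next
 case (Cons a as)
 interpret B': domain B' by (rule dom)
 obtain d y where d: "d : carrier T" "lT as y" "x = inl a *[T] d +[T] y" using Cons.prems(2) by auto
 have sA: "set as <= carrier A" "a : carrier A" and sa: "set as <= soc" using Cons.prems(1) unfolding soc_def by auto
 have am: "c *[A] a = 0[A]" if "c : m" for c using Cons.prems(1) that unfolding soc_def by auto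
 note yc = lin_closed[OF cT d(2) inl_sub[OF sA(1)]]
 have xc: "x : carrier T" unfolding d(3) using d(1) yc sA by simp
 have idA: "(%a. a) ` set as <= carrier A" using sA by simp
 define W where "W = {b. lin A (%a. a) as b}"
 have W: "ideal W A" unfolding W_def by (rule lin_ideal[OF cA idA])
 show ?case
 proof (cases "a : W")
  case True
  then have "lT as (inl a *[T] d)" unfolding W_def using lin_inl sA(1) d(1) by blast
  then have "lT as x" unfolding d(3) by (rule lin_add[OF cT _ d(2) inl_sub[OF sA(1)]])
  then show ?thesis using Cons.IH[OF sa _ Cons.prems(3)] by blast
 next
  case False
  let ?q = "(+>\<^bsub>A\<^esub>) W"
  interpret W: ideal W A by (rule W)
  have cW: "cring (A Quot W)" by (rule W.quotient_is_cring[OF cA])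
  interpret AW: cring "A Quot W" by (rule cW)
  have q: "?q : ring_hom A (A Quot W)" by (rule W.rcos_ring_hom)
  note qs = hom_simps[OF q cA cW]
  have "0[A Quot W] = W" by (simp add: FactRing_def)
  then have q0: "?q n = 0[A Quot W] \<longleftrightarrow> n : W" if "n : carrier A" for n
   using W.rcos_const_imp_mem[OF that] W.a_rcos_const[of n] by (simp only:) metis
  obtain v where v: "v : V" "t *[T] d = cls v" by (rule T_cases[OF T.m_closed[OF t(1) d(1)]])
  obtain Q where Q: "Q : ring_hom T (tensor R (alg (?q o ph) (A Quot W)) (alg py C))"
   "!!v. v : V ==> Q (cls v) = tensor_class R (alg (?q o ph) (A Quot W)) (alg py C) (map (%x. (?q (fst x), snd x)) v)"
   "!!a. a : carrier A ==> Q (inl a) = tensor_rings.inl R (A Quot W) C (?q o ph) py (?q a)"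
   by (rule T_map[OF cW q]) (rule that)
  interpret W': tensor_rings R "A Quot W" C "?q o ph" py by (rule tensor_rings_comp[OF tensor_rings_axioms cW q])
  note Qs = hom_simps[OF Q(1) cT W'.cT]
  have Qy: "Q y = 0[W'.T]"
  proof (rule lin_vanish[OF cT Q(1) W'.cT d(2) inl_sub[OF sA(1)]])
   fix b assume b: "b : set as"
   have "b : W" unfolding W_def using lin_mem[OF cA b idA] by simp
   then show "Q (inl b) = 0[W'.T]" using Q(3)[of b] q0[of b] b sA W'.inl_simps(5) by auto
  qed
  have "t *[T] x = inl a *[T] cls v +[T] t *[T] y"
   unfolding d(3) v(2)[symmetric] using t d yc sA by (simp add: T.r_distr T.m_lcomm)
  then have "Q (inl a *[T] cls v +[T] t *[T] y) = Q 0[T]" using Cons.prems(3) by (simp only:)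
  moreover have c: "inl a *[T] cls v : carrier T" "t *[T] y : carrier T" using t(1) yc sA v(1) by simp_all
  moreover have "Q (t *[T] y) = 0[W'.T]" unfolding Qs(2)[OF t(1) yc] Qy by (rule W'.T.r_null[OF Qs(1)[OF t(1)]])
  ultimately have "Q (inl a *[T] cls v) +[W'.T] 0[W'.T] = 0[W'.T]" unfolding Qs(3)[OF c] Qs(5) by (simp only:)
  then have Q0: "Q (inl a *[T] cls v) = 0[W'.T]" unfolding W'.T.r_zero[OF Qs(1)[OF c(1)]] .
  have av: "map (%x. (a *[A] fst x, snd x)) v : V" using v(1) sA(2) by auto
  note Q0[unfolded inl_mult_cls[OF sA(2) v(1)] Q(2)[OF av]]
  then have "W'.cls (map (%x. (?q (fst x), snd x)) (map (%x. (a *[A] fst x, snd x)) v)) = 0[W'.T]" .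
  moreover have "map (%x. (?q (fst x), snd x)) (map (%x. (a *[A] fst x, snd x)) v) = map (%x. (?q (fst x) *[A Quot W] ?q a, snd x)) v"
   using v(1) sA(2) qs(1,2) by (auto simp: AW.m_comm)
  ultimately have z: "W'.cls (map (%x. (?q (fst x) *[A Quot W] ?q a, snd x)) v) = 0[W'.T]" by (simp only:)
  have v': "set v <= carrier A \<times> carrier C" using v(1) by simp
  \<comment> \<open>Modulo \<open>W\<close> only the a-component of tx is left, and it is zero; by
    flatness td has a representative with left factors that annihilate the class of a, hence lie in
    m. So td vanishes in the domain B', and with it d.\<close>
  obtain w where w: "set w <= {n : carrier A. ?q n *[A Quot W] ?q a = 0[A Quot W]} \<times> carrier C" "cls v = cls w"
   by (rule flat_kernel[OF flat_tensor_axioms cW q qs(1)[OF sA(2)] A.oneideal v' z])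
  have "n : m" if n: "n : carrier A" "?q n *[A Quot W] ?q a = 0[A Quot W]" for n
  proof (rule ccontr)
   assume "n ~: m"
   then have u: "n : Units A" using unit_notin n(1) by blast
   have "n *[A] a : W" using n qs(2)[OF n(1) sA(2)] q0[of "n *[A] a"] sA(2) by simp
   then have "inv\<^bsub>A\<^esub> n *[A] (n *[A] a) : W" using W.I_l_closed A.Units_inv_closed[OF u] by blast
   then show False using False u n(1) sA(2) A.Units_inv_closed[OF u] by (simp add: A.m_assoc[symmetric])
  qed
  then have "set w <= m \<times> carrier C" using w(1) by blast
  then have "eo (t *[T] d) = 0[B']" unfolding v(2) w(2) by (rule eo_m)
  then have "eo d = 0[B']" using B'.integral[of "eo t" "eo d"] t d(1) eo_simps(1,2) by auto
  then obtain u1 w1 where u1: "u1 : carrier T" "u1 ~: p" "set w1 <= m \<times> carrier C" "u1 *[T] d = cls w1" by (rule eo_zero[OF d(1)])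
  \<comment> \<open>The factor u1 moves d into m \<otimes> C, which is killed by the socle element
    \<open>a\<close>. The a-component disappears, and the induction hypothesis applies to the
    multiple of y.\<close>
  have "u1 *[T] x = inl a *[T] cls w1 +[T] u1 *[T] y"
   unfolding d(3) u1(4)[symmetric] using u1(1) d yc sA by (simp add: T.r_distr T.m_lcomm)
  then have ux: "u1 *[T] x = u1 *[T] y" using kill_m[OF sA(2) am u1(3)] u1(1) yc by simp
  have "t *[T] (u1 *[T] y) = u1 *[T] (t *[T] x)" unfolding ux[symmetric] using t u1(1) xc by (simp add: T.m_lcomm)
  then have "t *[T] (u1 *[T] y) = 0[T]" using Cons.prems(3) u1(1) by simp
  then obtain u2 where u2: "u2 : carrier T" "u2 ~: p" "u2 *[T] (u1 *[T] y) = 0[T]"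
   using Cons.IH[OF sa lin_mult[OF cT d(2) u1(1) inl_sub[OF sA(1)]]] by blast
  show ?thesis using primeideal_mult_notin[OF is_locD(3)[OF B], of u2 u1] u1 u2 ux xc
   by (intro bexI[of _ "u2 *[T] u1"]) (auto simp: T.m_assoc)
 qed
qed

text \<open>An element b of B with annihilator the maximal ideal has, up to a unit, a numerator with
  all left factors in the socle of A. A nonzero one among them has annihilator m. Elements of p
  annihilate this numerator up to factors outside p, so by \<open>torsion\<close> they vanish in the
  domain B'; hence its maximal ideal is zero.\<close>

lemma ass_to_fibre:
 assumes dom: "domain B'" and b: "b : carrier B" "max_ideal B = annihilator B b"
  and G: "finite G" "G <= m" and noeth: "!!a n. a : m ==> n : carrier A ==> ALL c:G. c *[A] n = 0[A] ==> a *[A] n = 0[A]"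
 shows "EX a:carrier A. m = annihilator A a" "max_ideal B' = {0[B']}"
proof -
 interpret B: cring B by (rule is_locD(2)[OF B])
 interpret B': domain B' by (rule dom)
 note lB = is_loc_local(1)[OF B] and lB' = is_loc_local(1)[OF B'] and pp = is_locD(3)[OF B]
 note P = ideal.Icarr[OF primeideal.axioms(1)[OF pp]]
 obtain z e where ze: "z : carrier T" "e : carrier T" "e ~: p" "b *[B] dd e = dd z" by (rule is_loc_cases[OF B b(1)])
 have "b ~= 0[B]" using b primeideal_one[OF max_ideal_prime[OF lB]] unfolding annihilator_def by auto
 then have z0: "dd z ~= 0[B]"
  using Units_cancel[OF B.is_cring is_locD(5)[OF B ze(2,3)] b(1) B.zero_closed] ze(4) dd_simps(1)[OF ze(2)] by auto
 have pz: "dd d *[B] dd z = 0[B]" if d: "d : p" for d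
 proof -
  have "dd d : annihilator B b" using is_loc_local(2)[OF B P[OF d]] d b(2) by simp
  then have "dd d *[B] b = 0[B]" unfolding annihilator_def by blast
  then show ?thesis unfolding ze(4)[symmetric] using b(1) dd_simps(1)[OF ze(2)] dd_simps(1)[OF P[OF d]] by (simp add: B.m_assoc[symmetric])
 qed
 have mp: "inl a : p" if "a : m" for a
 proof -
  have a: "a : carrier A" using that m_sub by blast
  have "eo (inl a) = 0[B']" unfolding inl_def by (rule eo_m) (use that in auto)
  then show ?thesis using eo_p[of "inl a"] a additive_subgroup.zero_closed[OF ideal.axioms(1)[OF max_ideal_ideal[OF lB']]] by simp
 qed
 \<comment> \<open>In B each element of \<open>G\<close> kills the numerator z. As \<open>G\<close>
   is finite, one factor u outside p makes this true in T for all of them.\<close>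
 have "EX u:carrier T - p. ALL a:G. u *[T] (inl a *[T] z) = 0[T]" using G
 proof (induction G)
  case empty
  show ?case using primeideal_one[OF pp] by (intro bexI[of _ "1[T]"]) auto
 next
  case (insert a G)
  then obtain u where u: "u : carrier T - p" "ALL a:G. u *[T] (inl a *[T] z) = 0[T]" by auto
  have a: "a : m" "a : carrier A" using insert.prems m_sub by auto
  have "dd (inl a *[T] z) = 0[B]" using pz[OF mp[OF a(1)]] dd_simps(2) a ze(1) by simp
  then obtain u' where u': "u' : carrier T - p" "u' *[T] (inl a *[T] z) = 0[T]" using is_locD(6)[OF B, of "inl a *[T] z"] a ze(1) by auto
  have c: "inl c : carrier T" if "c : insert a G" for c using that insert.prems m_sub by auto
  have "(u' *[T] u) *[T] (inl c *[T] z) = 0[T]" if i: "c : insert a G" for c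
  proof -
   have 1: "(u' *[T] u) *[T] (inl c *[T] z) = u *[T] (u' *[T] (inl c *[T] z))"
    "(u' *[T] u) *[T] (inl c *[T] z) = u' *[T] (u *[T] (inl c *[T] z))"
    using u(1) u'(1) c[OF i] ze(1) by (simp_all add: T.m_ac)
   show ?thesis
   proof (cases "c = a")
    case True then show ?thesis unfolding 1(1) using u' u by simp
   next
    case False then show ?thesis unfolding 1(2) using u' u i by simp
   qed
  qed
  then show ?case using primeideal_mult_notin[OF pp u'(1) u(1)] by blast
 qed
 then obtain u where u: "u : carrier T" "u ~: p" "ALL a:G. u *[T] (inl a *[T] z) = 0[T]" by blast
 define z1 where "z1 = u *[T] z"
 have z1: "z1 : carrier T" unfolding z1_def using u ze by simp
 have z10: "dd z1 ~= 0[B]"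
  using z0 Units_cancel[OF B.is_cring is_locD(5)[OF B u(1,2)] dd_simps(1)[OF ze(1)] B.zero_closed] dd_simps(1)[OF u(1)] dd_simps(1)[OF ze(1)] dd_simps(2)[OF u(1) ze(1)]
  unfolding z1_def by (auto simp: B.m_comm)
 have gz: "inl a *[T] z1 = 0[T]" if "a : G" for a
 proof -
  have "inl a : carrier T" using that G(2) m_sub by auto
  then show ?thesis using u that ze(1) unfolding z1_def by (simp add: T.m_lcomm)
 qed
 \<comment> \<open>Starting from any list for z1, each further element of \<open>G\<close> shrinks
   the left factors to its annihilator by \<open>kill_inl\<close>.\<close>
 have "EX w. set w <= {n : carrier A. ALL a:G. a *[A] n = 0[A]} \<times> carrier C & cls w = z1" using G gz
 proof (induction G)
  case empty
  obtain v where "v : V" "z1 = cls v" by (rule T_cases[OF z1])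
  then show ?case by (intro exI[of _ v]) auto
 next
  case (insert a G)
  then obtain w where w: "set w <= {n : carrier A. ALL a:G. a *[A] n = 0[A]} \<times> carrier C" "cls w = z1" by auto
  have a: "a : carrier A" and Gc: "G <= carrier A" using insert.prems m_sub by auto
  have N: "ideal {n : carrier A. ALL a:G. a *[A] n = 0[A]} A"
  proof (rule idealI_cring[OF cA])
   fix r x assume "r : carrier A" "x : {n : carrier A. ALL a:G. a *[A] n = 0[A]}"
   then show "r *[A] x : {n : carrier A. ALL a:G. a *[A] n = 0[A]}" using Gc by (auto simp: A.m_lcomm[of _ r])
  qed (use Gc in \<open>auto simp: A.r_distr\<close>)
  have "inl a *[T] cls w = 0[T]" unfolding w(2) using insert.prems(2)[of a] by simp
  then obtain w' where w': "set w' <= {n : {n : carrier A. ALL a:G. a *[A] n = 0[A]}. n *[A] a = 0[A]} \<times> carrier C" "cls w = cls w'"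
   by (rule kill_inl[OF a N w(1)])
  have "set w' <= {n : carrier A. ALL c:insert a G. c *[A] n = 0[A]} \<times> carrier C" using w'(1) a by (auto simp: A.m_comm)
  then show ?case using w(2) w'(2) by (intro exI[of _ w'] conjI) simp_all
 qed
 then obtain w where w: "set w <= {n : carrier A. ALL a:G. a *[A] n = 0[A]} \<times> carrier C" "cls w = z1" by blast
 have wV: "w : V" using w(1) by blast
 have ws: "set (map fst w) <= soc"
 proof
  fix n assume "n : set (map fst w)"
  then have "n : carrier A" "ALL a:G. a *[A] n = 0[A]" using w(1) by auto
  then show "n : soc" unfolding soc_def using noeth by blast
 qed
 have "EX n:set (map fst w). n ~= 0[A]"
 proof (rule ccontr)
  assume n: "~  ?thesis"
  have "cls w = lsum T (%x. pure (fst x) (snd x)) w" by (rule cls_lsum[OF wV])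
  also have "... = 0[T]"
  proof (rule T.lsum_zero)
   fix x assume x: "x : set w"
   then have "fst x = 0[A]" "snd x : carrier C" using n wV by auto
   then show "pure (fst x) (snd x) = 0[T]" using pure_zero_left by simp
  qed
  finally show False using z10 w(2) dd_simps(5) by simp
 qed
 then obtain n where n: "n : soc" "n ~= 0[A]" using ws by blast
 have nc: "n : carrier A" using n(1) unfolding soc_def by blast
 show "EX a:carrier A. m = annihilator A a"
 proof (intro bexI[OF _ nc] equalityI subsetI)
  fix c assume "c : m" then show "c : annihilator A n" using n(1) m_sub unfolding soc_def annihilator_def by blast
 next
  fix c assume "c : annihilator A n"
  then have c: "c : carrier A" "c *[A] n = 0[A]" unfolding annihilator_def by blast+
  show "c : m"
  proof (rule ccontr)
   assume "c ~: m"
   then have "c : Units A" using unit_notin c(1) by blast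
   then show False using Units_cancel[OF cA, of c n "0[A]"] n(2) nc c by (simp add: A.m_comm)
  qed
 qed
 \<comment> \<open>d kills z in B, so some u'd with u' outside p kills z1 in T. If u'd were nonzero
   in B', \<open>torsion\<close> would provide a factor outside p that kills z1, against
   \<open>z10\<close>.\<close>
 have pe: "eo d = 0[B']" if d: "d : p" for d
 proof -
  have dc: "d : carrier T" by (rule P[OF d])
  have "dd (d *[T] z1) = dd u *[B] (dd d *[B] dd z)"
   unfolding z1_def using dd_simps(1,2) dc u(1) ze(1) by (simp add: B.m_lcomm)
  then have "dd (d *[T] z1) = 0[B]" using pz[OF d] dd_simps(1)[OF u(1)] by simp
  then obtain u' where u': "u' : carrier T" "u' ~: p" "u' *[T] (d *[T] z1) = 0[T]" using is_locD(6)[OF B T.m_closed[OF dc z1]] by blast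
  have tc: "u' *[T] d : carrier T" and tz: "(u' *[T] d) *[T] z1 = 0[T]" using u' dc z1 by (simp_all add: T.m_assoc)
  have "eo (u' *[T] d) = 0[B']"
  proof (rule ccontr)
   assume "eo (u' *[T] d) ~= 0[B']"
   then obtain u'' where u'': "u'' : carrier T" "u'' ~: p" "u'' *[T] z1 = 0[T]"
    using torsion[OF dom tc _ ws lin_cls[OF wV, unfolded w(2)] tz] by blast
   then show False using is_loc_zero_iff[OF B z1] z10 by blast
  qed
  then have "eo d *[B'] eo u' = 0[B']" using eo_simps(1,2) u'(1) dc by (simp add: B'.m_comm)
  then show ?thesis using Units_cancel[OF B'.is_cring eo_unit[OF u'(1,2)] eo_simps(1)[OF dc] B'.zero_closed] eo_simps(1)[OF u'(1)] by simp
 qed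
 have "b' = 0[B']" if bm: "b' : max_ideal B'" for b'
 proof -
  have bc: "b' : carrier B'" using bm max_ideal_subset[OF lB'] by blast
  obtain d' e' where de: "d' : carrier T'.T" "e' : carrier T'.T" "e' ~: p'" "b' *[B'] dd' e' = dd' d'" by (rule is_loc_cases[OF B' bc])
  note ec = ring_hom_closed[OF is_locD(4)[OF B'] de(2)]
  obtain d where d: "d : carrier T" "mm d = d'" by (rule mm_surj[OF de(1)])
  have "dd' d' : max_ideal B'" using ideal.I_r_closed[OF max_ideal_ideal[OF lB'] bm ec] de(4) by simp
  then have "dd' d' = 0[B']" using pe[of d] eo_p[OF d(1)] d(2) by simp
  then show ?thesis using Units_cancel[OF B'.is_cring is_locD(5)[OF B' de(2,3)] bc B'.zero_closed] de(4) ec by simp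
 qed
 then show "max_ideal B' = {0[B']}"
  using additive_subgroup.zero_closed[OF ideal.axioms(1)[OF max_ideal_ideal[OF lB']]] by blast
qed

end

subsection \<open>The fibre over a point\<close>

lemma morph_ptD:
 "mor X Y h ==> x : points X ==> pt h x : points Y" by (auto simp: is_morphism_def continuous_map_def)

context at_point begin

abbreviation "x0 == {0[K]}"
text \<open>The residue map at et, but with the stalk of Spec \<kappa>(et) at its only point as
  target, because this stalk is what enters the tensor rings of \<open>C\<close>.\<close>

definition "kap = smap SK pX x0"

lemma SK_points: "points SK = {x0}" by (rule field_spec_point[OF K_field])

lemma x0_loc: "is_loc K x0 (stalk SK x0) (spec_germ K x0)"
 using SK_points spec_ring.spec_points[OF spec_ring.intro, OF K_cring] spec_ring.spec_is_loc[OF spec_ring.intro, OF K_cring] by blast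

lemma kap: "kap : ring_hom (stalk X et) (stalk SK x0)"
 "c : Stk SK x0 ==> EX a:Stk X et. kap a = c"
 "a : Stk X et ==> kap a = 0[stalk SK x0] \<longleftrightarrow> a : Mst X et"
proof -
 interpret pX: lmorph SK X pX by unfold_locales (use SK_lrs P.f.X.lrs pX in auto)
 interpret K: field K by (rule K_field)
 interpret L: cring "stalk SK x0" by (rule is_locD(2)[OF x0_loc])
 have x: "x0 : points SK" using SK_points by simp
 note H = hom_simps[OF is_locD(4)[OF x0_loc] K_cring L.is_cring]
 have ke: "kap a = spec_germ K x0 (P.f.X.resid et a)" if "a : Stk X et" for a
  unfolding kap_def by (rule P.f.X.point_map_morphism(2)[OF et that])
 show "kap : ring_hom (stalk X et) (stalk SK x0)" using pX.stalk_map_hom[OF x] by (simp add: kap_def)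
 show "kap a = 0[stalk SK x0] \<longleftrightarrow> a : Mst X et" if a: "a : Stk X et"
 proof -
  note rc = ring_hom_closed[OF P.f.X.resid_hom[OF et] a]
  have "spec_germ K x0 (P.f.X.resid et a) = 0[stalk SK x0] \<longleftrightarrow> P.f.X.resid et a = 0[K]"
  proof
   assume "spec_germ K x0 (P.f.X.resid et a) = 0[stalk SK x0]"
   then obtain u where "u : carrier K - x0" "u *[K] P.f.X.resid et a = 0[K]" using is_locD(6)[OF x0_loc rc] by blast
   then show "P.f.X.resid et a = 0[K]" using K.integral rc by blast
  qed (use H(5) in simp)
  then show ?thesis unfolding ke[OF a] P.f.X.resid_zero_iff[OF et a] .
 qed
 assume c: "c : Stk SK x0"
 then obtain d e where de: "d : carrier K" "e : carrier K" "e ~: x0" "c *[stalk SK x0] spec_germ K x0 e = spec_germ K x0 d" by (rule is_loc_cases[OF x0_loc])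
 have eu: "e : Units K" using de K.field_Units by blast
 have "spec_germ K x0 (d *[K] inv\<^bsub>K\<^esub> e) *[stalk SK x0] spec_germ K x0 e = spec_germ K x0 d"
  using de(1,2) eu H(2)[of "d *[K] inv\<^bsub>K\<^esub> e" e] K.Units_inv_closed[OF eu] by (simp add: K.m_assoc)
 then have "c = spec_germ K x0 (d *[K] inv\<^bsub>K\<^esub> e)"
  using Units_cancel[OF L.is_cring is_locD(5)[OF x0_loc de(2,3)] c H(1)[OF K.m_closed[OF de(1) K.Units_inv_closed[OF eu]]]] de(4) by metis
 moreover obtain a where "a : Stk X et" "d *[K] inv\<^bsub>K\<^esub> e = P.f.X.resid et a"
  by (rule P.f.X.resid_surj[of "d *[K] inv\<^bsub>K\<^esub> e" et]) (use de K.Units_inv_closed[OF eu] in simp)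
 ultimately show "EX a:Stk X et. kap a = c" using ke by metis
qed

lemma stalk_mK: "r : Stk S s0 ==> smap SK mK x0 r = kap (smap X f et r)"
 using comp_morphism(2)[OF SK_lrs P.f.X.lrs P.f.Y.lrs pX P.f.morph, of x0 r] SK_points by (simp add: kap_def)

lemma C_point: "z : C.PT ==> fst z = x0 & pt g (fst (snd z)) = s0 & fst (snd z) : points Y"
 using C.PT_relD[of z] SK_points unfolding C.rel_def by auto

text \<open>Induced by Spec \<kappa>(et) -> X on the first factor and the identity on the second; it
  maps the model of the fibre to X \<times>_S Y.\<close>

lemma en_exists: "EX en. mor C.FP P.FP en & meq C.FP X (cmp P.FP P.FX en) (cmp SK pX C.FX) &
  meq C.FP Y (cmp P.FP P.FY en) C.FY"
proof -
 have a: "mor C.FP X (cmp SK pX C.FX)" by (rule comp_morphism(1)[OF C.fp_lrs SK_lrs P.f.X.lrs C.FX_morphism(1) pX])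
 have "meq C.FP S (cmp X f (cmp SK pX C.FX)) (cmp Y g C.FY)"
  unfolding comp_assoc[OF pX] by (rule C.fp_square)
 then show ?thesis by (rule P.fp_univ[OF C.fp_lrs a C.FY_morphism(1)]) (intro exI conjI)
qed

definition "en = (SOME en. mor C.FP P.FP en & meq C.FP X (cmp P.FP P.FX en) (cmp SK pX C.FX) &
  meq C.FP Y (cmp P.FP P.FY en) C.FY)"

lemma en: "mor C.FP P.FP en" "meq C.FP X (cmp P.FP P.FX en) (cmp SK pX C.FX)"
 "meq C.FP Y (cmp P.FP P.FY en) C.FY"
 using someI_ex[OF en_exists] unfolding en_def[symmetric] by blast+

lemma en_point:
 assumes z: "z : C.PT"
 shows "pt en z : P.PT" "fst (pt en z) = et" "fst (snd (pt en z)) = fst (snd z)"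
proof -
 have zp: "z : points C.FP" using z C.fp_points_eq by simp
 show "pt en z : P.PT" using morph_ptD[OF en(1) zp] P.fp_points_eq by simp
 show "fst (pt en z) = et" "fst (snd (pt en z)) = fst (snd z)" using en(2,3) zp unfolding morph_eq_def by auto
qed

text \<open>A point z over et defines Spec \<kappa>(z) -> X \<times>_S Y, whose first projection
  factors through Spec \<kappa>(et). The universal property of \<open>C\<close> turns this into a
  morphism to the model, and uniqueness shows that it lies over z.\<close>

lemma en_surj:
 assumes z: "z : P.PT" "fst z = et"
 obtains z' where "z' : C.PT" "pt en z' = z"
proof -
 interpret Pl: lringed P.FP by unfold_locales (rule P.fp_lrs)
 interpret h: lmorph P.FP X P.FX by unfold_locales (use P.f.X.lrs P.FX_morphism(1) in auto)
 have zp: "z : points P.FP" using z P.fp_points_eq by simp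
 let ?L = "residue_field P.FP z" and ?pz = "point_map P.FP z"
 let ?r = "Spec_map K ?L (residue_map P.FP X P.FX z)"
 note L = Pl.resid_cring[OF zp]
 have L_lrs: "lrsp (Spec ?L)" using spec_ring.spec_lrs[OF spec_ring.intro] L by blast
 note pz = Pl.point_map_morphism(1)[OF zp]
 have r: "mor (Spec ?L) SK ?r" using Spec_map_morphism(1)[OF K_cring L] h.residue_map_hom[OF zp] z(2) by simp
 have sqz: "meq (Spec ?L) X (cmp P.FP P.FX ?pz) (cmp SK pX ?r)" using h.point_map_square[OF zp] z(2) by simp
 have b: "mor (Spec ?L) Y (cmp P.FP P.FY ?pz)" by (rule comp_morphism(1)[OF L_lrs P.fp_lrs P.g.X.lrs pz P.FY_morphism(1)])
 have "meq (Spec ?L) S (cmp SK mK ?r) (cmp X f (cmp SK pX ?r))" unfolding comp_assoc[OF pX] by (rule morph_eq_refl)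
 also have "meq (Spec ?L) S ... (cmp X f (cmp P.FP P.FX ?pz))" by (rule comp_cong_left[OF P.f.morph morph_eq_sym[OF sqz]])
 also have "meq (Spec ?L) S ... (cmp P.FP (cmp Y g P.FY) ?pz)"
  unfolding comp_assoc[OF P.FX_morphism(1)] by (rule comp_cong_right[OF pz P.fp_square])
 also have "meq (Spec ?L) S ... (cmp Y g (cmp P.FP P.FY ?pz))" unfolding comp_assoc[OF P.FY_morphism(1)] by (rule morph_eq_refl)
 finally obtain t where t: "mor (Spec ?L) C.FP t" "meq (Spec ?L) SK (cmp C.FP C.FX t) ?r"
  "meq (Spec ?L) Y (cmp C.FP C.FY t) (cmp P.FP P.FY ?pz)" by (rule C.fp_univ[OF L_lrs r b])
 have "meq (Spec ?L) P.FP (cmp C.FP en t) ?pz"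
 proof (rule P.fp_monic[OF L_lrs comp_morphism(1)[OF L_lrs C.fp_lrs P.fp_lrs t(1) en(1)] pz])
  have "meq (Spec ?L) X (cmp P.FP P.FX (cmp C.FP en t)) (cmp C.FP (cmp SK pX C.FX) t)"
   unfolding comp_assoc[OF en(1)] by (rule comp_cong_right[OF t(1) en(2)])
  also have "meq (Spec ?L) X ... (cmp SK pX ?r)" unfolding comp_assoc[OF C.FX_morphism(1), symmetric] by (rule comp_cong_left[OF pX t(2)])
  also note morph_eq_sym[OF sqz]
  finally show "meq (Spec ?L) X (cmp P.FP P.FX (cmp C.FP en t)) (cmp P.FP P.FX ?pz)" .
  have "meq (Spec ?L) Y (cmp P.FP P.FY (cmp C.FP en t)) (cmp C.FP C.FY t)"
   unfolding comp_assoc[OF en(1)] by (rule comp_cong_right[OF t(1) en(3)])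
  also note t(3)
  finally show "meq (Spec ?L) Y (cmp P.FP P.FY (cmp C.FP en t)) (cmp P.FP P.FY ?pz)" .
 qed
 moreover have w: "{0[?L]} : points (Spec ?L)" using field_spec_point[OF Pl.resid_field[OF zp]] by simp
 ultimately have "pt en (pt t {0[?L]}) = z" unfolding morph_eq_def by auto
 then show ?thesis using that[of "pt t {0[?L]}"] morph_ptD[OF t(1) w] C.fp_points_eq by blast
qed

text \<open>The two ways from the tensor ring at et to the stalk of the model at z agree on both
  factors. Comparing preimages of the maximal ideal identifies the prime carried by
  \<open>pt en z\<close>.\<close>

lemma en_stalk:
 assumes z: "z : C.PT" and Q: "Q : ring_hom (P.FR et (fst (snd z))) (C.FR x0 (fst (snd z)))"
  and Ql: "!!a. a : Stk X et ==> Q (P.fin et (fst (snd z)) a) = C.fin x0 (fst (snd z)) (kap a)"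
  and Qr: "!!c. c : Stk Y (fst (snd z)) ==> Q (P.fir et (fst (snd z)) c) = C.fir x0 (fst (snd z)) c"
  and d: "d : carrier (P.FR et (fst (snd z)))"
 shows "d : snd (snd (pt en z)) \<longleftrightarrow> Q d : snd (snd z)"
proof -
 interpret en: lmorph C.FP P.FP en by unfold_locales (use C.fp_lrs P.fp_lrs en in auto)
 define y where "y = fst (snd z)"
 have zp: "z : points C.FP" using z C.fp_points_eq by simp
 have z1: "fst z = x0" using C_point[OF z] by blast
 note ep = en_point[OF z, folded y_def]
 have rP: "P.rel et y" using P.PT_relD[OF ep(1)] unfolding ep(2,3) .
 have rC: "C.rel x0 y" using C.PT_relD[OF z] unfolding z1 y_def .
 note LP = P.fp_is_loc[OF ep(1), unfolded ep(2,3)] and LC = C.fp_is_loc[OF z, unfolded z1, folded y_def]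
 note EX = morph_eqD[OF C.fp_lrs P.f.X.lrs comp_morphism(1)[OF C.fp_lrs P.fp_lrs P.f.X.lrs en(1) P.FX_morphism(1)]
   comp_morphism(1)[OF C.fp_lrs SK_lrs P.f.X.lrs C.FX_morphism(1) pX] en(2) zp]
 note EY = morph_eqD[OF C.fp_lrs P.g.X.lrs comp_morphism(1)[OF C.fp_lrs P.fp_lrs P.g.X.lrs en(1) P.FY_morphism(1)] C.FY_morphism(1) en(3) zp]
 have "(smap C.FP en z o P.F.dd (pt en z)) d = (C.F.dd z o Q) d"
 proof (rule P.FR_hom_eqI[OF rP])
  show "smap C.FP en z o P.F.dd (pt en z) : ring_hom (P.FR et y) (stalk C.FP z)"
   by (rule ring_hom_trans[OF is_locD(4)[OF LP] en.stalk_map_hom[OF zp]])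
  show "C.F.dd z o Q : ring_hom (P.FR et y) (stalk C.FP z)" by (rule ring_hom_trans[OF Q[folded y_def] is_locD(4)[OF LC]])
  show "cring (stalk C.FP z)" by (rule is_locD(2)[OF LC])
  show "d : carrier (P.FR et y)" using d unfolding y_def .
  fix a assume a: "a : Stk X et"
  have "smap C.FP en z (smap P.FP P.FX (pt en z) a) = smap C.FP C.FX z (kap a)"
   using EX(2)[of a] comp_morphism(2)[OF C.fp_lrs P.fp_lrs P.f.X.lrs en(1) P.FX_morphism(1) zp, of a]
    comp_morphism(2)[OF C.fp_lrs SK_lrs P.f.X.lrs C.FX_morphism(1) pX zp, of a] a z1 ep(2) by (simp add: kap_def)
  then show "(smap C.FP en z o P.F.dd (pt en z)) (P.fin et y a) = (C.F.dd z o Q) (P.fin et y a)"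
   using P.FX_morphism(2)[OF ep(1), of a] C.FX_morphism(2)[OF z, of "kap a"] a z1 ep(2,3) Ql[OF a] ring_hom_closed[OF kap(1) a]
   by (simp flip: y_def)
 next
  fix c assume c: "c : Stk Y y"
  have "smap C.FP en z (smap P.FP P.FY (pt en z) c) = smap C.FP C.FY z c"
   using EY(2)[of c] comp_morphism(2)[OF C.fp_lrs P.fp_lrs P.g.X.lrs en(1) P.FY_morphism(1) zp, of c] c ep(3) by simp
  then show "(smap C.FP en z o P.F.dd (pt en z)) (P.fir et y c) = (C.F.dd z o Q) (P.fir et y c)"
   using P.FY_morphism(2)[OF ep(1), of c] C.FY_morphism(2)[OF z, of c] c z1 ep(2,3) Qr[of c] by (simp flip: y_def)
 qed
 moreover have "smap C.FP en z (P.F.dd (pt en z) d) : max_ideal (stalk C.FP z) \<longleftrightarrow> d : snd (snd (pt en z))"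
  using P.F.morph_into_point[unfolded P.Z_eq, OF C.fp_lrs en(1) zp, of d] d ep(2,3) by (simp add: y_def)
 moreover have "C.F.dd z (Q d) : max_ideal (stalk C.FP z) \<longleftrightarrow> Q d : snd (snd z)"
  using is_loc_local(2)[OF LC, of "Q d"] ring_hom_closed[OF Q d] by (simp add: y_def)
 ultimately show ?thesis by simp
qed

lemma flat_point_at:
 assumes z: "z : C.PT" and flat: "flat_hom (stalk S s0) (stalk Y (fst (snd z))) (smap Y g (fst (snd z)))"
 shows "flat_point (stalk S s0) (stalk X et) (stalk Y (fst (snd z))) (smap X f et) (smap Y g (fst (snd z)))
  (stalk SK x0) kap (snd (snd (pt en z))) (stalk P.FP (pt en z)) (P.F.dd (pt en z)) (snd (snd z)) (stalk C.FP z) (C.F.dd z)"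
proof -
 define y where "y = fst (snd z)"
 note z1 = C_point[OF z, folded y_def] and ep = en_point[OF z, folded y_def]
 have rP: "P.rel et y" using P.PT_relD[OF ep(1)] unfolding ep(2,3) .
 interpret T: tensor_rings "stalk S s0" "stalk X et" "stalk Y y" "smap X f et" "smap Y g y" by (rule P.TR[OF rP])
 interpret K: cring "stalk SK x0" by (rule is_locD(2)[OF x0_loc])
 interpret T': tensor_rings "stalk S s0" "stalk SK x0" "stalk Y y" "kap o smap X f et" "smap Y g y"
  by (rule tensor_rings_comp[OF P.TR[OF rP] K.is_cring kap(1)])
 have mh: "smap SK mK x0 : ring_hom (stalk S s0) (stalk SK x0)" using C.f.stalk_map_hom[of x0] SK_points by simp
 note cong = tensor_alg_cong[OF T.cR K.is_cring T.cC mh T'.ph, of "alg (smap Y g y) (stalk Y y)"]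
 have FR: "C.FR x0 y = T'.T" and FC: "C.FC x0 y = T'.cls"
  unfolding C.FR_eq C.FC_eq using cong stalk_mK by simp_all
 have inl: "C.fin x0 y = T'.inl" "C.fir x0 y = T'.inr" unfolding FC by (simp_all add: fun_eq_iff T'.inl_def T'.inr_def)
 have inl2: "P.fin et y = T.inl" "P.fir et y = T.inr" unfolding P.FC_eq by (simp_all add: fun_eq_iff T.inl_def T.inr_def)
 note inle = inl(1)[THEN fun_cong] inl(2)[THEN fun_cong] and inl2e = inl2(1)[THEN fun_cong] inl2(2)[THEN fun_cong]
 have B: "is_loc T.T (snd (snd (pt en z))) (stalk P.FP (pt en z)) (P.F.dd (pt en z))"
  using P.fp_is_loc[OF ep(1)] unfolding ep(2,3) P.FR_eq .
 have B': "is_loc T'.T (snd (snd z)) (stalk C.FP z) (C.F.dd z)"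
  using C.fp_is_loc[OF z] unfolding y_def[symmetric] conjunct1[OF z1] FR .
 have L: "local_ring (stalk X et)" by (rule P.f.X.stalk_local[OF et])
 have "flat_point (stalk S s0) (stalk X et) (stalk Y y) (smap X f et) (smap Y g y)
  (stalk SK x0) kap (snd (snd (pt en z))) (stalk P.FP (pt en z)) (P.F.dd (pt en z)) (snd (snd z)) (stalk C.FP z) (C.F.dd z)"
 proof (intro flat_point.intro flat_tensor.intro flat_algebra.intro flat_point_axioms.intro)
  show "tensor_rings (stalk S s0) (stalk X et) (stalk Y y) (smap X f et) (smap Y g y)" by (rule P.TR[OF rP])
  show "flat_hom (stalk S s0) (stalk Y y) (smap Y g y)" using flat unfolding y_def .
  fix Q d assume Q: "Q : ring_hom T.T T'.T" "!!a. a : Stk X et ==> Q (T.inl a) = T'.inl (kap a)"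
   "!!c. c : Stk Y y ==> Q (T.inr c) = T'.inr c" "d : carrier T.T"
  show "d : snd (snd (pt en z)) \<longleftrightarrow> Q d : snd (snd z)"
   by (rule en_stalk[OF z, folded y_def, unfolded FR inle inl2e P.FR_eq, OF Q])
 qed (fact T.cR T.cC T.py L K.is_cring kap B B')+
 then show ?thesis unfolding y_def .
qed

end

subsection \<open>Lifting specialisations\<close>

lemma (in lringed) scheme_chart:
 assumes "scheme X" "y : points X"
 obtains U py Q where "chart X U (sec X U) py Q" "y : U"
proof -
 obtain U where U: "y : U" "affine_open X U" using assms unfolding scheme_def by blast
 show ?thesis by (rule affine_chart[OF U(2)], rule that[OF _ U(1)])
qed

lemma primeideal_pow:
 assumes "primeideal p R" "x : carrier R" "x ~: p" shows "x [^]\<^bsub>R\<^esub> (n::nat) ~: p"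
proof -
 interpret primeideal p R by (rule assms(1))
 have "x [^]\<^bsub>R\<^esub> (n::nat) : carrier R - p"
  by (induction n) (use primeideal_one[OF assms(1)] primeideal_mult_notin[OF assms(1)] assms in auto)
 then show ?thesis by blast
qed

context fp_pair begin

lemma FC_in_prime:
 assumes z: "(x, y, p) : PT" and w: "set w <= Mst X x \<times> Stk Y y"
 shows "FC x y w : p"
proof -
 have r: "rel x y" and pp: "primeideal p (FR x y)" using z PT_iff by auto
 interpret T: tensor_rings "stalk S (pt f x)" "stalk X x" "stalk Y y" "smap X f x" "smap Y g y" by (rule TR[OF r])
 have ms: "Mst X x <= Stk X x" using max_ideal_subset[OF f.X.stalk_local] r unfolding rel_def by blast
 note I = primeideal.axioms(1)[OF pp, unfolded FR_eq]
 show ?thesis using w unfolding FC_eq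
 proof (induction w)
  case Nil
  show ?case using additive_subgroup.zero_closed[OF ideal.axioms(1)[OF I]] unfolding T.T_zero .
 next
  case (Cons c w)
  have c: "fst c : Mst X x" "fst c : Stk X x" "snd c : Stk Y y" using Cons.prems ms by auto
  have "T.inl (fst c) : p" using c(1,2) z unfolding PT_iff FC_eq T.inl_def by blast
  then have "T.inl (fst c) *[T.T] T.inr (snd c) : p" using ideal.I_r_closed[OF I] c(3) by simp
  then have "T.cls [c] : p" using T.pure_eq[OF c(2,3)] by simp
  moreover have "T.cls (c # w) = T.cls [c] +[T.T] T.cls w" using Cons.prems ms by (subst T.T_add) auto
  ultimately show ?case using additive_subgroup.a_closed[OF ideal.axioms(1)[OF I]] Cons by simp
 qed
qed

text \<open>Over a generisation \<open>et'\<close> of \<open>et\<close> there are points arbitrarily close to a given one over \<open>et\<close>: a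
 function not vanishing at the given point is not nilpotent on \<open>\<kappa>(et') \<otimes> \<O>\<^sub>Y\<^sub>,\<^sub>y\<close> by flatness.\<close>
lemma generise:
 assumes schS: "scheme S" and schY: "scheme Y" and flat: "flat_morphism Y S g"
  and gen: "f.X.gen et et'" and z: "z : PT" "fst z = et" and W: "is_open FP W" "z : W"
 obtains w where "w : PT" "w : W" "fst w = et'"
proof -
 obtain Dl v where b: "(Dl, v) : fns" "z : F.bas Dl v" "F.bas Dl v <= W" by (rule F.base[folded fp_top_eq, OF W])
 obtain U V l where l: "f.X.opn U" "g.X.opn V" "l : FS U V" "Dl = Dm U V" "!!z. z : Dm U V ==> v z = FG U V l (fst z) (fst (snd z))"
  by (rule fns_cases[OF b(1)]) (rule that)
 define y p where "y = fst (snd z)" and "p = snd (snd z)"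
 have zp: "(et, y, p) : PT" using z unfolding y_def p_def by auto
 have r: "rel et y" and pp: "primeideal p (FR et y)" using zp PT_iff by auto
 have in1: "et : U" "y : V" using b(2) z(2) unfolding l(4) Dm_def y_def by auto
 have np: "FG U V l et y ~: p" using b(2) l(5)[of z] z(2) unfolding l(4) y_def p_def by auto
 have ps: "et : points X" "et' : points X" "y : points Y" using gen r unfolding f.X.gen_def rel_def by auto
 have e0: "pt g y = pt f et" using r unfolding rel_def by simp
 have in2: "et' : U" using gen l(1) in1(1) unfolding f.X.gen_def by blast
 let ?R = "stalk S (pt f et)" and ?A = "stalk X et" and ?C = "stalk Y y" and ?ph = "smap X f et" and ?py = "smap Y g y"
 interpret T: tensor_rings ?R ?A ?C ?ph ?py by (rule TR[OF r])
 let ?k = "residue_field X et'"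
 interpret k: field ?k by (rule f.X.resid_field[OF ps(2)])
 define rhh where "rhh = f.X.resid et' o f.X.sp et'"
 note spX = f.X.sp_hom[OF gen] and rh = f.X.resid_hom[OF ps(2)]
 have rhh: "rhh : ring_hom ?A ?k" unfolding rhh_def by (rule ring_hom_trans[OF spX rh])
 note rhhs = hom_simps[OF rhh T.cA k.is_cring]
 \<comment> \<open>This is \<kappa>(et') \<otimes> O_{Y,y}. A prime of it will yield a generisation
   y' of y together with a point of the fibre product over et' and y'.\<close>
 interpret E: tensor_rings ?R ?k ?C "rhh o ?ph" ?py by (rule tensor_rings_comp[OF TR[OF r] k.is_cring rhh])
 obtain Q where Q: "Q : ring_hom T.T E.T" "!!v. v : T.V ==> Q (T.cls v) = E.cls (map (%x. (rhh (fst x), snd x)) v)"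
  "!!a. a : carrier ?A ==> Q (T.inl a) = E.inl (rhh a)" "!!c. c : carrier ?C ==> Q (T.inr c) = E.inr c"
  by (rule T.T_map[OF k.is_cring rhh]) (rule that)
 define d where "d = FG U V l et y"
 have d: "d : carrier T.T" using FG_ops(1)[OF l(1-3,3) in1 r] unfolding d_def FR_eq .
 have F: "flat_tensor ?R ?A ?C ?ph ?py"
  unfolding flat_tensor_def flat_algebra_def using TR[OF r] T.cR T.cC T.py flat ps(3) e0 unfolding flat_morphism_def by auto
 \<comment> \<open>If a power of the image of d vanished, \<open>flat_kernel\<close> would place
   this power of d in m \<otimes> C, since units of the stalk at et stay units in \<kappa>(et'). But
   m \<otimes> C maps into p, and d is not in the prime p.\<close>
 have nil: "Q d [^]\<^bsub>E.T\<^esub> n ~= 0[E.T]" for n :: nat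
 proof
  assume "Q d [^]\<^bsub>E.T\<^esub> n = 0[E.T]"
  then have Q0: "Q (d [^]\<^bsub>T.T\<^esub> n) = 0[E.T]" using hom_pow[OF Q(1) T.cT E.cT d] by simp
  obtain u where u: "u : T.V" "d [^]\<^bsub>T.T\<^esub> n = T.cls u" by (rule T.T_cases[OF T.T.nat_pow_closed[OF d]])
  have e: "map (%x. (rhh (fst x) *[?k] 1[?k], snd x)) u = map (%x. (rhh (fst x), snd x)) u" using u(1) rhhs(1) by auto
  have z0: "E.cls (map (%x. (rhh (fst x) *[?k] 1[?k], snd x)) u) = 0[E.T]"
   unfolding e Q(2)[OF u(1), symmetric] u(2)[symmetric] by (rule Q0)
  have u': "set u <= carrier ?A \<times> carrier ?C" using u(1) by simp
  obtain w where w: "set w <= {n : carrier ?A. rhh n *[?k] 1[?k] = 0[?k]} \<times> carrier ?C" "T.cls u = T.cls w"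
   by (rule flat_kernel[OF F k.is_cring rhh k.one_closed T.A.oneideal u' z0])
  have "a : max_ideal ?A" if a: "a : carrier ?A" "rhh a *[?k] 1[?k] = 0[?k]" for a
  proof (rule ccontr)
   assume "a ~: max_ideal ?A"
   then have "a : Units ?A" using max_ideal_iff[OF f.X.stalk_local[OF ps(1)] a(1)] by blast
   then have "rhh a : Units ?k" by (rule hom_Units[OF rhh T.cA k.is_cring])
   then show False using a rhhs(1)[OF a(1)] k.field_Units by simp
  qed
  then have "set w <= max_ideal ?A \<times> carrier ?C" using w(1) by blast
  then have "d [^]\<^bsub>T.T\<^esub> n : p" using FC_in_prime[OF zp] u(2) w(2) unfolding FC_eq by simp
  then show False using primeideal_pow[OF pp[unfolded FR_eq] d] np unfolding d_def by blast
 qed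
 have Qd: "Q d : carrier E.T" by (rule ring_hom_closed[OF Q(1) d])
 obtain q where q: "primeideal q E.T" "Q d ~: q" by (rule prime_avoiding_nonnilpotent[OF E.cT Qd nil])
 define L where "L = loc E.T q"
 define lam where "lam a = loc_frac E.T q a 1[E.T]" for a
 have LL: "is_loc E.T q L lam" unfolding L_def lam_def using prime_at.is_loc_loc[OF prime_at.intro[OF q(1)]] .
 have cL: "cring L" by (rule is_locD(2)[OF LL])
 note lL = is_loc_local(1)[OF LL] and lh = is_locD(4)[OF LL]
 have inlq: "E.inl a : q \<longleftrightarrow> a = 0[?k]" if a: "a : carrier ?k" for a
 proof
  assume iq: "E.inl a : q"
  show "a = 0[?k]"
  proof (rule ccontr)
   assume "a ~= 0[?k]"
   then have "a : Units ?k" using k.field_Units a by blast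
   then obtain a' where a': "a' : carrier ?k" "a *[?k] a' = 1[?k]" by (rule UnitsE[OF k.is_cring])
   then have "E.inl a *[E.T] E.inl a' = 1[E.T]" using a by (simp flip: E.inl_simps(2))
   then show False using ideal.I_r_closed[OF primeideal.axioms(1)[OF q(1)] iq, of "E.inl a'"] a'(1) primeideal_one[OF q(1)] by simp
  qed
 next
  assume "a = 0[?k]"
  then show "E.inl a : q" using additive_subgroup.zero_closed[OF ideal.axioms(1)[OF primeideal.axioms(1)[OF q(1)]]] by simp
 qed
 \<comment> \<open>The contraction of q to O_{Y,y} determines the generisation y' of y.\<close>
 define Qp where "Qp = {c : carrier ?C. E.inr c : q}"
 have Qp: "primeideal Qp ?C" unfolding Qp_def by (rule primeideal_vimage[OF E.inr_hom T.cC E.cT q(1)])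
 obtain U1 py1 Q1 where c1: "chart Y U1 (sec Y U1) py1 Q1" "y : U1" by (rule g.X.scheme_chart[OF schY ps(3)])
 obtain y' where y': "g.X.gen y y'" "is_loc ?C Qp (stalk Y y') (g.X.sp y')" by (rule chart.gen_exists[OF c1 Qp])
 have in3: "y' : V" and y'p: "y' : points Y" using y'(1) l(2) in1(2) unfolding g.X.gen_def by blast+
 define al where "al = lam o (E.inl o f.X.resid et')"
 define bx0 where "bx0 = lam o E.inr"
 have al: "al : ring_hom (stalk X et') L" unfolding al_def by (rule ring_hom_trans[OF ring_hom_trans[OF rh E.inl_hom] lh])
 have bx0: "bx0 : ring_hom ?C L" unfolding bx0_def by (rule ring_hom_trans[OF E.inr_hom lh])
 have bx0u: "bx0 c : Units L" if "c : carrier ?C" "c ~: Qp" for c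
  using that is_locD(5)[OF LL, of "E.inr c"] unfolding bx0_def Qp_def by simp
 obtain bx where bx: "bx : ring_hom (stalk Y y') L" "!!c. c : carrier ?C ==> bx (g.X.sp y' c) = bx0 c"
  by (rule is_loc_hom_exists[OF y'(2) cL bx0 bx0u]) (assumption, assumption, rule that)
 \<comment> \<open>The points f(et') and g(y') must be shown equal. Both are generisations of f(et),
   and both correspond to \<open>PS\<close>, the kernel of the map from the stalk of S to
   \<kappa>(et'); a chart of S identifies them.\<close>
 define PS where "PS = {r : carrier ?R. rhh (?ph r) = 0[?k]}"
 have "primeideal {r : carrier ?R. (rhh o ?ph) r : {0[?k]}} ?R"
  by (rule primeideal_vimage[OF E.ph T.cR k.is_cring k.zeroprimeideal])
 then have PS: "primeideal PS ?R" unfolding PS_def by simp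
 have s0: "pt f et : points S" by (rule f.pt_closed[OF ps(1)])
 obtain U2 py2 Q2 where c2: "chart S U2 (sec S U2) py2 Q2" "pt f et : U2" by (rule f.Y.scheme_chart[OF schS s0])
 obtain t where t: "f.Y.gen (pt f et) t" "is_loc ?R PS (stalk S t) (f.Y.sp t)" by (rule chart.gen_exists[OF c2 PS])
 have gf: "f.Y.gen (pt f et) (pt f et')" by (rule f.gen_image[OF gen])
 have gg: "f.Y.gen (pt f et) (pt g y')" using g.gen_image[OF y'(1)] unfolding e0 .
 have mt: "f.Y.sp t r : Mst S t \<longleftrightarrow> rhh (?ph r) = 0[?k]" if "r : carrier ?R" for r
  using is_loc_local(2)[OF t(2) that] that by (simp add: PS_def)
 have mf: "f.Y.sp (pt f et') r : Mst S (pt f et') \<longleftrightarrow> rhh (?ph r) = 0[?k]" if rr: "r : carrier ?R" for r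
 proof -
  have "f.Y.sp (pt f et') r : Mst S (pt f et') \<longleftrightarrow> f.X.sp et' (?ph r) : Mst X et'"
   using f.stalk_map_max_iff[OF ps(2) ring_hom_closed[OF f.Y.sp_hom[OF gf] rr]] f.sp_stalk_map[OF gen rr] by simp
  also have "... \<longleftrightarrow> rhh (?ph r) = 0[?k]"
   using f.X.resid_zero_iff[OF ps(2) ring_hom_closed[OF spX T.ph_simps(1)[OF rr]]] unfolding rhh_def by simp
  finally show ?thesis .
 qed
 have mg: "f.Y.sp (pt g y') r : Mst S (pt g y') \<longleftrightarrow> rhh (?ph r) = 0[?k]" if rr: "r : carrier ?R" for r
 proof -
  have "f.Y.sp (pt g y') r : Mst S (pt g y') \<longleftrightarrow> g.X.sp y' (?py r) : Mst Y y'"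
   using g.stalk_map_max_iff[OF y'p ring_hom_closed[OF f.Y.sp_hom[OF gg] rr]] g.sp_stalk_map[OF y'(1), unfolded e0, OF rr] by simp
  also have "... \<longleftrightarrow> E.inr (?py r) : q" using is_loc_local(2)[OF y'(2) T.py_simps(1)[OF rr]] T.py_simps(1)[OF rr] unfolding Qp_def by simp
  also have "... \<longleftrightarrow> rhh (?ph r) = 0[?k]" using E.inl_inr[OF rr] inlq[of "rhh (?ph r)"] rhhs(1)[OF T.ph_simps(1)[OF rr]] by simp
  finally show ?thesis .
 qed
 have "pt f et' = t" by (rule chart.gen_unique[OF c2(1) gf t(1) c2(2)]) (simp add: mf mt)
 note tf = t(2)[folded this]
 have "pt g y' = pt f et'" by (rule chart.gen_unique[OF c2(1) gg gf c2(2)]) (simp add: mf mg)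
 then have r': "rel et' y'" unfolding rel_def using ps y'p by simp
 note eg = \<open>pt g y' = pt f et'\<close>
 \<comment> \<open>On germs coming from f(et) the equality is balancedness in \<open>E\<close>. The
   stalk of S at f(et') is a localisation of the one at f(et), so this determines the maps.\<close>
 have albx: "al (smap X f et' r) = bx (smap Y g y' r)" if rr: "r : Stk S (pt f et')" for r
 proof -
  have 1: "al o smap X f et' : ring_hom (stalk S (pt f et')) L" by (rule ring_hom_trans[OF f.stalk_map_hom[OF ps(2)] al])
  have 2: "bx o smap Y g y' : ring_hom (stalk S (pt f et')) L" using ring_hom_trans[OF g.stalk_map_hom[OF y'p] bx(1)] unfolding eg .
  have "(al o smap X f et') r = (bx o smap Y g y') r"
  proof (rule is_loc_hom_unique[OF tf cL 1 2 _ rr])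
   fix a assume a: "a : carrier ?R"
   have "al (smap X f et' (f.Y.sp (pt f et') a)) = lam (E.inl (rhh (?ph a)))"
    unfolding f.sp_stalk_map[OF gen a, symmetric] by (simp add: al_def rhh_def)
   also have "... = bx (g.X.sp y' (?py a))" using E.inl_inr[OF a] bx(2)[OF T.py_simps(1)[OF a]] by (simp add: bx0_def)
   also have "... = bx (smap Y g y' (f.Y.sp (pt f et') a))" using g.sp_stalk_map[OF y'(1), unfolded e0 eg, OF a] by simp
   finally show "(al o smap X f et') (f.Y.sp (pt f et') a) = (bx o smap Y g y') (f.Y.sp (pt f et') a)" by simp
  qed
  then show ?thesis by simp
 qed
 obtain th where th: "th : ring_hom (FR et' y') L"
  "!!u. set u <= Stk X et' \<times> Stk Y y' ==> th (FC et' y' u) = lsum L (%c. al (fst c) *[L] bx (snd c)) u"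
  "!!a. a : Stk X et' ==> th (fin et' y' a) = al a" "!!c. c : Stk Y y' ==> th (fir et' y' c) = bx c"
  by (rule FR_lift[OF r' cL al bx(1) albx]) (assumption, rule that)
 define p' where "p' = {e : carrier (FR et' y'). th e : max_ideal L}"
 have w: "(et', y', p') : PT" unfolding PT_iff
 proof (intro conjI ballI r')
  show "primeideal p' (FR et' y')" unfolding p'_def by (rule primeideal_vimage[OF th(1) FR_cring[OF r'] cL max_ideal_prime[OF lL]])
 next
  fix a assume a: "a : Stk X et'"
  note ra = ring_hom_closed[OF rh a]
  have "fin et' y' a : p' \<longleftrightarrow> lam (E.inl (f.X.resid et' a)) : max_ideal L"
   unfolding p'_def using th(3)[OF a] ring_hom_closed[OF fin_hom(1)[OF r'] a] by (simp add: al_def)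
  also have "... \<longleftrightarrow> a : Mst X et'"
   using is_loc_local(2)[OF LL, of "E.inl (f.X.resid et' a)"] inlq[OF ra] ra f.X.resid_zero_iff[OF ps(2) a] by simp
  finally show "fin et' y' a : p' \<longleftrightarrow> a : Mst X et'" .
 next
  fix c assume c: "c : Stk Y y'"
  obtain d e where de: "d : carrier ?C" "e : carrier ?C" "e ~: Qp" "c *[stalk Y y'] g.X.sp y' e = g.X.sp y' d" by (rule is_loc_cases[OF y'(2) c])
  note ly' = is_loc_local[OF y'(2)] and eu = is_locD(5)[OF y'(2) de(2,3)]
  note spc = ring_hom_closed[OF is_locD(4)[OF y'(2)]]
  have "c : Mst Y y' \<longleftrightarrow> d : Qp"
   using max_ideal_iff[OF ly'(1) c] Units_mult_iff[OF is_locD(2)[OF y'(2)] c spc[OF de(2)]] eu de(4) ly'(2)[OF de(1)] max_ideal_iff[OF ly'(1) spc[OF de(1)]] by simp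
  also have "... \<longleftrightarrow> bx0 d : max_ideal L" unfolding Qp_def bx0_def using is_loc_local(2)[OF LL, of "E.inr d"] de(1) by simp
  also have "bx0 d = bx c *[L] bx0 e" using ring_hom_mult[OF bx(1) c spc[OF de(2)]] bx(2) de by simp
  also have "... : max_ideal L \<longleftrightarrow> bx c : max_ideal L"
  proof -
   note bc = ring_hom_closed[OF bx(1) c] and be = ring_hom_closed[OF bx0 de(2)]
   have "bx c *[L] bx0 e : carrier L" using cring.cring_simprules(5)[OF cL bc be] .
   then show ?thesis using max_ideal_iff[OF lL] Units_mult_iff[OF cL bc be] bx0u[OF de(2,3)] bc by simp
  qed
  finally show "fir et' y' c : p' \<longleftrightarrow> c : Mst Y y'"
   unfolding p'_def using th(4)[OF c] ring_hom_closed[OF fin_hom(2)[OF r'] c] by simp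
 qed
 \<comment> \<open>The germs of the list l at (et', y') are cospecialised from those at (et, y). So
   the function takes at the new point the image of d, which avoids q.\<close>
 have thd: "th (FG U V l et' y') = lam (Q d)"
 proof -
  have a1: "al o f.X.sp et' : ring_hom ?A L" by (rule ring_hom_trans[OF spX al])
  have eq1: "(al o f.X.sp et') (?ph c) = bx0 (?py c)" if "c : carrier ?R" for c
   using E.inl_inr[OF that] by (simp add: al_def bx0_def rhh_def)
  obtain th1 where th1: "th1 : ring_hom (FR et y) L"
   "!!u. set u <= carrier ?A \<times> carrier ?C ==> th1 (FC et y u) = lsum L (%c. (al o f.X.sp et') (fst c) *[L] bx0 (snd c)) u"
   "!!a. a : carrier ?A ==> th1 (fin et y a) = (al o f.X.sp et') a" "!!c. c : carrier ?C ==> th1 (fir et y c) = bx0 c"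
   by (rule FR_lift[OF r cL a1 bx0 eq1]) (assumption, rule that)
  have QL: "lam o Q : ring_hom (FR et y) L" using ring_hom_trans[OF Q(1) lh] unfolding FR_eq .
  have "(lam o Q) d = th1 d"
  proof (rule FR_hom_eqI[OF r QL th1(1) cL])
   show "d : carrier (FR et y)" using d unfolding FR_eq .
   show "(lam o Q) (fin et y a) = th1 (fin et y a)" if "a : carrier ?A" for a
    using th1(3)[OF that] Q(3)[OF that] unfolding FC_eq T.inl_def by (simp add: al_def rhh_def)
   show "(lam o Q) (fir et y c) = th1 (fir et y c)" if "c : carrier ?C" for c
    using th1(4)[OF that] Q(4)[OF that] unfolding FC_eq T.inr_def by (simp add: bx0_def)
  qed
  also have "... = lsum L (%c. (al o f.X.sp et') (fst c) *[L] bx0 (snd c)) (G U V l et y)"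
   unfolding d_def FG_eq by (rule th1(2)[OF G_closed[OF l(1,2) in1 l(3)]])
  also have "... = lsum L (%c. al (fst c) *[L] bx (snd c)) (G U V l et' y')"
   unfolding G_def lsum_map
  proof (rule lsum_cong)
   fix c assume "c : set l"
   then have c: "fst c : f.X.Sec U" "snd c : g.X.Sec V" using l(3) unfolding FS_iff by auto
   show "(al o f.X.sp et') (fst (map_prod (germ X et U) (germ Y y V) c)) *[L] bx0 (snd (map_prod (germ X et U) (germ Y y V) c)) =
    al (fst (map_prod (germ X et' U) (germ Y y' V) c)) *[L] bx (snd (map_prod (germ X et' U) (germ Y y' V) c))"
    using f.X.sp_germ[OF gen l(1) in1(1) c(1)] g.X.sp_germ[OF y'(1) l(2) in1(2) c(2)] bx(2)[OF g.X.germ_closed[OF l(2) in1(2) c(2)]] by simp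
  qed
  also have "... = th (FG U V l et' y')" unfolding FG_eq by (rule th(2)[OF G_closed[OF l(1,2) in2 in3 l(3)], symmetric])
  finally show ?thesis by simp
 qed
 have "FG U V l et' y' ~: p'" using is_loc_local(2)[OF LL Qd] q(2) thd unfolding p'_def by simp
 moreover have wD: "(et', y', p') : Dm U V" using w in2 in3 by (simp add: Dm_def)
 ultimately have "(et', y', p') : F.bas Dl v" using l(5)[OF wD] unfolding l(4) by simp
 then have "(et', y', p') : W" using b(3) by blast
 then show ?thesis using that[OF w] by simp
qed

end

subsection \<open>The correspondence\<close>

locale at_flat = at_point X Y S f g et
 for X :: "('x, 'a) rspace" and Y :: "('y, 'b) rspace" and S :: "('s, 'o) rspace"
  and f :: "('x, 'a, 's, 'o) morph" and g :: "('y, 'b, 's, 'o) morph" and et :: 'x +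
 assumes flat: "flat_morphism Y S g" and noeth: "locally_noetherian X"
  and geom: "geometrically_integral_fibres TYPE(('s, 'o) residue + ('x, 'a) residue + nat) Y g S"
begin

text \<open>Geometric integrality speaks of extension fields of one fixed type. The residue field is
  copied into this type, and integrality of the resulting base change is carried to the model by
  \<open>base_change_iso\<close>.\<close>

lemma C_integral: "integral_scheme C.FP"
proof -
 \<comment> \<open>\<kappa>(et) goes into its own summand; the summands for \<kappa>(s) and nat
   leave room for an algebraic closure of \<kappa>(s).\<close>
 define j where "j = (Inr o Inl :: ('x, 'a) residue => ('s, 'o) residue + ('x, 'a) residue + nat)"
 interpret K: field K by (rule K_field)
 have inj: "inj_on j (carrier K)" by (auto simp: j_def inj_on_def)
 let ?K = "image_ring j K"
 have fK: "field ?K" by (rule K.inj_imp_image_ring_is_field[OF inj])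
 have "j : ring_iso K ?K" by (rule inj_imp_image_ring_iso[OF inj])
 then have j: "j : ring_hom K ?K" "bij_betw j (carrier K) (carrier ?K)" unfolding ring_iso_def by auto
 have cK: "cring ?K" using fK field.axioms(1) domain.axioms(1) by blast
 interpret b: base_changed X Y S f g et ?K j "j o ph"
  by (rule base_changed.intro[OF at_point_axioms base_changed_axioms.intro[OF cK j]]) simp
 obtain h h' where h: "mor b.B.FP C.FP h" "mor C.FP b.B.FP h'"
  "meq b.B.FP b.B.FP (cmp C.FP h' h) morph_id" "meq C.FP C.FP (cmp b.B.FP h h') morph_id"
  by (rule b.base_change_iso) (rule that)
 have iso: "isomorphic C.FP b.B.FP" unfolding isomorphic_def using h by blast
 have "integral_scheme b.B.FP"
  using geom s0 fK b.ph'_hom unfolding geometrically_integral_fibres_def geometrically_integral_def b.B_eq[symmetric] by blast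
 then show ?thesis by (rule integral_scheme_iso[OF C.fp_lrs iso])
qed

sublocale I: base_changed X Y S f g et K "%x. x" ph
 by (rule base_changed.intro[OF at_point_axioms base_changed_axioms.intro[OF K_cring]]) (simp_all add: ring_hom_def bij_betw_def)

abbreviation "FA == fibre_at X f Y g S et"

lemma FA_eq: "FA = I.B.FP" by (simp add: fibre_at_def I.B_eq)

lemma jj_id: "meq SK SK I.jj morph_id" by (rule Spec_map_id[OF K_cring]) simp

definition "comparison h \<longleftrightarrow> mor FA C.FP h & isomorphic FA C.FP & (ALL z':points C.FP. EX z:points FA. pt h z = z') &
 meq FA SK (cmp C.FP C.FX h) I.B.FY & meq FA Y (cmp C.FP C.FY h) I.cY"

lemma comparison_exists: obtains h where "comparison h"
proof -
 obtain h h' where h: "mor I.B.FP C.FP h" "mor C.FP I.B.FP h'"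
  "meq I.B.FP I.B.FP (cmp C.FP h' h) morph_id" "meq C.FP C.FP (cmp I.B.FP h h') morph_id"
  "meq I.B.FP SK (cmp C.FP C.FX h) I.cX" "meq I.B.FP Y (cmp C.FP C.FY h) I.cY"
  by (rule I.base_change_iso) (rule that)
 have "EX z:points I.B.FP. pt h z = z'" if z': "z' : points C.FP" for z'
 proof (rule bexI)
  show "pt h (pt h' z') = z'" using h(4) z' unfolding morph_eq_def by auto
 qed (rule morph_ptD[OF h(2) z'])
 moreover have "isomorphic I.B.FP C.FP" unfolding isomorphic_def using h(1-4) by blast
 moreover have "meq I.B.FP SK (cmp C.FP C.FX h) I.B.FY"
  by (rule morph_eq_trans[OF h(5) comp_id_left[OF I.B.FY_morphism(1) jj_id]])
 ultimately have "comparison h" unfolding comparison_def FA_eq using h(1,6) by blast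
 then show ?thesis by (rule that)
qed

lemma FA_integral: "integral_scheme FA"
proof (rule comparison_exists)
 fix h assume "comparison h"
 then have "isomorphic FA C.FP" unfolding comparison_def by blast
 then show ?thesis using integral_scheme_iso[OF _ _ C_integral] I.B.fp_lrs unfolding FA_eq by blast
qed

text \<open>Continuity and surjectivity of h suffice: the preimage of a nonempty open set is open
  and nonempty, hence contains z.\<close>

lemma generic_image:
 assumes h: "comparison h" and z: "generic_point FA z" shows "generic_point C.FP (pt h z)"
proof -
 have hm: "mor FA C.FP h" and hs: "ALL z':points C.FP. EX z:points FA. pt h z = z'" using h unfolding comparison_def by blast+
 interpret h: lmorph FA C.FP h by unfold_locales (use I.B.fp_lrs C.fp_lrs hm FA_eq in auto)
 have zp: "z : points FA" using z unfolding generic_point_def by blast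
 have "pt h z : W" if W: "is_open C.FP W" "W ~= {}" for W
 proof -
  obtain w where w: "w : W" using W(2) by blast
  then have "w : points C.FP" using h.Y.opn_sub[OF W(1)] by blast
  then obtain v where v: "v : points FA" "pt h v = w" using hs by blast
  then have "preim FA h W ~= {}" using w unfolding preim_def by blast
  then have "z : preim FA h W" using z h.preim_open[OF W(1)] unfolding h.X.generic_iff by blast
  then show ?thesis unfolding preim_def by blast
 qed
 then show ?thesis unfolding h.Y.generic_iff using h.pt_closed[OF zp] by blast
qed

lemma natural_iff:
 "natural_morphism X f Y g S et io \<longleftrightarrow> mor FA P.FP io &
   meq FA X (cmp P.FP P.FX io) (cmp SK pX I.B.FY) & meq FA Y (cmp P.FP P.FY io) I.cY"
 unfolding natural_morphism_def Let_def AY_eq Ys_eq ..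

lemma natural_en:
 assumes h: "comparison h" shows "natural_morphism X f Y g S et (cmp C.FP en h)"
proof -
 have hm: "mor FA C.FP h" "meq FA SK (cmp C.FP C.FX h) I.B.FY" "meq FA Y (cmp C.FP C.FY h) I.cY"
  using h unfolding comparison_def by blast+
 have "meq FA X (cmp P.FP P.FX (cmp C.FP en h)) (cmp C.FP (cmp SK pX C.FX) h)"
  unfolding comp_assoc[OF en(1)] by (rule comp_cong_right[OF hm(1) en(2)])
 also have "meq FA X ... (cmp SK pX I.B.FY)"
  unfolding comp_assoc[OF C.FX_morphism(1), symmetric] by (rule comp_cong_left[OF pX hm(2)])
 finally have 1: "meq FA X (cmp P.FP P.FX (cmp C.FP en h)) (cmp SK pX I.B.FY)" .
 have "meq FA Y (cmp P.FP P.FY (cmp C.FP en h)) (cmp C.FP C.FY h)"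
  unfolding comp_assoc[OF en(1)] by (rule comp_cong_right[OF hm(1) en(3)])
 also note hm(3)
 finally show ?thesis unfolding natural_iff
  using 1 comp_morphism(1)[OF _ C.fp_lrs P.fp_lrs hm(1) en(1)] I.B.fp_lrs unfolding FA_eq by blast
qed

lemma natural_unique:
 assumes "natural_morphism X f Y g S et io" "natural_morphism X f Y g S et io'"
 shows "meq FA P.FP io io'"
proof (rule P.fp_monic)
 show "lrsp FA" unfolding FA_eq by (rule I.B.fp_lrs)
 show "meq FA X (cmp P.FP P.FX io) (cmp P.FP P.FX io')" "meq FA Y (cmp P.FP P.FY io) (cmp P.FP P.FY io')"
  using assms unfolding natural_iff by (blast intro: morph_eq_trans morph_eq_sym)+
qed (use assms natural_iff in blast)+

text \<open>Every element of \<kappa>(et) is the class of a germ at et, so a morphism into Spec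
  \<kappa>(et) is determined by its composite with \<open>pX\<close>.\<close>

lemma pX_monic:
 assumes T: "lrsp T" and u: "mor T SK u" and v: "mor T SK v"
  and e: "meq T X (cmp SK pX u) (cmp SK pX v)"
 shows "meq T SK u v"
proof (rule spec_ring.morph_into_spec_eqI[OF spec_ring.intro[OF K_cring] T u v])
 fix t r assume t: "t : points T" and r: "r : carrier K"
 have p: "pt u t = x0" "pt v t = x0" using morph_ptD[OF u t] morph_ptD[OF v t] SK_points by auto
 obtain a where a: "a : Stk X et" "r = P.f.X.resid et a" by (rule P.f.X.resid_surj[OF r])
 have s: "spec_germ K x0 r = smap SK pX x0 a" unfolding a(2) by (rule P.f.X.point_map_morphism(2)[OF et a(1), symmetric])
 note cu = comp_morphism[OF T SK_lrs P.f.X.lrs u pX] and cv = comp_morphism[OF T SK_lrs P.f.X.lrs v pX]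
 show "smap T u t (spec_germ K (pt u t) r) = smap T v t (spec_germ K (pt v t) r)"
  using cu(2)[OF t, of a] cv(2)[OF t, of a] morph_eqD(2)[OF T P.f.X.lrs cu(1) cv(1) e t, of a] a(1) unfolding p s by simp
qed

text \<open>The projections of X \<times>_S Y determine the component to Spec \<kappa>(\<eta>), by
  \<open>pX_monic\<close>, and the component to Y. The former fixes the map to Spec \<kappa>(s), and
  together they determine the component to Y_s.\<close>

lemma natural_mono:
 assumes "natural_morphism X f Y g S et io"
 shows "monomorphism TYPE('t) TYPE('u) FA P.FP io"
 unfolding monomorphism_def
proof (intro conjI allI impI)
 have io: "mor FA P.FP io" "meq FA X (cmp P.FP P.FX io) (cmp SK pX I.B.FY)" "meq FA Y (cmp P.FP P.FY io) I.cY"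
  using assms unfolding natural_iff by blast+
 show "mor FA P.FP io" by (rule io(1))
 fix T :: "('t, 'u) rspace" and u v
 assume sT: "scheme T" and u: "mor T FA u" and v: "mor T FA v"
  and e: "meq T P.FP (cmp FA io u) (cmp FA io v)"
 have T: "lrsp T" using sT unfolding scheme_def by blast
 note u' = u[unfolded FA_eq] and v' = v[unfolded FA_eq]
 note BX = I.B.FX_morphism(1) and BY = I.B.FY_morphism(1)
 have bu: "mor T SK (cmp I.B.FP I.B.FY u)" "mor T SK (cmp I.B.FP I.B.FY v)"
  "mor T Ys (cmp I.B.FP I.B.FX u)" "mor T Ys (cmp I.B.FP I.B.FX v)"
  by (rule comp_morphism(1)[OF T I.B.fp_lrs SK_lrs u' BY], rule comp_morphism(1)[OF T I.B.fp_lrs SK_lrs v' BY],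
   rule comp_morphism(1)[OF T I.B.fp_lrs Ys_lrs u' BX], rule comp_morphism(1)[OF T I.B.fp_lrs Ys_lrs v' BX])
 have ex: "meq T X (cmp FA (cmp SK pX I.B.FY) u) (cmp FA (cmp SK pX I.B.FY) v)"
 proof -
  have "meq T X (cmp FA (cmp SK pX I.B.FY) u) (cmp FA (cmp P.FP P.FX io) u)" by (rule comp_cong_right[OF u morph_eq_sym[OF io(2)]])
  also have "meq T X ... (cmp FA (cmp P.FP P.FX io) v)" unfolding comp_assoc[OF io(1), symmetric] by (rule comp_cong_left[OF P.FX_morphism(1) e])
  also have "meq T X ... (cmp FA (cmp SK pX I.B.FY) v)" by (rule comp_cong_right[OF v io(2)])
  finally show ?thesis .
 qed
 have ey: "meq T Y (cmp FA I.cY u) (cmp FA I.cY v)"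
 proof -
  have "meq T Y (cmp FA I.cY u) (cmp FA (cmp P.FP P.FY io) u)" by (rule comp_cong_right[OF u morph_eq_sym[OF io(3)]])
  also have "meq T Y ... (cmp FA (cmp P.FP P.FY io) v)" unfolding comp_assoc[OF io(1), symmetric] by (rule comp_cong_left[OF P.FY_morphism(1) e])
  also have "meq T Y ... (cmp FA I.cY v)" by (rule comp_cong_right[OF v io(3)])
  finally show ?thesis .
 qed
 have yy: "meq T SK (cmp I.B.FP I.B.FY u) (cmp I.B.FP I.B.FY v)"
  by (rule pX_monic[OF T bu(1,2)]) (use ex in \<open>simp add: FA_eq comp_assoc[OF BY]\<close>)
 have "meq T Sk (cmp Ys AY (cmp I.B.FP I.B.FX u)) (cmp I.B.FP (cmp SK I.e' I.B.FY) u)"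
  unfolding comp_assoc[OF BX] by (rule comp_cong_right[OF u' I.B.fp_square])
 also have "meq T Sk ... (cmp I.B.FP (cmp SK I.e' I.B.FY) v)"
  unfolding comp_assoc[OF BY, symmetric] by (rule comp_cong_left[OF I.e' yy])
 also have "meq T Sk ... (cmp I.B.FP (cmp Ys AY I.B.FX) v)" by (rule comp_cong_right[OF v' morph_eq_sym[OF I.B.fp_square]])
 finally have sk: "meq T Sk (cmp Ys AY (cmp I.B.FP I.B.FX u)) (cmp Ys AY (cmp I.B.FP I.B.FX v))"
  unfolding comp_assoc[OF BX] .
 have xx: "meq T Ys (cmp I.B.FP I.B.FX u) (cmp I.B.FP I.B.FX v)"
  by (rule A_monic[OF T bu(3,4) _ sk]) (use ey in \<open>simp add: FA_eq comp_assoc[OF BX]\<close>)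
 show "meq T FA u v" unfolding FA_eq by (rule I.B.fp_monic[OF T u' v' xx yy])
qed

text \<open>Defined through the model, so that no particular natural morphism enters;
  \<open>natural_generic\<close> shows that each of them sends the generic point of (Y_s)_\<eta>
  here.\<close>

definition "xi = pt en (THE z. generic_point C.FP z)"

sublocale CL: lringed C.FP by unfold_locales (rule C.fp_lrs)
sublocale PL: lringed P.FP by unfold_locales (rule P.fp_lrs)

lemmas C_points = CL.integral_points[OF C_integral]

lemma xi_eq: "generic_point C.FP z ==> pt en z = xi"
 using C_points(1) theI_unique[of "generic_point C.FP"] unfolding xi_def by metis

lemma xi_generic: obtains z where "generic_point C.FP z" "z : C.PT" "xi = pt en z"
 using C_points(1) xi_eq C.fp_points_eq unfolding generic_point_def by metis

lemma natural_generic: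
 assumes "natural_morphism X f Y g S et io" "generic_point FA z" shows "pt io z = xi"
proof (rule comparison_exists)
 fix h assume h: "comparison h"
 have "pt io z = pt (cmp C.FP en h) z"
  using natural_unique[OF assms(1) natural_en[OF h]] assms(2) unfolding morph_eq_def generic_point_def by blast
 then show ?thesis using xi_eq[OF generic_image[OF h assms(2)]] by simp
qed

text \<open>The point z is an instance of \<open>flat_point\<close>. As the model is integral, its
  stalk at z is a domain, and the maximal ideal there is zero exactly when z is generic; the two
  transfer lemmas give the two directions.\<close>

lemma ass_iff:
 assumes z: "z : C.PT"
 shows "pt en z : Ass P.FP \<longleftrightarrow> et : Ass X & generic_point C.FP z"
proof -
 have zp: "z : points C.FP" using z C.fp_points_eq by simp
 have fl: "flat_hom (stalk S s0) (stalk Y (fst (snd z))) (smap Y g (fst (snd z)))"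
  using flat C_point[OF z] unfolding flat_morphism_def by metis
 interpret T: flat_point "stalk S s0" "stalk X et" "stalk Y (fst (snd z))" "smap X f et" "smap Y g (fst (snd z))"
  "stalk SK x0" kap "snd (snd (pt en z))" "stalk P.FP (pt en z)" "P.F.dd (pt en z)" "snd (snd z)" "stalk C.FP z" "C.F.dd z"
  by (rule flat_point_at[OF z fl])
 have ep: "pt en z : points P.FP" using en_point(1)[OF z] P.fp_points_eq by simp
 obtain G where G: "finite G" "G <= Mst X et"
  "!!a b. a : Mst X et ==> b : Stk X et ==> ALL c:G. c *[stalk X et] b = 0[stalk X et] ==>
   a *[stalk X et] b = 0[stalk X et]"
  by (rule P.f.X.noetherian_stalk[OF noeth et]) (rule that)
 show ?thesis
 proof
  assume "pt en z : Ass P.FP"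
  then obtain b where b: "b : carrier (stalk P.FP (pt en z))" "max_ideal (stalk P.FP (pt en z)) = annihilator (stalk P.FP (pt en z)) b"
   unfolding Ass_def by blast
  note R = T.ass_to_fibre[OF C_points(2)[OF zp] b G]
  show "et : Ass X & generic_point C.FP z" unfolding C_points(3)[OF zp] Ass_def using R et by blast
 next
  assume A: "et : Ass X & generic_point C.FP z"
  then obtain a where "a : Stk X et" "Mst X et = annihilator (stalk X et) a" unfolding Ass_def by blast
  from T.ass_from_fibre[OF this] have "EX b:carrier (stalk P.FP (pt en z)). max_ideal (stalk P.FP (pt en z)) = annihilator (stalk P.FP (pt en z)) b"
   using A C_points(3)[OF zp] by blast
  then show "pt en z : Ass P.FP" unfolding Ass_def using ep by blast
 qed
qed

lemma xi_Ass: "et : Ass X ==> xi : Ass P.FP" and xi_fst: "fst xi = et" and xi_PT: "xi : P.PT"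
proof -
 obtain z where z: "generic_point C.FP z" "z : C.PT" "xi = pt en z" by (rule xi_generic)
 show "et : Ass X ==> xi : Ass P.FP" "fst xi = et" "xi : P.PT" using ass_iff[OF z(2)] z en_point[OF z(2)] by auto
qed

lemma Ass_over: "w : Ass P.FP ==> fst w = et ==> et : Ass X & w = xi"
proof -
 assume w: "w : Ass P.FP" "fst w = et"
 then have "w : P.PT" unfolding Ass_def P.fp_points_eq by blast
 then obtain z where z: "z : C.PT" "pt en z = w" by (rule en_surj[OF _ w(2)])
 then show ?thesis using ass_iff[OF z(1)] w(1) xi_eq by metis
qed

text \<open>The points over et all come from the model, so the preimage of W there is open and
  nonempty and contains the generic point.\<close>

lemma xi_in_open:
 assumes W: "is_open P.FP W" "w : W" "w : P.PT" "fst w = et" shows "xi : W"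
proof -
 interpret en: lmorph C.FP P.FP en by unfold_locales (rule en(1))
 obtain z' where z': "z' : C.PT" "pt en z' = w" by (rule en_surj[OF W(3,4)])
 have "preim C.FP en W ~= {}" using z' W(2) unfolding preim_def C.fp_points_eq by blast
 obtain z where z: "generic_point C.FP z" "xi = pt en z" by (rule xi_generic)
 have "z : preim C.FP en W" using z(1) en.preim_open[OF W(1)] \<open>preim C.FP en W ~= {}\<close> unfolding CL.generic_iff by blast
 then show ?thesis unfolding preim_def z(2) by blast
qed

end

theorem lemma2p4:
  fixes S :: "('s, 'o) rspace" and X :: "('x, 'a) rspace" and Y :: "('y, 'b) rspace"
    and f :: "('x, 'a, 's, 'o) morph" and g :: "('y, 'b, 's, 'o) morph"
  assumes "locally_noetherian S" and "locally_noetherian X" and "locally_noetherian Y"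
    and "is_morphism X S f" and "is_morphism Y S g"
    and "flat_morphism Y S g"
    and "geometrically_integral_fibres TYPE(('s, 'o) residue + ('x, 'a) residue + nat) Y g S"
  shows "\<exists>\<xi>.
    (\<forall>\<eta>\<in>Ass X.
       integral_scheme (fibre_at X f Y g S \<eta>) \<and>
       (\<exists>!z. generic_point (fibre_at X f Y g S \<eta>) z) \<and>
       (\<exists>\<iota>. natural_morphism X f Y g S \<eta> \<iota>) \<and>
       (\<forall>\<iota>. natural_morphism X f Y g S \<eta> \<iota> \<longrightarrow>
          monomorphism TYPE('t) TYPE('u) (fibre_at X f Y g S \<eta>) (fibre_product X f S Y g) \<iota> \<and>
          (\<forall>z. generic_point (fibre_at X f Y g S \<eta>) z \<longrightarrow> pt \<iota> z = \<xi> \<eta>)) \<and>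
       \<xi> \<eta> \<in> Ass (fibre_product X f S Y g)) \<and>
    bij_betw \<xi> (Ass X) (Ass (fibre_product X f S Y g)) \<and>
    (\<forall>\<eta>\<in>Ass X. \<forall>\<eta>'\<in>Ass X.
       \<eta> \<in> space_top X closure_of {\<eta>'} \<longrightarrow>
       \<xi> \<eta> \<in> space_top (fibre_product X f S Y g) closure_of {\<xi> \<eta>'})"
proof -
 have sch: "scheme S" "scheme X" "scheme Y" using assms(1-3) unfolding locally_noetherian_def by blast+
 have lrs: "lrsp S" "lrsp X" "lrsp Y" using sch unfolding scheme_def by blast+
 interpret P: fp_pair X Y S f g by unfold_locales (use lrs assms in auto)
 have at: "at_flat X Y S f g et" if "et : points X" for et
  by unfold_locales (use that assms in auto)
 have AX: "et : points X" if "et : Ass X" for et using that unfolding Ass_def by blast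
 define xj where "xj et = at_flat.xi X Y S f g et" for et
 interpret PL: lringed P.FP by unfold_locales (rule P.fp_lrs)
 show ?thesis
 proof (intro exI[of _ xj] conjI ballI impI allI)
  fix et assume et: "et : Ass X"
  interpret M: at_flat X Y S f g et by (rule at[OF AX[OF et]])
  interpret FL: lringed "fibre_at X f Y g S et" by unfold_locales (unfold M.FA_eq, rule M.I.B.fp_lrs)
  show "integral_scheme (fibre_at X f Y g S et)" by (rule M.FA_integral)
  show "EX! z. generic_point (fibre_at X f Y g S et) z" by (rule FL.integral_points(1)[OF M.FA_integral])
  show "EX io. natural_morphism X f Y g S et io" by (rule M.comparison_exists) (use M.natural_en in blast)
  show "xj et : Ass P.FP" unfolding xj_def by (rule M.xi_Ass[OF et])
  fix io assume io: "natural_morphism X f Y g S et io"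
  show "monomorphism TYPE('t) TYPE('u) (fibre_at X f Y g S et) P.FP io" by (rule M.natural_mono[OF io])
  show "pt io z = xj et" if "generic_point (fibre_at X f Y g S et) z" for z unfolding xj_def by (rule M.natural_generic[OF io that])
 next
  \<comment> \<open>\<xi>(\<eta>) lies over \<eta>, so the first component is a left
    inverse.\<close>
  have "inj_on xj (Ass X)"
   by (rule inj_on_inverseI[where g = fst]) (use at_flat.xi_fst[OF at] AX xj_def in simp)
  moreover have "xj ` Ass X = Ass P.FP"
  proof (rule subset_antisym; rule subsetI)
   show "w : Ass P.FP" if "w : xj ` Ass X" for w using that at_flat.xi_Ass[OF at] AX xj_def by auto
   fix w assume w: "w : Ass P.FP"
   then have "w : P.PT" unfolding Ass_def P.fp_points_eq by blast
   then have "fst w : points X" using P.PT_relD unfolding P.rel_def by blast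
   then show "w : xj ` Ass X" using at_flat.Ass_over[OF at w] xj_def by auto
  qed
  ultimately show "bij_betw xj (Ass X) (Ass P.FP)" unfolding bij_betw_def ..
 next
  fix et et' assume et: "et : Ass X" "et' : Ass X" "et : space_top X closure_of {et'}"
  interpret M: at_flat X Y S f g et by (rule at[OF AX[OF et(1)]])
  interpret M': at_flat X Y S f g et' by (rule at[OF AX[OF et(2)]])
  have gen: "P.f.X.gen et et'" using et(3) P.f.X.gen_closure[OF AX[OF et(2)]] by blast
  have "xj et' : W" if W: "is_open P.FP W" "xj et : W" for W
  proof -
   obtain w where "w : P.PT" "w : W" "fst w = et'"
    by (rule P.generise[OF sch(1,3) assms(6) gen M.xi_PT M.xi_fst W[unfolded xj_def]])
   then show ?thesis unfolding xj_def by (intro M'.xi_in_open[OF W(1)])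
  qed
  then have "PL.gen (xj et) (xj et')"
   unfolding PL.gen_def using M.xi_PT M'.xi_PT P.fp_points_eq by (simp add: xj_def)
  then show "xj et : space_top P.FP closure_of {xj et'}"
   using PL.gen_closure[of "xj et'" "xj et"] unfolding PL.gen_def by blast
 qed
qed

end
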